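(* For every $t\in\mathbb{R}$ and every $\chi\in C^\infty_c(\mathbb{R})$, $$\lim_{N\to\infty}\int_{\mathbb{R}}\chi(x)\,u^{\mathrm{SSE}}_N(x,t)\,dx=-\frac{4\delta}{\pi}\int_{\mathbb{R}}\chi''(x)\,E^{\min}_\infty(x,t)\,dx,$$ i.e. $u^{\mathrm{SSE}}_N(\cdot,t)\to-\frac{4\delta}{\pi}\partial_x^2E^{\min}_\infty(\cdot,t)$ in the sense of distributions.
   Context: Fix $\delta>0$ and an admissible $u_0$ ($C^1$, positive, $\to0$ at $\pm\infty$, $\int(x^2+1)u_0<\infty$, $u_0'$ vanishing only at $x_{\max}$ where the maximum $u_{\max}$ is attained) with $\int\sqrt{u_0}<\infty$. Lambert $W$: standard branches $W_n$ of the inverse of $w\mapsto we^w$; for real $a\in[-e^{-1},0)$, $W_0(a)\in[-1,0)$, $W_{-1}(a)\le-1$; for real $a<-e^{-1}$, $W_0(a)$ is the solution with $0<\operatorname{Im}w<\pi$, $W_{-1}(a):=\overline{W_0(a)}$. $\zeta(\kappa):=\kappa\cot(2\delta\kappa)+i\kappa$, $\zeta(0):=1/(2\delta)$; $E(\zeta):=-\zeta+\frac1{2\delta}(1+\operatorname{Log}(2\delta\zeta))$; $\kappa_{\max}:=\operatorname{Im}[-\frac1{2\delta}W_{-1}(-e^{2\delta u_{\max}-1})]$; for $\kappa\in(0,\kappa_{\max}]$, $x_-(\kappa)\le x_{\max}\le x_+(\kappa)$ solve $u_0(x)=E(\zeta(\kappa))$, $x_\pm(0)=\pm\infty$; $a(\kappa,u):=-2\delta\zeta(\kappa)e^{-2\delta(\zeta(\kappa)+u)}$.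 $R^{\mathrm{Wyl}}(\kappa):=\frac1{4\delta}\int_{x_-(\kappa)}^{x_+(\kappa)}[W_0-W_{-1}](a(\kappa,u_0(x)))dx$ (strictly decreasing, $R^{\mathrm{Wyl}}(\kappa_{\max})=0$); $\rho^{\mathrm{Wyl}}:=-\frac{d}{d\kappa}R^{\mathrm{Wyl}}$. $\theta_+(\kappa):=\kappa x_+(\kappa)+\int_{x_+(\kappa)}^\infty\operatorname{Im}[\zeta(\kappa)+\frac1{2\delta}W_{-1}(a(\kappa,u_0(x)))]dx$. Data: $\epsilon_N:=R^{\mathrm{Wyl}}(0)/(\pi N)$; $\kappa_n$ with $R^{\mathrm{Wyl}}(\kappa_n)=\pi(n-\frac12)\epsilon_N$; $\zeta_n:=\zeta(\kappa_n)$; $c_n:=\exp(2\theta_+(\kappa_n)/\epsilon_N)$. $D_N(z,t)$ diagonal with entries $c_n^{1/2}\exp(-\kappa_nz/\epsilon_N-\operatorname{Im}[(\zeta_n-\frac1{2\delta})^2]t/\epsilon_N)$; $[C_N]_{n\ell}:=i/(\zeta_\ell-\overline{\zeta_n})$; $Z_N(z,t):=\det(I_N+D_NC_ND_N)$, which is positive on $\mathbb{R}$ and zero-free on $|\operatorname{Im}z|\le\delta\epsilon_N$; $F_N:=2\delta\epsilon_N^2\log Z_N$ (branch continuous in the strip, real on $\mathbb{R}$); $u^{\mathrm{SSE}}_N(x,t):=\partial_x\frac{F_N(x+i\delta\epsilon_N,t)-F_N(x-i\delta\epsilon_N,t)}{2i\delta\epsilon_N}$. $V(\kappa;x,t):=x\kappa+t\operatorname{Im}[(\zeta(\kappa)-\frac1{2\delta})^2]-\theta_+(\kappa)$;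 $\mathcal A$: real measurable $\rho$ on $[0,\kappa_{\max}]$ with $0\le\rho\le\rho^{\mathrm{Wyl}}$ a.e.; $\mathcal L[\rho](\lambda):=\frac1\pi\int_0^{\kappa_{\max}}\log\big|\frac{\lambda-\overline{\zeta(\eta)}}{\lambda-\zeta(\eta)}\big|\rho(\eta)d\eta$; $\mathcal E[\rho](x,t):=\int_0^{\kappa_{\max}}(V(\kappa;x,t)+\frac12\mathcal L[\rho](\zeta(\kappa)))\rho(\kappa)d\kappa$; $E^{\min}_\infty(x,t):=\min_{\rho\in\mathcal A}\mathcal E[\rho](x,t)$ (the minimum exists). *)

theory Defs
  imports "HOL-Analysis.Analysis"
begin

definition lambertW0 :: "real \<Rightarrow> complex" where
  "lambertW0 a =
     (if a < - exp (-1)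
      then (THE w::complex. 0 < Im w \<and> Im w < pi \<and> w * exp w = complex_of_real a)
      else complex_of_real (THE w::real. -1 \<le> w \<and> w * exp w = a))"

definition lambertWm1 :: "real \<Rightarrow> complex" where
  "lambertWm1 a =
     (if a < - exp (-1) then cnj (lambertW0 a)
      else complex_of_real (THE w::real. w \<le> -1 \<and> w * exp w = a))"

definition admissible :: "(real \<Rightarrow> real) \<Rightarrow> bool" where
  "admissible u0 \<longleftrightarrow>
     (\<exists>u0'. (\<forall>x. (u0 has_real_derivative u0' x) (at x)) \<and> continuous_on UNIV u0') \<and>
     (\<forall>x. 0 < u0 x) \<and>
     (u0 \<longlongrightarrow> 0) at_top \<and> (u0 \<longlongrightarrow> 0) at_bot \<and>
     integrable lborel (\<lambda>x. (x\<^sup>2 + 1) * u0 x) \<and>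
     (\<exists>xm. (\<forall>x. u0 x \<le> u0 xm) \<and> (\<forall>x. deriv u0 x = 0 \<longleftrightarrow> x = xm))"

definition u_max :: "(real \<Rightarrow> real) \<Rightarrow> real" where
  "u_max u0 = Sup (range u0)"

definition x_max :: "(real \<Rightarrow> real) \<Rightarrow> real" where
  "x_max u0 = (THE x. u0 x = u_max u0)"

definition zeta :: "real \<Rightarrow> real \<Rightarrow> complex" where
  "zeta \<delta> \<kappa> = (if \<kappa> = 0 then complex_of_real (1 / (2 * \<delta>))
                 else complex_of_real (\<kappa> * cot (2 * \<delta> * \<kappa>)) + \<i> * complex_of_real \<kappa>)"

definition Efun :: "real \<Rightarrow> complex \<Rightarrow> complex" where
  "Efun \<delta> z = - z + complex_of_real (1 / (2 * \<delta>)) * (1 + Ln (complex_of_real (2 * \<delta>) * z))"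

definition kappa_max :: "real \<Rightarrow> (real \<Rightarrow> real) \<Rightarrow> real" where
  "kappa_max \<delta> u0 =
     Im (- complex_of_real (1 / (2 * \<delta>)) * lambertWm1 (- exp (2 * \<delta> * u_max u0 - 1)))"

text \<open>x_-(kappa) \<le> x_max \<le> x_+(kappa), for kappa in (0, kappa_max].\<close>
definition x_plus :: "real \<Rightarrow> (real \<Rightarrow> real) \<Rightarrow> real \<Rightarrow> real" where
  "x_plus \<delta> u0 \<kappa> =
     (THE x. x_max u0 \<le> x \<and> complex_of_real (u0 x) = Efun \<delta> (zeta \<delta> \<kappa>))"

definition x_minus :: "real \<Rightarrow> (real \<Rightarrow> real) \<Rightarrow> real \<Rightarrow> real" where
  "x_minus \<delta> u0 \<kappa> =
     (THE x. x \<le> x_max u0 \<and> complex_of_real (u0 x) = Efun \<delta> (zeta \<delta> \<kappa>))"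

definition band :: "real \<Rightarrow> (real \<Rightarrow> real) \<Rightarrow> real \<Rightarrow> real set" where
  "band \<delta> u0 \<kappa> = (if \<kappa> = 0 then UNIV else {x_minus \<delta> u0 \<kappa> <..< x_plus \<delta> u0 \<kappa>})"

definition afun :: "real \<Rightarrow> real \<Rightarrow> real \<Rightarrow> complex" where
  "afun \<delta> \<kappa> u = - complex_of_real (2 * \<delta>) * zeta \<delta> \<kappa> *
                   exp (- complex_of_real (2 * \<delta>) * (zeta \<delta> \<kappa> + complex_of_real u))"

text \<open>afun is real (and negative); the Lambert branches are applied to its real part.\<close>
definition R_Wyl :: "real \<Rightarrow> (real \<Rightarrow> real) \<Rightarrow> real \<Rightarrow> real" where
  "R_Wyl \<delta> u0 \<kappa> = 1 / (4 * \<delta>) *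
     (LINT x : band \<delta> u0 \<kappa> | lborel.
        Re (lambertW0 (Re (afun \<delta> \<kappa> (u0 x))) - lambertWm1 (Re (afun \<delta> \<kappa> (u0 x)))))"

definition rho_Wyl :: "real \<Rightarrow> (real \<Rightarrow> real) \<Rightarrow> real \<Rightarrow> real" where
  "rho_Wyl \<delta> u0 \<kappa> = - deriv (R_Wyl \<delta> u0) \<kappa>"

definition theta_plus :: "real \<Rightarrow> (real \<Rightarrow> real) \<Rightarrow> real \<Rightarrow> real" where
  "theta_plus \<delta> u0 \<kappa> =
     (if \<kappa> = 0 then 0 else
      \<kappa> * x_plus \<delta> u0 \<kappa> +
      (LINT x : {x_plus \<delta> u0 \<kappa> <..} | lborel.
          Im (zeta \<delta> \<kappa> + complex_of_real (1 / (2 * \<delta>)) *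
                lambertWm1 (Re (afun \<delta> \<kappa> (u0 x))))))"

definition epsN :: "real \<Rightarrow> (real \<Rightarrow> real) \<Rightarrow> nat \<Rightarrow> real" where
  "epsN \<delta> u0 N = R_Wyl \<delta> u0 0 / (pi * real N)"

text \<open>Index j = 0..N-1 corresponds to n = j+1, so n - 1/2 = j + 1/2.\<close>
definition kappaN :: "real \<Rightarrow> (real \<Rightarrow> real) \<Rightarrow> nat \<Rightarrow> nat \<Rightarrow> real" where
  "kappaN \<delta> u0 N j = (THE \<kappa>. 0 \<le> \<kappa> \<and> \<kappa> \<le> kappa_max \<delta> u0 \<and>
        R_Wyl \<delta> u0 \<kappa> = pi * (real j + 1/2) * epsN \<delta> u0 N)"

definition zetaN :: "real \<Rightarrow> (real \<Rightarrow> real) \<Rightarrow> nat \<Rightarrow> nat \<Rightarrow> complex" where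
  "zetaN \<delta> u0 N j = zeta \<delta> (kappaN \<delta> u0 N j)"

definition cN :: "real \<Rightarrow> (real \<Rightarrow> real) \<Rightarrow> nat \<Rightarrow> nat \<Rightarrow> real" where
  "cN \<delta> u0 N j = exp (2 * theta_plus \<delta> u0 (kappaN \<delta> u0 N j) / epsN \<delta> u0 N)"

definition DN :: "real \<Rightarrow> (real \<Rightarrow> real) \<Rightarrow> nat \<Rightarrow> complex \<Rightarrow> real \<Rightarrow> nat \<Rightarrow> complex" where
  "DN \<delta> u0 N z t j =
     complex_of_real (sqrt (cN \<delta> u0 N j)) *
     exp (- complex_of_real (kappaN \<delta> u0 N j) * z / complex_of_real (epsN \<delta> u0 N)
          - complex_of_real (Im ((zetaN \<delta> u0 N j - complex_of_real (1 / (2 * \<delta>)))\<^sup>2) * t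
                             / epsN \<delta> u0 N))"

definition CN :: "real \<Rightarrow> (real \<Rightarrow> real) \<Rightarrow> nat \<Rightarrow> nat \<Rightarrow> nat \<Rightarrow> complex" where
  "CN \<delta> u0 N n l = \<i> / (zetaN \<delta> u0 N l - cnj (zetaN \<delta> u0 N n))"

definition detN :: "nat \<Rightarrow> (nat \<Rightarrow> nat \<Rightarrow> complex) \<Rightarrow> complex" where
  "detN N M = (\<Sum>p | p permutes {0..<N}. of_int (sign p) * (\<Prod>i<N. M i (p i)))"

definition ZN :: "real \<Rightarrow> (real \<Rightarrow> real) \<Rightarrow> nat \<Rightarrow> complex \<Rightarrow> real \<Rightarrow> complex" where
  "ZN \<delta> u0 N z t = detN N (\<lambda>n l. (if n = l then 1 else 0) +
        DN \<delta> u0 N z t n * CN \<delta> u0 N n l * DN \<delta> u0 N z t l)"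

definition stripN :: "real \<Rightarrow> (real \<Rightarrow> real) \<Rightarrow> nat \<Rightarrow> complex set" where
  "stripN \<delta> u0 N = {z. \<bar>Im z\<bar> \<le> \<delta> * epsN \<delta> u0 N}"

definition logZN :: "real \<Rightarrow> (real \<Rightarrow> real) \<Rightarrow> nat \<Rightarrow> real \<Rightarrow> complex \<Rightarrow> complex" where
  "logZN \<delta> u0 N t = (SOME L. continuous_on (stripN \<delta> u0 N) L \<and>
        (\<forall>z\<in>stripN \<delta> u0 N. exp (L z) = ZN \<delta> u0 N z t) \<and>
        (\<forall>x::real. L (complex_of_real x) \<in> \<real>))"

definition FN :: "real \<Rightarrow> (real \<Rightarrow> real) \<Rightarrow> nat \<Rightarrow> complex \<Rightarrow> real \<Rightarrow> complex" where
  "FN \<delta> u0 N z t = complex_of_real (2 * \<delta> * (epsN \<delta> u0 N)\<^sup>2) * logZN \<delta> u0 N t z"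

definition u_SSE :: "real \<Rightarrow> (real \<Rightarrow> real) \<Rightarrow> nat \<Rightarrow> real \<Rightarrow> real \<Rightarrow> complex" where
  "u_SSE \<delta> u0 N x t = vector_derivative
     (\<lambda>y::real. (FN \<delta> u0 N (complex_of_real y + \<i> * complex_of_real (\<delta> * epsN \<delta> u0 N)) t
               - FN \<delta> u0 N (complex_of_real y - \<i> * complex_of_real (\<delta> * epsN \<delta> u0 N)) t)
               / (2 * \<i> * complex_of_real (\<delta> * epsN \<delta> u0 N)))
     (at x)"

definition Vfun :: "real \<Rightarrow> (real \<Rightarrow> real) \<Rightarrow> real \<Rightarrow> real \<Rightarrow> real \<Rightarrow> real" where
  "Vfun \<delta> u0 \<kappa> x t = x * \<kappa> + t * Im ((zeta \<delta> \<kappa> - complex_of_real (1 / (2 * \<delta>)))\<^sup>2)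
                      - theta_plus \<delta> u0 \<kappa>"

definition admissible_measures :: "real \<Rightarrow> (real \<Rightarrow> real) \<Rightarrow> (real \<Rightarrow> real) set" where
  "admissible_measures \<delta> u0 = {\<rho>. \<rho> \<in> borel_measurable lborel \<and>
      (AE \<kappa> in lborel. \<kappa> \<in> {0..kappa_max \<delta> u0} \<longrightarrow> 0 \<le> \<rho> \<kappa> \<and> \<rho> \<kappa> \<le> rho_Wyl \<delta> u0 \<kappa>)}"

definition Lfun :: "real \<Rightarrow> (real \<Rightarrow> real) \<Rightarrow> (real \<Rightarrow> real) \<Rightarrow> complex \<Rightarrow> real" where
  "Lfun \<delta> u0 \<rho> w = 1 / pi * (LINT \<eta> : {0..kappa_max \<delta> u0} | lborel.
      ln (cmod ((w - cnj (zeta \<delta> \<eta>)) / (w - zeta \<delta> \<eta>))) * \<rho> \<eta>)"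

definition energy :: "real \<Rightarrow> (real \<Rightarrow> real) \<Rightarrow> (real \<Rightarrow> real) \<Rightarrow> real \<Rightarrow> real \<Rightarrow> real" where
  "energy \<delta> u0 \<rho> x t = (LINT \<kappa> : {0..kappa_max \<delta> u0} | lborel.
      (Vfun \<delta> u0 \<kappa> x t + 1/2 * Lfun \<delta> u0 \<rho> (zeta \<delta> \<kappa>)) * \<rho> \<kappa>)"

text \<open>The minimum exists (paper); Inf of the attained set is that minimum.\<close>
definition E_min :: "real \<Rightarrow> (real \<Rightarrow> real) \<Rightarrow> real \<Rightarrow> real \<Rightarrow> real" where
  "E_min \<delta> u0 x t = Inf ((\<lambda>\<rho>. energy \<delta> u0 \<rho> x t) ` admissible_measures \<delta> u0)"

definition smooth_compact_support :: "(real \<Rightarrow> real) \<Rightarrow> bool" where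
  "smooth_compact_support chi \<longleftrightarrow>
     (\<forall>k x. ((deriv ^^ k) chi) differentiable (at x)) \<and> compact (closure {x. chi x \<noteq> 0})"

end

theory Submission
  imports Defs "Jordan_Normal_Form.Determinant" "HOL-Complex_Analysis.Complex_Analysis"
begin

text \<open>
  Expanding the soliton determinant in principal minors, which are Cauchy determinants, shows that
  on the real line it is the sum over subsets \<open>S\<close> of \<open>{..<N}\<close> of the positive numbers
  \<open>(\<Prod>i\<in>S. 1 / (2 \<kappa>\<^sub>i)) exp (- 2 D(1\<^sub>S) / (\<pi> \<epsilon>\<^sup>2))\<close>, where \<open>D\<close> is a Riemann sum of the energy without
  diagonal terms. As \<open>\<epsilon>\<close> is of order \<open>1/N\<close> and \<open>\<bar>ln \<kappa>\<^sub>i\<bar>\<close> is \<open>O(ln N)\<close>, \<open>\<epsilon>\<^sup>2\<close> times the logarithm of this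
  sum is \<open>- 2/\<pi> min\<^sub>S D(1\<^sub>S) + o(1)\<close>. Without diagonal terms \<open>D\<close> is affine in each variable, so the
  minimum over the vertices of the cube \<open>[0,1]\<^sup>N\<close> is the minimum over the cube, and averaging profiles over
  cells makes it converge to the infimum of the continuous energy. The substitution
  \<open>s = R(\<kappa>) / R(0)\<close> turns the constraint \<open>0 \<le> \<rho> \<le> \<rho>\<^sup>W\<^sup>y\<^sup>l\<close> into \<open>0 \<le> f \<le> 1\<close>.

  Off the real line Gaussian elimination writes the determinant as a product of \<open>N\<close> pivots, each lying in
  a rotated half plane. Hence the logarithm of the determinant at \<open>z\<close> is bounded by its value at \<open>Re z\<close>
  plus \<open>O(N)\<close>, so that \<open>F\<^sub>N\<close> is bounded uniformly in \<open>N\<close> on the strip. Integrating by parts three times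
  against the test function replaces the difference quotient of \<open>F\<^sub>N'\<close> across the strip by
  \<open>F\<^sub>N''\<close> with an error proportional to \<open>\<epsilon>\<close>; no differentiability of the limit is needed.
\<close>

section \<open>Cauchy determinants and the soliton determinant\<close>

text \<open>On the strip of half-width \<delta> \<epsilon> every exponent rotates by at most 2
  \<delta> \<open>kappa_max\<close>, which is \<open>einv Um\<close> and hence strictly below \<pi>.
  Half of that angle is what a single rotation must absorb, and it stays below \<pi>/2; this makes
  one half plane serve all pivots. The same angle \<theta> = 2 \<delta> \<kappa> in [0, \<pi>)
  parametrizes the spectral curve: 2 \<delta> E becomes the increasing real function
  \<open>ecurve\<close>, and its inverse is the imaginary part of the complex Lambert branch.

  The analytic obstacle is the logarithmic singularity of the interaction. After the substitution it
  is integrable once the inverse of R separates points at a polynomial rate, that is, once R is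
  Hoelder continuous. The exponent obtained is 1/6, by interpolating between the square root
  behaviour of the Lambert branches at their branch point and the second moment of
  \<open>u0\<close>. The resulting sixth power only multiplies a logarithm by 6, and it also yields
  the O(ln N) bound for the prefactors.

  Convergence of the discrete minima is uniform over profiles because the error is an L1 distance of
  potential and kernel from cellwise constant versions.\<close>

lemma detN_eq_det: "detN n M = Determinant.det (mat n n (\<lambda>(i,j). M i j))"
  unfolding detN_def Determinant.det_def by (auto intro!: sum.cong prod.cong simp: atLeast0LessThan permutes_in_image
     dest: permutes_in_image)

lemma detN_cong:
  assumes "\<And>i j. i < n \<Longrightarrow> j < n \<Longrightarrow> M i j = M' i j"
  shows "detN n M = detN n M'"
  unfolding detN_eq_det by (rule arg_cong[where f = Determinant.det]) (auto intro!: eq_matI simp: assms)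

text \<open>Block elimination of the last row and column: the matrix is an upper block triangular
  factor, with the Schur complement in its corner, times a unipotent lower one. Eliminating the last
  index leaves the numbering of the others intact.\<close>

lemma detN_schur_complement:
  assumes "M m m \<noteq> 0"
  shows "detN (Suc m) M = M m m * detN m (\<lambda>i j. M i j - M i m * M m j / M m m)"
proof -
  let ?A = "mat m m (\<lambda>(i,j). M i j - M i m * M m j / M m m)"
  let ?B = "mat m 1 (\<lambda>(i,j). M i m)"
  let ?D = "mat 1 1 (\<lambda>(i,j). M m m)"
  let ?C = "mat 1 m (\<lambda>(i,j). M m j / M m m)"
  let ?P = "four_block_mat ?A ?B (0\<^sub>m 1 m) ?D"
  let ?Q = "four_block_mat (1\<^sub>m m) (0\<^sub>m m 1) ?C (1\<^sub>m 1)"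
  have "mat (Suc m) (Suc m) (\<lambda>(i,j). M i j)
      = four_block_mat (mat m m (\<lambda>(i,j). M i j)) ?B (mat 1 m (\<lambda>(i,j). M m j)) ?D"
    by (rule eq_matI) (auto simp: less_Suc_eq)
  also have "\<dots> = ?P * ?Q"
    by (subst mult_four_block_mat[of _ m m _ 1 _ 1 _ _ m _ 1])
       (auto intro!: arg_cong4[where f = four_block_mat] eq_matI simp: scalar_prod_def assms)
  finally have "detN (Suc m) M = Determinant.det (?P * ?Q)"
    by (simp add: detN_eq_det)
  also have "\<dots> = Determinant.det ?P * Determinant.det ?Q"
    by (rule det_mult[of _ "m+1"]) auto
  also have "Determinant.det ?Q = 1"
    by (subst det_four_block_mat_upper_right_zero[where n = m and m = 1]) auto
  also have "Determinant.det ?P = Determinant.det ?A * Determinant.det ?D"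
    by (rule det_four_block_mat_lower_left_zero) auto
  also have "Determinant.det ?D = M m m"
    by (subst det_single) auto
  finally show ?thesis by (simp add: detN_eq_det)
qed

text \<open>The witness is the last column of the adjugate, so no invertibility is required. Its
  last entry is the leading minor of size \<open>k\<close>, which links consecutive leading
  minors.\<close>

lemma detN_cofactor_column:
  obtains x where "x k = detN k B"
    "\<And>i. i \<le> k \<Longrightarrow> (\<Sum>j\<le>k. B i j * x j) = (if i = k then detN (Suc k) B else 0)"
proof -
  let ?A = "mat (Suc k) (Suc k) (\<lambda>(i,j). B i j)"
  have A: "?A \<in> carrier_mat (Suc k) (Suc k)" by simp
  define x where "x = (\<lambda>j. adj_mat ?A $$ (j,k))"
  have "mat_delete ?A k k = mat k k (\<lambda>(i,j). B i j)"
    by (rule eq_matI) (auto simp: mat_delete_def)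
  then have "x k = detN k B"
    by (simp add: x_def adj_mat_def cofactor_def detN_eq_det flip: mult_2)
  moreover have "(\<Sum>j\<le>k. B i j * x j) = (if i = k then detN (Suc k) B else 0)" if "i \<le> k" for i
  proof -
    have "(?A * adj_mat ?A) $$ (i,k) = (\<Sum>j\<le>k. B i j * x j)"
      using that adj_mat(1)[OF A] unfolding x_def
      by (auto simp: scalar_prod_def atLeast0LessThan lessThan_Suc_atMost intro!: sum.cong)
    then show ?thesis
      using that by (auto simp: adj_mat(2)[OF A] detN_eq_det)
  qed
  ultimately show ?thesis using that by blast
qed

text \<open>The Leibniz product is expanded row by row. A row outside \<open>S\<close> becomes a row
  of the identity, so a principal minor is encoded as a full \<open>n\<close> by \<open>n\<close>
  determinant and index sets need no renumbering.\<close>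

lemma detN_one_plus:
  "detN n (\<lambda>i j. (if i = j then 1 else 0) + A i j)
   = (\<Sum>S\<in>Pow {..<n}. detN n (\<lambda>i j. if i \<in> S then A i j else if i = j then 1 else 0))"
proof -
  have "(\<Prod>i<n. (if i = p i then 1 else 0) + A i (p i))
      = (\<Sum>S\<in>Pow {..<n}. \<Prod>i<n. if i \<in> S then A i (p i) else if i = p i then 1 else 0)" for p
  proof -
    have "(\<Prod>i<n. (if i = p i then 1 else 0) + A i (p i)) = (\<Prod>i<n. A i (p i) + (if i = p i then 1 else 0))"
      by (simp add: add.commute)
    also have "\<dots> = (\<Sum>S\<in>Pow {..<n}. (\<Prod>i\<in>S. A i (p i)) * (\<Prod>i\<in>{..<n}-S. if i = p i then 1 else 0))"
      by (rule prod_add) auto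
    also have "\<dots> = (\<Sum>S\<in>Pow {..<n}. \<Prod>i<n. if i \<in> S then A i (p i) else if i = p i then 1 else 0)"
      by (intro sum.cong refl, subst prod.If_cases) (auto simp: Int_absorb1 Diff_eq)
    finally show ?thesis .
  qed
  then show ?thesis
    unfolding detN_def by (simp add: sum_distrib_left sum.swap[of _ "Pow _"])
qed

text \<open>Only permutations that fix every index outside \<open>S\<close> contribute; they permute
  \<open>S\<close>, so the column factors \<open>\<beta> (p i)\<close> recombine to the product of
  the \<open>\<beta> i\<close>.\<close>

lemma detN_minor_scale:
  assumes "S \<subseteq> {..<n}"
  shows "detN n (\<lambda>i j. if i \<in> S then \<alpha> i * A i j * \<beta> j else if i = j then 1 else 0)
   = (\<Prod>i\<in>S. \<alpha> i * \<beta> i) * detN n (\<lambda>i j. if i \<in> S then A i j else if i = j then 1 else 0)"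
proof -
  have "(\<Prod>i<n. if i \<in> S then \<alpha> i * A i (p i) * \<beta> (p i) else if i = p i then 1 else 0)
      = (\<Prod>i\<in>S. \<alpha> i * \<beta> i) * (\<Prod>i<n. if i \<in> S then A i (p i) else if i = p i then 1 else 0)"
    (is "?L = ?R") if p: "p permutes {0..<n}" for p
  proof (cases "\<exists>i<n. i \<notin> S \<and> p i \<noteq> i")
    case True
    then obtain i where i: "i < n" "i \<notin> S" "p i \<noteq> i" by blast
    then have "?L = 0" by (intro prod_zero) (auto intro!: bexI[of _ i])
    moreover have "(\<Prod>i<n. if i \<in> S then A i (p i) else if i = p i then 1 else 0) = 0"
      using i by (intro prod_zero) (auto intro!: bexI[of _ i])
    ultimately show ?thesis by (simp only: mult_zero_right)
  next
    case False
    have pS: "p permutes S"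
    proof (rule permutes_superset[OF p])
      fix x assume "x \<in> {0..<n} - S"
      then show "p x = x" using False by auto
    qed
    have *: "(\<Prod>i<n. if i \<in> S then F i else if i = p i then 1 else 0) = (\<Prod>i\<in>S. F i)" for F :: "nat \<Rightarrow> complex"
      using False assms by (subst prod.If_cases) (auto simp: Int_absorb1 Diff_eq intro!: prod.neutral)
    have "(\<Prod>i\<in>S. \<beta> (p i)) = (\<Prod>i\<in>S. \<beta> i)"
      using prod.permute[OF pS, of \<beta>] by (simp add: o_def)
    then show ?thesis unfolding * by (simp add: prod.distrib)
  qed
  then show ?thesis
    unfolding detN_def sum_distrib_left by (intro sum.cong refl) (simp add: mult_ac)
qed

text \<open>Eliminating the last index of a Cauchy matrix leaves a Cauchy matrix with rescaled rows
  and columns, so induction on the size applies. The double product runs over ordered pairs: each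
  unordered pair enters squared.\<close>

lemma detN_minor_cauchy:
  fixes \<zeta> :: "nat \<Rightarrow> complex"
  assumes pos: "\<And>i. i < n \<Longrightarrow> 0 < Im (\<zeta> i)" and S: "S \<subseteq> {..<n}"
  shows "detN n (\<lambda>i j. if i \<in> S then \<i> / (\<zeta> j - cnj (\<zeta> i)) else if i = j then 1 else 0)
    = of_real ((\<Prod>i\<in>S. 1 / (2 * Im (\<zeta> i)))
        * (\<Prod>i\<in>S. \<Prod>j\<in>S-{i}. cmod (\<zeta> i - \<zeta> j) / cmod (\<zeta> i - cnj (\<zeta> j))))"
  using assms
proof (induction n arbitrary: S)
  case 0
  then show ?case by (simp add: detN_def)
next
  case (Suc m)
  let ?A = "\<lambda>i j. \<i> / (\<zeta> j - cnj (\<zeta> i))"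
  define r where "r = (\<lambda>i j. cmod (\<zeta> i - \<zeta> j) / cmod (\<zeta> i - cnj (\<zeta> j)))"
  have r_sym: "r i j = r j i" for i j
  proof -
    have "cmod (\<zeta> i - cnj (\<zeta> j)) = cmod (\<zeta> j - cnj (\<zeta> i))"
      by (metis complex_cnj_cnj complex_cnj_diff complex_mod_cnj norm_minus_commute)
    then show ?thesis by (simp add: r_def norm_minus_commute)
  qed
  have nz: "\<zeta> j - cnj (\<zeta> i) \<noteq> 0" if "i \<le> m" "j \<le> m" for i j
  proof -
    have "Im (\<zeta> j - cnj (\<zeta> i)) > 0"
      using Suc.prems(1)[of i] Suc.prems(1)[of j] that by simp
    then show ?thesis by (metis less_irrefl zero_complex.simps(2))
  qed
  let ?M = "\<lambda>S i j. if i \<in> S then ?A i j else if i = j then 1 else 0 :: complex"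
  show ?case
  proof (cases "m \<in> S")
    case False
    then have S': "S \<subseteq> {..<m}" using Suc.prems(2) by (auto simp: less_Suc_eq)
    have "detN (Suc m) (?M S) = ?M S m m * detN m (\<lambda>i j. ?M S i j - ?M S i m * ?M S m j / ?M S m m)"
      using False by (intro detN_schur_complement) auto
    also have "detN m (\<lambda>i j. ?M S i j - ?M S i m * ?M S m j / ?M S m m) = detN m (?M S)"
      using False by (intro detN_cong) auto
    finally show ?thesis using Suc.IH[OF _ S'] Suc.prems(1) False by simp
  next
    case True
    define S' where "S' = S - {m}"
    have S': "S' \<subseteq> {..<m}" using Suc.prems(2) by (auto simp: S'_def less_Suc_eq)
    have SS': "S = insert m S'" "m \<notin> S'" using True by (auto simp: S'_def)
    have fin: "finite S'" using S' finite_subset by blast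
    define \<alpha> where "\<alpha> = (\<lambda>i. (cnj (\<zeta> i) - cnj (\<zeta> m)) / (\<zeta> m - cnj (\<zeta> i)))"
    define \<beta> where "\<beta> = (\<lambda>j. (\<zeta> m - \<zeta> j) / (\<zeta> j - cnj (\<zeta> m)))"
    have "detN (Suc m) (?M S) = ?A m m * detN m (\<lambda>i j. ?M S i j - ?M S i m * ?M S m j / ?M S m m)"
      using True nz[of m m] by (subst detN_schur_complement) auto
    also have "detN m (\<lambda>i j. ?M S i j - ?M S i m * ?M S m j / ?M S m m)
       = detN m (\<lambda>i j. if i \<in> S' then \<alpha> i * ?A i j * \<beta> j else if i = j then 1 else 0)"
    proof (rule detN_cong)
      fix i j assume ij: "i < m" "j < m"
      show "?M S i j - ?M S i m * ?M S m j / ?M S m m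
          = (if i \<in> S' then \<alpha> i * ?A i j * \<beta> j else if i = j then 1 else 0)"
      proof (cases "i \<in> S'")
        case False
        then show ?thesis using ij SS' by auto
      next
        case iS: True
        have nzs: "\<zeta> j - cnj (\<zeta> i) \<noteq> 0" "\<zeta> m - cnj (\<zeta> i) \<noteq> 0" "\<zeta> j - cnj (\<zeta> m) \<noteq> 0" "\<zeta> m - cnj (\<zeta> m) \<noteq> 0"
          using nz ij by auto
        \<comment> \<open>Here \<open>a\<close>, \<open>b\<close>, \<open>c\<close>,
          \<open>d\<close> are the four Cauchy denominators. That \<open>b * c - a * d\<close>
          splits into a factor depending on \<open>i\<close> and one depending on \<open>j\<close>
          is the three-term identity behind the Cauchy determinant.\<close>
        have aux: "\<i> / a - \<i> / b * (\<i> / c) / (\<i> / d) = e / b * (\<i> / a) * (f / c)"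
          if "a \<noteq> 0" "b \<noteq> 0" "c \<noteq> 0" "d \<noteq> 0" "b * c - a * d = e * f" for a b c d e f :: complex
        proof -
          have "\<i> / a - \<i> / b * (\<i> / c) / (\<i> / d) = \<i> * (b * c - a * d) / (a * b * c)"
            using that(1-4) by (simp add: field_simps)
          also have "\<dots> = e / b * (\<i> / a) * (f / c)" unfolding that(5) by (simp add: mult_ac)
          finally show ?thesis .
        qed
        have "\<i> / (\<zeta> j - cnj (\<zeta> i)) - \<i> / (\<zeta> m - cnj (\<zeta> i)) * (\<i> / (\<zeta> j - cnj (\<zeta> m))) / (\<i> / (\<zeta> m - cnj (\<zeta> m)))
          = \<alpha> i * ?A i j * \<beta> j"
          unfolding \<alpha>_def \<beta>_def by (rule aux[OF nzs]) (simp add: algebra_simps)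
        then show ?thesis using iS SS' by auto
      qed
    qed
    also have "\<dots> = (\<Prod>i\<in>S'. \<alpha> i * \<beta> i) * detN m (?M S')"
      by (rule detN_minor_scale[OF S'])
    also have "detN m (?M S') = of_real ((\<Prod>i\<in>S'. 1 / (2 * Im (\<zeta> i))) * (\<Prod>i\<in>S'. \<Prod>j\<in>S'-{i}. r i j))"
      unfolding r_def using Suc.IH[OF _ S'] Suc.prems(1) by simp
    \<comment> \<open>Numerators and denominators of \<open>\<alpha> i\<close> and
      \<open>\<beta> i\<close> pair into conjugates, each pair giving minus a squared modulus; the
      two signs cancel.\<close>
    also have "(\<Prod>i\<in>S'. \<alpha> i * \<beta> i) = of_real (\<Prod>i\<in>S'. (r i m)\<^sup>2)"
      unfolding of_real_prod
    proof (rule prod.cong[OF refl])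
      fix i assume "i \<in> S'"
      have "(cnj (\<zeta> i) - cnj (\<zeta> m)) * (\<zeta> m - \<zeta> i) = - of_real ((cmod (\<zeta> i - \<zeta> m))\<^sup>2)"
        by (simp only: complex_norm_square) (simp add: algebra_simps)
      moreover have "(\<zeta> m - cnj (\<zeta> i)) * (\<zeta> i - cnj (\<zeta> m)) = - of_real ((cmod (\<zeta> i - cnj (\<zeta> m)))\<^sup>2)"
        by (simp only: complex_norm_square) (simp add: algebra_simps)
      ultimately show "\<alpha> i * \<beta> i = of_real ((r i m)\<^sup>2)"
        by (simp add: \<alpha>_def \<beta>_def r_def power_divide)
    qed
    also have "?A m m = of_real (1 / (2 * Im (\<zeta> m)))"
    proof -
      have "\<zeta> m - cnj (\<zeta> m) = \<i> * of_real (2 * Im (\<zeta> m))"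
        by (simp add: complex_eq_iff)
      then show ?thesis by simp
    qed
    finally have 1: "detN (Suc m) (?M S) = of_real (1 / (2 * Im (\<zeta> m)) * ((\<Prod>i\<in>S'. (r i m)\<^sup>2) *
       ((\<Prod>i\<in>S'. 1 / (2 * Im (\<zeta> i))) * (\<Prod>i\<in>S'. \<Prod>j\<in>S'-{i}. r i j))))"
      by (simp only: of_real_mult)
    have "(\<Prod>i\<in>S. \<Prod>j\<in>S-{i}. r i j) = (\<Prod>j\<in>S'. r m j) * (\<Prod>i\<in>S'. \<Prod>j\<in>insert m (S'-{i}). r i j)"
    proof -
      have "insert m S' - {i} = insert m (S' - {i})" if "i \<in> S'" for i using that SS' by auto
      then show ?thesis using SS' fin by simp
    qed
    also have "(\<Prod>i\<in>S'. \<Prod>j\<in>insert m (S'-{i}). r i j) = (\<Prod>i\<in>S'. r i m * (\<Prod>j\<in>S'-{i}. r i j))"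
      using SS' fin by (intro prod.cong) auto
    finally have 2: "(\<Prod>i\<in>S. \<Prod>j\<in>S-{i}. r i j) = (\<Prod>i\<in>S'. (r i m)\<^sup>2) * (\<Prod>i\<in>S'. \<Prod>j\<in>S'-{i}. r i j)"
      by (simp add: prod.distrib power2_eq_square r_sym[of m])
    have 3: "(\<Prod>i\<in>S. 1 / (2 * Im (\<zeta> i))) = 1 / (2 * Im (\<zeta> m)) * (\<Prod>i\<in>S'. 1 / (2 * Im (\<zeta> i)))"
      using SS' fin by simp
    show ?thesis using 1 unfolding 2[unfolded r_def] 3 r_def by (simp only: mult_ac)
  qed
qed

text \<open>Gram structure: \<open>\<i> / (\<zeta> j - cnj (\<zeta> i))\<close> is the integral over
  s > 0 of \<open>exp (\<i> * s * (\<zeta> j - cnj (\<zeta> i)))\<close>, so the form is the squared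
  L2 norm of the combination \<open>f\<close> of decaying exponentials. The integral is evaluated on
  [0, T] by an antiderivative, then T tends to infinity.\<close>

lemma cauchy_form_nonneg:
  fixes \<zeta> x :: "nat \<Rightarrow> complex"
  assumes I: "finite I" and pos: "\<And>i. i \<in> I \<Longrightarrow> 0 < Im (\<zeta> i)"
  defines "q \<equiv> \<Sum>i\<in>I. \<Sum>j\<in>I. cnj (x i) * (\<i> / (\<zeta> j - cnj (\<zeta> i))) * x j"
  shows "Im q = 0" "0 \<le> Re q"
proof -
  define w where "w = (\<lambda>i j. \<zeta> j - cnj (\<zeta> i))"
  have Imw: "0 < Im (w i j)" if "i \<in> I" "j \<in> I" for i j
    using pos[of i] pos[of j] that by (simp add: w_def)
  have wnz: "w i j \<noteq> 0" if "i \<in> I" "j \<in> I" for i j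
    using Imw[OF that] by auto
  define f where "f = (\<lambda>s::real. \<Sum>j\<in>I. x j * exp (\<i> * of_real s * \<zeta> j))"
  define Q where "Q = (\<lambda>T::real. \<Sum>i\<in>I. \<Sum>j\<in>I. cnj (x i) * x j * ((exp (\<i> * w i j * of_real T) - 1) / (\<i> * w i j)))"
  have Q: "((\<lambda>s. of_real ((cmod (f s))\<^sup>2)) has_integral Q T) {0..T}" if "0 \<le> T" for T
  proof -
    have e: "((\<lambda>s. exp (\<i> * w i j * of_real s)) has_integral ((exp (\<i> * w i j * of_real T) - 1) / (\<i> * w i j))) {0..T}"
      if "i \<in> I" "j \<in> I" for i j
    proof -
      have "((\<lambda>s. exp (\<i> * w i j * of_real s)) has_integral
         (exp (\<i> * w i j * of_real T) / (\<i> * w i j) - exp (\<i> * w i j * of_real 0) / (\<i> * w i j))) {0..T}"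
        using \<open>0 \<le> T\<close> wnz[OF that]
        by (intro fundamental_theorem_of_calculus)
           (auto intro!: derivative_eq_intros has_vector_derivative_real_field simp: field_simps)
      then show ?thesis by (simp add: diff_divide_distrib)
    qed
    have "((\<lambda>s. \<Sum>i\<in>I. \<Sum>j\<in>I. cnj (x i) * x j * exp (\<i> * w i j * of_real s)) has_integral Q T) {0..T}"
      unfolding Q_def by (intro has_integral_sum I has_integral_mult_right e)
    moreover have "(\<Sum>i\<in>I. \<Sum>j\<in>I. cnj (x i) * x j * exp (\<i> * w i j * of_real s)) = of_real ((cmod (f s))\<^sup>2)" for s
    proof -
      have "of_real ((cmod (f s))\<^sup>2) = cnj (f s) * f s"
        by (simp add: complex_norm_square[symmetric] mult.commute)
      also have "\<dots> = (\<Sum>i\<in>I. \<Sum>j\<in>I. cnj (x i) * x j * exp (\<i> * w i j * of_real s))"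
        unfolding f_def cnj_sum sum_product
        by (intro sum.cong refl) (simp add: exp_cnj w_def exp_diff exp_minus field_simps flip: exp_add)
      finally show ?thesis by simp
    qed
    ultimately show ?thesis by simp
  qed
  have Q_real: "Im (Q T) = 0" "0 \<le> Re (Q T)" if "0 \<le> T" for T
  proof -
    have "((\<lambda>s. Im (of_real ((cmod (f s))\<^sup>2))) has_integral Im (Q T)) {0..T}"
      using has_integral_linear[OF Q[OF that] bounded_linear_Im] by (simp add: o_def)
    then show "Im (Q T) = 0" by (simp add: has_integral_is_0 has_integral_unique)
    have "((\<lambda>s. Re (of_real ((cmod (f s))\<^sup>2))) has_integral Re (Q T)) {0..T}"
      using has_integral_linear[OF Q[OF that] bounded_linear_Re] by (simp add: o_def)
    then show "0 \<le> Re (Q T)" by (rule has_integral_nonneg) auto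
  qed
  have "(Q \<longlongrightarrow> (\<Sum>i\<in>I. \<Sum>j\<in>I. cnj (x i) * x j * ((0 - 1) / (\<i> * w i j)))) at_top"
    unfolding Q_def
  proof (intro tendsto_intros)
    fix i j assume ij: "i \<in> I" "j \<in> I"
    show "\<i> * w i j \<noteq> 0" using wnz[OF ij] by simp
    have "((\<lambda>T. exp (- (Im (w i j) * T))) \<longlongrightarrow> 0) at_top"
      using Imw[OF ij]
      by (intro filterlim_compose[OF exp_at_bot] filterlim_uminus_at_bot_at_top
          filterlim_compose[OF filterlim_uminus_at_bot_at_top] filterlim_tendsto_pos_mult_at_top[OF tendsto_const] filterlim_ident) auto
    then show "((\<lambda>T. exp (\<i> * w i j * of_real T)) \<longlongrightarrow> 0) at_top"
      by (rule tendsto_norm_zero_cancel[OF tendsto_cong[THEN iffD1, rotated]]) (auto simp: norm_exp_eq_Re)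
  qed
  moreover have "(\<Sum>i\<in>I. \<Sum>j\<in>I. cnj (x i) * x j * ((0 - 1) / (\<i> * w i j))) = q"
    unfolding q_def by (intro sum.cong refl) (auto simp: w_def divide_simps)
  ultimately have lim: "(Q \<longlongrightarrow> q) at_top" by simp
  have ev: "eventually (\<lambda>T. 0 \<le> (T::real)) at_top" by (rule eventually_ge_at_top)
  show "Im q = 0"
    by (rule tendsto_unique[OF _ tendsto_Im[OF lim]])
       (auto intro!: tendsto_eventually eventually_mono[OF ev] Q_real)
  show "0 \<le> Re q"
    by (rule tendsto_lowerbound[OF tendsto_Re[OF lim]]) (auto intro!: eventually_mono[OF ev] Q_real)
qed

text \<open>Pairing \<open>B x\<close> with \<open>x\<close>, the adjugate column, gives
  \<open>cnj (x k)\<close> times the next minor. The same number is a weighted sum of the squared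
  moduli of \<open>x\<close> plus a nonnegative Cauchy form; after multiplication by
  \<open>w\<close> all real parts are nonnegative and only the term \<open>i = k\<close> is
  kept.\<close>

lemma pivot_lower_bound:
  fixes \<zeta> \<omega> :: "nat \<Rightarrow> complex"
  assumes pos: "\<And>i. i \<le> k \<Longrightarrow> 0 < Im (\<zeta> i)"
    and w: "0 \<le> Re w" "\<And>i. i \<le> k \<Longrightarrow> 0 \<le> Re (w * \<omega> i)"
  defines "B \<equiv> \<lambda>i j. (if i = j then \<omega> i else 0) + \<i> / (\<zeta> j - cnj (\<zeta> i))"
  shows "Re (w * \<omega> k) * (cmod (detN k B))\<^sup>2 \<le> Re (w * (detN (Suc k) B * cnj (detN k B)))"
proof -
  obtain x where xk: "x k = detN k B" and
    x: "\<And>i. i \<le> k \<Longrightarrow> (\<Sum>j\<le>k. B i j * x j) = (if i = k then detN (Suc k) B else 0)"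
    using detN_cofactor_column[of k B] by blast
  define q where "q = (\<Sum>i\<in>{..k}. \<Sum>j\<in>{..k}. cnj (x i) * (\<i> / (\<zeta> j - cnj (\<zeta> i))) * x j)"
  have q: "Im q = 0" "0 \<le> Re q"
    unfolding q_def by (rule cauchy_form_nonneg; use pos in auto)+
  have "(\<Sum>i\<le>k. cnj (x i) * (\<Sum>j\<le>k. B i j * x j)) = cnj (x k) * detN (Suc k) B"
  proof -
    have "(\<Sum>i\<le>k. cnj (x i) * (\<Sum>j\<le>k. B i j * x j)) = (\<Sum>i\<le>k. if i = k then cnj (x k) * detN (Suc k) B else 0)"
      using x by (intro sum.cong) auto
    then show ?thesis by simp
  qed
  moreover have "(\<Sum>i\<le>k. cnj (x i) * (\<Sum>j\<le>k. B i j * x j))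
      = (\<Sum>i\<le>k. \<omega> i * of_real ((cmod (x i))\<^sup>2)) + q"
  proof -
    have "cnj (x i) * (\<Sum>j\<le>k. B i j * x j) = \<omega> i * of_real ((cmod (x i))\<^sup>2)
        + (\<Sum>j\<le>k. cnj (x i) * (\<i> / (\<zeta> j - cnj (\<zeta> i))) * x j)" if "i \<le> k" for i
    proof -
      have "(\<Sum>j\<le>k. B i j * x j) = (\<Sum>j\<le>k. if i = j then \<omega> i * x i else 0) + (\<Sum>j\<le>k. \<i> / (\<zeta> j - cnj (\<zeta> i)) * x j)"
        unfolding B_def sum.distrib[symmetric] by (intro sum.cong refl) (auto simp: distrib_right)
      also have "(\<Sum>j\<le>k. if i = j then \<omega> i * x i else 0) = \<omega> i * x i" using that by simp
      finally show ?thesis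
        by (simp only: distrib_left sum_distrib_left complex_norm_square) (simp add: mult_ac)
    qed
    then show ?thesis by (simp add: q_def sum.distrib)
  qed
  ultimately have eq: "w * (detN (Suc k) B * cnj (detN k B)) = (\<Sum>i\<le>k. w * \<omega> i * of_real ((cmod (x i))\<^sup>2)) + w * q"
    by (simp add: xk[symmetric] mult_ac distrib_left sum_distrib_left)
  have "Re (w * \<omega> k) * (cmod (detN k B))\<^sup>2 = (\<Sum>i\<in>{k}. Re (w * \<omega> i) * (cmod (x i))\<^sup>2)"
    by (simp add: xk)
  also have "\<dots> \<le> (\<Sum>i\<le>k. Re (w * \<omega> i) * (cmod (x i))\<^sup>2)"
    using w by (intro sum_mono2) auto
  also have "\<dots> \<le> Re ((\<Sum>i\<le>k. w * \<omega> i * of_real ((cmod (x i))\<^sup>2)) + w * q)"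
  proof -
    have "0 \<le> Re (w * q)" using q w by simp
    moreover have "Re (w * \<omega> i * of_real ((cmod (x i))\<^sup>2)) = Re (w * \<omega> i) * (cmod (x i))\<^sup>2" for i
      by (simp only: Re_complex_of_real Im_complex_of_real times_complex.sel(1) mult_zero_right diff_zero)
    ultimately show ?thesis by simp
  qed
  finally show ?thesis unfolding eq .
qed

lemma pivot_nonzero:
  fixes \<zeta> \<omega> :: "nat \<Rightarrow> complex"
  assumes pos: "\<And>i. i < n \<Longrightarrow> 0 < Im (\<zeta> i)"
    and w: "0 \<le> Re w" "\<And>i. i < n \<Longrightarrow> 0 < Re (w * \<omega> i)"
    and k: "k \<le> n"
  defines "B \<equiv> \<lambda>i j. (if i = j then \<omega> i else 0) + \<i> / (\<zeta> j - cnj (\<zeta> i))"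
  shows "detN k B \<noteq> 0"
  using k
proof (induction k)
  case 0
  then show ?case by (simp add: detN_def)
next
  case (Suc k)
  then have "0 < Re (w * \<omega> k) * (cmod (detN k B))\<^sup>2"
    using w(2)[of k] by simp
  also have "\<dots> \<le> Re (w * (detN (Suc k) B * cnj (detN k B)))"
    unfolding B_def by (rule pivot_lower_bound) (use Suc.prems pos w in \<open>auto intro: less_imp_le\<close>)
  finally show ?case by auto
qed

text \<open>Each elimination pivot lies at least as deep in the half plane selected by
  \<open>w\<close> as its own diagonal weight, however large the Cauchy part is.\<close>

lemma pivot_ratio_bound:
  fixes \<zeta> \<omega> :: "nat \<Rightarrow> complex"
  assumes pos: "\<And>i. i < n \<Longrightarrow> 0 < Im (\<zeta> i)"
    and w: "0 \<le> Re w" "\<And>i. i < n \<Longrightarrow> 0 < Re (w * \<omega> i)"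
    and k: "k < n"
  defines "B \<equiv> \<lambda>i j. (if i = j then \<omega> i else 0) + \<i> / (\<zeta> j - cnj (\<zeta> i))"
  shows "Re (w * \<omega> k) \<le> Re (w * (detN (Suc k) B / detN k B))"
proof -
  have nz: "detN k B \<noteq> 0" unfolding B_def by (rule pivot_nonzero[OF pos w]) (use k in auto)
  have 1: "Re (w * \<omega> k) * (cmod (detN k B))\<^sup>2 \<le> Re (w * (detN (Suc k) B * cnj (detN k B)))"
    unfolding B_def by (rule pivot_lower_bound) (use k pos w in \<open>auto intro: less_imp_le\<close>)
  have "w * (detN (Suc k) B / detN k B) = w * (detN (Suc k) B * cnj (detN k B)) / of_real ((cmod (detN k B))\<^sup>2)"
    using nz by (simp only: complex_norm_square) simp
  then have "Re (w * (detN (Suc k) B / detN k B)) = Re (w * (detN (Suc k) B * cnj (detN k B))) / (cmod (detN k B))\<^sup>2"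
    by (simp only: Re_divide_of_real)
  then show ?thesis using 1 nz by (simp add: pos_le_divide_eq)
qed

section \<open>A holomorphic logarithm of the soliton determinant in a strip\<close>

lemma cos_pos_of_abs_less: "\<bar>x\<bar> < pi / 2 \<Longrightarrow> 0 < cos x"
  by (rule cos_gt_zero_pi) linarith+

lemma cos_antimono_abs:
  assumes "\<bar>x\<bar> \<le> \<bar>y\<bar>" "\<bar>y\<bar> < pi / 2"
  shows "cos y \<le> cos x"
proof -
  have "cos \<bar>y\<bar> \<le> cos \<bar>x\<bar>"
    by (rule cos_monotone_0_pi_le) (use assms pi_gt_zero in linarith)+
  then show ?thesis by (simp only: cos_abs_real)
qed

locale soliton_det =
  fixes n :: nat and \<zeta> :: "nat \<Rightarrow> complex" and b :: "nat \<Rightarrow> real" and \<epsilon> km :: real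
  assumes eps_pos: "0 < \<epsilon>" and km_pos: "0 < km"
    and Im_pos: "\<And>i. i < n \<Longrightarrow> 0 < Im (\<zeta> i)" and Im_le: "\<And>i. i < n \<Longrightarrow> Im (\<zeta> i) \<le> km"
begin

definition expo :: "complex \<Rightarrow> nat \<Rightarrow> complex" where
  "expo z i = of_real (b i) - of_real (2 * Im (\<zeta> i) / \<epsilon>) * z"

definition Z :: "complex \<Rightarrow> complex" where
  "Z z = detN n (\<lambda>i j. (if i = j then 1 else 0) +
     exp (expo z i / 2) * (\<i> / (\<zeta> j - cnj (\<zeta> i))) * exp (expo z j / 2))"

text \<open>The matrix of \<open>Z\<close> with the factors \<open>exp (expo z i / 2)\<close> pulled
  out of rows and columns: the dependence on \<open>z\<close> sits on the diagonal alone, next to a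
  fixed Cauchy matrix with nonnegative form.\<close>

definition B :: "complex \<Rightarrow> nat \<Rightarrow> nat \<Rightarrow> complex" where
  "B z = (\<lambda>i j. (if i = j then exp (- expo z i) else 0) + \<i> / (\<zeta> j - cnj (\<zeta> i)))"

definition piv :: "complex \<Rightarrow> nat \<Rightarrow> complex" where
  "piv z k = detN (Suc k) (B z) / detN k (B z)"

text \<open>Principal logarithms are taken of the single pivots and not of the determinant: every
  pivot avoids the cut, whereas their product may wind around 0.\<close>

definition L :: "complex \<Rightarrow> complex" where
  "L z = (\<Sum>k<n. Ln (piv z k) + expo z k)"

definition W :: "nat set \<Rightarrow> real" where
  "W S = (\<Prod>i\<in>S. 1 / (2 * Im (\<zeta> i)))
        * (\<Prod>i\<in>S. \<Prod>j\<in>S-{i}. cmod (\<zeta> i - \<zeta> j) / cmod (\<zeta> i - cnj (\<zeta> j)))"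

definition Zr :: "real \<Rightarrow> real" where
  "Zr x = (\<Sum>S\<in>Pow {..<n}. W S * exp (\<Sum>i\<in>S. b i - 2 * Im (\<zeta> i) / \<epsilon> * x))"

definition Strip :: "complex set" where
  "Strip = {z. \<bar>Im z\<bar> * km / \<epsilon> < pi / 2}"

text \<open>The weight \<open>exp (- expo z i)\<close> has an argument between 0 and
  \<open>2 * km * Im z / \<epsilon>\<close>. Turning back by half of this maximal angle centres the
  range, so on \<open>Strip\<close> all rotated weights, and \<open>w z\<close> itself, lie in the
  open right half plane.\<close>

definition w :: "complex \<Rightarrow> complex" where
  "w z = cis (- (km * Im z / \<epsilon>))"

lemma W_nonneg: "S \<subseteq> {..<n} \<Longrightarrow> 0 \<le> W S"
  unfolding W_def using Im_pos by (intro mult_nonneg_nonneg prod_nonneg) (auto intro!: less_imp_le[OF Im_pos] dest: subsetD)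

lemma Z_expansion: "Z z = (\<Sum>S\<in>Pow {..<n}. of_real (W S) * exp (\<Sum>i\<in>S. expo z i))"
  unfolding Z_def detN_one_plus
proof (rule sum.cong[OF refl])
  fix S assume "S \<in> Pow {..<n}"
  then have S: "S \<subseteq> {..<n}" by auto
  then have fin: "finite S" using finite_subset by blast
  have "(\<Prod>i\<in>S. exp (expo z i / 2) * exp (expo z i / 2)) = exp (\<Sum>i\<in>S. expo z i)"
    by (simp add: exp_sum fin flip: exp_add)
  then show "detN n (\<lambda>i j. if i \<in> S then exp (expo z i / 2) * (\<i> / (\<zeta> j - cnj (\<zeta> i))) * exp (expo z j / 2)
        else if i = j then 1 else 0) = of_real (W S) * exp (\<Sum>i\<in>S. expo z i)"
    by (subst detN_minor_scale[OF S], subst detN_minor_cauchy[OF _ S]) (use Im_pos in \<open>auto simp: W_def\<close>)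
qed

lemma Z_real: "Z (of_real x) = of_real (Zr x)"
  unfolding Z_expansion Zr_def expo_def by (simp add: exp_of_real[symmetric] del: exp_of_real)

text \<open>The coefficients \<open>W S\<close> are nonnegative and \<open>z\<close> enters the
  exponents with real factors, so the sum of the moduli is the same sum at
  \<open>Re z\<close>.\<close>

lemma norm_Z_le: "cmod (Z z) \<le> Zr (Re z)"
proof -
  have "cmod (Z z) \<le> (\<Sum>S\<in>Pow {..<n}. cmod (of_real (W S) * exp (\<Sum>i\<in>S. expo z i)))"
    unfolding Z_expansion by (rule norm_sum)
  also have "\<dots> = Zr (Re z)"
    unfolding Zr_def using W_nonneg by (intro sum.cong refl) (auto simp: norm_mult expo_def)
  finally show ?thesis .
qed

lemma Zr_ge_1: "1 \<le> Zr x"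
proof -
  have "W {} * exp (\<Sum>i\<in>{}. b i - 2 * Im (\<zeta> i) / \<epsilon> * x) \<le> Zr x"
    unfolding Zr_def by (rule member_le_sum) (auto simp: W_nonneg)
  then show ?thesis by (simp add: W_def)
qed

lemma Z_eq_det_B: "Z z = exp (\<Sum>i<n. expo z i) * detN n (B z)"
proof -
  have *: "exp (expo z i / 2) * B z i j * exp (expo z j / 2)
     = (if i = j then 1 else 0) + exp (expo z i / 2) * (\<i> / (\<zeta> j - cnj (\<zeta> i))) * exp (expo z j / 2)" for i j
  proof -
    have "exp (expo z i / 2) * exp (- expo z i) * exp (expo z i / 2) = 1"
      by (simp flip: exp_add)
    then show ?thesis by (auto simp: B_def algebra_simps)
  qed
  have "Z z = detN n (\<lambda>i j. if i \<in> {..<n} then exp (expo z i / 2) * B z i j * exp (expo z j / 2) else if i = j then 1 else 0)"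
    unfolding Z_def * by (rule detN_cong) auto
  also have "\<dots> = (\<Prod>i\<in>{..<n}. exp (expo z i / 2) * exp (expo z i / 2)) *
      detN n (\<lambda>i j. if i \<in> {..<n} then B z i j else if i = j then 1 else 0)"
    by (rule detN_minor_scale) simp
  also have "detN n (\<lambda>i j. if i \<in> {..<n} then B z i j else if i = j then 1 else 0) = detN n (B z)"
    by (rule detN_cong) auto
  also have "(\<Prod>i\<in>{..<n}. exp (expo z i / 2) * exp (expo z i / 2)) = exp (\<Sum>i<n. expo z i)"
    by (simp add: exp_sum flip: exp_add)
  finally show ?thesis .
qed

context
  fixes z assumes z: "z \<in> Strip"
begin

lemma Re_w_pos: "0 < Re (w z)"
proof -
  have "\<bar>km * Im z / \<epsilon>\<bar> < pi / 2" using z eps_pos km_pos by (simp add: Strip_def abs_mult mult.commute)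
  then show ?thesis using cos_pos_of_abs_less by (simp add: w_def)
qed

lemma Re_w_weight:
  assumes i: "i < n"
  shows "cmod (exp (- expo z i)) * Re (w z) \<le> Re (w z * exp (- expo z i))"
    and "0 < Re (w z * exp (- expo z i))"
proof -
  have a: "\<bar>km * Im z / \<epsilon>\<bar> < pi / 2" using z eps_pos km_pos by (simp add: Strip_def abs_mult mult.commute)
  have "exp (- expo z i) = of_real (cmod (exp (- expo z i))) * cis (Im (- expo z i))"
    unfolding norm_exp_eq_Re by (rule exp_eq_polar)
  moreover have "cis (- (km * Im z / \<epsilon>)) * cis (Im (- expo z i)) = cis ((2 * Im (\<zeta> i) - km) * Im z / \<epsilon>)"
    by (simp add: cis_mult expo_def algebra_simps diff_divide_distrib)
  ultimately have "w z * exp (- expo z i) = of_real (cmod (exp (- expo z i))) * cis ((2 * Im (\<zeta> i) - km) * Im z / \<epsilon>)"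
    unfolding w_def by (metis mult.left_commute)
  then have "Re (w z * exp (- expo z i)) = cmod (exp (- expo z i)) * cos ((2 * Im (\<zeta> i) - km) * Im z / \<epsilon>)"
    by simp
  \<comment> \<open>As \<open>Im (\<zeta> i)\<close> ranges over (0, \<open>km\<close>], the factor
    \<open>2 * Im (\<zeta> i) - km\<close> ranges over (\<open>- km\<close>,
    \<open>km\<close>].\<close>
  moreover have "cos (km * Im z / \<epsilon>) \<le> cos ((2 * Im (\<zeta> i) - km) * Im z / \<epsilon>)"
  proof -
    have "\<bar>(2 * Im (\<zeta> i) - km) * Im z / \<epsilon>\<bar> \<le> \<bar>km * Im z / \<epsilon>\<bar>"
      unfolding abs_divide abs_mult using Im_pos[OF i] Im_le[OF i] eps_pos
      by (intro divide_right_mono mult_right_mono) auto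
    then show ?thesis using a by (rule cos_antimono_abs)
  qed
  ultimately show 1: "cmod (exp (- expo z i)) * Re (w z) \<le> Re (w z * exp (- expo z i))"
    by (simp add: w_def)
  have "0 < cmod (exp (- expo z i)) * Re (w z)" using Re_w_pos by simp
  with 1 show "0 < Re (w z * exp (- expo z i))" by linarith
qed

lemma det_B_nonzero: "k \<le> n \<Longrightarrow> detN k (B z) \<noteq> 0"
  unfolding B_def by (rule pivot_nonzero[where n = n and w = "w z"])
    (use Im_pos Re_w_pos Re_w_weight(2) in \<open>auto intro: less_imp_le\<close>)

lemma piv_bound: "k < n \<Longrightarrow> cmod (exp (- expo z k)) * Re (w z) \<le> Re (w z * piv z k)"
  unfolding piv_def B_def
  by (rule order_trans[OF Re_w_weight(1) pivot_ratio_bound[where n = n and w = "w z"]])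
    (use Im_pos Re_w_pos Re_w_weight(2) in \<open>auto intro: less_imp_le\<close>)

text \<open>A real pivot \<open>r \<le> 0\<close> would satisfy
  \<open>Re (w z * r) = r * Re (w z) \<le> 0\<close>, against the positive bound of
  \<open>piv_bound\<close>.\<close>

lemma piv_slit: assumes "k < n" shows "piv z k \<notin> \<real>\<^sub>\<le>\<^sub>0"
proof
  assume "piv z k \<in> \<real>\<^sub>\<le>\<^sub>0"
  then obtain r where r: "piv z k = of_real r" "r \<le> 0"
    by (auto elim!: nonpos_Reals_cases)
  have "0 < cmod (exp (- expo z k)) * Re (w z)" using Re_w_pos by simp
  also have "\<dots> \<le> Re (w z * piv z k)" by (rule piv_bound[OF assms])
  also have "\<dots> = r * Re (w z)" by (simp add: r)
  also have "\<dots> \<le> 0" using r Re_w_pos by (simp add: mult_nonpos_nonneg)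
  finally show False by simp
qed

lemma piv_nonzero: "k < n \<Longrightarrow> piv z k \<noteq> 0"
  using piv_slit[of k] by auto

lemma prod_piv: "k \<le> n \<Longrightarrow> (\<Prod>i<k. piv z i) = detN k (B z)"
proof (induction k)
  case 0
  then show ?case by (simp add: detN_def)
next
  case (Suc k)
  then show ?case using det_B_nonzero[of k] by (simp add: piv_def)
qed

lemma exp_L: "exp (L z) = Z z"
proof -
  have "exp (L z) = (\<Prod>k<n. piv z k) * exp (\<Sum>i<n. expo z i)"
    by (simp add: L_def sum.distrib exp_add exp_sum piv_nonzero)
  then show ?thesis by (simp add: prod_piv Z_eq_det_B)
qed

text \<open>The real part is bounded above globally, through the modulus of \<open>Z\<close>, and
  below pivot by pivot, each costing \<open>- ln (cos \<theta>)\<close>. The imaginary part costs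
  \<pi> for the principal logarithm and \<pi> for the exponent of each pivot, hence
  \<open>2 * pi\<close>.\<close>

lemma norm_L_le:
  assumes \<theta>: "\<bar>Im z\<bar> * km / \<epsilon> \<le> \<theta>" "\<theta> < pi / 2"
  shows "cmod (L z) \<le> ln (Zr (Re z)) + real n * (2 * pi - ln (cos \<theta>))"
proof -
  have a: "\<bar>km * Im z / \<epsilon>\<bar> \<le> \<theta>" using \<theta> eps_pos km_pos by (simp add: abs_mult mult.commute)
  then have th0: "0 \<le> \<theta>" by linarith
  have cpos: "0 < cos \<theta>" using \<theta> th0 by (intro cos_gt_zero_pi) auto
  have cw: "cos \<theta> \<le> Re (w z)"
  proof -
    have "cos \<theta> \<le> cos (km * Im z / \<epsilon>)"
      by (rule cos_antimono_abs) (use a th0 \<theta> in auto)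
    then show ?thesis by (simp add: w_def)
  qed
  have Re_term: "ln (cos \<theta>) \<le> Re (Ln (piv z k) + expo z k)" if k: "k < n" for k
  proof -
    have "cmod (exp (- expo z k)) * cos \<theta> \<le> cmod (exp (- expo z k)) * Re (w z)"
      using cw by (intro mult_left_mono) auto
    also have "\<dots> \<le> cmod (w z * piv z k)" using piv_bound[OF k] complex_Re_le_cmod order_trans by blast
    also have "\<dots> = cmod (piv z k)" by (simp add: norm_mult w_def)
    finally have "ln (exp (- Re (expo z k)) * cos \<theta>) \<le> ln (cmod (piv z k))"
      using cpos piv_nonzero[OF k] by (subst ln_le_cancel_iff) auto
    then show ?thesis using cpos piv_nonzero[OF k] by (simp add: ln_mult Re_Ln)
  qed
  have Re_L_lower: "real n * ln (cos \<theta>) \<le> Re (L z)"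
    using sum_mono[of "{..<n}" "\<lambda>_. ln (cos \<theta>)" "\<lambda>k. Re (Ln (piv z k) + expo z k)"] Re_term
    by (simp add: L_def)
  have "exp (Re (L z)) = cmod (Z z)" by (simp flip: exp_L)
  also have "\<dots> \<le> Zr (Re z)" by (rule norm_Z_le)
  finally have "ln (exp (Re (L z))) \<le> ln (Zr (Re z))"
    by (subst ln_le_cancel_iff) (use Zr_ge_1[of "Re z"] in auto)
  then have Re_L_upper: "Re (L z) \<le> ln (Zr (Re z))" by simp
  have ln_c: "ln (cos \<theta>) \<le> 0" using cpos by simp
  have "\<bar>Re (L z)\<bar> \<le> ln (Zr (Re z)) - real n * ln (cos \<theta>)"
  proof -
    have "0 \<le> ln (Zr (Re z))" using Zr_ge_1 by simp
    moreover have "real n * ln (cos \<theta>) \<le> 0" using ln_c by (simp add: mult_nonneg_nonpos)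
    ultimately show ?thesis using Re_L_lower Re_L_upper by linarith
  qed
  moreover have "\<bar>Im (L z)\<bar> \<le> real n * (2 * pi)"
  proof -
    have "\<bar>Im (Ln (piv z k) + expo z k)\<bar> \<le> 2 * pi" if k: "k < n" for k
    proof -
      have "\<bar>Im (Ln (piv z k))\<bar> \<le> pi" using mpi_less_Im_Ln[OF piv_nonzero[OF k]] Im_Ln_le_pi[OF piv_nonzero[OF k]] by linarith
      moreover have "\<bar>Im (expo z k)\<bar> \<le> pi"
      proof -
        have "\<bar>Im (expo z k)\<bar> = 2 * (Im (\<zeta> k) * \<bar>Im z\<bar> / \<epsilon>)"
          using eps_pos Im_pos[OF k] by (simp add: expo_def abs_mult)
        also have "\<dots> \<le> 2 * (km * \<bar>Im z\<bar> / \<epsilon>)"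
          using Im_le[OF k] eps_pos by (intro mult_left_mono divide_right_mono mult_right_mono) auto
        also have "\<dots> \<le> pi" using \<theta> by (simp add: mult.commute)
        finally show ?thesis .
      qed
      ultimately show ?thesis by simp
    qed
    then have "(\<Sum>k<n. \<bar>Im (Ln (piv z k) + expo z k)\<bar>) \<le> (\<Sum>k<n. 2 * pi)"
      by (intro sum_mono) auto
    then show ?thesis
      unfolding L_def Im_sum by (intro order_trans[OF sum_abs]) simp
  qed
  ultimately show ?thesis using cmod_le[of "L z"] by (simp add: algebra_simps)
qed

end

lemma open_O: "open Strip"
  unfolding Strip_def by (intro open_Collect_less continuous_intros) (use eps_pos in auto)

lemma L_holomorphic: "L holomorphic_on Strip"
proof -
  have "(\<lambda>z. detN k (B z)) holomorphic_on Strip" for k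
  proof -
    have "(\<lambda>z. (if i = j then exp (- expo z i) else 0) + \<i> / (\<zeta> j - cnj (\<zeta> i))) holomorphic_on Strip" for i j
      by (cases "i = j") (auto simp: expo_def intro!: holomorphic_intros)
    then show ?thesis
      unfolding detN_def B_def by (intro holomorphic_on_sum holomorphic_on_mult holomorphic_on_prod holomorphic_on_const)
  qed
  then show ?thesis
    unfolding L_def piv_def
    using piv_slit det_B_nonzero
    by (intro holomorphic_intros) (auto simp: piv_def expo_def intro!: holomorphic_intros)
qed

text \<open>On the real line the weights are real, so the half plane condition holds with
  \<open>\<i>\<close> and with \<open>- \<i>\<close> as rotation. The two resulting inequalities
  force a minor times the conjugate of its predecessor to be real.\<close>

lemma L_real: "L (of_real x) \<in> \<real>"
proof -
  have xS: "of_real x \<in> Strip" using eps_pos by (simp add: Strip_def)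
  have om: "exp (- expo (of_real x) i) = of_real (exp (2 * Im (\<zeta> i) / \<epsilon> * x - b i))" for i
    by (simp add: expo_def exp_of_real[symmetric] del: exp_of_real)
  have "Ln (piv (of_real x) k) \<in> \<real>" if k: "k < n" for k
  proof -
    let ?X = "detN (Suc k) (B (of_real x)) * cnj (detN k (B (of_real x)))"
    have "0 \<le> Re (v * ?X)" if "v = \<i> \<or> v = -\<i>" for v
      using pivot_lower_bound[of k \<zeta> v "\<lambda>i. exp (- expo (of_real x) i)"] k Im_pos that
      unfolding B_def om by auto
    from this[of "\<i>"] this[of "-\<i>"] have "Im ?X = 0" by simp
    then have X: "?X = of_real (Re ?X)" by (simp add: complex_eq_iff)
    have "piv (of_real x) k = ?X / of_real ((cmod (detN k (B (of_real x))))\<^sup>2)"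
      using det_B_nonzero[OF xS, of k] k by (simp only: piv_def complex_norm_square) simp
    then have "piv (of_real x) k = of_real (Re ?X / (cmod (detN k (B (of_real x))))\<^sup>2)"
      using X by (simp only: of_real_divide)
    then obtain r where r: "piv (of_real x) k = of_real r" by blast
    then have "0 < r" using piv_slit[OF xS k] by (metis complex_nonpos_Reals_iff Im_complex_of_real Re_complex_of_real not_le)
    then show ?thesis using r by (simp add: Ln_of_real)
  qed
  then show ?thesis unfolding L_def by (auto intro!: sum_in_Reals simp: expo_def)
qed

text \<open>Two continuous logarithms differ by an integer multiple of \<open>2 * pi * \<i>\<close>
  that is constant on a connected set and vanishes where both are real. This pins down whichever
  branch \<open>SOME\<close> selects in \<open>logZN\<close>.\<close>

lemma log_branch_unique:
  assumes S: "S \<subseteq> Strip" "connected S" "of_real x0 \<in> S"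
    and M: "continuous_on S M" "\<And>z. z \<in> S \<Longrightarrow> exp (M z) = Z z" "M (of_real x0) \<in> \<real>"
    and z: "z \<in> S"
  shows "M z = L z"
proof -
  define f where "f = (\<lambda>z. (M z - L z) / (2 * of_real pi * \<i>))"
  have fint: "f u \<in> \<int>" if "u \<in> S" for u
  proof -
    have "exp (M u) = exp (L u)" using M(2)[OF that] exp_L[of u] S that by auto
    then obtain m :: int where "M u = L u + (of_int (2 * m) * pi) * \<i>"
      unfolding exp_eq by blast
    then have "f u = of_int m" by (simp add: f_def)
    then show ?thesis by simp
  qed
  have "continuous_on S f"
    unfolding f_def
    by (intro continuous_intros M holomorphic_on_imp_continuous_on[OF holomorphic_on_subset[OF L_holomorphic S(1)]]) auto
  then have "f constant_on S"
  proof (rule continuous_discrete_range_constant[OF S(2)])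
    fix u assume u: "u \<in> S"
    show "\<exists>e>0. \<forall>y. y \<in> S \<and> f y \<noteq> f u \<longrightarrow> e \<le> cmod (f y - f u)"
    proof (intro exI[of _ 1] conjI allI impI)
      fix y assume y: "y \<in> S \<and> f y \<noteq> f u"
      obtain a c :: int where "f y = of_int a" "f u = of_int c" using fint u y by (metis Ints_cases)
      then have "cmod (f y - f u) = \<bar>of_int (a - c)\<bar>" by (simp flip: of_int_diff add: norm_of_int)
      moreover have "a \<noteq> c" using y \<open>f y = _\<close> \<open>f u = _\<close> by auto
      ultimately show "1 \<le> cmod (f y - f u)" by simp
    qed simp
  qed
  then have "f z = f (of_real x0)" using z S(3) by (auto simp: constant_on_def)
  moreover have "f (of_real x0) = 0"
  proof -
    obtain a c where "M (of_real x0) = of_real a" "L (of_real x0) = of_real c"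
      using M(3) L_real by (meson Reals_cases)
    then have "f (of_real x0) = - \<i> * of_real ((a - c) / (2 * pi))" by (simp add: f_def field_simps)
    moreover obtain m :: int where "f (of_real x0) = of_int m" using fint[OF S(3)] by (metis Ints_cases)
    ultimately have "- \<i> * of_real ((a - c) / (2 * pi)) = of_real (of_int m)" by simp
    then have "Re (- \<i> * of_real ((a - c) / (2 * pi))) = Re (of_real (of_int m))" by (rule arg_cong)
    then have "m = 0" by simp
    then show ?thesis using \<open>f (of_real x0) = of_int m\<close> by simp
  qed
  ultimately show ?thesis by (simp add: f_def)
qed

end

section \<open>Difference quotients across a strip\<close>

lemma norm_diff_le_of_vector_derivative_bound:
  fixes f f' :: "real \<Rightarrow> complex"
  assumes der: "\<And>s. s \<in> {a..b} \<Longrightarrow> (f has_vector_derivative f' s) (at s within {a..b})"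
    and bd: "\<And>s. s \<in> {a..b} \<Longrightarrow> cmod (f' s) \<le> K" and ab: "a \<le> b" and K: "0 \<le> K"
  shows "cmod (f b - f a) \<le> K * (b - a)"
proof -
  have "(f' has_integral (f b - f a)) {a..b}"
    by (rule fundamental_theorem_of_calculus[OF ab der])
  then show ?thesis
    using has_integral_bound_real[OF K finite.emptyI, of f' "f b - f a" a b] bd ab by simp
qed

text \<open>Let \<open>J \<phi> s\<close> pair \<open>\<phi>\<close> with \<open>F\<close> on the
  line of height \<open>s\<close>. The Cauchy-Riemann equations and one integration by parts give
  the \<open>s\<close>-derivative \<open>- \<i> * J \<phi>' s\<close>. Vertical regularity is thus
  paid for by derivatives of the test function, and a bound on \<open>F\<close> itself
  suffices.\<close>

lemma strip_shift_estimate: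
  fixes F :: "complex \<Rightarrow> complex" and \<chi>0 \<chi>1 \<chi>2 \<chi>3 :: "real \<Rightarrow> real"
  assumes h: "0 < h" and A: "0 < A"
    and S: "open S" "F holomorphic_on S" "{z. \<bar>Re z\<bar> \<le> A \<and> \<bar>Im z\<bar> \<le> h} \<subseteq> S"
    and d0: "\<And>x. (\<chi>0 has_real_derivative \<chi>1 x) (at x)"
    and d1: "\<And>x. (\<chi>1 has_real_derivative \<chi>2 x) (at x)"
    and d2: "\<And>x. (\<chi>2 has_real_derivative \<chi>3 x) (at x)"
    and c3: "continuous_on UNIV \<chi>3"
    and z: "\<chi>0 A = 0" "\<chi>0 (-A) = 0" "\<chi>1 A = 0" "\<chi>1 (-A) = 0" "\<chi>2 A = 0" "\<chi>2 (-A) = 0"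
    and M: "\<And>x. \<bar>x\<bar> \<le> A \<Longrightarrow> \<bar>\<chi>3 x\<bar> \<le> M"
    and C: "\<And>z. \<bar>Re z\<bar> \<le> A \<Longrightarrow> \<bar>Im z\<bar> \<le> h \<Longrightarrow> cmod (F z) \<le> C"
  shows "cmod (integral {-A..A} (\<lambda>x. of_real (\<chi>0 x) * ((deriv F (Complex x h) - deriv F (Complex x (-h))) / (2 * \<i> * of_real h)))
      - integral {-A..A} (\<lambda>x. of_real (\<chi>2 x) * F (of_real x))) \<le> h * (2 * A * M * C)"
proof -
  define R where "R = {z. \<bar>Re z\<bar> \<le> A \<and> \<bar>Im z\<bar> \<le> h}"
  define J where "J = (\<lambda>\<phi>::real \<Rightarrow> real. \<lambda>s. integral {-A..A} (\<lambda>x. of_real (\<phi> x) * F (Complex x s)))"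
  have FR: "continuous_on R F" "continuous_on R (deriv F)"
    using S unfolding R_def
    by (auto intro!: holomorphic_on_imp_continuous_on intro: holomorphic_on_subset holomorphic_deriv)
  have RC: "Complex x s \<in> R" if "x \<in> {-A..A}" "s \<in> {-h..h}" for x s
    using that by (auto simp: R_def)
  have Fd: "(F has_field_derivative deriv F z) (at z)" if "z \<in> R" for z
    using that S unfolding R_def by (meson holomorphic_derivI subsetD)
  have cF: "continuous_on X (\<lambda>p. F (Complex (f p) (g p)))" "continuous_on X (\<lambda>p. deriv F (Complex (f p) (g p)))"
    if "continuous_on X f" "continuous_on X g" "\<And>p. p \<in> X \<Longrightarrow> f p \<in> {-A..A}" "\<And>p. p \<in> X \<Longrightarrow> g p \<in> {-h..h}"
    for X :: "'z::topological_space set" and f g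
  proof -
    have c: "continuous_on X (\<lambda>p. Complex (f p) (g p))"
      using that by (auto intro!: continuous_intros simp: Complex_eq)
    show "continuous_on X (\<lambda>p. F (Complex (f p) (g p)))"
      by (rule continuous_on_compose2[OF FR(1) c]) (use RC that in auto)
    show "continuous_on X (\<lambda>p. deriv F (Complex (f p) (g p)))"
      by (rule continuous_on_compose2[OF FR(2) c]) (use RC that in auto)
  qed
  have parts: "integral {-A..A} (\<lambda>x. of_real (\<phi> x) * deriv F (Complex x s)) = - J \<phi>' s"
    if s: "s \<in> {-h..h}" and d: "\<And>x. (\<phi> has_real_derivative \<phi>' x) (at x)" and c: "continuous_on UNIV \<phi>'"
      and b0: "\<phi> A = 0" "\<phi> (-A) = 0" for \<phi> \<phi>' :: "real \<Rightarrow> real" and s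
  proof -
    have c\<phi>: "continuous_on {-A..A} \<phi>"
      using d by (auto intro!: continuous_at_imp_continuous_on DERIV_isCont)
    have c\<phi>': "continuous_on {-A..A} \<phi>'"
      by (rule continuous_on_subset[OF c]) simp
    have "((\<lambda>x. of_real (\<phi> x) * deriv F (Complex x s) + of_real (\<phi>' x) * F (Complex x s)) has_integral
        (of_real (\<phi> A) * F (Complex A s) - of_real (\<phi> (-A)) * F (Complex (-A) s))) {-A..A}"
    proof (rule fundamental_theorem_of_calculus)
      fix x assume x: "x \<in> {-A..A}"
      have "((\<lambda>x. of_real x + \<i> * of_real s) has_vector_derivative (of_real 1 + 0 :: complex)) (at x)"
        by (intro has_vector_derivative_add has_vector_derivative_of_real has_vector_derivative_const DERIV_ident)
      then have "((\<lambda>x. F (Complex x s)) has_vector_derivative deriv F (Complex x s)) (at x)"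
        using field_vector_diff_chain_at[of "\<lambda>x. Complex x s" 1 x F "deriv F (Complex x s)"] Fd[OF RC[OF x s]]
        by (simp add: o_def Complex_eq)
      then have 1: "((\<lambda>x. F (Complex x s)) has_vector_derivative deriv F (Complex x s)) (at x within {-A..A})"
        by (rule has_vector_derivative_at_within)
      have 2: "((\<lambda>x. of_real (\<phi> x)) has_vector_derivative complex_of_real (\<phi>' x)) (at x within {-A..A})"
        by (rule has_vector_derivative_of_real[OF has_field_derivative_at_within[OF d]])
      show "((\<lambda>x. of_real (\<phi> x) * F (Complex x s)) has_vector_derivative
          of_real (\<phi> x) * deriv F (Complex x s) + of_real (\<phi>' x) * F (Complex x s)) (at x within {-A..A})"
        by (rule has_vector_derivative_mult[OF 2 1])
    qed (use A in auto)
    then have "integral {-A..A} (\<lambda>x. of_real (\<phi> x) * deriv F (Complex x s) + of_real (\<phi>' x) * F (Complex x s)) = 0"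
      using b0 by (simp add: integral_unique)
    moreover have "(\<lambda>x. of_real (\<phi> x) * deriv F (Complex x s)) integrable_on {-A..A}"
      "(\<lambda>x. of_real (\<phi>' x) * F (Complex x s)) integrable_on {-A..A}"
      using s by (auto intro!: integrable_continuous_interval continuous_intros cF c\<phi> c\<phi>')
    ultimately have "integral {-A..A} (\<lambda>x. of_real (\<phi> x) * deriv F (Complex x s)) + J \<phi>' s = 0"
      unfolding J_def by (simp only: integral_add)
    then show ?thesis by (rule eq_neg_iff_add_eq_0[THEN iffD2])
  qed
  have Jder: "(J \<phi> has_vector_derivative - \<i> * J \<phi>' s) (at s within {-h..h})"
    if s: "s \<in> {-h..h}" and d: "\<And>x. (\<phi> has_real_derivative \<phi>' x) (at x)" and c: "continuous_on UNIV \<phi>'"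
      and b0: "\<phi> A = 0" "\<phi> (-A) = 0" for \<phi> \<phi>' :: "real \<Rightarrow> real" and s
  proof -
    have c\<phi>: "continuous_on {-A..A} \<phi>"
      using d by (auto intro!: continuous_at_imp_continuous_on DERIV_isCont)
    have "((\<lambda>s. integral (cbox (-A) A) (\<lambda>x. of_real (\<phi> x) * F (Complex x s))) has_vector_derivative
        integral (cbox (-A) A) (\<lambda>x. of_real (\<phi> x) * (\<i> * deriv F (Complex x s)))) (at s within {-h..h})"
    proof (rule leibniz_rule_vector_derivative)
      fix r x assume r: "r \<in> {-h..h}" and x: "x \<in> cbox (-A) A"
      have v: "((\<lambda>r. \<i> * complex_of_real r) has_vector_derivative \<i>) (at r)"
        using has_vector_derivative_mult_right[OF has_vector_derivative_of_real[OF DERIV_ident]] by fastforce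
      have 1: "((\<lambda>r. Complex x r) has_vector_derivative \<i>) (at r)"
        using has_vector_derivative_add[OF has_vector_derivative_const v]
        by (simp only: Complex_eq add_0_left)
      have "(F has_field_derivative deriv F (Complex x r)) (at (Complex x r))"
        by (rule Fd[OF RC]) (use r x in auto)
      from field_vector_diff_chain_at[OF 1 this]
      have "((\<lambda>r. F (Complex x r)) has_vector_derivative \<i> * deriv F (Complex x r)) (at r)"
        by (simp add: o_def)
      then show "((\<lambda>r. of_real (\<phi> x) * F (Complex x r)) has_vector_derivative of_real (\<phi> x) * (\<i> * deriv F (Complex x r)))
         (at r within {-h..h})"
        by (rule has_vector_derivative_mult_right[OF has_vector_derivative_at_within])
    next
      fix r assume r: "r \<in> {-h..h}"
      show "(\<lambda>x. of_real (\<phi> x) * F (Complex x r)) integrable_on cbox (-A) A"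
        using r by (auto intro!: integrable_continuous_interval continuous_intros cF c\<phi>)
    next
      show "continuous_on ({-h..h} \<times> cbox (-A) A) (\<lambda>(r, x). of_real (\<phi> x) * (\<i> * deriv F (Complex x r)))"
        unfolding split_beta
        by (intro continuous_intros cF continuous_on_compose2[OF c\<phi>]) auto
    qed (use s in auto)
    moreover have "integral (cbox (-A) A) (\<lambda>x. of_real (\<phi> x) * (\<i> * deriv F (Complex x s))) = - \<i> * J \<phi>' s"
      using parts[OF s d c b0] by (simp add: mult.left_commute[of _ \<i>])
    ultimately show ?thesis by (simp add: J_def)
  qed
  have c2: "continuous_on UNIV \<chi>2"
    using DERIV_isCont[OF d2] by (simp add: continuous_at_imp_continuous_on)
  have c1: "continuous_on UNIV \<chi>1"
    using DERIV_isCont[OF d1] by (simp add: continuous_at_imp_continuous_on)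
  have M0: "0 \<le> M" using M[of 0] A by auto
  have C0: "0 \<le> C" using order_trans[OF norm_ge_zero C[of 0]] A h by simp
  define K where "K = h * (2 * A * M * C)"
  have K0: "0 \<le> K" using h A M0 C0 by (simp add: K_def)
  have J3: "cmod (J \<chi>3 s) \<le> 2 * A * M * C" if s: "s \<in> {-h..h}" for s
  proof -
    have "cmod (J \<chi>3 s) \<le> (M * C) * (A - (-A))"
      unfolding J_def
    proof (rule integral_bound)
      show "continuous_on {-A..A} (\<lambda>x. of_real (\<chi>3 x) * F (Complex x s))"
        using s by (auto intro!: continuous_intros cF intro: continuous_on_subset[OF c3])
      fix x assume "x \<in> {-A..A}"
      then show "cmod (of_real (\<chi>3 x) * F (Complex x s)) \<le> M * C"
        unfolding norm_mult using s M[of x] C[of "Complex x s"] M0 by (intro mult_mono) auto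
    qed (use A in auto)
    then show ?thesis by (simp add: mult_ac)
  qed
  have J2: "cmod (J \<chi>2 s - J \<chi>2 0) \<le> K" if s: "s \<in> {-h..h}" for s
  proof -
    have *: "cmod (J \<chi>2 b - J \<chi>2 a) \<le> (2 * A * M * C) * (b - a)" if ab: "-h \<le> a" "a \<le> b" "b \<le> h" for a b
    proof (rule norm_diff_le_of_vector_derivative_bound)
      fix s assume "s \<in> {a..b}"
      then have s: "s \<in> {-h..h}" using ab by auto
      show "(J \<chi>2 has_vector_derivative - \<i> * J \<chi>3 s) (at s within {a..b})"
        by (rule has_vector_derivative_within_subset[OF Jder[OF s d2 c3 z(5,6)]]) (use ab in auto)
      show "cmod (- \<i> * J \<chi>3 s) \<le> 2 * A * M * C" using J3[OF s] by (simp add: norm_mult)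
    qed (use ab A M0 C0 in auto)
    have "cmod (J \<chi>2 s - J \<chi>2 0) \<le> (2 * A * M * C) * \<bar>s\<bar>"
      using *[of 0 s] *[of s 0] s by (cases "0 \<le> s") (auto simp: norm_minus_commute)
    also have "\<dots> \<le> (2 * A * M * C) * h" using s A M0 C0 by (intro mult_left_mono) auto
    finally show ?thesis by (simp add: K_def mult_ac)
  qed
  \<comment> \<open>The linear part of \<open>J \<chi>1\<close> at height 0, with slope
    \<open>- \<i> * J \<chi>2 0\<close>, is subtracted. The derivative of \<open>m\<close> is then a
    multiple of the increment of \<open>J \<chi>2\<close>, which is at most \<open>K\<close> in
    modulus.\<close>
  define m where "m = (\<lambda>s. J \<chi>1 s + of_real s * (\<i> * J \<chi>2 0))"
  have "cmod (m h - m (-h)) \<le> K * (h - (-h))"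
  proof (rule norm_diff_le_of_vector_derivative_bound)
    fix s assume s: "s \<in> {-h..h}"
    show "(m has_vector_derivative - \<i> * J \<chi>2 s + \<i> * J \<chi>2 0) (at s within {-h..h})"
      using has_vector_derivative_add[OF Jder[OF s d1 c2 z(3,4)]
          has_vector_derivative_mult_left[OF has_vector_derivative_of_real[OF DERIV_ident], of "\<i> * J \<chi>2 0"]]
      unfolding m_def by simp
    have "- \<i> * J \<chi>2 s + \<i> * J \<chi>2 0 = - \<i> * (J \<chi>2 s - J \<chi>2 0)" by (simp add: algebra_simps)
    then show "cmod (- \<i> * J \<chi>2 s + \<i> * J \<chi>2 0) \<le> K"
      using J2[OF s] by (simp only: norm_mult) simp
  qed (use h K0 in auto)
  then have m: "cmod (m h - m (-h)) / (2 * h) \<le> K" using h by (simp add: divide_le_eq mult.commute)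
  have "integral {-A..A} (\<lambda>x. of_real (\<chi>0 x) * ((deriv F (Complex x h) - deriv F (Complex x (-h))) / (2 * \<i> * of_real h)))
     = (integral {-A..A} (\<lambda>x. of_real (\<chi>0 x) * deriv F (Complex x h))
       - integral {-A..A} (\<lambda>x. of_real (\<chi>0 x) * deriv F (Complex x (-h)))) / (2 * \<i> * of_real h)"
  proof -
    have c\<phi>: "continuous_on {-A..A} \<chi>0"
      using d0 by (auto intro!: continuous_at_imp_continuous_on DERIV_isCont)
    have i: "(\<lambda>x. of_real (\<chi>0 x) * deriv F (Complex x s)) integrable_on {-A..A}" if "s \<in> {-h..h}" for s
      using that by (auto intro!: integrable_continuous_interval continuous_intros cF c\<phi>)
    have "(\<lambda>x. of_real (\<chi>0 x) * ((deriv F (Complex x h) - deriv F (Complex x (-h))) / (2 * \<i> * of_real h)))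
      = (\<lambda>x. (of_real (\<chi>0 x) * deriv F (Complex x h) - of_real (\<chi>0 x) * deriv F (Complex x (-h))) / (2 * \<i> * of_real h))"
      by (auto simp: algebra_simps)
    then show ?thesis
      using i[of h] i[of "-h"] h by (simp add: integral_diff integral_divide)
  qed
  also have "\<dots> = (J \<chi>1 (-h) - J \<chi>1 h) / (2 * \<i> * of_real h)"
    using parts[OF _ d0 c1 z(1,2), of h] parts[OF _ d0 c1 z(1,2), of "-h"] h by simp
  also have "\<dots> = J \<chi>2 0 - (m h - m (-h)) / (2 * \<i> * of_real h)"
  proof -
    have "m h - m (-h) = (2 * \<i> * of_real h) * J \<chi>2 0 - (J \<chi>1 (-h) - J \<chi>1 h)"
      by (simp add: m_def algebra_simps)
    then show ?thesis using h by (simp only: diff_divide_distrib) simp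
  qed
  finally have "integral {-A..A} (\<lambda>x. of_real (\<chi>0 x) * ((deriv F (Complex x h) - deriv F (Complex x (-h))) / (2 * \<i> * of_real h)))
      - integral {-A..A} (\<lambda>x. of_real (\<chi>2 x) * F (of_real x)) = - ((m h - m (-h)) / (2 * \<i> * of_real h))"
    by (simp add: J_def Complex_eq)
  also have "cmod \<dots> = cmod (m h - m (-h)) / (2 * h)"
    using h by (simp add: norm_divide norm_mult norm_minus_commute)
  finally show ?thesis using m by (simp add: K_def)
qed

section \<open>The Lambert branches on the spectral curve\<close>

lemma sin_ge_linear:
  assumes "0 \<le> x" "x \<le> m" "0 < m" "m \<le> pi"
  shows "sin m / m * x \<le> sin x"
proof -
  have "convex_on {0..pi} (\<lambda>x. - sin x)"
    by (rule f''_ge0_imp_convex[where f' = "\<lambda>x. - cos x" and f'' = sin])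
       (auto intro!: derivative_eq_intros simp: sin_ge_zero)
  from convex_onD[OF this, of "x / m" 0 m] assms
  have "- sin x \<le> x / m * (- sin m)" by simp
  then show ?thesis by (simp add: field_simps)
qed

text \<open>\<open>ecurve (2 * \<delta> * \<kappa>)\<close> is the real number \<open>2 \<delta> E(\<zeta>(\<kappa>))\<close> of the paper.\<close>

definition ecurve :: "real \<Rightarrow> real" where
  "ecurve \<theta> = (if \<theta> = 0 then 0 else 1 - \<theta> * cot \<theta> + ln (\<theta> / sin \<theta>))"

lemma ecurve_0 [simp]: "ecurve 0 = 0"
  by (simp add: ecurve_def)

text \<open>Written with a sum of squares over a denominator that is positive on (0, \<pi>), so that
  monotonicity of \<open>ecurve\<close> is visible.\<close>

definition ecurve' :: "real \<Rightarrow> real" where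
  "ecurve' \<theta> = ((\<theta> - sin \<theta> * cos \<theta>)\<^sup>2 + sin \<theta> ^ 4) / (\<theta> * (sin \<theta>)\<^sup>2)"

lemma ecurve_DERIV:
  assumes "0 < \<theta>" "\<theta> < pi"
  shows "(ecurve has_real_derivative ecurve' \<theta>) (at \<theta>)"
proof -
  have s: "0 < sin \<theta>" using assms by (rule sin_gt_zero)
  have "((\<lambda>\<theta>. 1 - \<theta> * (cos \<theta> / sin \<theta>) + ln (\<theta> / sin \<theta>)) has_real_derivative
     (- (\<theta> * ((- sin \<theta> * sin \<theta> - cos \<theta> * cos \<theta>) / (sin \<theta>)\<^sup>2) + cos \<theta> / sin \<theta>)
       + (sin \<theta> - \<theta> * cos \<theta>) / (sin \<theta>)\<^sup>2 * (sin \<theta> / \<theta>))) (at \<theta>)"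
  proof -
    have 1: "((\<lambda>\<theta>. cos \<theta> / sin \<theta>) has_real_derivative (- sin \<theta> * sin \<theta> - cos \<theta> * cos \<theta>) / (sin \<theta>)\<^sup>2) (at \<theta>)"
      using s by (auto intro!: derivative_eq_intros simp: power2_eq_square)
    have 2: "((\<lambda>\<theta>. \<theta> / sin \<theta>) has_real_derivative (sin \<theta> - \<theta> * cos \<theta>) / (sin \<theta>)\<^sup>2) (at \<theta>)"
      using s by (auto intro!: derivative_eq_intros simp: power2_eq_square)
    have 3: "((\<lambda>\<theta>. ln (\<theta> / sin \<theta>)) has_real_derivative (sin \<theta> - \<theta> * cos \<theta>) / (sin \<theta>)\<^sup>2 * (sin \<theta> / \<theta>)) (at \<theta>)"
      using DERIV_chain2[OF DERIV_ln 2] s assms by (simp add: field_simps)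
    show ?thesis
      by (rule derivative_eq_intros 1 3 refl)+ simp
  qed
  moreover have "- (\<theta> * ((- sin \<theta> * sin \<theta> - cos \<theta> * cos \<theta>) / (sin \<theta>)\<^sup>2) + cos \<theta> / sin \<theta>)
       + (sin \<theta> - \<theta> * cos \<theta>) / (sin \<theta>)\<^sup>2 * (sin \<theta> / \<theta>) = ecurve' \<theta>"
  proof -
    have 1: "- sin \<theta> * sin \<theta> - cos \<theta> * cos \<theta> = -1"
      using sin_cos_squared_add3[of \<theta>] by linarith
    have 2: "sin \<theta> ^ 4 = (sin \<theta>)\<^sup>2 * (1 - (cos \<theta>)\<^sup>2)"
      using sin_squared_eq[of \<theta>] by (simp add: power4_eq_xxxx power2_eq_square)
    show ?thesis
      unfolding 1 ecurve'_def 2 using s assms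
      by (simp add: field_simps power2_eq_square power3_eq_cube)
  qed
  moreover have "\<forall>\<^sub>F x in nhds \<theta>. ecurve x = 1 - x * (cos x / sin x) + ln (x / sin x)"
    using eventually_nhds_in_open[of "{0<..}" \<theta>] assms
    by (auto elim!: eventually_mono simp: ecurve_def cot_def)
  ultimately show ?thesis by (simp add: DERIV_cong_ev)
qed

lemma ecurve_tendsto_0: "(ecurve \<longlongrightarrow> 0) (at 0)"
proof -
  have s: "((\<lambda>x::real. sin x / x) \<longlongrightarrow> 1) (at 0)"
    using DERIV_sin[of 0] by (simp add: has_field_derivative_iff)
  have i: "((\<lambda>x::real. inverse (sin x / x)) \<longlongrightarrow> inverse 1) (at 0)"
    by (intro tendsto_inverse s) simp
  have "((\<lambda>x::real. 1 - cos x * inverse (sin x / x) + ln (inverse (sin x / x))) \<longlongrightarrow> 1 - cos 0 * inverse 1 + ln (inverse 1)) (at 0)"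
    by (intro tendsto_intros i) auto
  moreover have "\<forall>\<^sub>F x in at 0. 1 - cos x * inverse (sin x / x) + ln (inverse (sin x / x)) = ecurve x"
    by (auto simp: eventually_at_filter ecurve_def cot_def field_simps)
  ultimately show ?thesis by (simp add: tendsto_cong)
qed

lemma ecurve_continuous: "continuous_on {0..<pi} ecurve"
proof (rule continuous_at_imp_continuous_on, rule ballI)
  fix x :: real assume x: "x \<in> {0..<pi}"
  show "isCont ecurve x"
  proof (cases "x = 0")
    case True
    then show ?thesis using ecurve_tendsto_0 by (simp add: isCont_def)
  next
    case False
    then show ?thesis using ecurve_DERIV[of x] x by (auto intro: DERIV_isCont)
  qed
qed

text \<open>The summand \<open>(sin x)\<^sup>2 / x\<close> supplies the linear lower bound, since
  the sine lies above its chord on [0, m]. In the other summand the numerator is of order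
  \<open>x ^ 6\<close> and the denominator of order \<open>x ^ 3\<close>.\<close>

lemma ecurve'_bounds:
  assumes m: "0 < m" "m < pi" and x: "0 < x" "x \<le> m"
  shows "(sin m / m)\<^sup>2 * x \<le> ecurve' x" "ecurve' x \<le> 4 * m ^ 3 / (sin m / m)\<^sup>2 + m"
proof -
  define k where "k = sin m / m"
  have k: "0 < k" using m by (simp add: k_def sin_gt_zero)
  have s: "0 < sin x" using x m by (intro sin_gt_zero) auto
  have ks: "k * x \<le> sin x" unfolding k_def by (rule sin_ge_linear) (use x m in auto)
  have sx: "sin x \<le> x" using sin_x_le_x x by simp
  have e: "ecurve' x = (x - sin x * cos x)\<^sup>2 / (x * (sin x)\<^sup>2) + (sin x)\<^sup>2 / x"
  proof -
    have p: "sin x ^ 4 = (sin x)\<^sup>2 * (sin x)\<^sup>2" by (simp add: power4_eq_xxxx power2_eq_square)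
    have "(sin x)\<^sup>2 \<noteq> 0" using s by simp
    have "c * c / (x * c) = c / x" if "c \<noteq> 0" for c :: real using that by simp
    from this[OF \<open>(sin x)\<^sup>2 \<noteq> 0\<close>] show ?thesis unfolding ecurve'_def add_divide_distrib p by (simp only:)
  qed
  have "k\<^sup>2 * x = (k * x)\<^sup>2 / x" using x by (simp add: power2_eq_square)
  also have "\<dots> \<le> (sin x)\<^sup>2 / x"
    using ks k x by (intro divide_right_mono power_mono) auto
  also have "\<dots> \<le> ecurve' x" unfolding e using x by simp
  finally show "(sin m / m)\<^sup>2 * x \<le> ecurve' x" by (simp add: k_def)
  \<comment> \<open>The mean value theorem for \<open>x - sin x * cos x\<close>, whose derivative is
    \<open>2 * (sin x)\<^sup>2\<close>, gives a cubic bound.\<close>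
  have "\<exists>z. 0 < z \<and> z < x \<and> (x - sin x * cos x) - (0 - sin 0 * cos 0) = (x - 0) * (1 - (cos z * cos z + sin z * (- sin z)))"
    by (rule MVT2) (use x in \<open>auto intro!: derivative_eq_intros\<close>)
  then obtain z where z: "0 < z" "z < x" "x - sin x * cos x = x * (1 - (cos z * cos z - sin z * sin z))"
    by auto
  have "1 - (cos z * cos z - sin z * sin z) = 2 * (sin z)\<^sup>2"
    using sin_cos_squared_add3[of z] unfolding power2_eq_square by linarith
  then have zz: "x - sin x * cos x = 2 * x * (sin z)\<^sup>2" using z by simp
  have "0 \<le> sin z" using z x m by (intro sin_ge_zero) auto
  moreover have "sin z \<le> x" using sin_x_le_x[of z] z by simp
  ultimately have "(sin z)\<^sup>2 \<le> x\<^sup>2" by (intro power_mono) auto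
  then have u: "x - sin x * cos x \<le> 2 * x ^ 3" "0 \<le> x - sin x * cos x"
    unfolding zz using x by (auto simp: power3_eq_cube power2_eq_square)
  have "(x - sin x * cos x)\<^sup>2 \<le> (2 * x ^ 3)\<^sup>2" using u by (intro power_mono) auto
  moreover have "k\<^sup>2 * x\<^sup>2 \<le> (sin x)\<^sup>2" using ks k x by (metis power_mult_distrib power_mono mult_nonneg_nonneg less_imp_le)
  ultimately have "(x - sin x * cos x)\<^sup>2 / (x * (sin x)\<^sup>2) \<le> (2 * x ^ 3)\<^sup>2 / (x * (k\<^sup>2 * x\<^sup>2))"
    using x k s by (intro frac_le mult_left_mono) auto
  also have "\<dots> = 4 * x ^ 3 / k\<^sup>2" using x k by (simp add: field_simps power2_eq_square power3_eq_cube)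
  also have "\<dots> \<le> 4 * m ^ 3 / k\<^sup>2" using x k by (intro divide_right_mono mult_left_mono power_mono) auto
  finally have 1: "(x - sin x * cos x)\<^sup>2 / (x * (sin x)\<^sup>2) \<le> 4 * m ^ 3 / k\<^sup>2" .
  have "(sin x)\<^sup>2 / x \<le> x\<^sup>2 / x" using sx s x by (intro divide_right_mono power_mono) auto
  also have "\<dots> \<le> m" using x by (simp add: power2_eq_square)
  finally show "ecurve' x \<le> 4 * m ^ 3 / (sin m / m)\<^sup>2 + m" using 1 unfolding e k_def by linarith
qed

text \<open>The linear lower bound on the derivative integrates to a quadratic one, weakened by
  \<open>(b - a)\<^sup>2 \<le> b\<^sup>2 - a\<^sup>2\<close>. The inverse is therefore Hoelder
  continuous of exponent 1/2, the square root expected at a branch point.\<close>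

lemma ecurve_growth:
  assumes m: "m < pi" and ab: "0 \<le> a" "a \<le> b" "b \<le> m"
  shows "(sin m / m)\<^sup>2 / 2 * (b - a)\<^sup>2 \<le> ecurve b - ecurve a"
    and "ecurve b - ecurve a \<le> (4 * m ^ 3 / (sin m / m)\<^sup>2 + m) * (b - a)"
proof -
  have c: "continuous_on {a..b} ecurve"
    using ab m by (intro continuous_on_subset[OF ecurve_continuous]) auto
  have m0: "0 < m" if "a < b" using that ab by simp
  have "ecurve a - (sin m / m)\<^sup>2 / 2 * a\<^sup>2 \<le> ecurve b - (sin m / m)\<^sup>2 / 2 * b\<^sup>2"
  proof (rule DERIV_nonneg_imp_increasing_open[OF ab(2)])
    fix x assume x: "a < x" "x < b"
    then have "((\<lambda>x. ecurve x - (sin m / m)\<^sup>2 / 2 * x\<^sup>2) has_real_derivative ecurve' x - (sin m / m)\<^sup>2 * x) (at x)"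
      using ab m by (auto intro!: derivative_eq_intros ecurve_DERIV)
    then show "\<exists>y. ((\<lambda>x. ecurve x - (sin m / m)\<^sup>2 / 2 * x\<^sup>2) has_real_derivative y) (at x) \<and> 0 \<le> y"
      using ecurve'_bounds(1)[of m x] m x ab by (intro exI[of _ "ecurve' x - (sin m / m)\<^sup>2 * x"]) auto
  qed (intro continuous_intros c)
  moreover have "(b - a)\<^sup>2 \<le> b\<^sup>2 - a\<^sup>2"
    using ab mult_mono[of a b a a] by (simp add: power2_eq_square algebra_simps)
  then have "(sin m / m)\<^sup>2 / 2 * (b - a)\<^sup>2 \<le> (sin m / m)\<^sup>2 / 2 * (b\<^sup>2 - a\<^sup>2)"
    by (intro mult_left_mono) auto
  ultimately show "(sin m / m)\<^sup>2 / 2 * (b - a)\<^sup>2 \<le> ecurve b - ecurve a"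
    by (simp add: algebra_simps)
  define K where "K = 4 * m ^ 3 / (sin m / m)\<^sup>2 + m"
  have "K * a - ecurve a \<le> K * b - ecurve b"
  proof (rule DERIV_nonneg_imp_increasing_open[OF ab(2)])
    fix x assume x: "a < x" "x < b"
    then have "((\<lambda>x. K * x - ecurve x) has_real_derivative K - ecurve' x) (at x)"
      using ab m by (auto intro!: derivative_eq_intros ecurve_DERIV)
    then show "\<exists>y. ((\<lambda>x. K * x - ecurve x) has_real_derivative y) (at x) \<and> 0 \<le> y"
      using ecurve'_bounds(2)[of m x] m x ab by (intro exI[of _ "K - ecurve' x"]) (auto simp: K_def)
  qed (intro continuous_intros c)
  then show "ecurve b - ecurve a \<le> (4 * m ^ 3 / (sin m / m)\<^sup>2 + m) * (b - a)"
    unfolding K_def[symmetric] by (simp add: algebra_simps)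
qed

lemma ecurve_strict_mono:
  assumes "0 \<le> a" "a < b" "b < pi"
  shows "ecurve a < ecurve b"
proof -
  have "0 < (sin b / b)\<^sup>2 / 2 * (b - a)\<^sup>2" using assms sin_gt_zero[of b] by simp
  then show ?thesis using ecurve_growth(1)[of b a b] assms by linarith
qed

lemma ecurve_less_iff:
  assumes "0 \<le> a" "a < pi" "0 \<le> b" "b < pi"
  shows "ecurve a < ecurve b \<longleftrightarrow> a < b"
  using ecurve_strict_mono[of a b] ecurve_strict_mono[of b a] assms by (cases a b rule: linorder_cases) auto

lemma ecurve_nonneg: "0 \<le> \<theta> \<Longrightarrow> \<theta> < pi \<Longrightarrow> 0 \<le> ecurve \<theta>"
  using ecurve_strict_mono[of 0 \<theta>] by (cases "\<theta> = 0") auto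

definition einv :: "real \<Rightarrow> real" where
  "einv y = (THE \<theta>. 0 \<le> \<theta> \<and> \<theta> < pi \<and> ecurve \<theta> = y)"

lemma einv_ecurve [simp]:
  assumes "0 \<le> \<theta>" "\<theta> < pi" shows "einv (ecurve \<theta>) = \<theta>"
  unfolding einv_def
proof (rule the_equality)
  fix \<phi> assume \<phi>: "0 \<le> \<phi> \<and> \<phi> < pi \<and> ecurve \<phi> = ecurve \<theta>"
  then show "\<phi> = \<theta>" using ecurve_less_iff[of \<phi> \<theta>] ecurve_less_iff[of \<theta> \<phi>] assms by force
qed (use assms in auto)

lemma einv:
  assumes y: "0 \<le> y"
  shows "0 \<le> einv y" "einv y < pi" "ecurve (einv y) = y"
proof -
  \<comment> \<open>An upper end for the intermediate value theorem:
    \<open>sin t = exp (- y)\<close> makes the logarithm equal to \<open>ln t + y\<close> with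
    \<open>ln t \<ge> 0\<close>, and \<open>t \<ge> pi / 2\<close> makes \<open>- t * cot t\<close>
    nonnegative.\<close>
  define t where "t = pi - arcsin (exp (- y))"
  have r: "0 < exp (- y)" "exp (- y) \<le> 1" using y by auto
  have a: "0 < arcsin (exp (- y))" "arcsin (exp (- y)) \<le> pi / 2"
    using r arcsin_less_arcsin[of 0 "exp (- y)"] arcsin_ubound[OF order_trans[OF _ less_imp_le[OF r(1)]] r(2)] by auto
  have t: "pi / 2 \<le> t" "t < pi" using a by (auto simp: t_def)
  have st: "sin t = exp (- y)" using sin_arcsin[OF order_trans[OF _ less_imp_le[OF r(1)]] r(2)] by (simp add: t_def)
  have "y \<le> ecurve t"
  proof -
    have "cos t \<le> 0" using cos_monotone_0_pi_le[of "pi/2" t] t by simp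
    then have "0 \<le> - t * cot t" using t st by (simp add: cot_def mult_nonneg_nonpos divide_nonpos_pos)
    moreover have "ln (t / sin t) = ln t + y" using t pi_gt_zero by (simp add: st ln_div)
    moreover have "0 \<le> ln t" using t pi_ge_two by simp
    moreover have "ecurve t = 1 + - t * cot t + ln (t / sin t)" using t pi_gt_zero by (simp add: ecurve_def)
    ultimately show ?thesis by linarith
  qed
  then obtain \<theta> where "0 \<le> \<theta>" "\<theta> \<le> t" "ecurve \<theta> = y"
    using IVT'[of ecurve 0 y t] y t pi_gt_zero continuous_on_subset[OF ecurve_continuous, of "{0..t}"] by fastforce
  with t have "0 \<le> \<theta>" "\<theta> < pi" "y = ecurve \<theta>" by auto
  then show "0 \<le> einv y" "einv y < pi" "ecurve (einv y) = y" by auto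
qed

lemma einv_0 [simp]: "einv 0 = 0"
  using einv_ecurve[of 0] by simp

lemma einv_mono: "0 \<le> x \<Longrightarrow> x \<le> y \<Longrightarrow> einv x \<le> einv y"
  using ecurve_less_iff[of "einv y" "einv x"] einv[of x] einv[of y] by force

lemma einv_holder:
  assumes "0 \<le> x" "x \<le> y" "y \<le> Y"
  shows "einv y - einv x \<le> sqrt (2 / (sin (einv Y) / einv Y)\<^sup>2) * sqrt (y - x)"
proof (cases "Y = 0")
  case False
  then have Y: "0 < Y" using assms by simp
  let ?m = "einv Y"
  have m: "0 < ?m" "?m < pi" using einv[of Y] Y by (auto simp: order_less_le)
  have k: "0 < (sin ?m / ?m)\<^sup>2" using m sin_gt_zero[of ?m] by simp
  have g: "(sin ?m / ?m)\<^sup>2 / 2 * (einv y - einv x)\<^sup>2 \<le> y - x"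
    using ecurve_growth(1)[of ?m "einv x" "einv y"] einv[of x] einv[of y] einv_mono[of x y] einv_mono[of y Y] assms m by auto
  have "X \<le> 2 / c * D" if "0 < c" "c / 2 * X \<le> D" for c X D :: real
    using that by (simp add: field_simps)
  from this[OF k g]
  have "(einv y - einv x)\<^sup>2 \<le> 2 / (sin ?m / ?m)\<^sup>2 * (y - x)" .
  then show ?thesis by (simp only: real_le_rsqrt flip: real_sqrt_mult)
next
  case True
  then have "x = 0" "y = 0" using assms by auto
  then show ?thesis by simp
qed

lemma einv_continuous: "continuous_on {0..} einv"
proof -
  have cY: "continuous_on {0..Y} einv" for Y
  proof (rule continuous_onI)
    fix x e :: real assume x: "x \<in> {0..Y}" and e: "0 < e"
    define K where "K = sqrt (2 / (sin (einv Y) / einv Y)\<^sup>2) + 1"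
    have K: "0 < K" by (simp add: K_def add_nonneg_pos)
    have *: "\<bar>einv b - einv a\<bar> \<le> K * sqrt \<bar>b - a\<bar>" if ab: "a \<in> {0..Y}" "b \<in> {0..Y}" "a \<le> b" for a b
    proof -
      have "einv b - einv a \<le> sqrt (2 / (sin (einv Y) / einv Y)\<^sup>2) * sqrt (b - a)"
        using ab by (intro einv_holder) auto
      also have "\<dots> \<le> K * sqrt (b - a)" using ab by (intro mult_right_mono) (auto simp: K_def)
      finally show ?thesis using einv_mono[of a b] ab by auto
    qed
    show "\<exists>d>0. \<forall>x'\<in>{0..Y}. dist x' x < d \<longrightarrow> dist (einv x') (einv x) \<le> e"
    proof (intro exI[of _ "(e / K)\<^sup>2"] conjI ballI impI)
      fix x' assume x': "x' \<in> {0..Y}" "dist x' x < (e / K)\<^sup>2"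
      have "\<bar>einv x' - einv x\<bar> \<le> K * sqrt \<bar>x' - x\<bar>"
        using *[of x x'] *[of x' x] x x' by (cases "x \<le> x'") (auto simp: abs_minus_commute)
      also have "\<dots> \<le> K * sqrt ((e / K)\<^sup>2)"
        using x' K by (intro mult_left_mono real_sqrt_le_mono) (auto simp: dist_real_def)
      also have "\<dots> = e" using K e by simp
      finally show "dist (einv x') (einv x) \<le> e" by (simp add: dist_real_def)
    qed (use e K in auto)
  qed
  show ?thesis
  proof (rule continuous_on_eq_continuous_within[THEN iffD2], rule ballI)
    fix x :: real assume x: "x \<in> {0..}"
    have "continuous (at x within {0..x + 1}) einv"
      using cY[of "x + 1"] x by (auto simp: continuous_on_eq_continuous_within)
    moreover have "at x within {0..x + 1} = at x within {0..}"
      by (rule at_within_nhd[of _ "{..<x + 1}"]) auto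
    ultimately show "continuous (at x within {0..}) einv" by simp
  qed
qed

section \<open>The real Lambert branches as inverses of \<open>pfun\<close>\<close>

definition pfun :: "real \<Rightarrow> real" where
  "pfun v = v - 1 - ln v"

lemma pfun_DERIV: "0 < v \<Longrightarrow> (pfun has_real_derivative 1 - 1 / v) (at v)"
  unfolding pfun_def by (auto intro!: derivative_eq_intros)

lemma pfun_1 [simp]: "pfun 1 = 0"
  by (simp add: pfun_def)

lemma pfun_le: "0 < v \<Longrightarrow> pfun v \<le> (v - 1)\<^sup>2 / v"
  using ln_le_minus_one[of "1 / v"] by (simp add: pfun_def ln_div power2_eq_square field_simps)

lemma pfun_continuous: "continuous_on {0<..} pfun"
  unfolding pfun_def by (intro continuous_intros) auto

lemma pfun_mono:
  assumes "1 \<le> v" "v < w" shows "pfun v < pfun w"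
proof (rule DERIV_pos_imp_increasing_open[OF assms(2)])
  show "\<exists>y. (pfun has_real_derivative y) (at x) \<and> 0 < y" if "v < x" "x < w" for x
    using pfun_DERIV[of x] that assms by (intro exI[of _ "1 - 1 / x"]) auto
qed (rule continuous_on_subset[OF pfun_continuous], use assms in auto)

lemma pfun_antimono:
  assumes "0 < v" "v < w" "w \<le> 1" shows "pfun w < pfun v"
proof (rule DERIV_neg_imp_decreasing_open[OF assms(2)])
  show "\<exists>y. (pfun has_real_derivative y) (at x) \<and> y < 0" if "v < x" "x < w" for x
    using pfun_DERIV[of x] that assms by (intro exI[of _ "1 - 1 / x"]) auto
qed (rule continuous_on_subset[OF pfun_continuous], use assms in auto)

text \<open>By \<open>pfun x \<le> (x - 1)\<^sup>2 / x\<close> the square root of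
  \<open>pfun\<close> has slope at least \<open>1 / (2 * sqrt x)\<close>, so it still increases
  after subtraction of a linear function of slope \<open>c\<close>. Hence \<open>v1\<close> is
  Lipschitz in the square root of its argument, although its slope is unbounded at 0.\<close>

lemma pfun_sqrt_upper:
  assumes "1 \<le> v" "v \<le> w"
  shows "w - v \<le> 2 * sqrt w * (sqrt (pfun w) - sqrt (pfun v))"
proof -
  define c where "c = 1 / (2 * sqrt w)"
  have w: "0 < w" using assms by simp
  have "sqrt (pfun v) - c * v \<le> sqrt (pfun w) - c * w"
  proof (rule DERIV_nonneg_imp_increasing_open[OF assms(2)])
    fix x assume x: "v < x" "x < w"
    then have x1: "1 < x" using assms by simp
    have p: "0 < pfun x" using pfun_mono[of 1 x] x1 by simp
    have d: "((\<lambda>v. sqrt (pfun v) - c * v) has_real_derivative (1 - 1 / x) * inverse (sqrt (pfun x)) / 2 - c) (at x)"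
      using p x1 by (auto intro!: derivative_eq_intros pfun_DERIV)
    have "sqrt (pfun x) \<le> sqrt ((x - 1)\<^sup>2 / x)" using pfun_le[of x] x1 by (intro real_sqrt_le_mono) auto
    also have "\<dots> = (x - 1) / sqrt x" using x1 by (simp add: real_sqrt_divide)
    finally have "1 / ((x - 1) / sqrt x) \<le> 1 / sqrt (pfun x)"
      using p x1 by (intro divide_left_mono) auto
    then have "(1 - 1 / x) * (sqrt x / (x - 1)) \<le> (1 - 1 / x) * inverse (sqrt (pfun x))"
      using x1 by (intro mult_left_mono) (auto simp: inverse_eq_divide)
    moreover have "(1 - 1 / x) * (sqrt x / (x - 1)) = 1 / sqrt x"
    proof -
      have "1 - 1 / x = (x - 1) / x" using x1 by (simp add: field_simps)
      then show ?thesis using x1 by (simp add: real_div_sqrt field_simps)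
    qed
    moreover have "1 / sqrt w \<le> 1 / sqrt x" using x x1 by (intro divide_left_mono) auto
    ultimately have "c \<le> (1 - 1 / x) * inverse (sqrt (pfun x)) / 2" by (simp add: c_def)
    with d show "\<exists>y. ((\<lambda>v. sqrt (pfun v) - c * v) has_real_derivative y) (at x) \<and> 0 \<le> y"
      by (intro exI[of _ "(1 - 1 / x) * inverse (sqrt (pfun x)) / 2 - c"]) auto
  qed (intro continuous_intros continuous_on_subset[OF pfun_continuous], use assms in auto)
  then have "c * (w - v) \<le> sqrt (pfun w) - sqrt (pfun v)" by (simp add: algebra_simps)
  then show ?thesis using w by (simp add: c_def field_simps)
qed

lemma pfun_sqrt_lower:
  assumes "0 < v" "v \<le> w" "w \<le> 1"
  shows "w - v \<le> 2 * (sqrt (pfun v) - sqrt (pfun w))"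
proof -
  have "- sqrt (pfun v) - v / 2 \<le> - sqrt (pfun w) - w / 2"
  proof (rule DERIV_nonneg_imp_increasing_open[OF assms(2)])
    fix x assume x: "v < x" "x < w"
    then have x1: "0 < x" "x < 1" using assms by auto
    have p: "0 < pfun x" using pfun_antimono[of x 1] x1 by simp
    have d: "((\<lambda>v. - sqrt (pfun v) - v / 2) has_real_derivative (1 / x - 1) * inverse (sqrt (pfun x)) / 2 - 1 / 2) (at x)"
      using p x1 by (auto intro!: derivative_eq_intros pfun_DERIV) (simp add: field_simps)
    have "sqrt (pfun x) \<le> sqrt ((x - 1)\<^sup>2 / x)" using pfun_le[of x] x1 by (intro real_sqrt_le_mono) auto
    also have "\<dots> = (1 - x) / sqrt x" using x1 by (simp add: real_sqrt_divide)
    finally have "1 / ((1 - x) / sqrt x) \<le> 1 / sqrt (pfun x)"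
      using p x1 by (intro divide_left_mono) auto
    then have "(1 / x - 1) * (sqrt x / (1 - x)) \<le> (1 / x - 1) * inverse (sqrt (pfun x))"
      using x1 by (intro mult_left_mono) (auto simp: inverse_eq_divide)
    moreover have "(1 / x - 1) * (sqrt x / (1 - x)) = 1 / sqrt x"
    proof -
      have "1 / x - 1 = (1 - x) / x" using x1 by (simp add: field_simps)
      then show ?thesis using x1 by (simp add: real_div_sqrt field_simps)
    qed
    moreover have "1 \<le> 1 / sqrt x" using x1 by simp
    ultimately have "1 \<le> (1 / x - 1) * inverse (sqrt (pfun x))" by linarith
    with d show "\<exists>y. ((\<lambda>v. - sqrt (pfun v) - v / 2) has_real_derivative y) (at x) \<and> 0 \<le> y"
      by (intro exI[of _ "(1 / x - 1) * inverse (sqrt (pfun x)) / 2 - 1 / 2"]) auto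
  qed (intro continuous_intros continuous_on_subset[OF pfun_continuous], use assms in auto)
  then show ?thesis by simp
qed

text \<open>Here \<open>v0 s\<close> and \<open>v1 s\<close> are \<open>- W\<^sub>0\<close> and \<open>- W\<^sub>-\<^sub>1\<close> at \<open>- e\<^sup>-\<^sup>s\<^sup>-\<^sup>1\<close>.\<close>

definition v1 :: "real \<Rightarrow> real" where
  "v1 s = (THE v. 1 \<le> v \<and> pfun v = s)"

definition v0 :: "real \<Rightarrow> real" where
  "v0 s = (THE v. 0 < v \<and> v \<le> 1 \<and> pfun v = s)"

lemma v1_unique: "1 \<le> v \<Longrightarrow> v1 (pfun v) = v"
  unfolding v1_def by (rule the_equality) (auto, metis pfun_mono linorder_neqE_linordered_idom less_irrefl)

lemma v0_unique: "0 < v \<Longrightarrow> v \<le> 1 \<Longrightarrow> v0 (pfun v) = v"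
  unfolding v0_def by (rule the_equality) (auto, metis pfun_antimono linorder_neqE_linordered_idom less_irrefl)

lemma v1:
  assumes s: "0 \<le> s"
  shows "1 \<le> v1 s" "pfun (v1 s) = s"
proof -
  \<comment> \<open>For this \<open>b\<close>,
    \<open>pfun b = s + 2 * (sqrt s - ln (1 + sqrt s))\<close>, which is at least
    \<open>s\<close>.\<close>
  define b where "b = (1 + sqrt s)\<^sup>2"
  have b: "1 \<le> b" using s by (simp add: b_def one_le_power)
  have "s \<le> pfun b"
  proof -
    have "ln b = 2 * ln (1 + sqrt s)" using s by (simp add: b_def ln_realpow add_pos_nonneg)
    moreover have "ln (1 + sqrt s) \<le> sqrt s" using s by (intro ln_add_one_self_le_self) auto
    ultimately show ?thesis using s by (simp add: pfun_def b_def power2_eq_square algebra_simps)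
  qed
  then obtain v where "1 \<le> v" "v \<le> b" "pfun v = s"
    using IVT'[of pfun 1 s b] s b continuous_on_subset[OF pfun_continuous, of "{1..b}"] by fastforce
  then show "1 \<le> v1 s" "pfun (v1 s) = s" using v1_unique by auto
qed

lemma v0:
  assumes s: "0 \<le> s"
  shows "0 < v0 s" "v0 s \<le> 1" "pfun (v0 s) = s"
proof -
  \<comment> \<open>For this \<open>b\<close>, \<open>pfun b = b + s\<close>.\<close>
  define b where "b = exp (- s - 1)"
  have b: "0 < b" "b \<le> 1" using s by (auto simp: b_def)
  have "s \<le> pfun b" using b by (simp add: pfun_def b_def)
  then obtain v where "b \<le> v" "v \<le> 1" "pfun v = s"
    using IVT2'[of pfun 1 s b] s b continuous_on_subset[OF pfun_continuous, of "{b..1}"] by fastforce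
  then show "0 < v0 s" "v0 s \<le> 1" "pfun (v0 s) = s" using v0_unique[of v] b by auto
qed

lemma v1_mono: "0 \<le> a \<Longrightarrow> a < b \<Longrightarrow> v1 a < v1 b"
  using pfun_mono[of "v1 b" "v1 a"] v1[of a] v1[of b] by (cases "v1 a" "v1 b" rule: linorder_cases) auto

lemma v0_antimono: "0 \<le> a \<Longrightarrow> a < b \<Longrightarrow> v0 b < v0 a"
  using pfun_antimono[of "v0 a" "v0 b"] v0[of a] v0[of b] by (cases "v0 a" "v0 b" rule: linorder_cases) auto

lemma v1_sqrt_bound:
  assumes "0 \<le> a" "a \<le> b" "b \<le> S"
  shows "v1 b - v1 a \<le> 2 * sqrt (v1 S) * (sqrt b - sqrt a)"
proof -
  have m: "v1 a \<le> v1 b" "v1 b \<le> v1 S"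
    using v1_mono[of a b] v1_mono[of b S] assms by (cases "a = b"; cases "b = S"; simp)+
  have "v1 b - v1 a \<le> 2 * sqrt (v1 b) * (sqrt b - sqrt a)"
    using pfun_sqrt_upper[of "v1 a" "v1 b"] v1[of a] v1[of b] m assms by auto
  also have "\<dots> \<le> 2 * sqrt (v1 S) * (sqrt b - sqrt a)"
    using m assms by (intro mult_right_mono) auto
  finally show ?thesis .
qed

lemma v0_sqrt_bound:
  assumes "0 \<le> a" "a \<le> b"
  shows "v0 a - v0 b \<le> 2 * (sqrt b - sqrt a)"
proof -
  have m: "v0 b \<le> v0 a"
    using v0_antimono[of a b] assms by (cases "a = b") auto
  show ?thesis
    using pfun_sqrt_lower[of "v0 b" "v0 a"] v0[of a] v0[of b] m assms by auto
qed

text \<open>Supplies the continuity that the inverse function rule asks for before \<open>v0\<close>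
  and \<open>v1\<close> can be differentiated.\<close>

lemma isCont_of_sqrt_bound:
  fixes f :: "real \<Rightarrow> real"
  assumes b: "\<And>a b. 0 \<le> a \<Longrightarrow> a \<le> b \<Longrightarrow> b \<le> S \<Longrightarrow> \<bar>f b - f a\<bar> \<le> K * (sqrt b - sqrt a)"
    and s: "0 < s" "s < S"
  shows "isCont f s"
proof -
  have ev: "\<forall>\<^sub>F x in at s. norm (f x - f s) \<le> K * \<bar>sqrt x - sqrt s\<bar>"
  proof (rule eventually_at_in_open[of "{0<..<S}", THEN eventually_mono])
    fix x assume "x \<in> {0<..<S} - {s}"
    then show "norm (f x - f s) \<le> K * \<bar>sqrt x - sqrt s\<bar>"
      using b[of x s] b[of s x] s by (cases "x \<le> s") (auto simp: abs_minus_commute)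
  qed (use s in auto)
  have "((\<lambda>x. K * \<bar>sqrt x - sqrt s\<bar>) \<longlongrightarrow> K * \<bar>sqrt s - sqrt s\<bar>) (at s)"
    by (intro tendsto_intros)
  then have "((\<lambda>x. f x - f s) \<longlongrightarrow> 0) (at s)"
    by (intro Lim_null_comparison[OF ev]) simp
  then show ?thesis by (simp add: isCont_def LIM_zero_iff)
qed

lemma v1_differentiable:
  assumes "0 < s" shows "v1 differentiable (at s)"
proof -
  have "isCont v1 s"
  proof (rule isCont_of_sqrt_bound[of "s + 1" _ "2 * sqrt (v1 (s + 1))"])
    fix a b :: real assume "0 \<le> a" "a \<le> b" "b \<le> s + 1"
    then show "\<bar>v1 b - v1 a\<bar> \<le> 2 * sqrt (v1 (s + 1)) * (sqrt b - sqrt a)"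
      using v1_sqrt_bound[of a b "s + 1"] v1_mono[of a b] by (cases "a = b") auto
  qed (use assms in auto)
  moreover have "1 < v1 s" using v1_mono[of 0 s] v1_unique[of 1] assms by simp
  ultimately have "(v1 has_real_derivative inverse (1 - 1 / v1 s)) (at s)"
    by (intro DERIV_inverse_function[where f = pfun and a = 0 and b = "s + 1"] pfun_DERIV)
       (use assms v1 in auto)
  then show ?thesis using real_differentiable_def by blast
qed

lemma v0_differentiable:
  assumes "0 < s" shows "v0 differentiable (at s)"
proof -
  have "isCont v0 s"
  proof (rule isCont_of_sqrt_bound[of "s + 1" _ 2])
    fix a b :: real assume "0 \<le> a" "a \<le> b" "b \<le> s + 1"
    then show "\<bar>v0 b - v0 a\<bar> \<le> 2 * (sqrt b - sqrt a)"
      using v0_sqrt_bound[of a b] v0_antimono[of a b] by (cases "a = b") auto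
  qed (use assms in auto)
  moreover have "v0 s < 1" using v0_antimono[of 0 s] v0_unique[of 1] assms by simp
  ultimately have "(v0 has_real_derivative inverse (1 - 1 / v0 s)) (at s)"
    by (intro DERIV_inverse_function[where f = pfun and a = 0 and b = "s + 1"] pfun_DERIV)
       (use assms v0 in auto)
  then show ?thesis using real_differentiable_def by blast
qed

text \<open>The integrand \<open>W\<^sub>0 - W\<^sub>-\<^sub>1\<close> of the Weyl function at
  argument \<open>- exp (- s - 1)\<close>, continued by 0 past the branch point, so that the band of
  integration can be replaced by the whole line.\<close>

definition Gf :: "real \<Rightarrow> real" where
  "Gf s = v1 (max 0 s) - v0 (max 0 s)"

lemma Gf_nonpos [simp]: "s \<le> 0 \<Longrightarrow> Gf s = 0"
  using v1_unique[of 1] v0_unique[of 1] by (simp add: Gf_def max_def)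

lemma Gf_strict_mono: "0 \<le> a \<Longrightarrow> a < b \<Longrightarrow> Gf a < Gf b"
  using v1_mono[of a b] v0_antimono[of a b] by (simp add: Gf_def)

lemma Gf_mono: "a \<le> b \<Longrightarrow> Gf a \<le> Gf b"
proof -
  assume "a \<le> b"
  then have le: "max 0 a \<le> max 0 b" by (auto simp: max_def)
  have "Gf (max 0 a) \<le> Gf (max 0 b)"
  proof (cases "max 0 a = max 0 b")
    case False
    then have "max 0 a < max 0 b" using le by (rule le_neq_trans[rotated])
    from Gf_strict_mono[OF max.cobounded1 this] show ?thesis by (rule less_imp_le)
  qed simp
  then show ?thesis by (simp add: Gf_def)
qed

lemma Gf_nonneg: "0 \<le> Gf s"
  using Gf_mono[of "min 0 s" s] by simp

lemma Gf_sqrt_bound: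
  assumes "a \<le> b" "b \<le> S" "0 \<le> S"
  shows "Gf b - Gf a \<le> (2 + 2 * sqrt (v1 S)) * (sqrt (max 0 b) - sqrt (max 0 a))"
proof -
  define a' b' where "a' = max 0 a" and "b' = max 0 b"
  have "0 \<le> a'" "a' \<le> b'" "b' \<le> S" using assms by (auto simp: a'_def b'_def)
  note b = this
  from v1_sqrt_bound[OF b] v0_sqrt_bound[OF b(1,2)]
  have "v1 b' - v1 a' \<le> 2 * sqrt (v1 S) * (sqrt b' - sqrt a')" "v0 a' - v0 b' \<le> 2 * (sqrt b' - sqrt a')"
    by simp_all
  then show ?thesis unfolding Gf_def a'_def[symmetric] b'_def[symmetric] by (simp add: algebra_simps)
qed

lemma Gf_differentiable:
  assumes "0 < s" shows "Gf differentiable (at s)"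
proof -
  have "(\<lambda>s. v1 s - v0 s) differentiable (at s)"
    using assms by (intro derivative_intros v1_differentiable v0_differentiable)
  then obtain D where "((\<lambda>s. v1 s - v0 s) has_real_derivative D) (at s)"
    using real_differentiable_def by blast
  moreover have "\<forall>\<^sub>F x in nhds s. Gf x = v1 x - v0 x"
    using eventually_nhds_in_open[of "{0<..}" s] assms
    by (auto elim!: eventually_mono simp: Gf_def)
  ultimately have "(Gf has_real_derivative D) (at s)" by (simp add: DERIV_cong_ev)
  then show ?thesis using real_differentiable_def by blast
qed

text \<open>Every real solution is negative, and taking logarithms turns
  \<open>w * exp w = - exp (- s - 1)\<close> into \<open>pfun (- w) = s\<close>; the position of
  \<open>- w\<close> relative to 1 selects the branch.\<close>

lemma lambert_real:
  assumes s: "0 \<le> s"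
  shows "lambertW0 (- exp (- s - 1)) = of_real (- v0 s)"
    and "lambertWm1 (- exp (- s - 1)) = of_real (- v1 s)"
proof -
  have na: "\<not> - exp (- s - 1) < - exp (-1::real)" using s by simp
  have eq: "w * exp w = - exp (- s - 1) \<longleftrightarrow> pfun (- w) = s" if "w < 0" for w :: real
  proof -
    have "w * exp w = - exp (- s - 1) \<longleftrightarrow> exp (ln (- w)) * exp w = exp (- s - 1)"
      using that by (simp add: eq_neg_iff_add_eq_0 algebra_simps) linarith
    also have "\<dots> \<longleftrightarrow> ln (- w) + w = - s - 1"
      by (simp only: exp_add[symmetric] exp_inj_iff)
    also have "\<dots> \<longleftrightarrow> pfun (- w) = s" by (auto simp: pfun_def)
    finally show ?thesis .
  qed
  have neg: "w < 0" if "w * exp w = - exp (- s - 1)" for w :: real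
  proof (rule ccontr)
    assume "\<not> w < 0"
    then have "0 \<le> w * exp w" by simp
    also have "\<dots> < 0" unfolding that by simp
    finally show False by simp
  qed
  have "(THE w::real. -1 \<le> w \<and> w * exp w = - exp (- s - 1)) = - v0 s"
  proof (rule the_equality)
    fix w :: real assume w: "-1 \<le> w \<and> w * exp w = - exp (- s - 1)"
    then show "w = - v0 s" using v0_unique[of "- w"] neg[of w] eq[of w] by auto
  qed (use v0[OF s] eq[of "- v0 s"] in auto)
  then show "lambertW0 (- exp (- s - 1)) = of_real (- v0 s)" using na by (simp add: lambertW0_def)
  have "(THE w::real. w \<le> -1 \<and> w * exp w = - exp (- s - 1)) = - v1 s"
  proof (rule the_equality)
    fix w :: real assume w: "w \<le> -1 \<and> w * exp w = - exp (- s - 1)"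
    then show "w = - v1 s" using v1_unique[of "- w"] neg[of w] eq[of w] by auto
  qed (use v1[OF s] eq[of "- v1 s"] in auto)
  then show "lambertWm1 (- exp (- s - 1)) = of_real (- v1 s)" using na by (simp add: lambertWm1_def)
qed

lemma ecurve_exp:
  assumes "0 < \<theta>" "\<theta> < pi"
  shows "\<theta> / sin \<theta> * exp (- \<theta> * cot \<theta>) = exp (ecurve \<theta> - 1)"
proof -
  have "0 < \<theta> / sin \<theta>" using assms by (simp add: sin_gt_zero)
  then have "\<theta> / sin \<theta> * exp (- \<theta> * cot \<theta>) = exp (ln (\<theta> / sin \<theta>) - \<theta> * cot \<theta>)"
    by (simp add: exp_diff exp_minus field_simps)
  then show ?thesis using assms by (simp add: ecurve_def algebra_simps)
qed

text \<open>For w with imaginary part \<theta>, the vanishing imaginary part of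
  \<open>w * exp w\<close> forces the real part of \<open>w\<close> to be
  \<open>- \<theta> * cot \<theta>\<close>. The product then equals
  \<open>- exp (ecurve \<theta> - 1)\<close> by \<open>ecurve_exp\<close>, so \<theta> is determined
  by \<open>ecurve \<theta> = y\<close>.\<close>

lemma lambert_complex:
  assumes y: "0 < y"
  shows "lambertW0 (- exp (y - 1)) = Complex (- einv y * cot (einv y)) (einv y)"
proof -
  define \<theta> where "\<theta> = einv y"
  have \<theta>: "0 < \<theta>" "\<theta> < pi" "ecurve \<theta> = y"
    using einv[of y] y by (auto simp: \<theta>_def order_less_le)
  have a: "- exp (y - 1) < - exp (-1::real)" using y by simp
  have "(THE w::complex. 0 < Im w \<and> Im w < pi \<and> w * exp w = complex_of_real (- exp (y - 1))) = Complex (- \<theta> * cot \<theta>) \<theta>"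
  proof (rule the_equality)
    have s: "0 < sin \<theta>" using \<theta> by (simp add: sin_gt_zero)
    have "Im (Complex (- \<theta> * cot \<theta>) \<theta> * exp (Complex (- \<theta> * cot \<theta>) \<theta>)) = 0"
      using s by (simp add: Im_exp Re_exp cot_def field_simps)
    moreover have "Re (Complex (- \<theta> * cot \<theta>) \<theta> * exp (Complex (- \<theta> * cot \<theta>) \<theta>)) = - (\<theta> / sin \<theta> * exp (- \<theta> * cot \<theta>))"
    proof -
      have "- \<theta> * cot \<theta> * cos \<theta> - \<theta> * sin \<theta> = - (\<theta> / sin \<theta>) * (cos \<theta> * cos \<theta> + sin \<theta> * sin \<theta>)"
        using s by (simp add: cot_def field_simps del: sin_cos_squared_add3)
      also have "\<dots> = - (\<theta> / sin \<theta>)" using sin_cos_squared_add3[of \<theta>] by simp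
      finally have "exp (- \<theta> * cot \<theta>) * (- \<theta> * cot \<theta> * cos \<theta> - \<theta> * sin \<theta>) = exp (- \<theta> * cot \<theta>) * - (\<theta> / sin \<theta>)"
        by simp
      then show ?thesis by (simp add: Re_exp Im_exp algebra_simps)
    qed
    ultimately show "0 < Im (Complex (- \<theta> * cot \<theta>) \<theta>) \<and> Im (Complex (- \<theta> * cot \<theta>) \<theta>) < pi \<and>
        Complex (- \<theta> * cot \<theta>) \<theta> * exp (Complex (- \<theta> * cot \<theta>) \<theta>) = complex_of_real (- exp (y - 1))"
      using \<theta> ecurve_exp[of \<theta>] by (simp add: complex_eq_iff)
  next
    fix w :: complex
    assume w: "0 < Im w \<and> Im w < pi \<and> w * exp w = complex_of_real (- exp (y - 1))"
    define t where "t = Im w"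
    have t: "0 < t" "t < pi" using w by (auto simp: t_def)
    then have s: "0 < sin t" by (simp add: sin_gt_zero)
    have "Im (w * exp w) = 0" using w by simp
    then have "exp (Re w) * (Re w * sin t + t * cos t) = 0"
      by (simp add: Re_exp Im_exp t_def algebra_simps)
    then have "Re w * sin t + t * cos t = 0" by (simp only: mult_eq_0_iff exp_not_eq_zero simp_thms)
    then have r: "Re w = - t * cot t" using s by (simp add: cot_def field_simps eq_neg_iff_add_eq_0)
    have "Re (w * exp w) = - exp (y - 1)" using w by simp
    then have "exp (Re w) * (Re w * cos t - t * sin t) = - exp (y - 1)"
      by (simp add: Re_exp Im_exp t_def algebra_simps)
    moreover have "Re w * cos t - t * sin t = - (t / sin t) * (cos t * cos t + sin t * sin t)"
      unfolding r using s by (simp add: cot_def field_simps del: sin_cos_squared_add3)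
    ultimately have "t / sin t * exp (- t * cot t) = exp (y - 1)"
      using sin_cos_squared_add3[of t] r by (simp add: mult.commute)
    then have "ecurve t = y" using ecurve_exp[OF t] by simp
    then have "t = \<theta>" using t by (auto simp: \<theta>_def)
    then show "w = Complex (- \<theta> * cot \<theta>) \<theta>" using r t_def by (simp add: complex_eq_iff)
  qed
  then show ?thesis using a by (simp add: lambertW0_def \<theta>_def)
qed

text \<open>For \<kappa> > 0, in polar form \<open>2 * \<delta> * zeta \<delta> \<kappa>\<close> has
  modulus \<open>\<theta> / sin \<theta>\<close> and argument
  \<open>\<theta> = 2 * \<delta> * \<kappa>\<close> below \<pi>. Its principal logarithm is
  therefore explicit, and the imaginary parts in \<open>Efun\<close> cancel.\<close>

lemma scaled_zeta_exp:
  assumes "0 < \<delta>" "0 \<le> \<kappa>" "2 * \<delta> * \<kappa> < pi"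
  shows "of_real (2 * \<delta>) * zeta \<delta> \<kappa> = exp (of_real (2 * \<delta>) * zeta \<delta> \<kappa> + of_real (ecurve (2 * \<delta> * \<kappa>) - 1))"
    and "Efun \<delta> (zeta \<delta> \<kappa>) = of_real (ecurve (2 * \<delta> * \<kappa>) / (2 * \<delta>))"
proof -
  define \<theta> where "\<theta> = 2 * \<delta> * \<kappa>"
  have *: "Ln (of_real (2 * \<delta>) * zeta \<delta> \<kappa>) = of_real (2 * \<delta>) * zeta \<delta> \<kappa> + of_real (ecurve \<theta> - 1)
     \<and> of_real (2 * \<delta>) * zeta \<delta> \<kappa> \<noteq> 0"
  proof (cases "\<kappa> = 0")
    case True
    then show ?thesis using assms by (simp add: zeta_def \<theta>_def)
  next
    case False
    then have \<theta>: "0 < \<theta>" "\<theta> < pi" using assms by (auto simp: \<theta>_def)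
    then have s: "0 < sin \<theta>" by (simp add: sin_gt_zero)
    have z: "of_real (2 * \<delta>) * zeta \<delta> \<kappa> = Complex (\<theta> * cot \<theta>) \<theta>"
      using False by (simp add: zeta_def \<theta>_def Complex_eq algebra_simps)
    have "of_real (2 * \<delta>) * zeta \<delta> \<kappa> + of_real (ecurve \<theta> - 1) = Complex (ln (\<theta> / sin \<theta>)) \<theta>"
      unfolding z using \<theta> by (simp add: ecurve_def complex_eq_iff)
    moreover have "exp (Complex (ln (\<theta> / sin \<theta>)) \<theta>) = Complex (\<theta> * cot \<theta>) \<theta>"
      using s \<theta> by (simp add: complex_eq_iff Re_exp Im_exp cot_def)
    moreover have "Ln (exp (Complex (ln (\<theta> / sin \<theta>)) \<theta>)) = Complex (ln (\<theta> / sin \<theta>)) \<theta>"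
      using \<theta> by (intro Ln_exp) auto
    ultimately have "Ln (of_real (2 * \<delta>) * zeta \<delta> \<kappa>) = of_real (2 * \<delta>) * zeta \<delta> \<kappa> + of_real (ecurve \<theta> - 1)"
      unfolding z by (simp only:)
    moreover have "Complex (\<theta> * cot \<theta>) \<theta> \<noteq> 0" using \<theta> by (simp add: complex_eq_iff)
    ultimately show ?thesis unfolding z by blast
  qed
  show "of_real (2 * \<delta>) * zeta \<delta> \<kappa> = exp (of_real (2 * \<delta>) * zeta \<delta> \<kappa> + of_real (ecurve (2 * \<delta> * \<kappa>) - 1))"
    using exp_Ln[of "of_real (2 * \<delta>) * zeta \<delta> \<kappa>"] * unfolding \<theta>_def by metis
  show "Efun \<delta> (zeta \<delta> \<kappa>) = of_real (ecurve (2 * \<delta> * \<kappa>) / (2 * \<delta>))"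
    using * assms unfolding Efun_def \<theta>_def by (simp add: field_simps)
qed

text \<open>Compared with the branch value \<open>- exp (-1)\<close>, the argument lies above or
  below it according to whether \<open>2 * \<delta> * u\<close> is above or below
  \<open>ecurve (2 * \<delta> * \<kappa>)\<close>: this level separates the real from the complex
  Lambert regime.\<close>

lemma afun_eq:
  assumes "0 < \<delta>" "0 \<le> \<kappa>" "2 * \<delta> * \<kappa> < pi"
  shows "afun \<delta> \<kappa> u = of_real (- exp (ecurve (2 * \<delta> * \<kappa>) - 1 - 2 * \<delta> * u))"
proof -
  have "afun \<delta> \<kappa> u = - (of_real (2 * \<delta>) * zeta \<delta> \<kappa>) * exp (- of_real (2 * \<delta>) * (zeta \<delta> \<kappa> + of_real u))"
    by (simp add: afun_def)
  also have "of_real (2 * \<delta>) * zeta \<delta> \<kappa> = exp (of_real (2 * \<delta>) * zeta \<delta> \<kappa> + of_real (ecurve (2 * \<delta> * \<kappa>) - 1))"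
    by (rule scaled_zeta_exp(1)[OF assms])
  also have "- exp (of_real (2 * \<delta>) * zeta \<delta> \<kappa> + of_real (ecurve (2 * \<delta> * \<kappa>) - 1)) * exp (- of_real (2 * \<delta>) * (zeta \<delta> \<kappa> + of_real u))
      = - exp (of_real (ecurve (2 * \<delta> * \<kappa>) - 1 - 2 * \<delta> * u))"
    by (simp add: algebra_simps flip: exp_add)
  finally show ?thesis by (simp only: exp_of_real of_real_minus)
qed

section \<open>Minimal energies of Riemann sums\<close>

lemma inverse_sqrt_integrable:
  "integrable lborel (\<lambda>x. indicator {a..b} x * (1 / sqrt \<bar>x - c\<bar>))"
proof -
  have pos: "integrable lborel (\<lambda>x. indicator {0..r} x * (1 / sqrt \<bar>x\<bar>))" for r :: real
  proof (cases "0 \<le> r")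
    case True
    have "((\<lambda>x. 1 / sqrt x) has_integral (2 * sqrt r - 2 * sqrt 0)) {0..r}"
    proof (rule fundamental_theorem_of_calculus_interior[OF True])
      fix x assume "x \<in> {0<..<r}"
      then have "((\<lambda>x. 2 * sqrt x) has_real_derivative 1 / sqrt x) (at x)"
        by (auto intro!: derivative_eq_intros simp: field_simps)
      then show "((\<lambda>x. 2 * sqrt x) has_vector_derivative 1 / sqrt x) (at x)"
        by (simp add: has_real_derivative_iff_has_vector_derivative)
    qed (intro continuous_intros)
    then have "(\<lambda>x. 1 / sqrt x) absolutely_integrable_on {0..r}"
      by (intro nonnegative_absolutely_integrable_1) auto
    then have "integrable lebesgue (\<lambda>x. indicator {0..r} x * (1 / sqrt x))"
      by (simp add: set_integrable_def)
    then have "integrable lborel (\<lambda>x. indicator {0..r} x * (1 / sqrt x))"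
      by (subst (asm) integrable_completion) auto
    moreover have "(\<lambda>x. indicator {0..r} x * (1 / sqrt x)) = (\<lambda>x. indicator {0..r} x * (1 / sqrt \<bar>x\<bar>))"
      by (rule ext) (simp split: split_indicator)
    ultimately show ?thesis by (simp only:)
  qed simp
  define r where "r = \<bar>a - c\<bar> + \<bar>b - c\<bar>"
  have neg: "integrable lborel (\<lambda>x. indicator {0..r} (0 + (-1) * x) * (1 / sqrt \<bar>0 + (-1) * x\<bar>))"
    by (rule lborel_integrable_real_affine[OF pos]) simp
  have "integrable lborel (\<lambda>x. indicator {0..r} x * (1 / sqrt \<bar>x\<bar>) + indicator {0..r} (0 + (-1) * x) * (1 / sqrt \<bar>0 + (-1) * x\<bar>))"
    by (intro Bochner_Integration.integrable_add pos neg)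
  then have "integrable lborel (\<lambda>x. indicator {-r..r} x * (1 / sqrt \<bar>x\<bar>))"
    by (rule Bochner_Integration.integrable_bound) (auto split: split_indicator)
  then have "integrable lborel (\<lambda>x. indicator {-r..r} (- c + 1 * x) * (1 / sqrt \<bar>- c + 1 * x\<bar>))"
    by (rule lborel_integrable_real_affine) simp
  then show ?thesis
    by (rule Bochner_Integration.integrable_bound) (auto simp: r_def split: split_indicator)
qed

definition U01 :: "real measure" where
  "U01 = density lborel (indicator {0<..<1})"

lemma sets_U01 [measurable_cong, simp]: "sets U01 = sets borel"
  by (simp add: U01_def)

lemma space_U01 [simp]: "space U01 = UNIV"
  by (simp add: U01_def)

lemma emeasure_U01: "A \<in> sets borel \<Longrightarrow> emeasure U01 A = emeasure lborel ({0<..<1} \<inter> A)"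
  by (simp add: U01_def emeasure_density indicator_inter_arith[symmetric])

interpretation U01: finite_measure U01
  by (rule finite_measureI) (simp add: emeasure_U01)

interpretation U01_pair: pair_sigma_finite U01 U01 ..

interpretation U01_pair: finite_measure "U01 \<Otimes>\<^sub>M U01"
  by (rule finite_measure_pair_measure) unfold_locales

lemma AE_U01: "AE s in U01. 0 < s \<and> s < 1"
  unfolding U01_def by (subst AE_density) (auto simp: indicator_def)

lemma AE_U01_pair: "AE p in U01 \<Otimes>\<^sub>M U01. 0 < fst p \<and> fst p < 1 \<and> 0 < snd p \<and> snd p < 1"
proof (rule U01_pair.AE_pair_measure)
  show "AE x in U01. AE y in U01. 0 < fst (x, y) \<and> fst (x, y) < 1 \<and> 0 < snd (x, y) \<and> snd (x, y) < 1"
    using AE_U01 by eventually_elim (use AE_U01 in \<open>auto elim: eventually_mono\<close>)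
qed measurable

lemma U01_integral: "f \<in> borel_measurable borel \<Longrightarrow> integral\<^sup>L U01 f = (LINT s:{0<..<1}|lborel. f s)"
  for f :: "real \<Rightarrow> real"
proof -
  assume f: "f \<in> borel_measurable borel"
  have eq: "U01 = density lborel (\<lambda>x. ennreal (indicator {0<..<1} x))"
    by (simp add: U01_def ennreal_indicator)
  show ?thesis
    unfolding eq set_lebesgue_integral_def by (subst integral_density) (auto simp: f)
qed

lemma U01_pair_inverse_sqrt_integrable:
  "integrable (U01 \<Otimes>\<^sub>M U01) (\<lambda>p. 1 / sqrt \<bar>fst p - snd p\<bar>)"
proof -
  define C where "C = (\<integral>x. indicator {-1..1} x * (1 / sqrt \<bar>x\<bar>) \<partial>lborel)"
  have i1: "integrable lborel (\<lambda>x. indicator {-1..1} x * (1 / sqrt \<bar>x\<bar>))"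
    using inverse_sqrt_integrable[of "-1" 1 0] by simp
  have U: "U01 = density lborel (\<lambda>x. ennreal (indicator {0<..<1} x))"
    by (simp add: U01_def ennreal_indicator)
  have i: "integrable U01 (\<lambda>t. 1 / sqrt \<bar>s - t\<bar>)" for s
    unfolding U
    by (subst integrable_density)
       (auto intro!: Bochner_Integration.integrable_bound[OF inverse_sqrt_integrable[of 0 1 s]] simp: abs_minus_commute split: split_indicator)
  have bd: "(\<integral>t. 1 / sqrt \<bar>s - t\<bar> \<partial>U01) \<le> C" if "0 < s" "s < 1" for s
  proof -
    have "(\<integral>t. 1 / sqrt \<bar>s - t\<bar> \<partial>U01) = (\<integral>t. indicator {0<..<1} t * (1 / sqrt \<bar>s - t\<bar>) \<partial>lborel)"
      unfolding U by (subst integral_density) auto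
    also have "\<dots> \<le> (\<integral>t. indicator {-1..1} (- s + 1 * t) * (1 / sqrt \<bar>- s + 1 * t\<bar>) \<partial>lborel)"
    proof (rule integral_mono)
      show "integrable lborel (\<lambda>t. indicator {0<..<1} t * (1 / sqrt \<bar>s - t\<bar>))"
        by (rule Bochner_Integration.integrable_bound[OF inverse_sqrt_integrable[of 0 1 s]])
           (auto simp: abs_minus_commute split: split_indicator)
      show "integrable lborel (\<lambda>t. indicator {-1..1} (- s + 1 * t) * (1 / sqrt \<bar>- s + 1 * t\<bar>))"
        by (rule lborel_integrable_real_affine[OF i1]) simp
    qed (use that in \<open>auto simp: abs_minus_commute split: split_indicator\<close>)
    also have "\<dots> = C"
      using lborel_integral_real_affine[of 1 "\<lambda>x. indicator {-1..1} x * (1 / sqrt \<bar>x\<bar>)" "- s"] by (simp add: C_def)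
    finally show ?thesis .
  qed
  show ?thesis
  proof (rule U01_pair.Fubini_integrable)
    show "integrable U01 (\<lambda>x. \<integral>y. norm (1 / sqrt \<bar>fst (x, y) - snd (x, y)\<bar>) \<partial>U01)"
    proof (rule U01.integrable_const_bound[of _ C])
      show "AE x in U01. norm (\<integral>y. norm (1 / sqrt \<bar>fst (x, y) - snd (x, y)\<bar>) \<partial>U01) \<le> C"
        using AE_U01 by eventually_elim (auto simp: bd)
    qed measurable
    show "AE x in U01. integrable U01 (\<lambda>y. 1 / sqrt \<bar>fst (x, y) - snd (x, y)\<bar>)"
      by (simp add: i)
  qed measurable
qed

text \<open>The double sum omits \<open>i = j\<close>, so \<open>D\<close> is affine in each
  coordinate. Moving coordinates one at a time to the endpoint given by the sign of the slope never
  increases \<open>D\<close>, whatever the signs of \<open>V\<close> and \<open>H\<close>.\<close>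

lemma multilinear_vertex_min:
  fixes N :: nat and V :: "nat \<Rightarrow> real" and H :: "nat \<Rightarrow> nat \<Rightarrow> real"
  defines "D \<equiv> \<lambda>p. (\<Sum>j<N. V j * p j) + (\<Sum>i<N. \<Sum>j\<in>{..<N}-{i}. H i j * p i * p j)"
  assumes p: "\<And>j. j < N \<Longrightarrow> p j \<in> {0..1}"
  obtains S where "S \<subseteq> {..<N}" "D (indicator S) \<le> D p"
proof -
  have affine: "\<exists>a b. \<forall>s. D (p(m := s)) = a + b * s" if m: "m < N" for p :: "nat \<Rightarrow> real" and m
  proof -
    have 1: "(\<Sum>j<N. V j * (p(m := s)) j) = (\<Sum>j\<in>{..<N}-{m}. V j * p j) + V m * s" for s
      using m by (subst sum.remove[of _ m]) (auto simp: add.commute)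
    have 2: "(\<Sum>i<N. \<Sum>j\<in>{..<N}-{i}. H i j * (p(m := s)) i * (p(m := s)) j)
        = (\<Sum>j\<in>{..<N}-{m}. H m j * p j) * s
         + (\<Sum>i\<in>{..<N}-{m}. H i m * p i * s + (\<Sum>j\<in>{..<N}-{i}-{m}. H i j * p i * p j))" for s
    proof -
      have "(\<Sum>j\<in>{..<N}-{i}. H i j * (p(m := s)) i * (p(m := s)) j)
         = H i m * p i * s + (\<Sum>j\<in>{..<N}-{i}-{m}. H i j * p i * p j)" if "i \<in> {..<N}-{m}" for i
        using that m by (subst sum.remove[of _ m]) auto
      moreover have "(\<Sum>j\<in>{..<N}-{m}. H m j * (p(m := s)) m * (p(m := s)) j) = (\<Sum>j\<in>{..<N}-{m}. H m j * p j) * s"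
        unfolding sum_distrib_right by (intro sum.cong) auto
      ultimately show ?thesis
        using m by (subst sum.remove[of _ m]) (auto intro!: sum.cong)
    qed
    have "D (p(m := s)) = ((\<Sum>j\<in>{..<N}-{m}. V j * p j) + (\<Sum>i\<in>{..<N}-{m}. \<Sum>j\<in>{..<N}-{i}-{m}. H i j * p i * p j))
       + (V m + (\<Sum>j\<in>{..<N}-{m}. H m j * p j) + (\<Sum>i\<in>{..<N}-{m}. H i m * p i)) * s" for s
      unfolding D_def 1 2 by (simp add: sum.distrib algebra_simps sum_distrib_left sum_distrib_right)
    then show ?thesis by blast
  qed
  have "\<exists>q. (\<forall>j<k. q j \<in> {0, 1}) \<and> (\<forall>j<N. q j \<in> {0..1}) \<and> D q \<le> D p" if "k \<le> N" for k
    using that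
  proof (induction k)
    case 0
    then show ?case using p by (intro exI[of _ p]) auto
  next
    case (Suc k)
    then obtain q where q: "\<forall>j<k. q j \<in> {0, 1}" "\<forall>j<N. q j \<in> {0..1}" "D q \<le> D p" by auto
    obtain a b where ab: "\<And>s. D (q(k := s)) = a + b * s" using affine[of k q] Suc.prems by auto
    have qk: "D q = a + b * q k" using ab[of "q k"] by simp
    have qk01: "q k \<in> {0..1}" using q(2) Suc.prems by simp
    define s :: real where "s = (if 0 \<le> b then 0 else 1)"
    have "b * s \<le> b * q k"
      using qk01 mult_left_mono_neg[of "q k" 1 b] by (auto simp: s_def)
    then have "D (q(k := s)) \<le> D p" using ab[of s] qk q(3) by linarith
    moreover have "s \<in> {0, 1}" "s \<in> {0..1}" by (auto simp: s_def)
    moreover define q' where "q' = q(k := s)"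
    moreover have "q' j \<in> {0, 1}" if "j < Suc k" for j
      using q that \<open>s \<in> {0, 1}\<close> by (auto simp: q'_def less_Suc_eq)
    moreover have "q' j \<in> {0..1}" if "j < N" for j
      using q that \<open>s \<in> {0..1}\<close> by (auto simp: q'_def)
    ultimately show ?case by (intro exI[of _ q']) (simp only:, blast)
  qed
  then obtain q where q: "\<forall>j<N. q j \<in> {0, 1}" "D q \<le> D p" by blast
  define S where "S = {j. j < N \<and> q j = 1}"
  have e: "indicator S j = q j" if "j < N" for j using q(1) that by (auto simp: S_def indicator_def)
  have "D (indicator S) = D q"
    unfolding D_def using e by (intro arg_cong2[where f = "(+)"] sum.cong) auto
  then show thesis using that[of S] q(2) by (auto simp: S_def)
qed

text \<open>An abstract energy on (0, 1) with potential \<open>v\<close> and interaction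
  \<open>h\<close>. The inverse square root majorizes the logarithmic singularity; being
  homogeneous, it survives the replacement of points by nearby nodes at the price of a
  constant.\<close>

locale discretization =
  fixes v :: "real \<Rightarrow> real" and h :: "real \<Rightarrow> real \<Rightarrow> real" and Bv A0 B0 :: real
  assumes v_meas [measurable]: "v \<in> borel_measurable borel"
    and h_meas [measurable]: "(\<lambda>p. h (fst p) (snd p)) \<in> borel_measurable (borel \<Otimes>\<^sub>M borel)"
    and v_cont: "\<And>s. 0 < s \<Longrightarrow> s < 1 \<Longrightarrow> isCont v s"
    and v_bound: "\<And>s. 0 < s \<Longrightarrow> s < 1 \<Longrightarrow> \<bar>v s\<bar> \<le> Bv"
    and h_cont: "\<And>s t. 0 < s \<Longrightarrow> s < 1 \<Longrightarrow> 0 < t \<Longrightarrow> t < 1 \<Longrightarrow> s \<noteq> t \<Longrightarrow> isCont (\<lambda>p. h (fst p) (snd p)) (s, t)"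
    and h_diag: "\<And>s. h s s = 0"
    and h_nonneg: "\<And>s t. 0 < s \<Longrightarrow> s < 1 \<Longrightarrow> 0 < t \<Longrightarrow> t < 1 \<Longrightarrow> 0 \<le> h s t"
    and h_bound: "\<And>s t. 0 < s \<Longrightarrow> s < 1 \<Longrightarrow> 0 < t \<Longrightarrow> t < 1 \<Longrightarrow> h s t \<le> A0 + B0 / sqrt \<bar>s - t\<bar>"
    and AB_nonneg: "0 \<le> A0" "0 \<le> B0"
begin

definition profiles :: "(real \<Rightarrow> real) set" where
  "profiles = {f \<in> borel_measurable borel. \<forall>s. 0 \<le> f s \<and> f s \<le> 1}"

definition E :: "(real \<Rightarrow> real) \<Rightarrow> real" where
  "E f = (\<integral>s. v s * f s \<partial>U01) + (\<integral>p. h (fst p) (snd p) * f (fst p) * f (snd p) \<partial>(U01 \<Otimes>\<^sub>M U01))"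

text \<open>Midpoints of the cells, matching the half-integer quantization \<open>n - 1/2\<close> of
  the spectrum.\<close>

definition node :: "nat \<Rightarrow> nat \<Rightarrow> real" where
  "node N j = (real j + 1 / 2) / real N"

definition cell :: "nat \<Rightarrow> real \<Rightarrow> nat" where
  "cell N s = nat \<lfloor>real N * s\<rfloor>"

definition D :: "nat \<Rightarrow> (nat \<Rightarrow> real) \<Rightarrow> real" where
  "D N p = (\<Sum>j<N. v (node N j) / real N * p j)
     + (\<Sum>i<N. \<Sum>j\<in>{..<N}-{i}. h (node N i) (node N j) / (real N)\<^sup>2 * p i * p j)"

text \<open>Zero on the diagonal cells, which the kernel would otherwise enter at its singularity.\<close>

definition hN :: "nat \<Rightarrow> real \<Rightarrow> real \<Rightarrow> real" where
  "hN N s t = (if cell N s = cell N t then 0 else h (node N (cell N s)) (node N (cell N t)))"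

text \<open>An L1 distance in which no profile occurs; since profiles take values in [0, 1], it
  bounds the discretization error for all of them at once.\<close>

definition err :: "nat \<Rightarrow> real" where
  "err N = (\<integral>s. \<bar>v s - v (node N (cell N s))\<bar> \<partial>U01)
     + (\<integral>p. \<bar>h (fst p) (snd p) - hN N (fst p) (snd p)\<bar> \<partial>(U01 \<Otimes>\<^sub>M U01))"

text \<open>The factor 2 absorbs the loss in \<open>node_separation\<close>, so that one integrable
  function dominates \<open>h\<close> and every \<open>hN N\<close> with
  \<open>N > 0\<close>.\<close>

definition Wb :: "real \<times> real \<Rightarrow> real" where
  "Wb p = A0 + 2 * B0 * (1 / sqrt \<bar>fst p - snd p\<bar>)"

lemma cell_meas [measurable]: "cell N \<in> measurable borel (count_space UNIV)"
  unfolding cell_def by measurable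

lemma node_cell_meas [measurable]: "(\<lambda>s. node N (cell N s)) \<in> borel_measurable borel"
  by (rule measurable_compose[OF cell_meas]) simp

lemma hN_meas [measurable]: "(\<lambda>p. hN N (fst p) (snd p)) \<in> borel_measurable (borel \<Otimes>\<^sub>M borel)"
proof -
  have "(\<lambda>p. (node N (cell N (fst p)), node N (cell N (snd p)))) \<in> measurable (borel \<Otimes>\<^sub>M borel) (borel \<Otimes>\<^sub>M borel)"
    by measurable
  from measurable_compose[OF this h_meas]
  have [measurable]: "(\<lambda>p. h (node N (cell N (fst p))) (node N (cell N (snd p)))) \<in> borel_measurable (borel \<Otimes>\<^sub>M borel)"
    by simp
  have [measurable]: "(\<lambda>s. real (cell N s)) \<in> borel_measurable borel"
    by (rule measurable_compose[OF cell_meas]) simp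
  have eq: "(\<lambda>p. hN N (fst p) (snd p)) = (\<lambda>p. if real (cell N (fst p)) = real (cell N (snd p)) then 0
      else h (node N (cell N (fst p))) (node N (cell N (snd p))))"
    by (rule ext) (simp add: hN_def)
  show ?thesis unfolding eq by measurable
qed

lemma pair_meas_eq: "measurable (U01 \<Otimes>\<^sub>M U01) X = measurable (borel \<Otimes>\<^sub>M borel) X"
  by (rule measurable_cong_sets) (auto intro!: sets_pair_measure_cong)

lemma cell_less: "0 < N \<Longrightarrow> 0 < s \<Longrightarrow> s < 1 \<Longrightarrow> cell N s < N"
  unfolding cell_def by (simp add: nat_less_iff floor_less_iff)

lemma cell_floor: "0 < s \<Longrightarrow> real (cell N s) = of_int \<lfloor>real N * s\<rfloor>"
  unfolding cell_def by simp

lemma node_bounds: "0 < N \<Longrightarrow> j < N \<Longrightarrow> 0 < node N j \<and> node N j < 1"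
  unfolding node_def by (auto simp: field_simps)

lemma node_cell_close:
  assumes "0 < N" "0 < s" shows "\<bar>node N (cell N s) - s\<bar> \<le> 1 / real N"
proof -
  have "\<bar>real (cell N s) + 1 / 2 - real N * s\<bar> \<le> 1"
    unfolding cell_floor[OF assms(2)] by linarith
  then have "\<bar>real (cell N s) + 1 / 2 - real N * s\<bar> / real N \<le> 1 / real N"
    by (rule divide_right_mono) simp
  moreover have "\<bar>real (cell N s) + 1 / 2 - real N * s\<bar> / real N = \<bar>node N (cell N s) - s\<bar>"
  proof -
    have "node N (cell N s) - s = (real (cell N s) + 1 / 2 - real N * s) / real N"
      using assms by (simp add: node_def field_simps)
    then show ?thesis by (simp add: abs_divide)
  qed
  ultimately show ?thesis by simp
qed

lemma node_cell_tendsto: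
  assumes "0 < s" shows "(\<lambda>N. node N (cell N s)) \<longlonglongrightarrow> s"
proof -
  have "(\<lambda>N. node N (cell N s) - s) \<longlonglongrightarrow> 0"
    by (rule Lim_null_comparison[OF _ lim_1_over_n])
       (auto intro!: eventually_sequentiallyI[of 1] simp: node_cell_close assms)
  then show ?thesis by (simp add: LIM_zero_iff)
qed

text \<open>The floors of \<open>N * s\<close> and \<open>N * t\<close>, if different, differ by at
  least 1, while the numbers themselves differ by at most 1 more than their floors.\<close>

lemma node_separation:
  assumes N: "0 < N" and st: "0 < s" "0 < t" and ne: "cell N s \<noteq> cell N t"
  shows "\<bar>s - t\<bar> \<le> 2 * \<bar>node N (cell N s) - node N (cell N t)\<bar>"
proof -
  define a b where "a = \<lfloor>real N * s\<rfloor>" and "b = \<lfloor>real N * t\<rfloor>"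
  have "a \<noteq> b" using ne by (auto simp: cell_def a_def b_def)
  then have ab: "1 \<le> \<bar>of_int a - of_int b :: real\<bar>" by linarith
  have "\<bar>real N * s - real N * t\<bar> \<le> \<bar>of_int a - of_int b :: real\<bar> + 1"
    unfolding a_def b_def by linarith
  moreover have "X \<le> 2 * Y" if "X \<le> Y + 1" "1 \<le> Y" for X Y :: real using that by linarith
  ultimately have "\<bar>real N * s - real N * t\<bar> \<le> 2 * \<bar>of_int a - of_int b :: real\<bar>" using ab by blast
  then have "\<bar>real N * s - real N * t\<bar> / real N \<le> 2 * \<bar>of_int a - of_int b :: real\<bar> / real N"
    by (rule divide_right_mono) simp
  moreover have "\<bar>real N * s - real N * t\<bar> / real N = \<bar>s - t\<bar>"
    using N by (simp add: abs_mult flip: right_diff_distrib)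
  moreover have "node N (cell N s) - node N (cell N t) = (of_int a - of_int b) / real N"
    using st by (simp add: node_def cell_floor a_def b_def diff_divide_distrib[symmetric])
  then have "2 * \<bar>of_int a - of_int b :: real\<bar> / real N = 2 * \<bar>node N (cell N s) - node N (cell N t)\<bar>"
    by (simp add: abs_divide)
  ultimately show ?thesis by simp
qed

lemma h_abs_bound:
  assumes "0 < s" "s < 1" "0 < t" "t < 1"
  shows "\<bar>h s t\<bar> \<le> Wb (s, t)"
proof -
  have "h s t \<le> A0 + B0 / sqrt \<bar>s - t\<bar>" by (rule h_bound[OF assms])
  moreover have "0 \<le> B0 / sqrt \<bar>s - t\<bar>" using AB_nonneg by simp
  ultimately show ?thesis using h_nonneg[OF assms] by (simp add: Wb_def)
qed

lemma hN_abs_bound: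
  assumes N: "0 < N" and st: "0 < s" "s < 1" "0 < t" "t < 1"
  shows "\<bar>hN N s t\<bar> \<le> Wb (s, t)"
proof (cases "cell N s = cell N t")
  case True
  then show ?thesis using AB_nonneg by (simp add: hN_def Wb_def)
next
  case False
  define x y where "x = node N (cell N s)" and "y = node N (cell N t)"
  have xy: "0 < x" "x < 1" "0 < y" "y < 1"
    using node_bounds[OF N cell_less[OF N]] st by (auto simp: x_def y_def)
  have sep: "\<bar>s - t\<bar> \<le> 2 * \<bar>x - y\<bar>"
    unfolding x_def y_def by (rule node_separation[OF N st(1,3) False])
  have "s \<noteq> t" using False by auto
  then have d: "0 < \<bar>s - t\<bar>" by simp
  have "sqrt \<bar>s - t\<bar> \<le> sqrt (4 * \<bar>x - y\<bar>)" using sep by (intro real_sqrt_le_mono) linarith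
  then have "sqrt \<bar>s - t\<bar> \<le> 2 * sqrt \<bar>x - y\<bar>" by (simp add: real_sqrt_mult)
  then have "1 / sqrt \<bar>x - y\<bar> \<le> 2 / sqrt \<bar>s - t\<bar>"
    using d sep by (simp add: divide_simps)
  then have "B0 * (1 / sqrt \<bar>x - y\<bar>) \<le> B0 * (2 / sqrt \<bar>s - t\<bar>)" using AB_nonneg by (intro mult_left_mono) auto
  moreover have "h x y \<le> A0 + B0 / sqrt \<bar>x - y\<bar>" "0 \<le> h x y" using h_bound[OF xy] h_nonneg[OF xy] by auto
  moreover have "hN N s t = h x y" using False by (simp add: hN_def x_def y_def)
  moreover have "Wb (s, t) = A0 + B0 * (2 / sqrt \<bar>s - t\<bar>)" by (simp add: Wb_def)
  moreover have "B0 * (1 / sqrt \<bar>x - y\<bar>) = B0 / sqrt \<bar>x - y\<bar>" by simp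
  ultimately show ?thesis by linarith
qed

lemma Wb_integrable: "integrable (U01 \<Otimes>\<^sub>M U01) Wb"
  unfolding Wb_def
  by (intro Bochner_Integration.integrable_add integrable_mult_right U01_pair_inverse_sqrt_integrable) simp

lemma h_integrable: "integrable (U01 \<Otimes>\<^sub>M U01) (\<lambda>p. h (fst p) (snd p))"
  by (rule Bochner_Integration.integrable_bound[OF Wb_integrable])
     (auto simp: pair_meas_eq intro!: eventually_mono[OF AE_U01_pair] order_trans[OF h_abs_bound])

lemma hN_integrable: "0 < N \<Longrightarrow> integrable (U01 \<Otimes>\<^sub>M U01) (\<lambda>p. hN N (fst p) (snd p))"
  by (rule Bochner_Integration.integrable_bound[OF Wb_integrable])
     (auto simp: pair_meas_eq intro!: eventually_mono[OF AE_U01_pair] order_trans[OF hN_abs_bound])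

lemma v_integrable: "integrable U01 v"
  by (rule U01.integrable_const_bound[of _ Bv]) (auto intro!: eventually_mono[OF AE_U01] v_bound)

lemma vN_meas [measurable]: "(\<lambda>s. v (node N (cell N s))) \<in> borel_measurable borel"
  by measurable

lemma vN_integrable: "0 < N \<Longrightarrow> integrable U01 (\<lambda>s. v (node N (cell N s)))"
  by (rule U01.integrable_const_bound[of _ Bv])
     (auto intro!: eventually_mono[OF AE_U01] v_bound simp: node_bounds cell_less)

lemma err_tendsto: "err \<longlonglongrightarrow> 0"
proof -
  \<comment> \<open>The shift to \<open>Suc N\<close> keeps the number of cells positive, as the
    bounds on the nodes require.\<close>
  have "(\<lambda>N. \<integral>s. \<bar>v s - v (node (Suc N) (cell (Suc N) s))\<bar> \<partial>U01) \<longlonglongrightarrow> (\<integral>s. 0 \<partial>U01)"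
  proof (rule integral_dominated_convergence[where w = "\<lambda>_. 2 * Bv"])
    show "AE s in U01. (\<lambda>N. \<bar>v s - v (node (Suc N) (cell (Suc N) s))\<bar>) \<longlonglongrightarrow> 0"
    proof (rule eventually_mono[OF AE_U01])
      fix s :: real assume s: "0 < s \<and> s < 1"
      have "(\<lambda>N. v (node N (cell N s))) \<longlonglongrightarrow> v s"
        using v_cont[of s] s node_cell_tendsto[of s] by (metis isCont_tendsto_compose)
      then have "(\<lambda>N. \<bar>v s - v (node N (cell N s))\<bar>) \<longlonglongrightarrow> \<bar>v s - v s\<bar>" by (intro tendsto_intros)
      then show "(\<lambda>N. \<bar>v s - v (node (Suc N) (cell (Suc N) s))\<bar>) \<longlonglongrightarrow> 0"
        by (subst filterlim_sequentially_Suc) simp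
    qed
    show "AE s in U01. norm \<bar>v s - v (node (Suc N) (cell (Suc N) s))\<bar> \<le> 2 * Bv" for N
    proof (rule eventually_mono[OF AE_U01])
      fix s :: real assume s: "0 < s \<and> s < 1"
      then have "\<bar>v s\<bar> \<le> Bv" "\<bar>v (node (Suc N) (cell (Suc N) s))\<bar> \<le> Bv"
        by (auto intro!: v_bound simp: node_bounds cell_less)
      then show "norm \<bar>v s - v (node (Suc N) (cell (Suc N) s))\<bar> \<le> 2 * Bv" by simp
    qed
  qed auto
  moreover have "(\<lambda>N. \<integral>p. \<bar>h (fst p) (snd p) - hN (Suc N) (fst p) (snd p)\<bar> \<partial>(U01 \<Otimes>\<^sub>M U01)) \<longlonglongrightarrow> (\<integral>p. 0 \<partial>(U01 \<Otimes>\<^sub>M U01))"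
  proof (rule integral_dominated_convergence[where w = "\<lambda>p. 2 * Wb p"])
    show "integrable (U01 \<Otimes>\<^sub>M U01) (\<lambda>p. 2 * Wb p)" by (intro integrable_mult_right Wb_integrable)
    show "AE p in U01 \<Otimes>\<^sub>M U01. (\<lambda>N. \<bar>h (fst p) (snd p) - hN (Suc N) (fst p) (snd p)\<bar>) \<longlonglongrightarrow> 0"
    proof (rule eventually_mono[OF AE_U01_pair])
      fix p :: "real \<times> real" assume p: "0 < fst p \<and> fst p < 1 \<and> 0 < snd p \<and> snd p < 1"
      obtain s t where st: "p = (s, t)" by (cases p)
      have lim: "(\<lambda>N. hN N s t) \<longlonglongrightarrow> h s t"
      proof (cases "s = t")
        case True
        then show ?thesis by (simp add: hN_def h_diag)
      next
        case False
        have l: "(\<lambda>N. (node N (cell N s), node N (cell N t))) \<longlonglongrightarrow> (s, t)"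
          using p st by (intro tendsto_Pair node_cell_tendsto) auto
        have "isCont (\<lambda>p. h (fst p) (snd p)) (s, t)" using p st False by (intro h_cont) auto
        from isCont_tendsto_compose[OF this l]
        have "(\<lambda>N. h (node N (cell N s)) (node N (cell N t))) \<longlonglongrightarrow> h s t" by simp
        \<comment> \<open>The nodes converge to distinct points, so they eventually differ; then the
          cells differ too and the diagonal convention of \<open>hN\<close> is inactive.\<close>
        moreover have "\<forall>\<^sub>F N in sequentially. h (node N (cell N s)) (node N (cell N t)) = hN N s t"
        proof -
          have "(\<lambda>N. node N (cell N s) - node N (cell N t)) \<longlonglongrightarrow> s - t"
            using p st by (intro tendsto_intros node_cell_tendsto) auto
          then have "\<forall>\<^sub>F N in sequentially. node N (cell N s) - node N (cell N t) \<noteq> 0"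
            using False by (intro tendsto_imp_eventually_ne) auto
          then show ?thesis by eventually_elim (auto simp: hN_def)
        qed
        ultimately show ?thesis by (simp add: tendsto_cong)
      qed
      then have "(\<lambda>N. \<bar>h s t - hN N s t\<bar>) \<longlonglongrightarrow> \<bar>h s t - h s t\<bar>" by (intro tendsto_intros)
      then show "(\<lambda>N. \<bar>h (fst p) (snd p) - hN (Suc N) (fst p) (snd p)\<bar>) \<longlonglongrightarrow> 0"
        using st by (subst filterlim_sequentially_Suc) simp
    qed
    show "AE p in U01 \<Otimes>\<^sub>M U01. norm \<bar>h (fst p) (snd p) - hN (Suc N) (fst p) (snd p)\<bar> \<le> 2 * Wb p" for N
    proof (rule eventually_mono[OF AE_U01_pair])
      fix p :: "real \<times> real" assume "0 < fst p \<and> fst p < 1 \<and> 0 < snd p \<and> snd p < 1"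
      then have "\<bar>h (fst p) (snd p)\<bar> \<le> Wb p" "\<bar>hN (Suc N) (fst p) (snd p)\<bar> \<le> Wb p"
        using h_abs_bound[of "fst p" "snd p"] hN_abs_bound[of "Suc N" "fst p" "snd p"] by auto
      then show "norm \<bar>h (fst p) (snd p) - hN (Suc N) (fst p) (snd p)\<bar> \<le> 2 * Wb p" by simp
    qed
  qed (auto simp: pair_meas_eq)
  ultimately have "(\<lambda>N. err (Suc N)) \<longlonglongrightarrow> 0"
    unfolding err_def using tendsto_add by fastforce
  then show ?thesis by (simp add: filterlim_sequentially_Suc)
qed

lemma profiles_D:
  assumes "f \<in> profiles"
  shows "f \<in> borel_measurable borel" "\<And>s. 0 \<le> f s" "\<And>s. f s \<le> 1"
  using assms by (auto simp: profiles_def)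

lemma profile_pair_meas:
  assumes "f \<in> profiles"
  shows "(\<lambda>p. f (fst p)) \<in> borel_measurable (U01 \<Otimes>\<^sub>M U01)" "(\<lambda>p. f (snd p)) \<in> borel_measurable (U01 \<Otimes>\<^sub>M U01)"
  using profiles_D(1)[OF assms] by measurable

lemma integrable_mult_profile:
  assumes g: "integrable U01 g" and f: "f \<in> profiles"
  shows "integrable U01 (\<lambda>s. g s * f s)"
proof (rule Bochner_Integration.integrable_bound[OF g])
  show "(\<lambda>s. g s * f s) \<in> borel_measurable U01"
    using borel_measurable_integrable[OF g] profiles_D(1)[OF f] by simp
  have "norm (g s * f s) \<le> norm (g s)" for s
    using mult_left_le[of "f s" "\<bar>g s\<bar>"] profiles_D[OF f] by (simp add: abs_mult)
  then show "AE s in U01. norm (g s * f s) \<le> norm (g s)" by simp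
qed

lemma integrable_mult_profile2:
  assumes g: "integrable (U01 \<Otimes>\<^sub>M U01) g" and f: "f \<in> profiles"
  shows "integrable (U01 \<Otimes>\<^sub>M U01) (\<lambda>p. g p * f (fst p) * f (snd p))"
proof (rule Bochner_Integration.integrable_bound[OF g])
  show "(\<lambda>p. g p * f (fst p) * f (snd p)) \<in> borel_measurable (U01 \<Otimes>\<^sub>M U01)"
    using borel_measurable_integrable[OF g] profile_pair_meas[OF f] by measurable
  have "norm (g p * f (fst p) * f (snd p)) \<le> norm (g p)" for p
  proof -
    have "\<bar>g p\<bar> * (f (fst p) * f (snd p)) \<le> \<bar>g p\<bar>"
      using profiles_D[OF f] by (intro mult_left_le mult_le_one) auto
    then show ?thesis using profiles_D[OF f] by (simp add: abs_mult mult.assoc)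
  qed
  then show "AE p in U01 \<Otimes>\<^sub>M U01. norm (g p * f (fst p) * f (snd p)) \<le> norm (g p)" by simp
qed

definition EN :: "nat \<Rightarrow> (real \<Rightarrow> real) \<Rightarrow> real" where
  "EN N f = (\<integral>s. v (node N (cell N s)) * f s \<partial>U01) + (\<integral>p. hN N (fst p) (snd p) * f (fst p) * f (snd p) \<partial>(U01 \<Otimes>\<^sub>M U01))"

lemma E_EN_close:
  assumes f: "f \<in> profiles" and N: "0 < N"
  shows "\<bar>E f - EN N f\<bar> \<le> err N"
proof -
  have f01: "0 \<le> f s" "f s \<le> 1" for s using profiles_D[OF f] by auto
  have "\<bar>(\<integral>s. v s * f s \<partial>U01) - (\<integral>s. v (node N (cell N s)) * f s \<partial>U01)\<bar>
      = \<bar>\<integral>s. (v s - v (node N (cell N s))) * f s \<partial>U01\<bar>"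
    by (subst Bochner_Integration.integral_diff[symmetric])
       (auto intro!: integrable_mult_profile f v_integrable vN_integrable N simp: left_diff_distrib)
  also have "\<dots> \<le> (\<integral>s. \<bar>v s - v (node N (cell N s))\<bar> \<partial>U01)"
  proof (rule order_trans[OF integral_abs_bound], rule integral_mono)
    show "integrable U01 (\<lambda>s. \<bar>(v s - v (node N (cell N s))) * f s\<bar>)"
      by (intro integrable_abs integrable_mult_profile Bochner_Integration.integrable_diff v_integrable vN_integrable N f)
    show "integrable U01 (\<lambda>s. \<bar>v s - v (node N (cell N s))\<bar>)"
      by (intro integrable_abs Bochner_Integration.integrable_diff v_integrable vN_integrable N)
    show "\<bar>(v s - v (node N (cell N s))) * f s\<bar> \<le> \<bar>v s - v (node N (cell N s))\<bar>" for s
      using mult_left_le[of "f s" "\<bar>v s - v (node N (cell N s))\<bar>"] f01[of s] by (simp add: abs_mult)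
  qed
  finally have 1: "\<bar>(\<integral>s. v s * f s \<partial>U01) - (\<integral>s. v (node N (cell N s)) * f s \<partial>U01)\<bar>
      \<le> (\<integral>s. \<bar>v s - v (node N (cell N s))\<bar> \<partial>U01)" .
  let ?P = "U01 \<Otimes>\<^sub>M U01"
  have "\<bar>(\<integral>p. h (fst p) (snd p) * f (fst p) * f (snd p) \<partial>?P) - (\<integral>p. hN N (fst p) (snd p) * f (fst p) * f (snd p) \<partial>?P)\<bar>
      = \<bar>\<integral>p. (h (fst p) (snd p) - hN N (fst p) (snd p)) * f (fst p) * f (snd p) \<partial>?P\<bar>"
    by (subst Bochner_Integration.integral_diff[symmetric])
       (auto intro!: integrable_mult_profile2 f h_integrable hN_integrable N simp: left_diff_distrib)
  also have "\<dots> \<le> (\<integral>p. \<bar>h (fst p) (snd p) - hN N (fst p) (snd p)\<bar> \<partial>?P)"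
  proof (rule order_trans[OF integral_abs_bound], rule integral_mono)
    show "integrable ?P (\<lambda>p. \<bar>(h (fst p) (snd p) - hN N (fst p) (snd p)) * f (fst p) * f (snd p)\<bar>)"
      by (intro integrable_abs integrable_mult_profile2 Bochner_Integration.integrable_diff h_integrable hN_integrable N f)
    show "integrable ?P (\<lambda>p. \<bar>h (fst p) (snd p) - hN N (fst p) (snd p)\<bar>)"
      by (intro integrable_abs Bochner_Integration.integrable_diff h_integrable hN_integrable N)
    fix p
    have "\<bar>h (fst p) (snd p) - hN N (fst p) (snd p)\<bar> * (f (fst p) * f (snd p)) \<le> \<bar>h (fst p) (snd p) - hN N (fst p) (snd p)\<bar>"
      using f01 by (intro mult_left_le mult_le_one) auto
    then show "\<bar>(h (fst p) (snd p) - hN N (fst p) (snd p)) * f (fst p) * f (snd p)\<bar> \<le> \<bar>h (fst p) (snd p) - hN N (fst p) (snd p)\<bar>"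
      using f01 by (simp add: abs_mult mult.assoc)
  qed
  finally show ?thesis using 1 unfolding E_def EN_def err_def by linarith
qed

lemma cell_measure:
  assumes N: "0 < N" and j: "j < N"
  shows "measure U01 {s. cell N s = j} = 1 / real N"
proof -
  have [measurable]: "{s. cell N s = j} \<in> sets borel"
    using measurable_sets[OF cell_meas, of "{j}" N] by (simp add: vimage_def)
  have fl: "cell N s = j \<longleftrightarrow> real j \<le> real N * s \<and> real N * s < real j + 1" if "0 < s" for s
    using that mult_nonneg_nonneg[of "real N" s] by (simp add: cell_def nat_eq_iff floor_eq_iff)
  have j1: "(real j + 1) / real N \<le> 1" using N j by (simp add: divide_le_eq)
  have "emeasure lborel {real j / real N <..< (real j + 1) / real N} \<le> emeasure lborel ({0<..<1} \<inter> {s. cell N s = j})"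
  proof (rule emeasure_mono)
    show "{real j / real N <..< (real j + 1) / real N} \<subseteq> {0<..<1} \<inter> {s. cell N s = j}"
    proof
      fix s assume s: "s \<in> {real j / real N <..< (real j + 1) / real N}"
      then have s0: "0 < s" using N by (auto intro: le_less_trans[of _ "real j / real N"])
      moreover have "s < 1" using s j1 by (auto intro: less_le_trans)
      ultimately show "s \<in> {0<..<1} \<inter> {s. cell N s = j}"
        using s N fl[OF s0] by (auto simp: divide_less_eq less_divide_eq mult.commute)
    qed
  qed simp
  moreover have "emeasure lborel ({0<..<1} \<inter> {s. cell N s = j}) \<le> emeasure lborel {real j / real N ..< (real j + 1) / real N}"
  proof (rule emeasure_mono)
    show "{0<..<1} \<inter> {s. cell N s = j} \<subseteq> {real j / real N ..< (real j + 1) / real N}"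
    proof
      fix s assume s: "s \<in> {0<..<1} \<inter> {s. cell N s = j}"
      then show "s \<in> {real j / real N ..< (real j + 1) / real N}"
        using fl[of s] N by (simp add: divide_le_eq less_divide_eq mult.commute)
    qed
  qed simp
  ultimately have "emeasure U01 {s. cell N s = j} = ennreal (1 / real N)"
    using N by (simp add: emeasure_U01 divide_right_mono diff_divide_distrib[symmetric])
  then show ?thesis by (simp add: measure_def)
qed

definition avg :: "nat \<Rightarrow> (real \<Rightarrow> real) \<Rightarrow> nat \<Rightarrow> real" where
  "avg N f j = real N * (\<integral>s. indicator {s. cell N s = j} s * f s \<partial>U01)"

lemma cell_set_meas [measurable]: "{s. cell N s = j} \<in> sets borel"
  using measurable_sets[OF cell_meas, of "{j}" N] by (simp add: vimage_def)

lemma ind_profile_integrable: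
  assumes f: "f \<in> profiles"
  shows "integrable U01 (\<lambda>s. indicator {s. cell N s = j} s * f s)"
  by (rule integrable_mult_profile[OF _ f]) (rule U01.integrable_const_bound[of _ 1], auto)

lemma avg_01:
  assumes N: "0 < N" and j: "j < N" and f: "f \<in> profiles"
  shows "avg N f j \<in> {0..1}"
proof -
  have "(\<integral>s. indicator {s. cell N s = j} s * f s \<partial>U01) \<le> (\<integral>s. indicator {s. cell N s = j} s \<partial>U01)"
    using profiles_D[OF f]
    by (intro integral_mono ind_profile_integrable[OF f] U01.integrable_const_bound[of _ 1]) (auto simp: mult_left_le)
  also have "\<dots> = 1 / real N" using cell_measure[OF N j] by simp
  finally have "avg N f j \<le> real N * (1 / real N)" unfolding avg_def by (rule mult_left_mono) simp
  moreover have "0 \<le> avg N f j"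
    unfolding avg_def using profiles_D[OF f] by (intro mult_nonneg_nonneg Bochner_Integration.integral_nonneg) auto
  ultimately show ?thesis using N by simp
qed

text \<open>The sampled potential and kernel are constant on cells, so only the mass of the profile
  in each cell enters: the discretized energy of a profile is exactly a finite form at a point of
  the cube.\<close>

lemma EN_eq_D:
  assumes N: "0 < N" and f: "f \<in> profiles"
  shows "EN N f = D N (avg N f)"
proof -
  let ?I = "\<lambda>j. indicator {s. cell N s = j} :: real \<Rightarrow> real"
  let ?P = "U01 \<Otimes>\<^sub>M U01"
  note [measurable] = profiles_D(1)[OF f]
  have m: "(\<integral>s. ?I j s * f s \<partial>U01) = avg N f j / real N" for j
    using N by (simp add: avg_def)
  have "(\<integral>s. v (node N (cell N s)) * f s \<partial>U01) = (\<integral>s. (\<Sum>j<N. v (node N j) * (?I j s * f s)) \<partial>U01)"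
  proof (rule integral_cong_AE)
    show "AE s in U01. v (node N (cell N s)) * f s = (\<Sum>j<N. v (node N j) * (?I j s * f s))"
    proof (rule eventually_mono[OF AE_U01])
      fix s :: real assume s: "0 < s \<and> s < 1"
      have "(\<Sum>j<N. v (node N j) * (?I j s * f s)) = (\<Sum>j<N. if cell N s = j then v (node N j) * f s else 0)"
        by (intro sum.cong) auto
      then show "v (node N (cell N s)) * f s = (\<Sum>j<N. v (node N j) * (?I j s * f s))"
        using cell_less[OF N] s by simp
    qed
  qed measurable
  also have "\<dots> = (\<Sum>j<N. v (node N j) * (\<integral>s. ?I j s * f s \<partial>U01))"
    by (subst Bochner_Integration.integral_sum) (auto intro!: integrable_mult_right ind_profile_integrable f)
  also have "\<dots> = (\<Sum>j<N. v (node N j) / real N * avg N f j)"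
    unfolding m by (intro sum.cong) auto
  finally have 1: "(\<integral>s. v (node N (cell N s)) * f s \<partial>U01) = (\<Sum>j<N. v (node N j) / real N * avg N f j)" .
  define T where "T = (\<lambda>i j (p::real \<times> real). (?I i (fst p) * f (fst p)) * (?I j (snd p) * f (snd p)))"
  have T_meas [measurable]: "T i j \<in> borel_measurable ?P" for i j
    unfolding T_def by measurable
  have T_int: "integrable ?P (T i j)" for i j
  proof (rule U01_pair.integrable_const_bound[of _ 1])
    have "norm (T i j p) \<le> 1" for p
      using profiles_D(2,3)[OF f] by (auto simp: T_def indicator_def mult_le_one)
    then show "AE p in ?P. norm (T i j p) \<le> 1" by simp
  qed simp
  have T_val: "(\<integral>p. T i j p \<partial>?P) = avg N f i * avg N f j / (real N)\<^sup>2" for i j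
  proof -
    have "(\<integral>p. T i j p \<partial>?P) = (\<integral>x. (\<integral>y. T i j (x, y) \<partial>U01) \<partial>U01)"
      by (rule U01_pair.integral_fst'[OF T_int, symmetric])
    also have "\<dots> = (\<integral>x. (?I i x * f x) * (avg N f j / real N) \<partial>U01)"
      by (simp only: T_def fst_conv snd_conv integral_mult_right_zero m)
    also have "\<dots> = avg N f i / real N * (avg N f j / real N)"
      by (simp only: integral_mult_left_zero m)
    finally show ?thesis by (simp add: power2_eq_square)
  qed
  have "(\<integral>p. hN N (fst p) (snd p) * f (fst p) * f (snd p) \<partial>?P)
     = (\<integral>p. (\<Sum>i<N. \<Sum>j\<in>{..<N}-{i}. h (node N i) (node N j) * T i j p) \<partial>?P)"
  proof (rule integral_cong_AE)
    show "AE p in ?P. hN N (fst p) (snd p) * f (fst p) * f (snd p) = (\<Sum>i<N. \<Sum>j\<in>{..<N}-{i}. h (node N i) (node N j) * T i j p)"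
    proof (rule eventually_mono[OF AE_U01_pair])
      fix p :: "real \<times> real" assume p: "0 < fst p \<and> fst p < 1 \<and> 0 < snd p \<and> snd p < 1"
      define a b where "a = cell N (fst p)" and "b = cell N (snd p)"
      have ab: "a < N" "b < N" using p cell_less[OF N] by (auto simp: a_def b_def)
      have T: "h (node N i) (node N j) * T i j p
          = (if a = i then if b = j then h (node N i) (node N j) * f (fst p) * f (snd p) else 0 else 0)" for i j
        by (auto simp: T_def a_def b_def)
      have "(\<Sum>i<N. \<Sum>j\<in>{..<N}-{i}. h (node N i) (node N j) * T i j p)
          = (\<Sum>i<N. if a = i then (\<Sum>j\<in>{..<N}-{i}. if b = j then h (node N i) (node N j) * f (fst p) * f (snd p) else 0) else 0)"
        unfolding T by (intro sum.cong refl) (auto intro!: sum.cong)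
      also have "\<dots> = (if a = b then 0 else h (node N a) (node N b) * f (fst p) * f (snd p))"
        using ab by simp
      finally show "hN N (fst p) (snd p) * f (fst p) * f (snd p) = (\<Sum>i<N. \<Sum>j\<in>{..<N}-{i}. h (node N i) (node N j) * T i j p)"
        by (simp add: hN_def a_def b_def)
    qed
    show "(\<lambda>p. hN N (fst p) (snd p) * f (fst p) * f (snd p)) \<in> borel_measurable ?P"
      by (rule borel_measurable_integrable) (intro integrable_mult_profile2 hN_integrable N f)
  qed measurable
  also have "\<dots> = (\<Sum>i<N. \<Sum>j\<in>{..<N}-{i}. h (node N i) (node N j) * (\<integral>p. T i j p \<partial>?P))"
    by (subst Bochner_Integration.integral_sum, intro Bochner_Integration.integrable_sum integrable_mult_right T_int)
       (intro sum.cong refl, subst Bochner_Integration.integral_sum, auto intro!: integrable_mult_right T_int)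
  also have "\<dots> = (\<Sum>i<N. \<Sum>j\<in>{..<N}-{i}. h (node N i) (node N j) / (real N)\<^sup>2 * avg N f i * avg N f j)"
    unfolding T_val by (intro sum.cong) auto
  finally show ?thesis using 1 unfolding EN_def D_def by simp
qed

definition mN :: "nat \<Rightarrow> real" where
  "mN N = Min ((\<lambda>S. D N (indicator S)) ` Pow {..<N})"

text \<open>With a single cell the pair sum is empty, so the discretized energy is one bounded term,
  and \<open>err 1\<close> compares it with \<open>E\<close>.\<close>

lemma E_bounded_below: "bdd_below (E ` profiles)"
proof (rule bdd_belowI2)
  fix f assume f: "f \<in> profiles"
  have "EN 1 f = D 1 (avg 1 f)" by (rule EN_eq_D) (use f in auto)
  also have "\<dots> = v (node 1 0) * avg 1 f 0" by (simp add: D_def lessThan_Suc)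
  also have "- \<bar>v (node 1 0)\<bar> \<le> \<dots>"
  proof -
    have "\<bar>v (node 1 0)\<bar> * avg 1 f 0 \<le> \<bar>v (node 1 0)\<bar>"
      using avg_01[of 1 0 f] f by (intro mult_left_le) auto
    moreover have "\<bar>v (node 1 0) * avg 1 f 0\<bar> = \<bar>v (node 1 0)\<bar> * avg 1 f 0"
      using avg_01[of 1 0 f] f by (simp add: abs_mult)
    ultimately show ?thesis by linarith
  qed
  finally show "- \<bar>v (node 1 0)\<bar> - err 1 \<le> E f" using E_EN_close[OF f, of 1] by simp
qed

text \<open>One inequality rounds the cell averages of a profile to a vertex of the cube; the other
  turns a vertex into a step profile, whose cell averages are that vertex.\<close>

lemma mN_close:
  assumes N: "0 < N"
  shows "\<bar>mN N - Inf (E ` profiles)\<bar> \<le> err N"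
proof -
  have ne: "E ` profiles \<noteq> {}" by (auto simp: profiles_def intro!: exI[of _ "\<lambda>_. 0"])
  have "mN N - err N \<le> E f" if f: "f \<in> profiles" for f
  proof -
    obtain S where S: "S \<subseteq> {..<N}" "D N (indicator S) \<le> D N (avg N f)"
      unfolding D_def by (rule multilinear_vertex_min[of N "avg N f" "\<lambda>j. v (node N j) / real N" "\<lambda>i j. h (node N i) (node N j) / (real N)\<^sup>2"])
        (rule avg_01[OF N _ f], assumption, blast)
    have "mN N \<le> D N (indicator S)" unfolding mN_def using S by (intro Min_le) auto
    also have "\<dots> \<le> EN N f" using S EN_eq_D[OF N f] by simp
    finally show ?thesis using E_EN_close[OF f N] by linarith
  qed
  then have 1: "mN N - err N \<le> Inf (E ` profiles)" by (intro cInf_greatest ne) auto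
  have "mN N \<in> (\<lambda>S. D N (indicator S)) ` Pow {..<N}" unfolding mN_def by (intro Min_in) auto
  then obtain S where S: "S \<subseteq> {..<N}" "mN N = D N (indicator S)" by auto
  define f :: "real \<Rightarrow> real" where "f = (\<lambda>s. indicator S (cell N s))"
  have [measurable]: "(indicator S :: nat \<Rightarrow> real) \<in> borel_measurable (count_space UNIV)" by simp
  have f: "f \<in> profiles"
    using measurable_compose[OF cell_meas, of "indicator S :: nat \<Rightarrow> real" borel]
    by (auto simp: profiles_def f_def)
  have "avg N f j = indicator S j" if j: "j < N" for j
  proof -
    have "(\<integral>s. indicator {s. cell N s = j} s * f s \<partial>U01) = (\<integral>s. indicator S j * indicator {s. cell N s = j} s \<partial>U01)"
      by (intro Bochner_Integration.integral_cong refl) (auto simp: f_def indicator_def)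
    also have "\<dots> = indicator S j * (1 / real N)" using cell_measure[OF N j] by simp
    finally show ?thesis using N by (simp add: avg_def)
  qed
  then have "D N (avg N f) = D N (indicator S)" unfolding D_def by (intro arg_cong2[where f = "(+)"] sum.cong) auto
  then have "mN N = EN N f" using S EN_eq_D[OF N f] by simp
  moreover have "Inf (E ` profiles) \<le> E f" using f by (intro cInf_lower E_bounded_below) auto
  ultimately show ?thesis using 1 E_EN_close[OF f N] by linarith
qed

lemma mN_tendsto: "mN \<longlonglongrightarrow> Inf (E ` profiles)"
proof -
  have "(\<lambda>N. mN N - Inf (E ` profiles)) \<longlonglongrightarrow> 0"
    by (rule Lim_null_comparison[OF _ err_tendsto])
       (auto intro!: eventually_sequentiallyI[of 1] simp: mN_close)
  then show ?thesis by (simp add: LIM_zero_iff)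
qed

text \<open>By Fubini the double integral takes the iterated form in which \<open>energy\<close> is
  defined.\<close>

lemma E_nested:
  assumes f: "f \<in> profiles"
  shows "E f = (\<integral>s. (v s + (\<integral>t. h s t * f t \<partial>U01)) * f s \<partial>U01)"
proof -
  have i: "integrable (U01 \<Otimes>\<^sub>M U01) (\<lambda>p. h (fst p) (snd p) * f (fst p) * f (snd p))"
    by (rule integrable_mult_profile2[OF h_integrable f])
  have e: "(\<integral>t. h (fst (s, t)) (snd (s, t)) * f (fst (s, t)) * f (snd (s, t)) \<partial>U01) = (\<integral>t. h s t * f t \<partial>U01) * f s" for s
  proof -
    have "(\<lambda>t. h (fst (s, t)) (snd (s, t)) * f (fst (s, t)) * f (snd (s, t))) = (\<lambda>t. h s t * f t * f s)" by (simp add: mult_ac)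
    then show ?thesis by (simp only: integral_mult_left_zero)
  qed
  have i2: "integrable U01 (\<lambda>s. (\<integral>t. h s t * f t \<partial>U01) * f s)"
    using U01_pair.integrable_fst'[OF i] unfolding e .
  have "E f = (\<integral>s. v s * f s \<partial>U01) + (\<integral>s. (\<integral>t. h s t * f t \<partial>U01) * f s \<partial>U01)"
    unfolding E_def U01_pair.integral_fst'[OF i, symmetric] e ..
  also have "\<dots> = (\<integral>s. v s * f s + (\<integral>t. h s t * f t \<partial>U01) * f s \<partial>U01)"
    by (rule Bochner_Integration.integral_add[OF integrable_mult_profile[OF v_integrable f] i2, symmetric])
  finally show ?thesis by (simp add: distrib_right)
qed

end

section \<open>The Weyl counting function\<close>

lemma integrable_inverse_1_plus_square: "integrable lborel (\<lambda>x::real. 1 / (1 + x\<^sup>2))"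
proof -
  have half: "integrable lborel (\<lambda>x::real. indicator {0..} x * (1 / (1 + x\<^sup>2)))"
  proof (rule integrableI_nonneg)
    have "(\<integral>\<^sup>+x. ennreal (1 / (1 + x\<^sup>2)) * indicator {0..} x \<partial>lborel) = ennreal (pi / 2 - arctan 0)"
      by (rule nn_integral_FTC_atLeast)
         (auto intro!: derivative_eq_intros tendsto_arctan_at_top simp: field_simps)
    also have "(\<integral>\<^sup>+x. ennreal (1 / (1 + x\<^sup>2)) * indicator {0..} x \<partial>lborel)
       = (\<integral>\<^sup>+x. ennreal (indicator {0..} x * (1 / (1 + x\<^sup>2))) \<partial>lborel)"
      by (intro nn_integral_cong) (auto split: split_indicator)
    finally show "(\<integral>\<^sup>+x. ennreal (indicator {0..} x * (1 / (1 + x\<^sup>2))) \<partial>lborel) < \<infinity>"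
      by simp
  qed auto
  have "integrable lborel (\<lambda>x::real. indicator {0..} (0 + (-1) * x) * (1 / (1 + (0 + (-1) * x)\<^sup>2)))"
    by (rule lborel_integrable_real_affine[OF half]) simp
  from Bochner_Integration.integrable_add[OF half this] show ?thesis
    by (rule Bochner_Integration.integrable_bound) (auto simp: add_nonneg_pos split: split_indicator)
qed

text \<open>The estimate is linear in \<open>d\<close> with a factor depending on \<open>w\<close>
  alone, even when \<open>w - d\<close> lies across the branch point. It is what dominates
  difference quotients of \<open>Gf\<close>.\<close>

lemma sqrt_increment_bound:
  assumes w: "w \<noteq> (0::real)"
  shows "\<bar>sqrt (max 0 (w - d)) - sqrt (max 0 w)\<bar> \<le> \<bar>d\<bar> / sqrt \<bar>w\<bar>"
proof (cases "0 < w")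
  case True
  define p q where "p = sqrt (max 0 (w - d))" and "q = sqrt w"
  have q: "0 < q" and p: "0 \<le> p" using True by (auto simp: p_def q_def)
  have "\<bar>p - q\<bar> * q \<le> \<bar>p - q\<bar> * (p + q)" using p by (intro mult_left_mono) auto
  also have "\<dots> = \<bar>(p - q) * (p + q)\<bar>" using p q by (simp add: abs_mult)
  also have "(p - q) * (p + q) = max 0 (w - d) - w"
    using True by (simp add: p_def q_def algebra_simps)
  also have "\<bar>max 0 (w - d) - w\<bar> \<le> \<bar>d\<bar>" using True by linarith
  finally show ?thesis using True q by (simp add: p_def q_def pos_le_divide_eq)
next
  case False
  then have w: "w < 0" using w by simp
  show ?thesis
  proof (cases "w - d \<le> 0")
    case True
    then show ?thesis using w by simp
  next
    case False
    then have d: "- w \<le> - d" "0 < - w" "w - d \<le> - d" using w by auto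
    have "sqrt (w - d) * sqrt (- w) \<le> sqrt (- d) * sqrt (- d)"
      using d False by (intro mult_mono real_sqrt_le_mono) auto
    also have "\<dots> = - d" using d by simp
    finally have m: "sqrt (w - d) * sqrt (- w) \<le> - d" .
    have t: "0 < sqrt (- w)" using d by simp
    have "sqrt (w - d) \<le> - d / sqrt (- w)" unfolding pos_le_divide_eq[OF t] by (rule m)
    moreover have "\<bar>sqrt (max 0 (w - d)) - sqrt (max 0 w)\<bar> = sqrt (w - d)" "\<bar>w\<bar> = - w" "\<bar>d\<bar> = - d"
      using w d False by auto
    ultimately show ?thesis by (simp only:)
  qed
qed

text \<open>The level \<open>e\<close> is crossed once, at \<open>c\<close>, with nonzero slope.
  Beyond \<open>a\<close> the mean value theorem bounds \<open>\<bar>f x - e\<bar>\<close> from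
  below by a multiple of \<open>\<bar>x - c\<bar>\<close>; before \<open>a\<close> it is at least
  \<open>m\<close>. Requiring \<open>f x \<ge> e / 2\<close> confines everything to a bounded
  interval, on which the slope has a maximum.\<close>

lemma inverse_sqrt_profile_bound:
  fixes f f' :: "real \<Rightarrow> real"
  assumes f: "\<And>x. (f has_real_derivative f' x) (at x)" and f': "continuous_on UNIV f'"
    and neg: "\<And>x. 0 < x \<Longrightarrow> f' x < 0" and lim: "(f \<longlongrightarrow> 0) at_top"
    and e: "0 < e" "e < f 0"
  obtains K c b where "0 \<le> K" "\<And>x. 0 \<le> x \<Longrightarrow> e / 2 \<le> f x \<Longrightarrow> x \<le> b"
    "\<And>x. 0 \<le> x \<Longrightarrow> e / 2 \<le> f x \<Longrightarrow> f x \<noteq> e \<Longrightarrow> 1 / sqrt \<bar>f x - e\<bar> \<le> K * (1 + 1 / sqrt \<bar>x - c\<bar>)"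
proof -
  have cont: "continuous_on A f" for A
    using f by (auto intro!: continuous_at_imp_continuous_on DERIV_isCont)
  have mono: "f y < f x" if "0 \<le> x" "x < y" for x y
  proof (rule DERIV_neg_imp_decreasing_open[OF that(2)])
    show "\<exists>d. (f has_real_derivative d) (at z) \<and> d < 0" if "x < z" for z
      using f[of z] neg[of z] \<open>0 \<le> x\<close> that by (intro exI[of _ "f' z"]) auto
  qed (rule cont)
  have ex: "\<exists>x>0. f x = l" if l: "0 < l" "l < f 0" for l
  proof -
    have "\<forall>\<^sub>F x in at_top. f x < l \<and> 0 < x"
      using order_tendstoD(2)[OF lim l(1)] eventually_gt_at_top[of 0] by eventually_elim auto
    then obtain y where y: "f y < l" "0 < y" using eventually_happens'[OF trivial_limit_at_top_linorder] by blast
    then obtain x where "0 \<le> x" "f x = l" using IVT2'[of f y l 0] l cont by auto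
    then show ?thesis using l by (intro exI[of _ x]) (auto simp: order_less_le)
  qed
  obtain c where c: "0 < c" "f c = e" using ex[of e] e by auto
  obtain b where b: "0 < b" "f b = e / 2" using ex[of "e / 2"] e by auto
  have xb: "x \<le> b" if "0 \<le> x" "e / 2 \<le> f x" for x
    using mono[of b x] b that by force
  have cb: "c < b" using xb[of c] c b e by (cases "c = b") auto
  \<comment> \<open>A point strictly between 0 and \<open>c\<close>: the sign of \<open>f'\<close>
    is prescribed for positive arguments only, and in the application it vanishes at 0, the position
    of the maximum.\<close>
  define a where "a = c / 2"
  have a: "0 < a" "a < c" using c by (auto simp: a_def)
  define m where "m = f a - e"
  have m: "0 < m" using mono[of a c] a c by (simp add: m_def)
  obtain z where z: "z \<in> {a..b}" "\<And>y. y \<in> {a..b} \<Longrightarrow> f' y \<le> f' z"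
    using continuous_attains_sup[of "{a..b}" f'] a cb continuous_on_subset[OF f'] by auto
  define k where "k = - f' z"
  have k: "0 < k" using neg[of z] z a by (simp add: k_def)
  have lip: "k * \<bar>x - y\<bar> \<le> \<bar>f x - f y\<bar>" if xy: "x \<in> {a..b}" "y \<in> {a..b}" for x y
  proof -
    have *: "k * (y - x) \<le> f x - f y" if xy: "x < y" "x \<in> {a..b}" "y \<in> {a..b}" for x y
    proof -
      obtain t where t: "x < t" "t < y" "f y - f x = (y - x) * f' t"
        using MVT2[OF xy(1), of f f'] f by auto
      have "(y - x) * f' t \<le> (y - x) * (- k)"
        using z(2)[of t] t xy by (intro mult_left_mono) (auto simp: k_def)
      then show ?thesis using t by (simp add: algebra_simps)
    qed
    show ?thesis using *[of x y] *[of y x] xy by (cases x y rule: linorder_cases) auto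
  qed
  show thesis
  proof (rule that[of "1 / sqrt m + 1 / sqrt k" b c])
    show "0 \<le> 1 / sqrt m + 1 / sqrt k" using m k by simp
    show "x \<le> b" if "0 \<le> x" "e / 2 \<le> f x" for x using xb that by blast
    fix x assume x: "0 \<le> x" "e / 2 \<le> f x" "f x \<noteq> e"
    show "1 / sqrt \<bar>f x - e\<bar> \<le> (1 / sqrt m + 1 / sqrt k) * (1 + 1 / sqrt \<bar>x - c\<bar>)"
    proof (cases "x \<le> a")
      case True
      then have "f a \<le> f x" using mono[of x a] x by (cases "x = a") auto
      then have "m \<le> \<bar>f x - e\<bar>" by (simp add: m_def)
      then have "1 / sqrt \<bar>f x - e\<bar> \<le> 1 / sqrt m" using m by (intro divide_left_mono real_sqrt_le_mono) auto
      also have "\<dots> \<le> (1 / sqrt m + 1 / sqrt k) * (1 + 1 / sqrt \<bar>x - c\<bar>)"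
        using m k by (simp add: algebra_simps)
      finally show ?thesis .
    next
      case False
      have "x \<noteq> c" using x c by auto
      have "k * \<bar>x - c\<bar> \<le> \<bar>f x - e\<bar>" using lip[of x c] False xb[OF x(1,2)] a cb c by auto
      then have "1 / sqrt \<bar>f x - e\<bar> \<le> 1 / sqrt (k * \<bar>x - c\<bar>)"
        using k \<open>x \<noteq> c\<close> x by (intro divide_left_mono real_sqrt_le_mono) auto
      also have "\<dots> = 1 / sqrt k * (1 / sqrt \<bar>x - c\<bar>)" by (simp add: real_sqrt_mult)
      also have "\<dots> \<le> (1 / sqrt m + 1 / sqrt k) * (1 + 1 / sqrt \<bar>x - c\<bar>)"
        using m k by (intro mult_mono) auto
      finally show ?thesis .
    qed
  qed
qed

section \<open>The initial profile and its level sets\<close>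

locale ilw_data =
  fixes \<delta> :: real and u0 :: "real \<Rightarrow> real"
  assumes \<delta>: "0 < \<delta>" and adm: "admissible u0" and sqrt_int: "integrable lborel (\<lambda>x. sqrt (u0 x))"
begin

definition U :: "real \<Rightarrow> real" where "U x = 2 * \<delta> * u0 x"

abbreviation xm :: real where "xm \<equiv> x_max u0"

definition U' :: "real \<Rightarrow> real" where "U' = deriv U"

abbreviation Um :: real where "Um \<equiv> U xm"

abbreviation km :: real where "km \<equiv> kappa_max \<delta> u0"

lemma u0_facts:
  shows u0_DERIV: "(u0 has_real_derivative deriv u0 x) (at x)"
    and u0_deriv_cont: "continuous_on UNIV (deriv u0)"
    and u0_pos: "0 < u0 x"
    and u0_top: "(u0 \<longlongrightarrow> 0) at_top" and u0_bot: "(u0 \<longlongrightarrow> 0) at_bot"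
    and u0_moment: "integrable lborel (\<lambda>x. (x\<^sup>2 + 1) * u0 x)"
    and u_max_eq: "u_max u0 = u0 xm" and u0_le: "u0 x \<le> u0 xm"
    and u0_deriv_zero: "deriv u0 x = 0 \<longleftrightarrow> x = xm"
proof -
  obtain u0' where u0': "\<And>x. (u0 has_real_derivative u0' x) (at x)" "continuous_on UNIV u0'"
    using adm unfolding admissible_def by blast
  have d: "deriv u0 = u0'" using u0' DERIV_imp_deriv by blast
  show "(u0 has_real_derivative deriv u0 x) (at x)" "continuous_on UNIV (deriv u0)" using u0' d by auto
  show "0 < u0 x" "(u0 \<longlongrightarrow> 0) at_top" "(u0 \<longlongrightarrow> 0) at_bot" "integrable lborel (\<lambda>x. (x\<^sup>2 + 1) * u0 x)"
    using adm unfolding admissible_def by auto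
  obtain y where y: "\<And>x. u0 x \<le> u0 y" "\<And>x. deriv u0 x = 0 \<longleftrightarrow> x = y"
    using adm unfolding admissible_def by blast
  have um: "u_max u0 = u0 y" unfolding u_max_def by (rule cSup_eq_maximum) (use y in auto)
  have "xm = y" unfolding x_max_def um
  proof (rule the_equality)
    fix x assume "u0 x = u0 y"
    then have "deriv u0 x = 0"
      using DERIV_local_max[OF u0'(1)[of x], of 1] y(1) d by auto
    then show "x = y" using y by simp
  qed simp
  then show "u_max u0 = u0 xm" "u0 x \<le> u0 xm" "deriv u0 x = 0 \<longleftrightarrow> x = xm" using um y by auto
qed

lemma U_DERIV: "(U has_real_derivative U' x) (at x)"
proof -
  have "(U has_real_derivative 2 * \<delta> * deriv u0 x) (at x)"
    unfolding U_def by (intro DERIV_cmult u0_DERIV)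
  then show ?thesis unfolding U'_def using DERIV_imp_deriv by fastforce
qed

lemma U'_eq: "U' x = 2 * \<delta> * deriv u0 x"
  unfolding U'_def U_def by (rule DERIV_imp_deriv, intro DERIV_cmult u0_DERIV)

lemma U'_cont: "continuous_on UNIV U'"
  unfolding U'_eq[abs_def] by (intro continuous_intros u0_deriv_cont)

lemma U_cont: "continuous_on A U"
  using U_DERIV by (auto intro!: continuous_at_imp_continuous_on DERIV_isCont)

lemma U_meas [measurable]: "U \<in> borel_measurable borel"
  by (rule borel_measurable_continuous_onI[OF U_cont])

lemma U_pos: "0 < U x" using u0_pos[of x] \<delta> by (simp add: U_def)

lemma U_le: "U x \<le> Um" using u0_le[of x] \<delta> by (simp add: U_def)

lemma U_top: "(U \<longlongrightarrow> 0) at_top" and U_bot: "(U \<longlongrightarrow> 0) at_bot"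
  unfolding U_def using tendsto_mult_right_zero[OF u0_top] tendsto_mult_right_zero[OF u0_bot] by blast+

text \<open>The derivative has no zero to the right of \<open>xm\<close>, so by the intermediate
  value theorem it keeps one sign there, and maximality at \<open>xm\<close> decides which.\<close>

lemma U'_neg: assumes "xm < x" shows "U' x < 0"
proof -
  have nz: "U' y \<noteq> 0" if "xm < y" for y using u0_deriv_zero[of y] \<delta> that by (simp add: U'_eq)
  obtain z where z: "xm < z" "z < x" "U x - U xm = (x - xm) * U' z"
    using MVT2[OF assms, of U U'] U_DERIV by auto
  then have "(x - xm) * U' z \<le> 0" using U_le[of x] by simp
  then have "U' z < 0" using assms nz[OF z(1)] by (simp add: mult_le_0_iff)
  show ?thesis
  proof (rule ccontr)
    assume "\<not> U' x < 0"
    then obtain y where "z \<le> y" "y \<le> x" "U' y = 0"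
      using IVT'[of U' z 0 x] z \<open>U' z < 0\<close> continuous_on_subset[OF U'_cont] by force
    then show False using nz[of y] z by auto
  qed
qed

lemma U'_pos: assumes "x < xm" shows "0 < U' x"
proof -
  have nz: "U' y \<noteq> 0" if "y < xm" for y using u0_deriv_zero[of y] \<delta> that by (simp add: U'_eq)
  obtain z where z: "x < z" "z < xm" "U xm - U x = (xm - x) * U' z"
    using MVT2[OF assms, of U U'] U_DERIV by auto
  then have "0 \<le> (xm - x) * U' z" using U_le[of x] by simp
  then have "0 < U' z" using assms nz[OF z(2)] by (simp add: zero_le_mult_iff order_less_le)
  show ?thesis
  proof (rule ccontr)
    assume "\<not> 0 < U' x"
    then obtain y where "x \<le> y" "y \<le> z" "U' y = 0"
      using IVT'[of U' x 0 z] z \<open>0 < U' z\<close> continuous_on_subset[OF U'_cont] by force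
    then show False using nz[of y] z by auto
  qed
qed

lemma U_antimono: "xm \<le> x \<Longrightarrow> x < y \<Longrightarrow> U y < U x"
proof -
  assume xy: "xm \<le> x" "x < y"
  show ?thesis
  proof (rule DERIV_neg_imp_decreasing_open[OF xy(2)])
    show "\<exists>d. (U has_real_derivative d) (at z) \<and> d < 0" if "x < z" for z
      using U_DERIV[of z] U'_neg[of z] xy that by (intro exI[of _ "U' z"]) auto
  qed (rule U_cont)
qed

lemma U_mono: "y \<le> xm \<Longrightarrow> x < y \<Longrightarrow> U x < U y"
proof -
  assume xy: "y \<le> xm" "x < y"
  show ?thesis
  proof (rule DERIV_pos_imp_increasing_open[OF xy(2)])
    show "\<exists>d. (U has_real_derivative d) (at z) \<and> 0 < d" if "z < y" for z
      using U_DERIV[of z] U'_pos[of z] xy that by (intro exI[of _ "U' z"]) auto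
  qed (rule U_cont)
qed

lemma U_right_ex:
  assumes "0 < e" "e \<le> Um" obtains x where "xm \<le> x" "U x = e"
proof -
  have "\<forall>\<^sub>F x in at_top. U x < e \<and> xm < x"
    using order_tendstoD(2)[OF U_top assms(1)] eventually_gt_at_top[of xm] by eventually_elim auto
  then obtain y where y: "U y < e" "xm < y" using eventually_happens'[OF trivial_limit_at_top_linorder] by blast
  then show thesis using IVT2'[of U y e xm] assms U_cont that by auto
qed

lemma U_left_ex:
  assumes "0 < e" "e \<le> Um" obtains x where "x \<le> xm" "U x = e"
proof -
  have "\<forall>\<^sub>F x in at_bot. U x < e \<and> x < xm"
    using order_tendstoD(2)[OF U_bot assms(1)] eventually_gt_at_bot[of xm] by eventually_elim auto
  then obtain y where y: "U y < e" "y < xm" using eventually_happens'[OF trivial_limit_at_bot_linorder] by blast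
  then show thesis using IVT'[of U y e xm] assms U_cont that by auto
qed

section \<open>Spectral parameters as levels of the rescaled profile\<close>

definition ek :: "real \<Rightarrow> real" where "ek \<kappa> = ecurve (2 * \<delta> * \<kappa>)"

lemma km_eq: "km = einv Um / (2 * \<delta>)"
proof -
  have "lambertWm1 (- exp (Um - 1)) = cnj (Complex (- einv Um * cot (einv Um)) (einv Um))"
    using lambert_complex[OF U_pos[of xm]] U_pos[of xm] by (simp add: lambertWm1_def)
  then show ?thesis unfolding kappa_max_def u_max_eq by (simp add: U_def)
qed

lemma km_theta: "2 * \<delta> * km = einv Um"
  using \<delta> by (simp add: km_eq)

lemma km_pos: "0 < km"
proof -
  have "einv Um \<noteq> 0" using einv(3)[of Um] U_pos[of xm] by auto
  then show ?thesis using einv(1)[of Um] U_pos[of xm] \<delta> by (simp add: km_eq)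
qed

lemma kappa_range: "0 \<le> \<kappa> \<Longrightarrow> \<kappa> \<le> km \<Longrightarrow> 0 \<le> 2 * \<delta> * \<kappa> \<and> 2 * \<delta> * \<kappa> \<le> einv Um \<and> 2 * \<delta> * \<kappa> < pi"
proof -
  assume k: "0 \<le> \<kappa>" "\<kappa> \<le> km"
  have "2 * \<delta> * \<kappa> \<le> 2 * \<delta> * km" using k \<delta> by (intro mult_left_mono) auto
  moreover have "einv Um < pi" using einv(2)[of Um] U_pos[of xm] by simp
  ultimately show ?thesis using k \<delta> km_theta by simp
qed

lemma ek_0 [simp]: "ek 0 = 0" by (simp add: ek_def)

lemma ek_km: "ek km = Um" unfolding ek_def km_theta using einv(3) U_pos[of xm] by simp

lemma ek_strict_mono: "0 \<le> a \<Longrightarrow> a < b \<Longrightarrow> b \<le> km \<Longrightarrow> ek a < ek b"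
  unfolding ek_def using kappa_range[of b] \<delta> by (intro ecurve_strict_mono) auto

lemma ek_bounds: "0 \<le> \<kappa> \<Longrightarrow> \<kappa> \<le> km \<Longrightarrow> 0 \<le> ek \<kappa> \<and> ek \<kappa> \<le> Um"
  using ek_strict_mono[of 0 \<kappa>] ek_strict_mono[of \<kappa> km] ek_km U_pos[of xm] by (cases "\<kappa> = 0"; cases "\<kappa> = km") auto

lemma einv_ek: "0 \<le> \<kappa> \<Longrightarrow> \<kappa> \<le> km \<Longrightarrow> einv (ek \<kappa>) = 2 * \<delta> * \<kappa>"
  unfolding ek_def using kappa_range[of \<kappa>] by (intro einv_ecurve) auto

lemma ek_cont: "continuous_on {0..km} ek"
  unfolding ek_def
proof (rule continuous_on_compose2[OF ecurve_continuous])
  show "(\<lambda>\<kappa>. 2 * \<delta> * \<kappa>) ` {0..km} \<subseteq> {0..<pi}" using kappa_range by force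
qed (intro continuous_intros)

lemma ek_lipschitz: obtains C where "0 < C" "\<And>a b. 0 \<le> a \<Longrightarrow> a \<le> b \<Longrightarrow> b \<le> km \<Longrightarrow> ek b - ek a \<le> C * (b - a)"
proof -
  define m where "m = einv Um"
  have "0 < 2 * \<delta> * km" using km_pos \<delta> by simp
  then have m: "0 < m" "m < pi" using einv(2)[of Um] U_pos[of xm] by (auto simp: m_def km_theta)
  define K where "K = 4 * m ^ 3 / (sin m / m)\<^sup>2 + m"
  have K: "0 < K" using m by (simp add: K_def add_nonneg_pos)
  have "ek b - ek a \<le> K * (2 * \<delta>) * (b - a)" if "0 \<le> a" "a \<le> b" "b \<le> km" for a b
    using ecurve_growth(2)[of m "2 * \<delta> * a" "2 * \<delta> * b"] m kappa_range[of b] that \<delta>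
    by (simp add: ek_def K_def m_def[symmetric] algebra_simps)
  then show thesis using that[of "K * (2 * \<delta>)"] K \<delta> by simp
qed

lemma Efun_iff:
  assumes "0 \<le> \<kappa>" "\<kappa> \<le> km"
  shows "complex_of_real (u0 x) = Efun \<delta> (zeta \<delta> \<kappa>) \<longleftrightarrow> U x = ek \<kappa>"
  using scaled_zeta_exp(2)[of \<delta> \<kappa>] kappa_range[OF assms] assms \<delta>
  by (simp only: of_real_eq_iff) (simp add: U_def ek_def field_simps)

lemma x_plus:
  assumes "0 < \<kappa>" "\<kappa> \<le> km"
  shows "xm \<le> x_plus \<delta> u0 \<kappa>" "U (x_plus \<delta> u0 \<kappa>) = ek \<kappa>"
proof -
  have "0 < ek \<kappa>" using ek_strict_mono[of 0 \<kappa>] assms by simp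
  then obtain x where x: "xm \<le> x" "U x = ek \<kappa>" using U_right_ex[of "ek \<kappa>"] ek_bounds[of \<kappa>] assms by auto
  have "x_plus \<delta> u0 \<kappa> = x"
    unfolding x_plus_def
  proof (rule the_equality)
    fix y assume "xm \<le> y \<and> complex_of_real (u0 y) = Efun \<delta> (zeta \<delta> \<kappa>)"
    then show "y = x" using Efun_iff[of \<kappa> y] assms x U_antimono[of x y] U_antimono[of y x] by (cases x y rule: linorder_cases) auto
  qed (use x Efun_iff[of \<kappa> x] assms in auto)
  then show "xm \<le> x_plus \<delta> u0 \<kappa>" "U (x_plus \<delta> u0 \<kappa>) = ek \<kappa>" using x by auto
qed

lemma x_minus:
  assumes "0 < \<kappa>" "\<kappa> \<le> km"
  shows "x_minus \<delta> u0 \<kappa> \<le> xm" "U (x_minus \<delta> u0 \<kappa>) = ek \<kappa>"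
proof -
  have "0 < ek \<kappa>" using ek_strict_mono[of 0 \<kappa>] assms by simp
  then obtain x where x: "x \<le> xm" "U x = ek \<kappa>" using U_left_ex[of "ek \<kappa>"] ek_bounds[of \<kappa>] assms by auto
  have "x_minus \<delta> u0 \<kappa> = x"
    unfolding x_minus_def
  proof (rule the_equality)
    fix y assume "y \<le> xm \<and> complex_of_real (u0 y) = Efun \<delta> (zeta \<delta> \<kappa>)"
    then show "y = x" using Efun_iff[of \<kappa> y] assms x U_mono[of x y] U_mono[of y x] by (cases x y rule: linorder_cases) auto
  qed (use x Efun_iff[of \<kappa> x] assms in auto)
  then show "x_minus \<delta> u0 \<kappa> \<le> xm" "U (x_minus \<delta> u0 \<kappa>) = ek \<kappa>" using x by auto
qed

text \<open>Strict monotonicity on either side of \<open>xm\<close> identifies the turning points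
  with the boundary of a superlevel set. The separately defined case \<kappa> = 0 fits in, because
  \<open>ek 0 = 0\<close> lies below the positive profile.\<close>

lemma band_eq:
  assumes "0 \<le> \<kappa>" "\<kappa> \<le> km"
  shows "band \<delta> u0 \<kappa> = {x. ek \<kappa> < U x}"
proof (cases "\<kappa> = 0")
  case True
  then show ?thesis using U_pos by (simp add: band_def)
next
  case False
  then have k: "0 < \<kappa>" using assms by simp
  define p q where "p = x_plus \<delta> u0 \<kappa>" and "q = x_minus \<delta> u0 \<kappa>"
  have p: "xm \<le> p" "U p = ek \<kappa>" and q: "q \<le> xm" "U q = ek \<kappa>"
    using x_plus[OF k assms(2)] x_minus[OF k assms(2)] by (auto simp: p_def q_def)
  have "q < x \<and> x < p \<longleftrightarrow> ek \<kappa> < U x" for x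
  proof (cases "xm \<le> x")
    case True
    then show ?thesis using p q U_antimono[of x p] U_antimono[of p x]
      by (cases x p rule: linorder_cases; cases "x = q") auto
  next
    case False
    then show ?thesis using p q U_mono[of x q] U_mono[of q x]
      by (cases x q rule: linorder_cases) auto
  qed
  then have "{q<..<p} = {x. ek \<kappa> < U x}"
    unfolding set_eq_iff greaterThanLessThan_iff mem_Collect_eq by blast
  then show ?thesis using False by (simp only: band_def if_False p_def q_def)
qed

text \<open>Up to the factor \<open>1 / (4 * \<delta>)\<close>, the Weyl function in terms of the
  level: since \<open>Gf\<close> vanishes for nonpositive arguments, the moving band disappears from
  the integral.\<close>

definition Phi :: "real \<Rightarrow> real" where "Phi e = (\<integral>x. Gf (U x - e) \<partial>lborel)"

lemma Gf_meas [measurable]: "Gf \<in> borel_measurable borel"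
  by (rule borel_measurable_mono) (simp add: mono_def Gf_mono)

lemma R_Wyl_eq:
  assumes "0 \<le> \<kappa>" "\<kappa> \<le> km"
  shows "R_Wyl \<delta> u0 \<kappa> = Phi (ek \<kappa>) / (4 * \<delta>)"
proof -
  have "indicator (band \<delta> u0 \<kappa>) x *\<^sub>R Re (lambertW0 (Re (afun \<delta> \<kappa> (u0 x))) - lambertWm1 (Re (afun \<delta> \<kappa> (u0 x))))
     = Gf (U x - ek \<kappa>)" for x
  proof (cases "ek \<kappa> < U x")
    case True
    have "Re (afun \<delta> \<kappa> (u0 x)) = - exp (- (U x - ek \<kappa>) - 1)"
      using afun_eq[of \<delta> \<kappa> "u0 x"] kappa_range[OF assms] assms \<delta> by (simp add: U_def ek_def)
    then show ?thesis
      using True lambert_real[of "U x - ek \<kappa>"] band_eq[OF assms] by (simp add: Gf_def)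
  next
    case False
    then show ?thesis using band_eq[OF assms] by simp
  qed
  then show ?thesis unfolding R_Wyl_def Phi_def set_lebesgue_integral_def by simp
qed

section \<open>Regularity of the counting function\<close>

definition KG :: real where "KG = 2 + 2 * sqrt (v1 Um)"

lemma KG_pos: "0 < KG"
  using v1(1)[of Um] U_pos[of xm] by (simp add: KG_def add_pos_nonneg)

lemma Gf_diff_bound:
  assumes "0 \<le> e" "e \<le> e'"
  shows "Gf (U x - e) - Gf (U x - e') \<le> KG * (sqrt (max 0 (U x - e)) - sqrt (max 0 (U x - e')))"
  unfolding KG_def using U_le[of x] U_pos[of xm] assms by (intro Gf_sqrt_bound) auto

text \<open>Comparison with the square root of the profile is how integrability of
  \<open>sqrt u0\<close> makes the counting function finite, at level 0 included.\<close>

lemma Gf_U_bound: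
  assumes "0 \<le> e"
  shows "\<bar>Gf (U x - e)\<bar> \<le> KG * sqrt (U x)"
proof -
  have "Gf (U x - e) - Gf (min 0 (U x - e)) \<le> KG * (sqrt (max 0 (U x - e)) - sqrt (max 0 (min 0 (U x - e))))"
    unfolding KG_def using U_le[of x] U_pos[of xm] assms by (intro Gf_sqrt_bound) auto
  also have "\<dots> \<le> KG * sqrt (U x)"
    using KG_pos U_pos[of x] assms by (intro mult_left_mono) (auto simp: max_def min_def)
  finally show ?thesis using Gf_nonneg[of "U x - e"] by simp
qed

lemma sqrt_U_integrable: "integrable lborel (\<lambda>x. sqrt (U x))"
  unfolding U_def real_sqrt_mult by (intro integrable_mult_right sqrt_int)

lemma Gf_U_integrable: "0 \<le> e \<Longrightarrow> integrable lborel (\<lambda>x. Gf (U x - e))"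
  by (rule Bochner_Integration.integrable_bound[OF integrable_mult_right[OF sqrt_U_integrable, of KG]])
     (use Gf_U_bound KG_pos U_pos in \<open>auto simp: abs_mult less_imp_le\<close>)

text \<open>Just to the right of \<open>xm\<close> the profile exceeds \<open>e\<close>, and on that
  interval, of positive measure, the integrand drops strictly when the level rises.\<close>

lemma Phi_strict_antimono:
  assumes "0 \<le> e" "e < e'" "e' \<le> Um"
  shows "Phi e' < Phi e"
proof -
  define f where "f = (\<lambda>x. Gf (U x - e) - Gf (U x - e'))"
  have f0: "0 \<le> f x" for x using Gf_mono[of "U x - e'" "U x - e"] assms by (simp add: f_def)
  have fi: "integrable lborel f" unfolding f_def using assms by (intro Bochner_Integration.integrable_diff Gf_U_integrable) auto
  have Phi_f: "Phi e - Phi e' = integral\<^sup>L lborel f"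
    unfolding Phi_def f_def using assms by (intro Bochner_Integration.integral_diff[symmetric] Gf_U_integrable) auto
  obtain p where p: "xm < p" "\<And>x. xm < x \<Longrightarrow> x < p \<Longrightarrow> e < U x"
  proof (cases "e = 0")
    case True
    then show ?thesis using that[of "xm + 1"] U_pos by auto
  next
    case False
    then obtain p where p: "xm \<le> p" "U p = e" using U_right_ex[of e] assms by auto
    have "p \<noteq> xm" using p assms by auto
    then show ?thesis using that[of p] p U_antimono by force
  qed
  have fp: "f x \<noteq> 0" if "x \<in> {xm<..<p}" for x
  proof (cases "U x \<le> e'")
    case True
    then show ?thesis using Gf_strict_mono[of 0 "U x - e"] p(2)[of x] that by (simp add: f_def)
  next
    case False
    then show ?thesis using Gf_strict_mono[of "U x - e'" "U x - e"] assms by (simp add: f_def)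
  qed
  have "integral\<^sup>L lborel f \<noteq> 0"
  proof
    assume "integral\<^sup>L lborel f = 0"
    then have "AE x in lborel. f x = 0" using integral_nonneg_eq_0_iff_AE[OF fi] f0 by simp
    then have "AE x in lborel. x \<notin> {xm<..<p}" by eventually_elim (use fp in blast)
    then have "{xm<..<p} \<in> null_sets lborel" by (subst AE_iff_null_sets) auto
    then show False using p(1) by (simp add: null_sets_def)
  qed
  moreover have "0 \<le> integral\<^sup>L lborel f" using f0 by simp
  ultimately show ?thesis using Phi_f by linarith
qed

lemma Phi_Um: "Phi Um = 0"
  unfolding Phi_def using U_le by simp

text \<open>Hoelder continuity of exponent 1/6. The integrand changes by at most
  \<open>KG * d\<close>, where \<open>d\<close> is bounded by \<open>q = sqrt (U x)\<close> and by
  \<open>r ^ 3\<close>, as the level change is at most \<open>r ^ 6\<close>. Interpolation with the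
  moment weight \<open>x\<^sup>2 + 1\<close> gives an integrable bound of total mass O(r).\<close>

lemma Phi_holder:
  obtains C where "0 < C" "\<And>e e' r. 0 \<le> e \<Longrightarrow> e \<le> e' \<Longrightarrow> 0 \<le> r \<Longrightarrow> e' - e \<le> r ^ 6 \<Longrightarrow> Phi e - Phi e' \<le> C * r"
proof -
  define M where "M = (\<integral>x. (x\<^sup>2 + 1) * U x \<partial>lborel)"
  define C1 where "C1 = (\<integral>x. 1 / (1 + x\<^sup>2) \<partial>(lborel::real measure))"
  have Mi: "integrable lborel (\<lambda>x. (x\<^sup>2 + 1) * U x)"
    using integrable_mult_right[OF u0_moment, of "2 * \<delta>"] by (simp add: U_def mult_ac)
  have M0: "0 \<le> M" unfolding M_def using U_pos by (intro Bochner_Integration.integral_nonneg) (auto simp: less_imp_le)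
  have C10: "0 \<le> C1" unfolding C1_def by (intro Bochner_Integration.integral_nonneg) auto
  have main: "Phi e - Phi e' \<le> KG * (M + 2 * C1) * r" if e: "0 \<le> e" "e \<le> e'" "0 < r" "e' - e \<le> r ^ 6" for e e' r
  proof -
    have ci: "integrable lborel (\<lambda>x. 1 / (1 + (0 + r\<^sup>2 * x)\<^sup>2))"
      using e by (intro lborel_integrable_real_affine integrable_inverse_1_plus_square) auto
    have cv: "(\<integral>x. 1 / (1 + (0 + r\<^sup>2 * x)\<^sup>2) \<partial>lborel) = C1 / r\<^sup>2"
      using lborel_integral_real_affine[of "r\<^sup>2" "\<lambda>x. 1 / (1 + x\<^sup>2)" 0] e by (simp add: C1_def field_simps)
    have pw: "Gf (U x - e) - Gf (U x - e') \<le> KG * (r * ((x\<^sup>2 + 1) * U x) + 2 * r ^ 3 * (1 / (1 + (0 + r\<^sup>2 * x)\<^sup>2)))" for x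
    proof -
      define d where "d = sqrt (max 0 (U x - e)) - sqrt (max 0 (U x - e'))"
      define q where "q = sqrt (U x)"
      have q: "0 < q" "q * q = U x" using U_pos[of x] by (auto simp: q_def)
      have d0: "0 \<le> d" using e by (auto simp: d_def)
      have dq: "d \<le> q"
      proof -
        have "sqrt (max 0 (U x - e)) \<le> sqrt (U x)" using e U_pos[of x] by (intro real_sqrt_le_mono) auto
        moreover have "0 \<le> sqrt (max 0 (U x - e'))" by simp
        ultimately show ?thesis unfolding d_def q_def by linarith
      qed
      have dr: "d \<le> r ^ 3"
      proof -
        have "sqrt (max 0 (U x - e)) \<le> sqrt (max 0 (U x - e') + (e' - e))" using e by (intro real_sqrt_le_mono) auto
        also have "\<dots> \<le> sqrt (max 0 (U x - e')) + sqrt (e' - e)" using e by (intro sqrt_add_le_add_sqrt) auto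
        also have "sqrt (e' - e) \<le> sqrt ((r ^ 3)\<^sup>2)" using e by (intro real_sqrt_le_mono) (simp flip: power_mult)
        also have "sqrt ((r ^ 3)\<^sup>2) = r ^ 3" by (rule real_sqrt_unique) (use e in auto)
        finally show ?thesis by (simp add: d_def)
      qed
      have t: "0 \<le> r * ((x\<^sup>2 + 1) * U x)" "0 \<le> 2 * r ^ 3 * (1 / (1 + (0 + r\<^sup>2 * x)\<^sup>2))"
        using e U_pos[of x] by (auto simp: less_imp_le)
      \<comment> \<open>Either \<open>q\<close> is at most \<open>r\<close> times the moment
        density, or \<open>q * x\<^sup>2 \<le> 1 / r\<close>. In the second case \<open>d\<close> is
        at most a bump of height \<open>2 * r ^ 3\<close> and width of order
        \<open>1 / r\<^sup>2\<close>, hence of mass O(r).\<close>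
      have "d \<le> r * ((x\<^sup>2 + 1) * U x) + 2 * r ^ 3 * (1 / (1 + (0 + r\<^sup>2 * x)\<^sup>2))"
      proof (cases "1 \<le> r * (x\<^sup>2 + 1) * q")
        case True
        have "q * 1 \<le> q * (r * (x\<^sup>2 + 1) * q)" using True q by (intro mult_left_mono) auto
        also have "\<dots> = r * ((x\<^sup>2 + 1) * U x)" unfolding q(2)[symmetric] by (simp add: mult_ac)
        finally show ?thesis using dq t by linarith
      next
        case False
        have "r * x\<^sup>2 * q \<le> r * (x\<^sup>2 + 1) * q" using q e by (intro mult_right_mono mult_left_mono) auto
        then have rq: "r * x\<^sup>2 * q \<le> 1" using False by linarith
        have "d * (r\<^sup>2 * x)\<^sup>2 \<le> q * (r\<^sup>2 * x)\<^sup>2" using dq by (intro mult_right_mono) auto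
        also have "\<dots> = r ^ 3 * (r * x\<^sup>2 * q)" by (simp add: power2_eq_square power3_eq_cube mult_ac)
        also have "\<dots> \<le> r ^ 3 * 1" using rq e by (intro mult_left_mono) auto
        finally have "d * (1 + (r\<^sup>2 * x)\<^sup>2) \<le> 2 * r ^ 3" using dr by (simp add: distrib_left)
        moreover have "0 < 1 + (r\<^sup>2 * x)\<^sup>2" by (simp add: add_pos_nonneg)
        ultimately have "d \<le> 2 * r ^ 3 * (1 / (1 + (0 + r\<^sup>2 * x)\<^sup>2))" by (simp add: pos_le_divide_eq)
        then show ?thesis using t by linarith
      qed
      then have "KG * d \<le> KG * (r * ((x\<^sup>2 + 1) * U x) + 2 * r ^ 3 * (1 / (1 + (0 + r\<^sup>2 * x)\<^sup>2)))"
        using KG_pos by (intro mult_left_mono) auto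
      then show ?thesis using Gf_diff_bound[OF e(1,2), of x] unfolding d_def by linarith
    qed
    have "Phi e - Phi e' = (\<integral>x. Gf (U x - e) - Gf (U x - e') \<partial>lborel)"
      unfolding Phi_def using e by (intro Bochner_Integration.integral_diff[symmetric] Gf_U_integrable) auto
    also have "\<dots> \<le> (\<integral>x. KG * (r * ((x\<^sup>2 + 1) * U x) + 2 * r ^ 3 * (1 / (1 + (0 + r\<^sup>2 * x)\<^sup>2))) \<partial>lborel)"
      using e by (intro integral_mono pw Bochner_Integration.integrable_diff Bochner_Integration.integrable_add
          integrable_mult_right Gf_U_integrable Mi ci) auto
    also have "\<dots> = KG * (r * M + 2 * r ^ 3 * (C1 / r\<^sup>2))"
      by (simp only: integral_mult_right_zero Bochner_Integration.integral_add[OF integrable_mult_right[OF Mi] integrable_mult_right[OF ci]] cv M_def)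
    also have "\<dots> = KG * (M + 2 * C1) * r"
      using e by (simp add: power2_eq_square power3_eq_cube field_simps)
    finally show ?thesis .
  qed
  define C where "C = KG * (M + 2 * C1) + 1"
  have C: "0 < C" using KG_pos M0 C10 by (simp add: C_def add_nonneg_pos)
  have "Phi e - Phi e' \<le> C * r" if e: "0 \<le> e" "e \<le> e'" "0 \<le> r" "e' - e \<le> r ^ 6" for e e' r
  proof (cases "r = 0")
    case True
    then have "e = e'" using e by simp
    then show ?thesis using True by simp
  next
    case False
    then have "Phi e - Phi e' \<le> KG * (M + 2 * C1) * r" using main[of e e' r] e by simp
    then show ?thesis using e by (simp add: C_def algebra_simps)
  qed
  then show thesis using that C by blast
qed

lemma Gf_DERIV: "s \<noteq> 0 \<Longrightarrow> (Gf has_real_derivative deriv Gf s) (at s)"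
proof -
  assume s: "s \<noteq> 0"
  have "Gf field_differentiable (at s)"
  proof (cases "0 < s")
    case True
    then show ?thesis using Gf_differentiable real_differentiable_def field_differentiable_def by metis
  next
    case False
    have "((\<lambda>_. 0) has_real_derivative 0) (at s)" by simp
    moreover have "\<forall>\<^sub>F x in nhds s. Gf x = 0"
      using eventually_nhds_in_open[of "{..<0}" s] False s by (auto elim!: eventually_mono)
    ultimately have "(Gf has_real_derivative 0) (at s)" by (simp add: DERIV_cong_ev)
    then show ?thesis by (auto simp: field_differentiable_def)
  qed
  then show ?thesis by (simp add: DERIV_deriv_iff_field_differentiable)
qed

text \<open>The half line estimate is applied on both sides of \<open>xm\<close>, on the left after
  reflection; the two majorants live on bounded intervals and are added.\<close>

lemma U_inverse_sqrt_dominated: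
  assumes e: "0 < e" "e < Um"
  obtains w where "integrable lborel w" "\<And>x. 0 \<le> w x"
    "\<And>x. e / 2 \<le> U x \<Longrightarrow> U x \<noteq> e \<Longrightarrow> 1 / sqrt \<bar>U x - e\<bar> \<le> w x"
proof -
  obtain K1 c1 b1 where 1: "0 \<le> K1" "\<And>x. 0 \<le> x \<Longrightarrow> e / 2 \<le> U (xm + x) \<Longrightarrow> x \<le> b1"
    "\<And>x. 0 \<le> x \<Longrightarrow> e / 2 \<le> U (xm + x) \<Longrightarrow> U (xm + x) \<noteq> e \<Longrightarrow> 1 / sqrt \<bar>U (xm + x) - e\<bar> \<le> K1 * (1 + 1 / sqrt \<bar>x - c1\<bar>)"
  proof (rule inverse_sqrt_profile_bound[of "\<lambda>x. U (xm + x)" "\<lambda>x. U' (xm + x)" e])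
    show "((\<lambda>x. U (xm + x)) has_real_derivative U' (xm + x)) (at x)" for x
    proof -
      have "((\<lambda>x. xm + x) has_real_derivative 1) (at x)" by (auto intro!: derivative_eq_intros)
      from DERIV_chain2[OF U_DERIV this] show ?thesis by simp
    qed
    show "continuous_on UNIV (\<lambda>x. U' (xm + x))"
      by (rule continuous_on_compose2[OF U'_cont]) (auto intro!: continuous_intros)
    show "((\<lambda>x. U (xm + x)) \<longlongrightarrow> 0) at_top"
      by (rule filterlim_compose[OF U_top]) (rule filterlim_tendsto_add_at_top[OF tendsto_const filterlim_ident])
  qed (use U'_neg e in auto)
  obtain K2 c2 b2 where 2: "0 \<le> K2" "\<And>x. 0 \<le> x \<Longrightarrow> e / 2 \<le> U (xm - x) \<Longrightarrow> x \<le> b2"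
    "\<And>x. 0 \<le> x \<Longrightarrow> e / 2 \<le> U (xm - x) \<Longrightarrow> U (xm - x) \<noteq> e \<Longrightarrow> 1 / sqrt \<bar>U (xm - x) - e\<bar> \<le> K2 * (1 + 1 / sqrt \<bar>x - c2\<bar>)"
  proof (rule inverse_sqrt_profile_bound[of "\<lambda>x. U (xm - x)" "\<lambda>x. - U' (xm - x)" e])
    show "((\<lambda>x. U (xm - x)) has_real_derivative - U' (xm - x)) (at x)" for x
    proof -
      have "((\<lambda>x. xm - x) has_real_derivative -1) (at x)" by (auto intro!: derivative_eq_intros)
      from DERIV_chain2[OF U_DERIV this] show ?thesis by simp
    qed
    show "continuous_on UNIV (\<lambda>x. - U' (xm - x))"
      by (intro continuous_intros continuous_on_compose2[OF U'_cont]) auto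
    have "filterlim (\<lambda>x. xm - x) at_bot at_top"
      using filterlim_compose[OF filterlim_uminus_at_bot_at_top
          filterlim_tendsto_add_at_top[OF tendsto_const[of "- xm"] filterlim_ident]] by simp
    then show "((\<lambda>x. U (xm - x)) \<longlongrightarrow> 0) at_top"
      by (rule filterlim_compose[OF U_bot])
  qed (use U'_pos e in auto)
  define w where "w = (\<lambda>x. K1 * (indicator {xm..xm + b1} x + indicator {xm..xm + b1} x * (1 / sqrt \<bar>x - (xm + c1)\<bar>))
     + K2 * (indicator {xm - b2..xm} x + indicator {xm - b2..xm} x * (1 / sqrt \<bar>x - (xm - c2)\<bar>)))"
  show thesis
  proof (rule that)
    show "integrable lborel w"
      unfolding w_def
      by (intro Bochner_Integration.integrable_add integrable_mult_right inverse_sqrt_integrable)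
         (auto intro!: integrable_real_indicator simp: emeasure_lborel_Icc_eq)
    show "0 \<le> w x" for x using 1(1) 2(1) by (simp add: w_def)
    fix x assume x: "e / 2 \<le> U x" "U x \<noteq> e"
    show "1 / sqrt \<bar>U x - e\<bar> \<le> w x"
    proof (cases "xm \<le> x")
      case True
      have "x - xm \<le> b1" using 1(2)[of "x - xm"] x True by simp
      then have "x \<in> {xm..xm + b1}" using True by auto
      moreover have "1 / sqrt \<bar>U x - e\<bar> \<le> K1 * (1 + 1 / sqrt \<bar>x - xm - c1\<bar>)" using 1(3)[of "x - xm"] x True by simp
      moreover have "0 \<le> K2 * (indicator {xm - b2..xm} x + indicator {xm - b2..xm} x * (1 / sqrt \<bar>x - (xm - c2)\<bar>))"
        using 2(1) by simp
      ultimately show ?thesis unfolding w_def by (simp add: diff_diff_eq)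
    next
      case False
      have "xm - x \<le> b2" using 2(2)[of "xm - x"] x False by simp
      then have "x \<in> {xm - b2..xm}" using False by auto
      moreover have "1 / sqrt \<bar>U x - e\<bar> \<le> K2 * (1 + 1 / sqrt \<bar>xm - x - c2\<bar>)" using 2(3)[of "xm - x"] x False by simp
      moreover have "\<bar>xm - x - c2\<bar> = \<bar>x - (xm - c2)\<bar>" by simp
      moreover have "0 \<le> K1 * (indicator {xm..xm + b1} x + indicator {xm..xm + b1} x * (1 / sqrt \<bar>x - (xm + c1)\<bar>))"
        using 1(1) by simp
      ultimately show ?thesis unfolding w_def by simp
    qed
  qed
qed

text \<open>Differentiation under the integral sign. Near the two points of level \<open>e\<close>
  the difference quotients are controlled by the inverse square root of
  \<open>\<bar>U x - e\<bar>\<close>, which is integrable because the profile crosses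
  \<open>e\<close> with nonzero slope; this is why the extreme levels 0 and \<open>Um\<close> are
  excluded.\<close>

lemma Phi_differentiable:
  assumes e: "0 < e" "e < Um"
  obtains d where "(Phi has_real_derivative d) (at e)"
proof -
  obtain w where w: "integrable lborel w" "\<And>x. 0 \<le> w x"
    "\<And>x. e / 2 \<le> U x \<Longrightarrow> U x \<noteq> e \<Longrightarrow> 1 / sqrt \<bar>U x - e\<bar> \<le> w x"
    using U_inverse_sqrt_dominated[OF e] by blast
  define g where "g = (\<lambda>x. if U x = e then 0 else - deriv Gf (U x - e))"
  \<comment> \<open>The value 0 on the null set \<open>U x = e\<close>, used for \<open>g\<close> as
    well, lets convergence and domination hold at every \<open>x\<close>.\<close>
  define Q where "Q = (\<lambda>y x. if U x = e then 0 else (Gf (U x - y) - Gf (U x - e)) / (y - e))"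
  have Q_meas [measurable]: "Q y \<in> borel_measurable borel" for y unfolding Q_def by measurable
  have Q_lim: "(\<lambda>i. Q (X i) x) \<longlonglongrightarrow> g x" if X: "X \<longlonglongrightarrow> e" "\<And>i. X i \<noteq> e" for X :: "nat \<Rightarrow> real" and x
  proof (cases "U x = e")
    case True
    then show ?thesis by (simp add: Q_def g_def)
  next
    case False
    then have "((\<lambda>y. Gf (U x - y)) has_real_derivative deriv Gf (U x - e) * (-1)) (at e)"
      by (intro DERIV_chain2[OF Gf_DERIV]) (auto intro!: derivative_eq_intros)
    then have "((\<lambda>y. (Gf (U x - y) - Gf (U x - e)) / (y - e)) \<longlongrightarrow> - deriv Gf (U x - e)) (at e)"
      by (simp add: has_field_derivative_iff)
    then have "(\<lambda>i. (Gf (U x - X i) - Gf (U x - e)) / (X i - e)) \<longlonglongrightarrow> - deriv Gf (U x - e)"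
      unfolding tendsto_at_iff_sequentially using X by (auto simp: o_def)
    then show ?thesis using False by (simp add: Q_def g_def)
  qed
  have seq: "(\<lambda>i. e + 1 / real (Suc i)) \<longlonglongrightarrow> e"
    using tendsto_add[OF tendsto_const[of e] LIMSEQ_inverse_real_of_nat] by (simp add: inverse_eq_divide)
  have g_meas: "g \<in> borel_measurable borel"
    by (rule borel_measurable_LIMSEQ_real[OF Q_lim[OF seq]]) auto
  have null: "AE x in lborel. U x \<noteq> e"
  proof -
    obtain p q where pq: "xm \<le> p" "U p = e" "q \<le> xm" "U q = e"
      using U_right_ex[of e] U_left_ex[of e] e by (metis less_imp_le)
    have "x = p \<or> x = q" if "U x = e" for x
      using U_antimono[of x p] U_antimono[of p x] U_mono[of x q] U_mono[of q x] pq that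
      by (cases "xm \<le> x"; cases x p rule: linorder_cases; cases x q rule: linorder_cases) auto
    moreover have "AE x in lborel. x \<noteq> p \<and> x \<noteq> q" using AE_lborel_singleton[of p] AE_lborel_singleton[of q] by eventually_elim auto
    ultimately show ?thesis by (auto elim: eventually_mono)
  qed
  \<comment> \<open>Where \<open>U x < e / 2\<close>, both levels \<open>y\<close> and
    \<open>e\<close> exceed \<open>U x\<close> and the quotient vanishes.\<close>
  have dom: "\<bar>Q y x\<bar> \<le> KG * w x" if y: "y \<in> {e / 2<..<Um} - {e}" for y x
  proof (cases "U x = e \<or> U x < e / 2")
    case True
    then show ?thesis using w(2)[of x] KG_pos y e by (auto simp: Q_def)
  next
    case False
    have *: "\<bar>Gf (U x - y) - Gf (U x - e)\<bar> \<le> KG * \<bar>sqrt (max 0 (U x - y)) - sqrt (max 0 (U x - e))\<bar>"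
      using Gf_diff_bound[of y e x] Gf_diff_bound[of e y x] Gf_mono[of "U x - y" "U x - e"] Gf_mono[of "U x - e" "U x - y"] y e
      by (cases "y \<le> e") (auto simp: abs_if split: if_splits)
    also have "\<dots> \<le> KG * (\<bar>y - e\<bar> / sqrt \<bar>U x - e\<bar>)"
      using sqrt_increment_bound[of "U x - e" "y - e"] False KG_pos by (intro mult_left_mono) auto
    finally have "\<bar>Gf (U x - y) - Gf (U x - e)\<bar> / \<bar>y - e\<bar> \<le> KG * (1 / sqrt \<bar>U x - e\<bar>)"
      using y by (simp add: pos_divide_le_eq mult_ac)
    also have "\<dots> \<le> KG * w x" using w(3)[of x] False KG_pos by (intro mult_left_mono) auto
    finally show ?thesis using False by (simp add: Q_def abs_divide)
  qed
  have "((\<lambda>y. (Phi y - Phi e) / (y - e)) \<longlongrightarrow> integral\<^sup>L lborel g) (at e within {e / 2<..<Um})"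
    unfolding tendsto_at_iff_sequentially
  proof (intro allI impI)
    fix X :: "nat \<Rightarrow> real" assume X: "\<forall>i. X i \<in> {e / 2<..<Um} - {e}" "X \<longlonglongrightarrow> e"
    have "(\<lambda>i. integral\<^sup>L lborel (Q (X i))) \<longlonglongrightarrow> integral\<^sup>L lborel g"
    proof (rule integral_dominated_convergence[where w = "\<lambda>x. KG * w x"])
      show "AE x in lborel. (\<lambda>i. Q (X i) x) \<longlonglongrightarrow> g x" using Q_lim[OF X(2)] X(1) by auto
      show "AE x in lborel. norm (Q (X i) x) \<le> KG * w x" for i using dom X(1) by auto
    qed (use g_meas w(1) in auto)
    moreover have "integral\<^sup>L lborel (Q y) = (Phi y - Phi e) / (y - e)" if y: "y \<in> {e / 2<..<Um} - {e}" for y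
    proof -
      have "integral\<^sup>L lborel (Q y) = (\<integral>x. (Gf (U x - y) - Gf (U x - e)) / (y - e) \<partial>lborel)"
      proof (rule integral_cong_AE)
        show "AE x in lborel. Q y x = (Gf (U x - y) - Gf (U x - e)) / (y - e)"
          by (rule eventually_mono[OF null]) (simp add: Q_def)
      qed auto
      also have "\<dots> = (\<integral>x. Gf (U x - y) - Gf (U x - e) \<partial>lborel) / (y - e)" by (rule integral_divide_zero)
      also have "(\<integral>x. Gf (U x - y) - Gf (U x - e) \<partial>lborel) = Phi y - Phi e"
        unfolding Phi_def using y e by (intro Bochner_Integration.integral_diff Gf_U_integrable) auto
      finally show ?thesis .
    qed
    ultimately show "((\<lambda>y. (Phi y - Phi e) / (y - e)) \<circ> X) \<longlonglongrightarrow> integral\<^sup>L lborel g"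
      using X(1) by (simp add: o_def)
  qed
  moreover have "at e within {e / 2<..<Um} = at e" using e by (intro at_within_open) auto
  ultimately have "(Phi has_real_derivative integral\<^sup>L lborel g) (at e)"
    by (simp add: has_field_derivative_iff)
  then show thesis using that by blast
qed

abbreviation Rw :: "real \<Rightarrow> real" where "Rw \<equiv> R_Wyl \<delta> u0"

text \<open>\<open>rho_Wyl\<close> is defined through \<open>deriv\<close>, which carries
  information only once differentiability is known; inside the spectrum it is now a genuine
  density.\<close>

lemma Rw_DERIV:
  assumes k: "0 < \<kappa>" "\<kappa> < km"
  shows "(Rw has_real_derivative - rho_Wyl \<delta> u0 \<kappa>) (at \<kappa>)"
proof -
  have "0 < ek \<kappa>" "ek \<kappa> < Um" using ek_strict_mono[of 0 \<kappa>] ek_strict_mono[of \<kappa> km] ek_km k by auto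
  then obtain d where d: "(Phi has_real_derivative d) (at (ek \<kappa>))" using Phi_differentiable by blast
  have "(ek has_real_derivative ecurve' (2 * \<delta> * \<kappa>) * (2 * \<delta>)) (at \<kappa>)"
    unfolding ek_def using kappa_range[of \<kappa>] k \<delta>
    by (intro DERIV_chain2[OF ecurve_DERIV]) (auto intro!: derivative_eq_intros)
  from DERIV_chain2[OF d this] have "((\<lambda>\<kappa>. Phi (ek \<kappa>) / (4 * \<delta>)) has_real_derivative d * (ecurve' (2 * \<delta> * \<kappa>) * (2 * \<delta>)) / (4 * \<delta>)) (at \<kappa>)"
    by (rule DERIV_cdivide)
  moreover have "\<forall>\<^sub>F y in nhds \<kappa>. Rw y = Phi (ek y) / (4 * \<delta>)"
    using eventually_nhds_in_open[of "{0<..<km}" \<kappa>] k by (auto elim!: eventually_mono simp: R_Wyl_eq)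
  ultimately have "(Rw has_real_derivative d * (ecurve' (2 * \<delta> * \<kappa>) * (2 * \<delta>)) / (4 * \<delta>)) (at \<kappa>)"
    by (simp add: DERIV_cong_ev)
  then show ?thesis unfolding rho_Wyl_def using DERIV_imp_deriv by fastforce
qed

lemma Rw_strict_antimono: "0 \<le> a \<Longrightarrow> a < b \<Longrightarrow> b \<le> km \<Longrightarrow> Rw b < Rw a"
  using Phi_strict_antimono[of "ek a" "ek b"] ek_strict_mono[of a b] ek_bounds[of a] ek_bounds[of b] \<delta>
  by (simp add: R_Wyl_eq divide_strict_right_mono)

lemma Rw_km: "Rw km = 0"
  using R_Wyl_eq[of km] km_pos by (simp add: ek_km Phi_Um)

lemma Rw_0_pos: "0 < Rw 0"
  using Rw_strict_antimono[of 0 km] Rw_km km_pos by simp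

text \<open>\<open>ek\<close> is Lipschitz, so the exponent 1/6 survives; the sixth root
  \<open>s\<close> of the Lipschitz constant only rescales \<open>r\<close>.\<close>

lemma Rw_holder:
  obtains C where "0 < C" "\<And>a b r. 0 \<le> a \<Longrightarrow> a \<le> b \<Longrightarrow> b \<le> km \<Longrightarrow> 0 \<le> r \<Longrightarrow> b - a \<le> r ^ 6 \<Longrightarrow> Rw a - Rw b \<le> C * r"
proof -
  obtain C where C: "0 < C" "\<And>e e' r. 0 \<le> e \<Longrightarrow> e \<le> e' \<Longrightarrow> 0 \<le> r \<Longrightarrow> e' - e \<le> r ^ 6 \<Longrightarrow> Phi e - Phi e' \<le> C * r"
    using Phi_holder by blast
  obtain L where L: "0 < L" "\<And>a b. 0 \<le> a \<Longrightarrow> a \<le> b \<Longrightarrow> b \<le> km \<Longrightarrow> ek b - ek a \<le> L * (b - a)"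
    using ek_lipschitz by blast
  define s where "s = root 6 L"
  have s: "0 < s" "s ^ 6 = L" using L(1) by (auto simp: s_def)
  have "Rw a - Rw b \<le> (C * s / (4 * \<delta>)) * r" if ab: "0 \<le> a" "a \<le> b" "b \<le> km" "0 \<le> r" "b - a \<le> r ^ 6" for a b r
  proof -
    have "ek b - ek a \<le> L * (b - a)" using L ab by simp
    also have "\<dots> \<le> L * r ^ 6" using L ab by (intro mult_left_mono) auto
    also have "\<dots> = (s * r) ^ 6" using s by (simp add: power_mult_distrib)
    finally have "Phi (ek a) - Phi (ek b) \<le> C * (s * r)"
      using C(2)[of "ek a" "ek b" "s * r"] ek_bounds[of a] ek_strict_mono[of a b] ab s by (cases "a = b") auto
    then have "(Phi (ek a) - Phi (ek b)) / (4 * \<delta>) \<le> C * (s * r) / (4 * \<delta>)" using \<delta> by (intro divide_right_mono) auto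
    then show ?thesis using ab by (simp add: R_Wyl_eq diff_divide_distrib mult_ac)
  qed
  then show thesis using that[of "C * s / (4 * \<delta>)"] C s \<delta> by simp
qed

lemma Rw_cont: "continuous_on {0..km} Rw"
proof (rule continuous_onI)
  fix x e :: real assume x: "x \<in> {0..km}" and e: "0 < e"
  obtain C where C: "0 < C" "\<And>a b r. 0 \<le> a \<Longrightarrow> a \<le> b \<Longrightarrow> b \<le> km \<Longrightarrow> 0 \<le> r \<Longrightarrow> b - a \<le> r ^ 6 \<Longrightarrow> Rw a - Rw b \<le> C * r"
    using Rw_holder by blast
  show "\<exists>d>0. \<forall>y\<in>{0..km}. dist y x < d \<longrightarrow> dist (Rw y) (Rw x) \<le> e"
  proof (intro exI[of _ "(e / C) ^ 6"] conjI ballI impI)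
    show "0 < (e / C) ^ 6" using e C(1) by simp
    fix y assume y: "y \<in> {0..km}" "dist y x < (e / C) ^ 6"
    have *: "Rw a - Rw b \<le> e \<and> Rw b \<le> Rw a" if "a \<in> {0..km}" "b \<in> {0..km}" "a \<le> b" "b - a < (e / C) ^ 6" for a b
      using C(2)[of a b "e / C"] that e C(1) Rw_strict_antimono[of a b] by (cases "a = b") auto
    show "dist (Rw y) (Rw x) \<le> e"
      using *[of x y] *[of y x] x y by (cases "x \<le> y") (auto simp: dist_real_def abs_if split: if_splits)
  qed
qed

definition Kinv :: "real \<Rightarrow> real" where
  "Kinv y = (THE \<kappa>. 0 \<le> \<kappa> \<and> \<kappa> \<le> km \<and> Rw \<kappa> = y)"

lemma Kinv_Rw: "0 \<le> \<kappa> \<Longrightarrow> \<kappa> \<le> km \<Longrightarrow> Kinv (Rw \<kappa>) = \<kappa>"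
  unfolding Kinv_def
proof (rule the_equality)
  fix a assume "0 \<le> \<kappa>" "\<kappa> \<le> km" "0 \<le> a \<and> a \<le> km \<and> Rw a = Rw \<kappa>"
  then show "a = \<kappa>" using Rw_strict_antimono[of a \<kappa>] Rw_strict_antimono[of \<kappa> a] by (cases a \<kappa> rule: linorder_cases) auto
qed auto

lemma Kinv:
  assumes "0 \<le> y" "y \<le> Rw 0"
  shows "0 \<le> Kinv y" "Kinv y \<le> km" "Rw (Kinv y) = y"
proof -
  obtain \<kappa> where "0 \<le> \<kappa>" "\<kappa> \<le> km" "Rw \<kappa> = y"
    using IVT2'[of Rw km y 0] assms Rw_km km_pos Rw_cont by auto
  then show "0 \<le> Kinv y" "Kinv y \<le> km" "Rw (Kinv y) = y" using Kinv_Rw by auto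
qed

lemma Kinv_bounds: "0 < y \<Longrightarrow> y < Rw 0 \<Longrightarrow> 0 < Kinv y \<and> Kinv y < km"
  using Kinv[of y] Rw_km by (cases "Kinv y = 0"; cases "Kinv y = km") auto

text \<open>Keeps the logarithmic singularity of the interaction integrable after the substitution \<open>\<kappa> = R\<^sup>-\<^sup>1(y)\<close>, although \<open>R\<^sup>-\<^sup>1\<close>
  may be flat.\<close>

lemma Kinv_separation:
  obtains c where "0 < c" "\<And>y z. 0 \<le> y \<Longrightarrow> y \<le> Rw 0 \<Longrightarrow> 0 \<le> z \<Longrightarrow> z \<le> Rw 0 \<Longrightarrow> c * \<bar>y - z\<bar> ^ 6 \<le> \<bar>Kinv y - Kinv z\<bar>"
proof -
  obtain C where C: "0 < C" "\<And>a b r. 0 \<le> a \<Longrightarrow> a \<le> b \<Longrightarrow> b \<le> km \<Longrightarrow> 0 \<le> r \<Longrightarrow> b - a \<le> r ^ 6 \<Longrightarrow> Rw a - Rw b \<le> C * r"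
    using Rw_holder by blast
  have *: "(1 / C ^ 6) * \<bar>y - z\<bar> ^ 6 \<le> \<bar>Kinv y - Kinv z\<bar>"
    if that: "0 \<le> y" "y \<le> Rw 0" "0 \<le> z" "z \<le> Rw 0" "Kinv y \<le> Kinv z" for y z
  proof -
    define r where "r = root 6 (Kinv z - Kinv y)"
    have r: "0 \<le> r" "r ^ 6 = Kinv z - Kinv y" using that by (auto simp: r_def)
    have "y - z \<le> C * r" using C(2)[of "Kinv y" "Kinv z" r] Kinv[of y] Kinv[of z] that r by auto
    moreover have "z \<le> y"
    proof (rule ccontr)
      assume "\<not> z \<le> y"
      then have lt: "Rw (Kinv y) < Rw (Kinv z)" using Kinv(3)[of y] Kinv(3)[of z] that by simp
      then have "Kinv y \<noteq> Kinv z" by auto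
      then have "Kinv y < Kinv z" using that by simp
      then show False using Rw_strict_antimono[of "Kinv y" "Kinv z"] Kinv(1)[of y] Kinv(2)[of z] that lt by auto
    qed
    ultimately have "\<bar>y - z\<bar> ^ 6 \<le> (C * r) ^ 6" by (intro power_mono) auto
    then show ?thesis using C(1) r that by (simp add: power_mult_distrib field_simps)
  qed
  have "(1 / C ^ 6) * \<bar>y - z\<bar> ^ 6 \<le> \<bar>Kinv y - Kinv z\<bar>"
    if "0 \<le> y" "y \<le> Rw 0" "0 \<le> z" "z \<le> Rw 0" for y z
    using *[of y z] *[of z y] that by (cases "Kinv y \<le> Kinv z") (auto simp: abs_minus_commute)
  then show thesis using that[of "1 / C ^ 6"] C(1) by simp
qed

end

section \<open>The phase and the interaction kernel\<close>

context ilw_data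
begin

text \<open>Divided by \<open>2 * \<delta>\<close>, this is the integrand of
  \<open>theta_plus\<close> beyond the turning point; before it the truncated argument of the second
  \<open>einv\<close> is 0 and the value is \<kappa>. One formula on a fixed half line replaces a
  moving endpoint.\<close>

definition tau :: "real \<Rightarrow> real \<Rightarrow> real" where
  "tau \<kappa> x = einv (ek \<kappa>) - einv (max 0 (ek \<kappa> - U x))"

definition Kth :: real where "Kth = sqrt (2 / (sin (einv Um) / einv Um)\<^sup>2)"

lemma Kth_nonneg: "0 \<le> Kth" by (simp add: Kth_def)

lemma tau_bounds:
  assumes "0 \<le> \<kappa>" "\<kappa> \<le> km"
  shows "0 \<le> tau \<kappa> x" "tau \<kappa> x \<le> Kth * sqrt (U x)"
proof -
  have e: "0 \<le> ek \<kappa>" "ek \<kappa> \<le> Um" using ek_bounds assms by auto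
  have le: "max 0 (ek \<kappa> - U x) \<le> ek \<kappa>" using e U_pos[of x] by simp
  show "0 \<le> tau \<kappa> x" unfolding tau_def using einv_mono[OF _ le] by simp
  have "tau \<kappa> x \<le> Kth * sqrt (ek \<kappa> - max 0 (ek \<kappa> - U x))"
    unfolding tau_def Kth_def using e le by (intro einv_holder) auto
  also have "\<dots> \<le> Kth * sqrt (U x)"
    using Kth_nonneg by (intro mult_left_mono real_sqrt_le_mono) auto
  finally show "tau \<kappa> x \<le> Kth * sqrt (U x)" .
qed

lemma tau_meas [measurable]: "tau \<kappa> \<in> borel_measurable borel"
proof -
  have "continuous_on UNIV (\<lambda>x. einv (max 0 (ek \<kappa> - U x)))"
    by (rule continuous_on_compose2[OF einv_continuous]) (auto intro!: continuous_intros U_cont)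
  then show ?thesis unfolding tau_def by (intro borel_measurable_continuous_onI continuous_intros)
qed

lemma tau_integrable:
  assumes k: "0 \<le> \<kappa>" "\<kappa> \<le> km" and A: "A \<in> sets borel"
  shows "integrable lborel (\<lambda>x. indicator A x * tau \<kappa> x)"
proof (rule Bochner_Integration.integrable_bound[OF integrable_mult_right[OF sqrt_U_integrable, of Kth]])
  show "(\<lambda>x. indicator A x * tau \<kappa> x) \<in> borel_measurable lborel" using A by measurable
  show "AE x in lborel. norm (indicator A x * tau \<kappa> x) \<le> norm (Kth * sqrt (U x))"
    using tau_bounds[OF k] Kth_nonneg U_pos by (auto simp: indicator_def less_imp_le)
qed

text \<open>Between \<open>xm\<close> and the turning point \<open>p\<close> the integrand
  \<open>tau\<close> is the constant \<open>2 * \<delta> * \<kappa>\<close>, which accounts exactly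
  for the difference between \<open>\<kappa> * p\<close> and \<open>\<kappa> * xm\<close>. In this
  form continuity up to \<kappa> = 0, where the turning point escapes to infinity, is accessible by
  dominated convergence.\<close>

lemma theta_plus_eq:
  assumes k: "0 \<le> \<kappa>" "\<kappa> \<le> km"
  shows "theta_plus \<delta> u0 \<kappa> = \<kappa> * xm + (\<integral>x. indicator {xm<..} x * tau \<kappa> x \<partial>lborel) / (2 * \<delta>)"
proof (cases "\<kappa> = 0")
  case True
  have "tau 0 x = 0" for x using U_pos[of x] by (simp add: tau_def)
  then show ?thesis using True by (simp add: theta_plus_def)
next
  case False
  then have k0: "0 < \<kappa>" using k by simp
  define p where "p = x_plus \<delta> u0 \<kappa>"
  have p: "xm \<le> p" "U p = ek \<kappa>" using x_plus[OF k0 k(2)] by (auto simp: p_def)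
  have inner: "tau \<kappa> x = 2 * \<delta> * \<kappa>" if "xm < x" "x \<le> p" for x
  proof -
    have "ek \<kappa> \<le> U x" using U_antimono[of x p] p that by (cases "x = p") auto
    then show ?thesis using einv_ek[OF k] by (simp add: tau_def)
  qed
  have outer: "Im (zeta \<delta> \<kappa> + complex_of_real (1 / (2 * \<delta>)) * lambertWm1 (Re (afun \<delta> \<kappa> (u0 x)))) = tau \<kappa> x / (2 * \<delta>)"
    if "p < x" for x
  proof -
    have lt: "U x < ek \<kappa>" using U_antimono[of p x] p that by simp
    have a: "Re (afun \<delta> \<kappa> (u0 x)) = - exp ((ek \<kappa> - U x) - 1)"
      using afun_eq[of \<delta> \<kappa> "u0 x"] kappa_range[OF k] k \<delta> by (simp add: U_def ek_def algebra_simps)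
    have "lambertWm1 (- exp ((ek \<kappa> - U x) - 1)) = cnj (lambertW0 (- exp ((ek \<kappa> - U x) - 1)))"
      using lt by (simp add: lambertWm1_def)
    then have "Im (lambertWm1 (- exp ((ek \<kappa> - U x) - 1))) = - einv (ek \<kappa> - U x)"
      using lambert_complex[of "ek \<kappa> - U x"] lt by simp
    moreover have "Im (zeta \<delta> \<kappa>) = \<kappa>" using False by (simp add: zeta_def)
    ultimately show ?thesis unfolding a using lt einv_ek[OF k] \<delta> by (simp add: tau_def field_simps)
  qed
  have ind: "indicator {xm<..} x * tau \<kappa> x = (2 * \<delta> * \<kappa>) * indicator {xm<..p} x + indicator {p<..} x * tau \<kappa> x" for x
    using inner[of x] p(1) by (auto simp: indicator_def)
  have i1: "integrable lborel (\<lambda>x. (2 * \<delta> * \<kappa>) * indicator {xm<..p} x)"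
    using p by (intro integrable_mult_right integrable_real_indicator) auto
  have "(\<integral>x. indicator {xm<..} x * tau \<kappa> x \<partial>lborel)
     = (\<integral>x. (2 * \<delta> * \<kappa>) * indicator {xm<..p} x \<partial>lborel) + (\<integral>x. indicator {p<..} x * tau \<kappa> x \<partial>lborel)"
    unfolding ind by (intro Bochner_Integration.integral_add i1 tau_integrable k) auto
  also have "(\<integral>x. (2 * \<delta> * \<kappa>) * indicator {xm<..p} x \<partial>lborel) = (2 * \<delta> * \<kappa>) * (p - xm)"
    using p by simp
  finally have 1: "(\<integral>x. indicator {xm<..} x * tau \<kappa> x \<partial>lborel) = (2 * \<delta> * \<kappa>) * (p - xm) + (\<integral>x. indicator {p<..} x * tau \<kappa> x \<partial>lborel)" .
  have "(LINT x : {p<..} | lborel. Im (zeta \<delta> \<kappa> + complex_of_real (1 / (2 * \<delta>)) * lambertWm1 (Re (afun \<delta> \<kappa> (u0 x)))))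
      = (\<integral>x. (indicator {p<..} x * tau \<kappa> x) / (2 * \<delta>) \<partial>lborel)"
    unfolding set_lebesgue_integral_def using outer by (intro Bochner_Integration.integral_cong refl) (simp add: indicator_def)
  also have "\<dots> = (\<integral>x. indicator {p<..} x * tau \<kappa> x \<partial>lborel) / (2 * \<delta>)" by (rule integral_divide_zero)
  finally have "theta_plus \<delta> u0 \<kappa> = \<kappa> * p + (\<integral>x. indicator {p<..} x * tau \<kappa> x \<partial>lborel) / (2 * \<delta>)"
    using False by (simp add: theta_plus_def p_def)
  then show ?thesis unfolding 1 using \<delta> by (simp add: field_simps)
qed

lemma theta_plus_cont: "continuous_on {0..km} (theta_plus \<delta> u0)"
proof -
  have "continuous_on {0..km} (\<lambda>\<kappa>. \<integral>x. indicator {xm<..} x * tau \<kappa> x \<partial>lborel)"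
    unfolding continuous_on_sequentially
  proof (intro allI ballI impI)
    fix X a assume X: "a \<in> {0..km}" "(\<forall>n. X n \<in> {0..km}) \<and> X \<longlonglongrightarrow> a"
    have tl: "(\<lambda>n. tau (X n) x) \<longlonglongrightarrow> tau a x" for x
    proof -
      have "continuous_on {0..km} (\<lambda>\<kappa>. tau \<kappa> x)"
        unfolding tau_def
        by (intro continuous_intros continuous_on_compose2[OF einv_continuous] ek_cont) (use ek_bounds in auto)
      then show ?thesis using X unfolding continuous_on_sequentially by (auto simp: o_def)
    qed
    have "(\<lambda>n. \<integral>x. indicator {xm<..} x * tau (X n) x \<partial>lborel) \<longlonglongrightarrow> (\<integral>x. indicator {xm<..} x * tau a x \<partial>lborel)"
    proof (rule integral_dominated_convergence[where w = "\<lambda>x. Kth * sqrt (U x)"])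
      show "AE x in lborel. (\<lambda>n. indicator {xm<..} x * tau (X n) x) \<longlonglongrightarrow> indicator {xm<..} x * tau a x"
        by (intro AE_I2 tendsto_intros tl)
      show "AE x in lborel. norm (indicator {xm<..} x * tau (X n) x) \<le> Kth * sqrt (U x)" for n
        using tau_bounds[of "X n"] X Kth_nonneg U_pos by (auto simp: indicator_def less_imp_le)
      show "integrable lborel (\<lambda>x. Kth * sqrt (U x))" by (intro integrable_mult_right sqrt_U_integrable)
    qed measurable
    then show "((\<lambda>\<kappa>. \<integral>x. indicator {xm<..} x * tau \<kappa> x \<partial>lborel) \<circ> X) \<longlonglongrightarrow> (\<integral>x. indicator {xm<..} x * tau a x \<partial>lborel)"
      by (simp add: o_def)
  qed
  then have "continuous_on {0..km} (\<lambda>\<kappa>. \<kappa> * xm + (\<integral>x. indicator {xm<..} x * tau \<kappa> x \<partial>lborel) / (2 * \<delta>))"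
    using \<delta> by (intro continuous_intros) auto
  then show ?thesis by (rule continuous_on_eq) (simp add: theta_plus_eq)
qed

section \<open>The spectral curve and the external field\<close>

lemma Im_zeta: "Im (zeta \<delta> \<kappa>) = \<kappa>"
  by (simp add: zeta_def)

lemma zeta_cont: "continuous_on {0<..km} (zeta \<delta>)"
proof -
  have "continuous_on {0<..km} (\<lambda>\<kappa>. complex_of_real (\<kappa> * (cos (2 * \<delta> * \<kappa>) / sin (2 * \<delta> * \<kappa>))) + \<i> * complex_of_real \<kappa>)"
  proof (intro continuous_intros ballI)
    fix \<kappa> assume "\<kappa> \<in> {0<..km}"
    then have "0 < 2 * \<delta> * \<kappa>" "2 * \<delta> * \<kappa> < pi" using kappa_range[of \<kappa>] \<delta> by auto
    then show "sin (2 * \<delta> * \<kappa>) \<noteq> 0" using sin_gt_zero[of "2 * \<delta> * \<kappa>"] by simp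
  qed
  then show ?thesis by (rule continuous_on_eq) (simp add: zeta_def cot_def)
qed

lemma zeta_meas [measurable]: "zeta \<delta> \<in> borel_measurable borel"
  unfolding zeta_def cot_def by measurable

lemma zeta_bounded:
  obtains C where "0 < C" "\<And>\<kappa>. 0 \<le> \<kappa> \<Longrightarrow> \<kappa> \<le> km \<Longrightarrow> cmod (zeta \<delta> \<kappa>) \<le> C"
proof -
  define m where "m = einv Um"
  have "0 < 2 * \<delta> * km" using km_pos \<delta> by simp
  then have m: "0 < m" "m < pi" using einv(2)[of Um] U_pos[of xm] by (auto simp: m_def km_theta)
  have sm: "0 < sin m" using m by (simp add: sin_gt_zero)
  define C where "C = 1 / (2 * \<delta>) + m / sin m / (2 * \<delta>) + km"
  have C: "0 < C" using \<delta> m sm km_pos by (simp add: C_def add_pos_pos)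
  have "cmod (zeta \<delta> \<kappa>) \<le> C" if k: "0 \<le> \<kappa>" "\<kappa> \<le> km" for \<kappa>
  proof (cases "\<kappa> = 0")
    case True
    have "0 \<le> m / sin m / (2 * \<delta>)" using m sm \<delta> by simp
    then show ?thesis using True \<delta> km_pos by (simp add: zeta_def C_def norm_divide)
  next
    case False
    define \<theta> where "\<theta> = 2 * \<delta> * \<kappa>"
    have \<theta>: "0 < \<theta>" "\<theta> \<le> m" "\<theta> < pi" using kappa_range[OF k] False k \<delta> by (auto simp: \<theta>_def m_def)
    have s: "0 < sin \<theta>" using \<theta> by (simp add: sin_gt_zero)
    have "sin m / m * \<theta> \<le> sin \<theta>" using \<theta> m by (intro sin_ge_linear) auto
    then have "\<theta> / sin \<theta> \<le> m / sin m" using s m sm by (simp add: field_simps)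
    moreover have "\<bar>\<theta> * cot \<theta>\<bar> \<le> \<theta> / sin \<theta>"
    proof -
      have "\<bar>\<theta> * cot \<theta>\<bar> = \<theta> / sin \<theta> * \<bar>cos \<theta>\<bar>" using \<theta> s by (simp add: cot_def abs_mult)
      also have "\<dots> \<le> \<theta> / sin \<theta> * 1" using \<theta> s by (intro mult_left_mono) auto
      finally show ?thesis by simp
    qed
    ultimately have "\<bar>\<theta> * cot \<theta>\<bar> / (2 * \<delta>) \<le> m / sin m / (2 * \<delta>)" using \<delta> by (intro divide_right_mono) auto
    moreover have "\<bar>\<theta> * cot \<theta>\<bar> / (2 * \<delta>) = \<bar>\<kappa> * cot (2 * \<delta> * \<kappa>)\<bar>" using \<delta> by (simp add: \<theta>_def abs_mult)
    ultimately have r: "\<bar>Re (zeta \<delta> \<kappa>)\<bar> \<le> m / sin m / (2 * \<delta>)" using False by (simp add: zeta_def)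
    have "cmod (zeta \<delta> \<kappa>) \<le> \<bar>Re (zeta \<delta> \<kappa>)\<bar> + \<bar>Im (zeta \<delta> \<kappa>)\<bar>" by (rule cmod_le)
    also have "\<dots> \<le> C"
    proof -
      have "0 \<le> 1 / (2 * \<delta>)" using \<delta> by simp
      then show ?thesis using r k unfolding C_def Im_zeta by linarith
    qed
    finally show ?thesis .
  qed
  then show thesis using that C by blast
qed

lemma V_cont: "continuous_on {0<..km} (\<lambda>\<kappa>. Vfun \<delta> u0 \<kappa> x t)"
  unfolding Vfun_def
  by (intro continuous_intros zeta_cont continuous_on_subset[OF theta_plus_cont]) auto

lemma V_bounded:
  obtains C where "0 < C" "\<And>\<kappa> x. 0 \<le> \<kappa> \<Longrightarrow> \<kappa> \<le> km \<Longrightarrow> \<bar>Vfun \<delta> u0 \<kappa> x t\<bar> \<le> C + \<bar>x\<bar> * km"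
proof -
  obtain Cz where Cz: "0 < Cz" "\<And>\<kappa>. 0 \<le> \<kappa> \<Longrightarrow> \<kappa> \<le> km \<Longrightarrow> cmod (zeta \<delta> \<kappa>) \<le> Cz" using zeta_bounded by blast
  have "bounded (theta_plus \<delta> u0 ` {0..km})"
    by (intro compact_imp_bounded compact_continuous_image theta_plus_cont) simp
  then obtain Ct where Ct: "0 < Ct" "\<And>\<kappa>. 0 \<le> \<kappa> \<Longrightarrow> \<kappa> \<le> km \<Longrightarrow> \<bar>theta_plus \<delta> u0 \<kappa>\<bar> \<le> Ct"
    unfolding bounded_pos by auto
  define C where "C = \<bar>t\<bar> * (Cz + 1 / (2 * \<delta>))\<^sup>2 + Ct"
  have "\<bar>Vfun \<delta> u0 \<kappa> x t\<bar> \<le> C + \<bar>x\<bar> * km" if k: "0 \<le> \<kappa>" "\<kappa> \<le> km" for \<kappa> x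
  proof -
    define q where "q = zeta \<delta> \<kappa> - complex_of_real (1 / (2 * \<delta>))"
    have "cmod q \<le> Cz + 1 / (2 * \<delta>)"
      unfolding q_def using norm_triangle_ineq4[of "zeta \<delta> \<kappa>" "complex_of_real (1 / (2 * \<delta>))"] Cz(2)[OF k] \<delta>
      by (simp add: norm_divide)
    then have "(cmod q)\<^sup>2 \<le> (Cz + 1 / (2 * \<delta>))\<^sup>2" by (intro power_mono) auto
    then have "\<bar>Im (q\<^sup>2)\<bar> \<le> (Cz + 1 / (2 * \<delta>))\<^sup>2" using abs_Im_le_cmod[of "q\<^sup>2"] by (simp add: norm_power)
    then have "\<bar>t\<bar> * \<bar>Im (q\<^sup>2)\<bar> \<le> \<bar>t\<bar> * (Cz + 1 / (2 * \<delta>))\<^sup>2" by (intro mult_left_mono) auto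
    moreover have "\<bar>x * \<kappa>\<bar> \<le> \<bar>x\<bar> * km" using k by (simp add: abs_mult mult_left_mono)
    ultimately show ?thesis
      using Ct(2)[OF k] unfolding Vfun_def q_def[symmetric] C_def abs_mult[symmetric] by linarith
  qed
  moreover have "0 < C" using Ct(1) by (simp add: C_def add_nonneg_pos)
  ultimately show thesis using that by blast
qed

section \<open>The logarithmic interaction kernel\<close>

definition gker :: "real \<Rightarrow> real \<Rightarrow> real" where
  "gker \<kappa> \<eta> = ln (cmod ((zeta \<delta> \<kappa> - cnj (zeta \<delta> \<eta>)) / (zeta \<delta> \<kappa> - zeta \<delta> \<eta>)))"

text \<open>With the conventions \<open>a / 0 = 0\<close> and \<open>ln 0 = 0\<close> the
  logarithmic pole is replaced by 0, in agreement with sums that omit the diagonal.\<close>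

lemma gker_diag: "gker \<kappa> \<kappa> = 0"
  by (simp add: gker_def)

text \<open>The imaginary part of \<open>zeta\<close> is the parameter itself, so a separation of
  parameters is a separation on the curve.\<close>

lemma zeta_diff_ge: "\<bar>\<kappa> - \<eta>\<bar> \<le> cmod (zeta \<delta> \<kappa> - zeta \<delta> \<eta>)"
  using abs_Im_le_cmod[of "zeta \<delta> \<kappa> - zeta \<delta> \<eta>"] by (simp add: Im_zeta)

lemma zeta_cnj_ge: "\<kappa> + \<eta> \<le> cmod (zeta \<delta> \<kappa> - cnj (zeta \<delta> \<eta>))"
  using abs_Im_le_cmod[of "zeta \<delta> \<kappa> - cnj (zeta \<delta> \<eta>)"] by (simp add: Im_zeta)

lemma zeta_ratio:
  assumes "0 \<le> \<kappa>" "0 \<le> \<eta>"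
  shows "cmod (zeta \<delta> \<kappa> - zeta \<delta> \<eta>) \<le> cmod (zeta \<delta> \<kappa> - cnj (zeta \<delta> \<eta>))"
proof -
  have "\<bar>\<kappa> - \<eta>\<bar>\<^sup>2 \<le> (\<kappa> + \<eta>)\<^sup>2" using assms by (intro power_mono) auto
  then show ?thesis unfolding cmod_def by (intro real_sqrt_le_mono) (simp add: Im_zeta)
qed

lemma gker_nonneg:
  assumes "0 < \<kappa>" "0 < \<eta>" shows "0 \<le> gker \<kappa> \<eta>"
proof (cases "\<kappa> = \<eta>")
  case False
  then have "0 < cmod (zeta \<delta> \<kappa> - zeta \<delta> \<eta>)" using zeta_diff_ge[of \<kappa> \<eta>] by linarith
  then show ?thesis using zeta_ratio[of \<kappa> \<eta>] assms by (simp add: gker_def norm_divide)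
qed (simp add: gker_diag)

text \<open>Turns the pair factors of the Cauchy minors into Boltzmann factors of the
  kernel.\<close>

lemma exp_gker:
  assumes "0 < \<kappa>" "0 < \<eta>" "\<kappa> \<noteq> \<eta>"
  shows "exp (- gker \<kappa> \<eta>) = cmod (zeta \<delta> \<kappa> - zeta \<delta> \<eta>) / cmod (zeta \<delta> \<kappa> - cnj (zeta \<delta> \<eta>))"
proof -
  have "0 < cmod (zeta \<delta> \<kappa> - zeta \<delta> \<eta>)" using zeta_diff_ge[of \<kappa> \<eta>] assms by linarith
  moreover have "0 < cmod (zeta \<delta> \<kappa> - cnj (zeta \<delta> \<eta>))" using zeta_cnj_ge[of \<kappa> \<eta>] assms by linarith
  ultimately show ?thesis by (simp add: gker_def norm_divide exp_minus)
qed

text \<open>The decreasing quantile map of the Weyl density: the parameter at which the counting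
  function has the fraction \<open>s\<close> of its total. The indicator makes it a Borel function
  on the whole line.\<close>

definition Ks :: "real \<Rightarrow> real" where
  "Ks s = indicator {0<..<1} s *\<^sub>R Kinv (Rw 0 * s)"

lemma Kinv_cont: "continuous_on {0..Rw 0} Kinv"
proof -
  have "continuous_on (Rw ` {0..km}) Kinv"
    by (rule continuous_on_inv[OF Rw_cont]) (auto simp: Kinv_Rw)
  moreover have "{0..Rw 0} \<subseteq> Rw ` {0..km}"
  proof
    fix y assume "y \<in> {0..Rw 0}"
    then have "Kinv y \<in> {0..km}" "y = Rw (Kinv y)" using Kinv[of y] by auto
    then show "y \<in> Rw ` {0..km}" by (rule rev_image_eqI)
  qed
  ultimately show ?thesis by (rule continuous_on_subset)
qed

lemma Ks_cont0: "continuous_on {0<..<1} (\<lambda>s. Kinv (Rw 0 * s))"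
proof (rule continuous_on_compose2[OF Kinv_cont])
  show "(\<lambda>s. Rw 0 * s) ` {0<..<1} \<subseteq> {0..Rw 0}" using Rw_0_pos by (auto intro!: mult_left_le)
qed (intro continuous_intros)

lemma Ks_eq: "0 < s \<Longrightarrow> s < 1 \<Longrightarrow> Ks s = Kinv (Rw 0 * s)"
  by (simp add: Ks_def)

lemma Ks_meas [measurable]: "Ks \<in> borel_measurable borel"
  unfolding Ks_def by (rule borel_measurable_continuous_on_indicator[OF _ Ks_cont0]) simp

lemma Ks_cont: "continuous_on {0<..<1} Ks"
  by (rule continuous_on_eq[OF Ks_cont0]) (simp add: Ks_def)

lemma Ks_isCont: "0 < s \<Longrightarrow> s < 1 \<Longrightarrow> isCont Ks s"
  using Ks_cont by (simp add: continuous_on_eq_continuous_at)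

lemma Ks_range: assumes "0 < s" "s < 1" shows "0 < Ks s" "Ks s < km"
proof -
  have "0 < Rw 0 * s" "Rw 0 * s < Rw 0" using assms Rw_0_pos by auto
  then show "0 < Ks s" "Ks s < km" using Kinv_bounds assms by (auto simp: Ks_eq)
qed

lemma Rw_Ks: "0 < s \<Longrightarrow> s < 1 \<Longrightarrow> Rw (Ks s) = Rw 0 * s"
  using Kinv(3)[of "Rw 0 * s"] Rw_0_pos by (simp add: Ks_eq)

lemma Ks_inj: "0 < s \<Longrightarrow> s < 1 \<Longrightarrow> 0 < t \<Longrightarrow> t < 1 \<Longrightarrow> Ks s = Ks t \<Longrightarrow> s = t"
proof -
  assume st: "0 < s" "s < 1" "0 < t" "t < 1" and eq: "Ks s = Ks t"
  have "Rw 0 * s = Rw (Ks s)" by (rule Rw_Ks[OF st(1,2), symmetric])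
  also have "\<dots> = Rw 0 * t" unfolding eq by (rule Rw_Ks[OF st(3,4)])
  finally show "s = t" using Rw_0_pos by simp
qed

text \<open>Each integration against the Weyl density contributes a factor \<open>Rw 0\<close>. In
  \<open>hs\<close> the 1/2 of \<open>energy\<close> and the 1/\<pi> of \<open>Lfun\<close> combine
  to \<open>1 / (2 * pi)\<close>.\<close>

definition vs :: "real \<Rightarrow> real \<Rightarrow> real \<Rightarrow> real" where
  "vs x t s = indicator {0<..<1} s *\<^sub>R (Rw 0 * Vfun \<delta> u0 (Ks s) x t)"

definition hs :: "real \<Rightarrow> real \<Rightarrow> real" where
  "hs s t = (if s \<in> {0<..<1} \<and> t \<in> {0<..<1} then (Rw 0)\<^sup>2 / (2 * pi) * gker (Ks s) (Ks t) else 0)"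

lemma gker_meas [measurable]: "(\<lambda>p. gker (Ks (fst p)) (Ks (snd p))) \<in> borel_measurable (borel \<Otimes>\<^sub>M borel)"
proof -
  have [measurable]: "(\<lambda>s. zeta \<delta> (Ks s)) \<in> borel_measurable borel"
    by (rule measurable_compose[OF Ks_meas zeta_meas])
  have c: "cnj \<in> borel_measurable borel"
    by (intro borel_measurable_continuous_onI continuous_intros)
  have a: "(\<lambda>p. zeta \<delta> (Ks (fst p))) \<in> borel_measurable (borel \<Otimes>\<^sub>M borel)"
    "(\<lambda>p. zeta \<delta> (Ks (snd p))) \<in> borel_measurable (borel \<Otimes>\<^sub>M borel)"
    by measurable
  have b: "(\<lambda>p. cnj (zeta \<delta> (Ks (snd p)))) \<in> borel_measurable (borel \<Otimes>\<^sub>M borel)"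
    by (rule measurable_compose[OF a(2) c])
  note [measurable] = a b
  show ?thesis unfolding gker_def by measurable
qed

lemma vs_cont0: "continuous_on {0<..<1} (\<lambda>s. Rw 0 * Vfun \<delta> u0 (Ks s) x t)"
  by (intro continuous_intros continuous_on_compose2[OF V_cont Ks_cont]) (use Ks_range in force)

text \<open>The sixth power separation of \<open>Kinv\<close> bounds the kernel by the logarithm of
  \<open>C / d ^ 6\<close>, where \<open>d = \<bar>s - t\<bar>\<close>. As \<open>1 / d ^ 6\<close>
  is the twelfth power of \<open>1 / sqrt d\<close>, the inequality \<open>ln x \<le> x\<close> at
  \<open>x = 1 / sqrt d\<close> yields the inverse square root with factor 12.\<close>

lemma hs_bound_ex:
  obtains A0 B0 where "0 \<le> A0" "0 \<le> B0"
    "\<And>s t. 0 < s \<Longrightarrow> s < 1 \<Longrightarrow> 0 < t \<Longrightarrow> t < 1 \<Longrightarrow> hs s t \<le> A0 + B0 / sqrt \<bar>s - t\<bar>"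
proof -
  obtain Cz where Cz: "0 < Cz" "\<And>\<kappa>. 0 \<le> \<kappa> \<Longrightarrow> \<kappa> \<le> km \<Longrightarrow> cmod (zeta \<delta> \<kappa>) \<le> Cz" using zeta_bounded by blast
  obtain c where c: "0 < c" "\<And>y z. 0 \<le> y \<Longrightarrow> y \<le> Rw 0 \<Longrightarrow> 0 \<le> z \<Longrightarrow> z \<le> Rw 0 \<Longrightarrow> c * \<bar>y - z\<bar> ^ 6 \<le> \<bar>Kinv y - Kinv z\<bar>"
    using Kinv_separation by blast
  define C where "C = 2 * Cz / (c * Rw 0 ^ 6)"
  have C: "0 < C" using Cz c Rw_0_pos by (simp add: C_def)
  define F where "F = (Rw 0)\<^sup>2 / (2 * pi)"
  have F: "0 \<le> F" by (simp add: F_def)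
  have "hs s t \<le> F * max 0 (ln C) + F * 12 / sqrt \<bar>s - t\<bar>" if st: "0 < s" "s < 1" "0 < t" "t < 1" for s t
  proof (cases "s = t")
    case True
    then show ?thesis using F by (simp add: hs_def gker_diag)
  next
    case False
    define d where "d = \<bar>s - t\<bar>"
    have d: "0 < d" using False by (simp add: d_def)
    have "c * \<bar>Rw 0 * s - Rw 0 * t\<bar> ^ 6 \<le> \<bar>Ks s - Ks t\<bar>"
      using c(2)[of "Rw 0 * s" "Rw 0 * t"] st Rw_0_pos by (simp add: Ks_eq)
    moreover have "\<bar>Rw 0 * s - Rw 0 * t\<bar> = Rw 0 * d"
      using Rw_0_pos by (simp add: d_def abs_mult flip: right_diff_distrib)
    ultimately have sep: "c * Rw 0 ^ 6 * d ^ 6 \<le> \<bar>Ks s - Ks t\<bar>" by (simp add: power_mult_distrib)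
    have sep0: "0 < c * Rw 0 ^ 6 * d ^ 6" using c Rw_0_pos d by simp
    let ?a = "zeta \<delta> (Ks s)" and ?b = "zeta \<delta> (Ks t)"
    have dn: "c * Rw 0 ^ 6 * d ^ 6 \<le> cmod (?a - ?b)" using zeta_diff_ge[of "Ks s" "Ks t"] sep by linarith
    have "cmod (?a - cnj ?b) \<le> cmod ?a + cmod (cnj ?b)" by (rule norm_triangle_ineq4)
    also have "\<dots> \<le> 2 * Cz"
      using Cz(2)[of "Ks s"] Cz(2)[of "Ks t"] Ks_range[OF st(1,2)] Ks_range[OF st(3,4)] by simp
    finally have nn: "cmod (?a - cnj ?b) \<le> 2 * Cz" .
    have "cmod (?a - cnj ?b) / cmod (?a - ?b) \<le> 2 * Cz / (c * Rw 0 ^ 6 * d ^ 6)"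
      using nn dn sep0 Cz(1) by (intro frac_le) auto
    then have r1: "cmod (?a - cnj ?b) / cmod (?a - ?b) \<le> 2 * Cz / (c * Rw 0 ^ 6 * d ^ 6)" .
    have r0: "0 < cmod (?a - cnj ?b) / cmod (?a - ?b)"
    proof -
      have "0 < cmod (?a - ?b)" using dn sep0 by linarith
      moreover have "0 < cmod (?a - cnj ?b)"
        using zeta_cnj_ge[of "Ks s" "Ks t"] Ks_range[OF st(1,2)] Ks_range[OF st(3,4)] by linarith
      ultimately show ?thesis by (rule divide_pos_pos[rotated])
    qed
    have "gker (Ks s) (Ks t) \<le> ln (2 * Cz / (c * Rw 0 ^ 6 * d ^ 6))"
      unfolding gker_def norm_divide ln_le_cancel_iff[OF r0 less_le_trans[OF r0 r1]] by (rule r1)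
    also have "2 * Cz / (c * Rw 0 ^ 6 * d ^ 6) = C * (1 / sqrt d) ^ 12"
    proof -
      have "sqrt d ^ 12 = (sqrt d ^ 2) ^ 6" by (simp flip: power_mult)
      then show ?thesis using d by (simp add: C_def power_divide)
    qed
    also have "ln (C * (1 / sqrt d) ^ 12) = ln C + 12 * ln (1 / sqrt d)"
      using C d by (subst ln_mult) (auto simp: ln_realpow)
    also have "\<dots> \<le> max 0 (ln C) + 12 * (1 / sqrt d)"
    proof -
      have "ln (1 / sqrt d) \<le> 1 / sqrt d" by (rule less_imp_le, rule ln_less_self) (use d in simp)
      then show ?thesis by (intro add_mono mult_left_mono) simp_all
    qed
    finally have "F * gker (Ks s) (Ks t) \<le> F * (max 0 (ln C) + 12 * (1 / sqrt d))" using F by (rule mult_left_mono)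
    moreover have "hs s t = F * gker (Ks s) (Ks t)" using st by (simp add: hs_def F_def)
    ultimately show ?thesis by (simp add: d_def algebra_simps)
  qed
  then show thesis using that[of "F * max 0 (ln C)" "F * 12"] F by simp
qed

lemma hs_isCont:
  assumes st: "0 < s" "s < 1" "0 < t" "t < 1" "s \<noteq> t"
  shows "isCont (\<lambda>p. hs (fst p) (snd p)) (s, t)"
proof -
  have zc: "isCont (zeta \<delta>) \<kappa>" if "0 < \<kappa>" "\<kappa> < km" for \<kappa>
  proof -
    have "continuous_on {0<..<km} (zeta \<delta>)" by (rule continuous_on_subset[OF zeta_cont]) auto
    then show ?thesis using that by (simp add: continuous_on_eq_continuous_at)
  qed
  have z1: "isCont (\<lambda>p. zeta \<delta> (Ks (fst p))) (s, t)"
    by (rule isCont_o2[OF isCont_o2[OF isCont_fst[OF continuous_ident]]]) (use st Ks_range Ks_isCont zc in auto)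
  have z2: "isCont (\<lambda>p. zeta \<delta> (Ks (snd p))) (s, t)"
    by (rule isCont_o2[OF isCont_o2[OF isCont_snd[OF continuous_ident]]]) (use st Ks_range Ks_isCont zc in auto)
  have "Ks s \<noteq> Ks t" using Ks_inj st by blast
  then have n1: "zeta \<delta> (Ks s) - zeta \<delta> (Ks t) \<noteq> 0" using zeta_diff_ge[of "Ks s" "Ks t"] by force
  have "0 < Ks s + Ks t" using Ks_range st by (simp add: add_pos_pos)
  then have n2: "zeta \<delta> (Ks s) - cnj (zeta \<delta> (Ks t)) \<noteq> 0" using zeta_cnj_ge[of "Ks s" "Ks t"] by force
  have "isCont (\<lambda>p. (Rw 0)\<^sup>2 / (2 * pi) * gker (Ks (fst p)) (Ks (snd p))) (s, t)"
    unfolding gker_def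
    by (intro continuous_intros z1 z2) (use n1 n2 in auto)
  moreover have "\<forall>\<^sub>F p in nhds (s, t). hs (fst p) (snd p) = (Rw 0)\<^sup>2 / (2 * pi) * gker (Ks (fst p)) (Ks (snd p))"
  proof (rule eventually_mono)
    show "\<forall>\<^sub>F p in nhds (s, t). p \<in> {0<..<1} \<times> {0<..<1}"
      by (rule eventually_nhds_in_open) (use st in \<open>auto intro!: open_Times\<close>)
  qed (auto simp: hs_def)
  ultimately show ?thesis by (simp add: isCont_cong)
qed

text \<open>The constants are independent of \<open>x\<close>, and the bound on the potential grows
  only linearly in it; uniformity for bounded \<open>x\<close> rests on this.\<close>

lemma discretization_instance:
  obtains A0 B0 C where "0 < C"
    "\<And>x. discretization (vs x t) hs (Rw 0 * (C + \<bar>x\<bar> * km)) A0 B0"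
proof -
  obtain A0 B0 where AB: "0 \<le> A0" "0 \<le> B0"
    "\<And>s t. 0 < s \<Longrightarrow> s < 1 \<Longrightarrow> 0 < t \<Longrightarrow> t < 1 \<Longrightarrow> hs s t \<le> A0 + B0 / sqrt \<bar>s - t\<bar>"
    using hs_bound_ex by blast
  obtain C where C: "0 < C" "\<And>\<kappa> x. 0 \<le> \<kappa> \<Longrightarrow> \<kappa> \<le> km \<Longrightarrow> \<bar>Vfun \<delta> u0 \<kappa> x t\<bar> \<le> C + \<bar>x\<bar> * km"
    using V_bounded[of t] by blast
  have "discretization (vs x t) hs (Rw 0 * (C + \<bar>x\<bar> * km)) A0 B0" for x
  proof
    show "vs x t \<in> borel_measurable borel"
      unfolding vs_def by (rule borel_measurable_continuous_on_indicator[OF _ vs_cont0]) simp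
    show "(\<lambda>p. hs (fst p) (snd p)) \<in> borel_measurable (borel \<Otimes>\<^sub>M borel)"
      unfolding hs_def by measurable
    show "isCont (vs x t) s" if s: "0 < s" "s < 1" for s
    proof -
      have "continuous_on {0<..<1} (vs x t)" by (rule continuous_on_eq[OF vs_cont0[of x t]]) (simp add: vs_def)
      then show ?thesis using s by (simp add: continuous_on_eq_continuous_at)
    qed
    show "\<bar>vs x t s\<bar> \<le> Rw 0 * (C + \<bar>x\<bar> * km)" if s: "0 < s" "s < 1" for s
      using C(2)[of "Ks s" x] Ks_range[OF s] s Rw_0_pos by (simp add: vs_def abs_mult)
    show "0 \<le> hs s r" if "0 < s" "s < 1" "0 < r" "r < 1" for s r
      using gker_nonneg Ks_range that by (simp add: hs_def)
    show "hs s s = 0" for s by (simp add: hs_def gker_diag)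
  qed (use AB hs_isCont in auto)
  then show thesis using that C(1) by blast
qed

end

section \<open>Transfer of the energy to the unit interval\<close>

context discretization
begin

lemma E_cong:
  assumes f: "f \<in> profiles" "f' \<in> profiles" and eq: "\<And>s. 0 < s \<Longrightarrow> s < 1 \<Longrightarrow> f s = f' s"
  shows "E f = E f'"
proof -
  have "(\<integral>s. v s * f s \<partial>U01) = (\<integral>s. v s * f' s \<partial>U01)"
    by (intro integral_cong_AE borel_measurable_integrable integrable_mult_profile v_integrable f eventually_mono[OF AE_U01])
       (simp add: eq)
  moreover have "(\<integral>p. h (fst p) (snd p) * f (fst p) * f (snd p) \<partial>(U01 \<Otimes>\<^sub>M U01))
      = (\<integral>p. h (fst p) (snd p) * f' (fst p) * f' (snd p) \<partial>(U01 \<Otimes>\<^sub>M U01))"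
    by (intro integral_cong_AE borel_measurable_integrable integrable_mult_profile2 h_integrable f eventually_mono[OF AE_U01_pair])
       (simp add: eq)
  ultimately show ?thesis by (simp add: E_def)
qed

end

context ilw_data
begin

text \<open>Set to 0 off the open spectrum, since at its endpoints \<open>deriv\<close> need not
  describe the counting function.\<close>

definition rdens :: "real \<Rightarrow> real" where
  "rdens \<kappa> = indicator {0<..<km} \<kappa> * rho_Wyl \<delta> u0 \<kappa>"

definition Rc :: "real \<Rightarrow> real" where
  "Rc \<kappa> = Rw (max 0 (min km \<kappa>))"

lemma Rc_cont: "continuous_on UNIV Rc"
  unfolding Rc_def
  by (rule continuous_on_compose2[OF Rw_cont]) (use km_pos in \<open>auto intro!: continuous_intros\<close>)

lemma Rc_meas [measurable]: "Rc \<in> borel_measurable borel"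
  by (rule borel_measurable_continuous_onI[OF Rc_cont])

lemma Rc_eq: "0 \<le> \<kappa> \<Longrightarrow> \<kappa> \<le> km \<Longrightarrow> Rc \<kappa> = Rw \<kappa>"
  by (simp add: Rc_def)

lemma Rw_mono: "0 \<le> a \<Longrightarrow> a \<le> b \<Longrightarrow> b \<le> km \<Longrightarrow> Rw b \<le> Rw a"
  using Rw_strict_antimono[of a b] by (cases "a = b") auto

lemma rdens_limit:
  assumes "0 < \<kappa>" "\<kappa> < km"
  shows "(\<lambda>n. (Rc \<kappa> - Rc (\<kappa> + inverse (real (Suc n)))) / inverse (real (Suc n))) \<longlonglongrightarrow> rdens \<kappa>"
proof -
  have "\<forall>\<^sub>F y in nhds \<kappa>. Rc y = Rw y"
    using eventually_nhds_in_open[of "{0<..<km}" \<kappa>] assms by (auto elim!: eventually_mono simp: Rc_eq)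
  then have "(Rc has_real_derivative - rho_Wyl \<delta> u0 \<kappa>) (at \<kappa>)"
    using Rw_DERIV[OF assms] by (simp add: DERIV_cong_ev)
  then have "((\<lambda>h. (Rc (\<kappa> + h) - Rc \<kappa>) / h) \<longlongrightarrow> - rho_Wyl \<delta> u0 \<kappa>) (at 0)"
    by (simp add: DERIV_def)
  moreover have "filterlim (\<lambda>n. inverse (real (Suc n))) (at 0) sequentially"
    using LIMSEQ_inverse_real_of_nat by (auto simp: filterlim_at)
  ultimately have "(\<lambda>n. (Rc (\<kappa> + inverse (real (Suc n))) - Rc \<kappa>) / inverse (real (Suc n))) \<longlonglongrightarrow> - rho_Wyl \<delta> u0 \<kappa>"
    by (rule filterlim_compose)
  from tendsto_minus[OF this] show ?thesis using assms by (simp add: rdens_def minus_divide_left)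
qed

lemma rdens_meas [measurable]: "rdens \<in> borel_measurable borel"
proof (rule borel_measurable_LIMSEQ_real)
  show "(\<lambda>n. indicator {0<..<km} \<kappa> * ((Rc \<kappa> - Rc (\<kappa> + inverse (real (Suc n)))) / inverse (real (Suc n)))) \<longlonglongrightarrow> rdens \<kappa>" for \<kappa>
    using rdens_limit[of \<kappa>] by (cases "\<kappa> \<in> {0<..<km}") (auto simp: rdens_def)
qed measurable

lemma rdens_nonneg: "0 \<le> rdens \<kappa>"
proof (cases "\<kappa> \<in> {0<..<km}")
  case True
  have "Rc (\<kappa> + inverse (real (Suc n))) \<le> Rc \<kappa>" for n
    unfolding Rc_def
  proof (rule Rw_mono)
    show "max 0 (min km \<kappa>) \<le> max 0 (min km (\<kappa> + inverse (real (Suc n))))"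
      by (intro max.mono min.mono order_refl) simp
  qed (use km_pos in auto)
  then show ?thesis
    using True by (intro tendsto_lowerbound[OF rdens_limit]) (auto intro!: always_eventually)
qed (simp add: rdens_def)

lemma rdens_eq: "0 < \<kappa> \<Longrightarrow> \<kappa> < km \<Longrightarrow> rdens \<kappa> = rho_Wyl \<delta> u0 \<kappa>"
  by (simp add: rdens_def)

text \<open>The fundamental theorem is used with differentiability in the interior and mere
  continuity at the ends, so a blow-up of the density there is harmless.\<close>

lemma rdens_tail:
  assumes x: "0 \<le> x" "x \<le> km"
  shows "(\<integral>\<^sup>+\<kappa>. indicator {x..km} \<kappa> * ennreal (rdens \<kappa>) \<partial>lborel) = ennreal (Rw x)"
proof -
  have "((\<lambda>\<kappa>. - rdens \<kappa>) has_integral (Rw km - Rw x)) {x..km}"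
  proof (rule fundamental_theorem_of_calculus_interior[OF x(2)])
    show "continuous_on {x..km} Rw" using x by (intro continuous_on_subset[OF Rw_cont]) auto
    show "(Rw has_vector_derivative - rdens \<kappa>) (at \<kappa>)" if "\<kappa> \<in> {x<..<km}" for \<kappa>
      using Rw_DERIV[of \<kappa>] that x by (simp add: rdens_eq has_real_derivative_iff_has_vector_derivative)
  qed
  from has_integral_neg[OF this] have "(rdens has_integral Rw x) {x..km}" by (simp add: Rw_km)
  then have "((\<lambda>\<kappa>. if \<kappa> \<in> {x..km} then rdens \<kappa> else 0) has_integral Rw x) UNIV"
    by (simp only: has_integral_restrict_UNIV)
  moreover have "(\<lambda>\<kappa>. if \<kappa> \<in> {x..km} then rdens \<kappa> else 0) = (\<lambda>\<kappa>. indicator {x..km} \<kappa> * rdens \<kappa>)"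
    by (auto simp: indicator_def)
  ultimately have "((\<lambda>\<kappa>. indicator {x..km} \<kappa> * rdens \<kappa>) has_integral Rw x) UNIV" by (simp only:)
  then have "(\<integral>\<^sup>+\<kappa>. ennreal (indicator {x..km} \<kappa> * rdens \<kappa>) \<partial>lborel) = ennreal (Rw x)"
    by (rule nn_integral_has_integral_lborel[rotated 2]) (auto simp: rdens_nonneg)
  then show ?thesis by (simp add: ennreal_mult' ennreal_indicator)
qed

text \<open>The change of variables as an identity of measures: the normalized Weyl density is the
  law of \<open>Ks\<close> under the uniform measure. Both sides are compared on half lines
  \<open>{x<..}\<close>, and no derivative of \<open>Ks\<close> appears.\<close>

lemma density_eq_distr: "density lborel (\<lambda>\<kappa>. ennreal (rdens \<kappa> / Rw 0)) = distr U01 borel Ks"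
proof -
  have left: "emeasure (density lborel (\<lambda>\<kappa>. ennreal (rdens \<kappa> / Rw 0))) {x<..} = ennreal (Rw (max 0 (min km x)) / Rw 0)" for x
  proof -
    define y where "y = max 0 (min km x)"
    have y: "0 \<le> y" "y \<le> km" using km_pos by (auto simp: y_def)
    have "emeasure (density lborel (\<lambda>\<kappa>. ennreal (rdens \<kappa> / Rw 0))) {x<..}
       = (\<integral>\<^sup>+\<kappa>. ennreal (rdens \<kappa> / Rw 0) * indicator {x<..} \<kappa> \<partial>lborel)"
      by (rule emeasure_density) auto
    also have "\<dots> = (\<integral>\<^sup>+\<kappa>. ennreal (1 / Rw 0) * (indicator {y..km} \<kappa> * ennreal (rdens \<kappa>)) \<partial>lborel)"
    proof (rule nn_integral_cong_AE)
      show "AE \<kappa> in lborel. ennreal (rdens \<kappa> / Rw 0) * indicator {x<..} \<kappa> = ennreal (1 / Rw 0) * (indicator {y..km} \<kappa> * ennreal (rdens \<kappa>))"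
        using AE_lborel_singleton[of y]
      proof eventually_elim
        fix \<kappa> assume ne: "\<kappa> \<noteq> y"
        have "ennreal (rdens \<kappa> / Rw 0) = ennreal (1 / Rw 0) * ennreal (rdens \<kappa>)"
          using Rw_0_pos rdens_nonneg by (simp flip: ennreal_mult)
        moreover have "rdens \<kappa> = 0 \<or> (x < \<kappa> \<longleftrightarrow> y \<le> \<kappa> \<and> \<kappa> \<le> km)"
          using ne by (auto simp: rdens_def indicator_def y_def)
        ultimately show "ennreal (rdens \<kappa> / Rw 0) * indicator {x<..} \<kappa> = ennreal (1 / Rw 0) * (indicator {y..km} \<kappa> * ennreal (rdens \<kappa>))"
          by (auto simp: indicator_def)
      qed
    qed
    also have "\<dots> = ennreal (1 / Rw 0) * ennreal (Rw y)"
      by (subst nn_integral_cmult) (auto simp: rdens_tail[OF y])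
    also have "\<dots> = ennreal (Rw y / Rw 0)"
      using Rw_0_pos Rw_mono[OF y order_refl] by (simp add: Rw_km flip: ennreal_mult)
    finally show ?thesis by (simp add: y_def)
  qed
  have right: "emeasure (distr U01 borel Ks) {x<..} = ennreal (Rw (max 0 (min km x)) / Rw 0)" for x
  proof -
    define y where "y = max 0 (min km x)"
    have y: "0 \<le> y" "y \<le> km" using km_pos by (auto simp: y_def)
    have a: "0 \<le> Rw y / Rw 0" "Rw y / Rw 0 \<le> 1"
      using Rw_mono[OF y order_refl] Rw_mono[OF order_refl y] Rw_0_pos by (auto simp: Rw_km)
    have iff: "x < Ks s \<longleftrightarrow> s < Rw y / Rw 0" if s: "0 < s" "s < 1" for s
    proof -
      have k: "0 < Ks s" "Ks s < km" using Ks_range[OF s] by auto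
      have "x < Ks s \<longleftrightarrow> y < Ks s" using k by (auto simp: y_def)
      also have "\<dots> \<longleftrightarrow> Rw (Ks s) < Rw y"
        using Rw_strict_antimono[of y "Ks s"] Rw_mono[of "Ks s" y] k y by force
      also have "\<dots> \<longleftrightarrow> s < Rw y / Rw 0" unfolding Rw_Ks[OF s] using Rw_0_pos by (simp add: pos_less_divide_eq mult.commute)
      finally show ?thesis .
    qed
    have "emeasure (distr U01 borel Ks) {x<..} = emeasure U01 (Ks -` {x<..})"
      by (subst emeasure_distr) auto
    also have "\<dots> = emeasure lborel ({0<..<1} \<inter> Ks -` {x<..})"
      by (rule emeasure_U01) (use measurable_sets[OF Ks_meas, of "{x<..}"] in simp)
    also have "{0<..<1} \<inter> Ks -` {x<..} = {0<..<Rw y / Rw 0}"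
      using iff a by auto
    also have "emeasure lborel {0<..<Rw y / Rw 0} = ennreal (Rw y / Rw 0)"
      using a by simp
    finally show ?thesis by (simp add: y_def)
  qed
  show ?thesis
    by (rule measure_eqI_lessThan) (auto simp: left right)
qed

lemma transfer_integral:
  assumes [measurable]: "\<phi> \<in> borel_measurable borel"
  shows "(\<integral>\<kappa>. rdens \<kappa> * \<phi> \<kappa> \<partial>lborel) = Rw 0 * (\<integral>s. \<phi> (Ks s) \<partial>U01)"
proof -
  have "(\<integral>s. \<phi> (Ks s) \<partial>U01) = integral\<^sup>L (distr U01 borel Ks) \<phi>"
    by (rule integral_distr[symmetric]) auto
  also have "\<dots> = (\<integral>\<kappa>. rdens \<kappa> / Rw 0 * \<phi> \<kappa> \<partial>lborel)"
    unfolding density_eq_distr[symmetric] using rdens_nonneg Rw_0_pos by (subst integral_density) auto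
  also have "\<dots> = (\<integral>\<kappa>. (rdens \<kappa> * \<phi> \<kappa>) / Rw 0 \<partial>lborel)" by simp
  also have "\<dots> = (\<integral>\<kappa>. rdens \<kappa> * \<phi> \<kappa> \<partial>lborel) / Rw 0" by (rule integral_divide_zero)
  finally show ?thesis using Rw_0_pos by simp
qed

lemma cnj_meas [measurable]: "cnj \<in> borel_measurable borel"
  by (intro borel_measurable_continuous_onI continuous_intros)

lemma Lfun_transfer:
  assumes [measurable]: "\<rho> \<in> borel_measurable lborel" "\<phi> \<in> borel_measurable borel"
    and ae: "AE \<kappa> in lborel. \<kappa> \<in> {0..km} \<longrightarrow> \<rho> \<kappa> = rdens \<kappa> * \<phi> \<kappa>"
  shows "Lfun \<delta> u0 \<rho> (zeta \<delta> \<kappa>) = Rw 0 / pi * (\<integral>s. gker \<kappa> (Ks s) * \<phi> (Ks s) \<partial>U01)"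
proof -
  have z2: "(\<lambda>\<eta>. cnj (zeta \<delta> \<eta>)) \<in> borel_measurable borel"
    by (rule measurable_compose[OF zeta_meas cnj_meas])
  note [measurable] = z2
  have [measurable]: "gker \<kappa> \<in> borel_measurable borel" unfolding gker_def by measurable
  have "(LINT \<eta> : {0..km} | lborel. ln (cmod ((zeta \<delta> \<kappa> - cnj (zeta \<delta> \<eta>)) / (zeta \<delta> \<kappa> - zeta \<delta> \<eta>))) * \<rho> \<eta>)
     = (\<integral>\<eta>. rdens \<eta> * (gker \<kappa> \<eta> * \<phi> \<eta>) \<partial>lborel)"
    unfolding set_lebesgue_integral_def gker_def[symmetric]
  proof (rule integral_cong_AE)
    show "AE \<eta> in lborel. indicator {0..km} \<eta> *\<^sub>R (gker \<kappa> \<eta> * \<rho> \<eta>) = rdens \<eta> * (gker \<kappa> \<eta> * \<phi> \<eta>)"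
      using ae by eventually_elim (auto simp: rdens_def indicator_def)
  qed measurable
  also have "\<dots> = Rw 0 * (\<integral>s. gker \<kappa> (Ks s) * \<phi> (Ks s) \<partial>U01)" by (rule transfer_integral) measurable
  finally show ?thesis by (simp add: Lfun_def)
qed

lemma gker_Ks_pair_meas: "(\<lambda>p. gker (fst p) (Ks (snd p))) \<in> borel_measurable (borel \<Otimes>\<^sub>M U01)"
proof -
  have s: "measurable (borel \<Otimes>\<^sub>M U01) borel = (measurable (borel \<Otimes>\<^sub>M borel) borel :: (real \<times> real \<Rightarrow> real) set)"
    by (rule measurable_cong_sets) (auto intro!: sets_pair_measure_cong)
  have 1: "(\<lambda>s. zeta \<delta> (Ks s)) \<in> borel_measurable borel" by (rule measurable_compose[OF Ks_meas zeta_meas])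
  have a: "(\<lambda>p::real \<times> real. zeta \<delta> (fst p)) \<in> borel_measurable (borel \<Otimes>\<^sub>M borel)"
    "(\<lambda>p::real \<times> real. zeta \<delta> (Ks (snd p))) \<in> borel_measurable (borel \<Otimes>\<^sub>M borel)"
    by (rule measurable_compose[OF measurable_fst zeta_meas], rule measurable_compose[OF measurable_snd 1])
  have b: "(\<lambda>p::real \<times> real. cnj (zeta \<delta> (Ks (snd p)))) \<in> borel_measurable (borel \<Otimes>\<^sub>M borel)"
    by (rule measurable_compose[OF a(2) cnj_meas])
  note [measurable] = a b
  show ?thesis unfolding s gker_def by measurable
qed

text \<open>The substitution is made twice, in the inner logarithmic potential and in the outer
  integral; \<open>\<phi>\<close> is the fraction of the maximal density occupied by
  \<open>\<rho>\<close>.\<close>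

lemma energy_transfer:
  assumes \<rho>: "\<rho> \<in> borel_measurable lborel" and \<phi>: "\<phi> \<in> borel_measurable borel" "\<And>\<kappa>. 0 \<le> \<phi> \<kappa> \<and> \<phi> \<kappa> \<le> 1"
    and ae: "AE \<kappa> in lborel. \<kappa> \<in> {0..km} \<longrightarrow> \<rho> \<kappa> = rdens \<kappa> * \<phi> \<kappa>"
  shows "energy \<delta> u0 \<rho> x t = discretization.E (vs x t) hs (\<lambda>s. \<phi> (Ks s))"
    and "(\<lambda>s. \<phi> (Ks s)) \<in> discretization.profiles"
proof -
  obtain A0 B0 C where "discretization (vs x t) hs (Rw 0 * (C + \<bar>x\<bar> * km)) A0 B0"
    using discretization_instance[of t] by metis
  then interpret d: discretization "vs x t" hs "Rw 0 * (C + \<bar>x\<bar> * km)" A0 B0 .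
  note [measurable] = \<rho> \<phi>(1)
  show prof: "(\<lambda>s. \<phi> (Ks s)) \<in> d.profiles" unfolding d.profiles_def using \<phi>(2) by simp
  define Lm where "Lm = (\<lambda>\<kappa>. Rw 0 / pi * (\<integral>s. gker \<kappa> (Ks s) * \<phi> (Ks s) \<partial>U01))"
  have [measurable]: "Lm \<in> borel_measurable borel"
  proof -
    have "(\<lambda>p::real \<times> real. \<phi> (Ks (snd p))) \<in> borel_measurable (borel \<Otimes>\<^sub>M U01)" by measurable
    then have "(\<lambda>(\<kappa>, s). gker \<kappa> (Ks s) * \<phi> (Ks s)) \<in> borel_measurable (borel \<Otimes>\<^sub>M U01)"
      using gker_Ks_pair_meas by (simp add: split_beta borel_measurable_times)
    then have "(\<lambda>\<kappa>. \<integral>s. gker \<kappa> (Ks s) * \<phi> (Ks s) \<partial>U01) \<in> borel_measurable borel"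
      by (rule sigma_finite_measure.borel_measurable_lebesgue_integral[rotated]) unfold_locales
    then show ?thesis unfolding Lm_def by measurable
  qed
  define Vm where "Vm = (\<lambda>\<kappa>. indicator {0<..km} \<kappa> *\<^sub>R Vfun \<delta> u0 \<kappa> x t)"
  have [measurable]: "Vm \<in> borel_measurable borel"
    unfolding Vm_def by (rule borel_measurable_continuous_on_indicator[OF _ V_cont]) simp
  have L: "Lfun \<delta> u0 \<rho> (zeta \<delta> \<kappa>) = Lm \<kappa>" for \<kappa> unfolding Lm_def by (rule Lfun_transfer[OF \<rho> \<phi>(1) ae])
  have eq: "AE \<kappa> in lborel. indicator {0..km} \<kappa> *\<^sub>R ((Vfun \<delta> u0 \<kappa> x t + 1 / 2 * Lfun \<delta> u0 \<rho> (zeta \<delta> \<kappa>)) * \<rho> \<kappa>)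
     = rdens \<kappa> * ((Vm \<kappa> + 1 / 2 * Lm \<kappa>) * \<phi> \<kappa>)"
    using ae by eventually_elim (auto simp: L Vm_def rdens_def indicator_def)
  have meas1: "(\<lambda>\<kappa>. rdens \<kappa> * ((Vm \<kappa> + 1 / 2 * Lm \<kappa>) * \<phi> \<kappa>)) \<in> borel_measurable lborel" by measurable
  have "indicator {0..km} \<kappa> *\<^sub>R ((Vfun \<delta> u0 \<kappa> x t + 1 / 2 * Lfun \<delta> u0 \<rho> (zeta \<delta> \<kappa>)) * \<rho> \<kappa>)
      = indicator {0..km} \<kappa> * ((Vm \<kappa> + indicator {0} \<kappa> * Vfun \<delta> u0 0 x t + 1 / 2 * Lm \<kappa>) * \<rho> \<kappa>)" for \<kappa>
    by (auto simp: L Vm_def indicator_def)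
  then have meas2: "(\<lambda>\<kappa>. indicator {0..km} \<kappa> *\<^sub>R ((Vfun \<delta> u0 \<kappa> x t + 1 / 2 * Lfun \<delta> u0 \<rho> (zeta \<delta> \<kappa>)) * \<rho> \<kappa>)) \<in> borel_measurable lborel"
    by (simp only:) measurable
  have "energy \<delta> u0 \<rho> x t = (\<integral>\<kappa>. rdens \<kappa> * ((Vm \<kappa> + 1 / 2 * Lm \<kappa>) * \<phi> \<kappa>) \<partial>lborel)"
    unfolding energy_def set_lebesgue_integral_def by (rule integral_cong_AE[OF meas2 meas1 eq])
  also have "\<dots> = Rw 0 * (\<integral>s. (Vm (Ks s) + 1 / 2 * Lm (Ks s)) * \<phi> (Ks s) \<partial>U01)"
    by (rule transfer_integral) measurable
  also have "\<dots> = (\<integral>s. Rw 0 * ((Vm (Ks s) + 1 / 2 * Lm (Ks s)) * \<phi> (Ks s)) \<partial>U01)" by simp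
  also have "\<dots> = (\<integral>s. (vs x t s + (\<integral>r. hs s r * \<phi> (Ks r) \<partial>U01)) * \<phi> (Ks s) \<partial>U01)"
  proof (rule integral_cong_AE)
    show "(\<lambda>s. (vs x t s + (\<integral>r. hs s r * \<phi> (Ks r) \<partial>U01)) * \<phi> (Ks s)) \<in> borel_measurable U01"
    proof -
      have "(\<lambda>p. hs (fst p) (snd p) * \<phi> (Ks (snd p))) \<in> borel_measurable (U01 \<Otimes>\<^sub>M U01)"
        unfolding d.pair_meas_eq by measurable
      then have "(\<lambda>(s, r). hs s r * \<phi> (Ks r)) \<in> borel_measurable (U01 \<Otimes>\<^sub>M U01)" by (simp add: split_beta)
      then have "(\<lambda>s. \<integral>r. hs s r * \<phi> (Ks r) \<partial>U01) \<in> borel_measurable U01"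
        by (rule sigma_finite_measure.borel_measurable_lebesgue_integral[rotated]) unfold_locales
      then show ?thesis using d.v_meas by simp
    qed
    show "AE s in U01. Rw 0 * ((Vm (Ks s) + 1 / 2 * Lm (Ks s)) * \<phi> (Ks s)) = (vs x t s + (\<integral>r. hs s r * \<phi> (Ks r) \<partial>U01)) * \<phi> (Ks s)"
      using AE_U01
    proof eventually_elim
      fix s :: real assume s: "0 < s \<and> s < 1"
      have "(\<integral>r. hs s r * \<phi> (Ks r) \<partial>U01) = (\<integral>r. (Rw 0)\<^sup>2 / (2 * pi) * (gker (Ks s) (Ks r) * \<phi> (Ks r)) \<partial>U01)"
      proof (rule integral_cong_AE)
        have [measurable]: "hs s \<in> borel_measurable borel"
          using measurable_compose[OF measurable_Pair1'[of s borel borel] d.h_meas] by simp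
        show "(\<lambda>r. hs s r * \<phi> (Ks r)) \<in> borel_measurable U01" by measurable
        have [measurable]: "(\<lambda>r. gker (Ks s) (Ks r)) \<in> borel_measurable borel"
          using measurable_compose[OF measurable_Pair1'[of s borel borel] gker_meas] by simp
        show "(\<lambda>r. (Rw 0)\<^sup>2 / (2 * pi) * (gker (Ks s) (Ks r) * \<phi> (Ks r))) \<in> borel_measurable U01" by measurable
        show "AE r in U01. hs s r * \<phi> (Ks r) = (Rw 0)\<^sup>2 / (2 * pi) * (gker (Ks s) (Ks r) * \<phi> (Ks r))"
          by (rule eventually_mono[OF AE_U01]) (use s in \<open>simp add: hs_def\<close>)
      qed
      also have "\<dots> = Rw 0 * (1 / 2 * Lm (Ks s))" by (simp add: Lm_def power2_eq_square)
      finally have "(\<integral>r. hs s r * \<phi> (Ks r) \<partial>U01) = Rw 0 * (1 / 2 * Lm (Ks s))" .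
      moreover have "vs x t s = Rw 0 * Vm (Ks s)" using s Ks_range[of s] by (simp add: vs_def Vm_def)
      ultimately show "Rw 0 * ((Vm (Ks s) + 1 / 2 * Lm (Ks s)) * \<phi> (Ks s)) = (vs x t s + (\<integral>r. hs s r * \<phi> (Ks r) \<partial>U01)) * \<phi> (Ks s)"
        by (simp add: algebra_simps)
    qed
  qed measurable
  also have "\<dots> = d.E (\<lambda>s. \<phi> (Ks s))" by (rule d.E_nested[OF prof, symmetric])
  finally show "energy \<delta> u0 \<rho> x t = d.E (\<lambda>s. \<phi> (Ks s))" .
qed

text \<open>The two sets of energies coincide: a density corresponds to its ratio to
  \<open>rdens\<close> read along \<open>Ks\<close>, and a profile \<open>f\<close> to
  \<open>rdens\<close> times \<open>f (Rc \<kappa> / Rw 0)\<close>, because \<open>Rw\<close>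
  inverts \<open>Ks\<close> up to scaling.\<close>

lemma E_min_eq: "E_min \<delta> u0 x t = Inf (discretization.E (vs x t) hs ` discretization.profiles)"
proof -
  obtain A0 B0 C where "discretization (vs x t) hs (Rw 0 * (C + \<bar>x\<bar> * km)) A0 B0"
    using discretization_instance[of t] by metis
  then interpret d: discretization "vs x t" hs "Rw 0 * (C + \<bar>x\<bar> * km)" A0 B0 .
  have endpoints: "AE \<kappa> in lborel. \<kappa> \<noteq> 0 \<and> \<kappa> \<noteq> km"
    using AE_lborel_singleton[of "0::real"] AE_lborel_singleton[of km] by eventually_elim auto
  have "(\<lambda>\<rho>. energy \<delta> u0 \<rho> x t) ` admissible_measures \<delta> u0 = d.E ` d.profiles"
  proof (intro equalityI subsetI)
    fix y assume "y \<in> (\<lambda>\<rho>. energy \<delta> u0 \<rho> x t) ` admissible_measures \<delta> u0"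
    then obtain \<rho> where \<rho>: "\<rho> \<in> borel_measurable lborel"
      "AE \<kappa> in lborel. \<kappa> \<in> {0..km} \<longrightarrow> 0 \<le> \<rho> \<kappa> \<and> \<rho> \<kappa> \<le> rho_Wyl \<delta> u0 \<kappa>"
      and y: "y = energy \<delta> u0 \<rho> x t"
      unfolding admissible_measures_def by auto
    \<comment> \<open>Clipping makes the bounds hold everywhere and leaves
      \<open>rdens \<kappa> * \<phi> \<kappa>\<close> unchanged at almost every point of the
      spectrum; where \<open>rdens\<close> is 0, so is \<rho> up to a null set.\<close>
    define \<phi> where "\<phi> = (\<lambda>\<kappa>. max 0 (min 1 (\<rho> \<kappa> / rdens \<kappa>)))"
    have [measurable]: "\<rho> \<in> borel_measurable borel" using \<rho>(1) by simp
    have \<phi>: "\<phi> \<in> borel_measurable borel" "\<And>\<kappa>. 0 \<le> \<phi> \<kappa> \<and> \<phi> \<kappa> \<le> 1" unfolding \<phi>_def by auto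
    have "AE \<kappa> in lborel. \<kappa> \<in> {0..km} \<longrightarrow> \<rho> \<kappa> = rdens \<kappa> * \<phi> \<kappa>"
      using \<rho>(2) endpoints
    proof eventually_elim
      fix \<kappa> assume a: "\<kappa> \<in> {0..km} \<longrightarrow> 0 \<le> \<rho> \<kappa> \<and> \<rho> \<kappa> \<le> rho_Wyl \<delta> u0 \<kappa>" "\<kappa> \<noteq> 0 \<and> \<kappa> \<noteq> km"
      show "\<kappa> \<in> {0..km} \<longrightarrow> \<rho> \<kappa> = rdens \<kappa> * \<phi> \<kappa>"
      proof
        assume k: "\<kappa> \<in> {0..km}"
        then have r: "0 \<le> \<rho> \<kappa>" "\<rho> \<kappa> \<le> rdens \<kappa>" using a by (auto simp: rdens_def)
        show "\<rho> \<kappa> = rdens \<kappa> * \<phi> \<kappa>"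
        proof (cases "rdens \<kappa> = 0")
          case True
          then show ?thesis using r by simp
        next
          case False
          then have "0 < rdens \<kappa>" using rdens_nonneg[of \<kappa>] by simp
          then show ?thesis using r by (simp add: \<phi>_def)
        qed
      qed
    qed
    then show "y \<in> d.E ` d.profiles"
      using energy_transfer[OF \<rho>(1) \<phi>] y by blast
  next
    fix y assume "y \<in> d.E ` d.profiles"
    then obtain f where f: "f \<in> d.profiles" and y: "y = d.E f" by auto
    note [measurable] = d.profiles_D(1)[OF f]
    define \<phi> where "\<phi> = (\<lambda>\<kappa>. f (Rc \<kappa> / Rw 0))"
    have \<phi>: "\<phi> \<in> borel_measurable borel" "\<And>\<kappa>. 0 \<le> \<phi> \<kappa> \<and> \<phi> \<kappa> \<le> 1"
      unfolding \<phi>_def using d.profiles_D[OF f] by auto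
    define \<rho> where "\<rho> = (\<lambda>\<kappa>. rdens \<kappa> * \<phi> \<kappa>)"
    have \<rho>: "\<rho> \<in> borel_measurable lborel" unfolding \<rho>_def using \<phi>(1) by simp
    have "AE \<kappa> in lborel. \<kappa> \<in> {0..km} \<longrightarrow> 0 \<le> \<rho> \<kappa> \<and> \<rho> \<kappa> \<le> rho_Wyl \<delta> u0 \<kappa>"
      using endpoints
    proof eventually_elim
      fix \<kappa> assume a: "\<kappa> \<noteq> 0 \<and> \<kappa> \<noteq> km"
      show "\<kappa> \<in> {0..km} \<longrightarrow> 0 \<le> \<rho> \<kappa> \<and> \<rho> \<kappa> \<le> rho_Wyl \<delta> u0 \<kappa>"
        using a rdens_nonneg[of \<kappa>] \<phi>(2)[of \<kappa>] mult_left_le[of "\<phi> \<kappa>" "rdens \<kappa>"] by (auto simp: \<rho>_def rdens_eq)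
    qed
    then have adm: "\<rho> \<in> admissible_measures \<delta> u0" using \<rho> by (simp add: admissible_measures_def)
    have e: "energy \<delta> u0 \<rho> x t = d.E (\<lambda>s. \<phi> (Ks s))" "(\<lambda>s. \<phi> (Ks s)) \<in> d.profiles"
      by (rule energy_transfer[OF \<rho> \<phi>], simp add: \<rho>_def)+
    have "\<phi> (Ks s) = f s" if s: "0 < s" "s < 1" for s
      using Rc_eq[of "Ks s"] Ks_range[OF s] Rw_Ks[OF s] Rw_0_pos by (simp add: \<phi>_def)
    then have "d.E (\<lambda>s. \<phi> (Ks s)) = d.E f" by (intro d.E_cong e f) auto
    then show "y \<in> (\<lambda>\<rho>. energy \<delta> u0 \<rho> x t) ` admissible_measures \<delta> u0"
      using adm e y by (metis image_eqI)
  qed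
  then show ?thesis by (simp add: E_min_def)
qed

end

section \<open>The soliton ensemble\<close>

context ilw_data
begin

abbreviation eps :: "nat \<Rightarrow> real" where "eps N \<equiv> epsN \<delta> u0 N"

definition nd :: "nat \<Rightarrow> nat \<Rightarrow> real" where "nd N j = (real j + 1 / 2) / real N"

lemma eps_pos: "0 < N \<Longrightarrow> 0 < eps N"
  using Rw_0_pos by (simp add: epsN_def)

lemma pi_eps: "0 < N \<Longrightarrow> Rw 0 / real N = pi * eps N"
  by (simp add: epsN_def)

lemma nd_bounds: "j < N \<Longrightarrow> 0 < nd N j \<and> nd N j < 1"
  unfolding nd_def by (auto simp: field_simps)

text \<open>Dividing the quantization condition by \<open>Rw 0\<close> gives
  \<open>(j + 1/2) / N\<close>: the discrete spectrum is the image of the midpoint nodes.\<close>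

lemma kappaN_eq: assumes "j < N" shows "kappaN \<delta> u0 N j = Ks (nd N j)"
proof -
  have "pi * (real j + 1 / 2) * eps N = Rw 0 * nd N j"
    using assms by (simp add: epsN_def nd_def)
  then show ?thesis unfolding kappaN_def using nd_bounds[OF assms] by (simp add: Ks_eq Kinv_def)
qed

lemma kappaN_range: "j < N \<Longrightarrow> 0 < kappaN \<delta> u0 N j \<and> kappaN \<delta> u0 N j < km"
  using Ks_range[of "nd N j"] nd_bounds[of j N] by (simp add: kappaN_eq)

lemma kappaN_inj: "i < N \<Longrightarrow> j < N \<Longrightarrow> i \<noteq> j \<Longrightarrow> kappaN \<delta> u0 N i \<noteq> kappaN \<delta> u0 N j"
proof
  assume ij: "i < N" "j < N" "i \<noteq> j" and eq: "kappaN \<delta> u0 N i = kappaN \<delta> u0 N j"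
  have "nd N i = nd N j"
    by (rule Ks_inj) (use ij eq nd_bounds[of i N] nd_bounds[of j N] in \<open>auto simp: kappaN_eq\<close>)
  then show False using ij by (simp add: nd_def)
qed

text \<open>The spectral points are compared with \<open>Kinv (Rw 0) = 0\<close>. Nodes stay at
  distance at least \<open>1 / (2 * N)\<close> from 1, so the sixth power separation keeps the
  spectral points above a constant over \<open>N ^ 6\<close>.\<close>

lemma kappaN_log_bound:
  obtains C where "0 \<le> C" "\<And>N j. j < N \<Longrightarrow> \<bar>ln (2 * kappaN \<delta> u0 N j)\<bar> \<le> C + 6 * ln (real N)"
proof -
  obtain c where c: "0 < c" "\<And>y z. 0 \<le> y \<Longrightarrow> y \<le> Rw 0 \<Longrightarrow> 0 \<le> z \<Longrightarrow> z \<le> Rw 0 \<Longrightarrow> c * \<bar>y - z\<bar> ^ 6 \<le> \<bar>Kinv y - Kinv z\<bar>"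
    using Kinv_separation by blast
  define a where "a = 2 * (c * (Rw 0 / 2) ^ 6)"
  have a: "0 < a" using c Rw_0_pos by (simp add: a_def)
  have "\<bar>ln (2 * kappaN \<delta> u0 N j)\<bar> \<le> (\<bar>ln a\<bar> + \<bar>ln (2 * km)\<bar>) + 6 * ln (real N)" if j: "j < N" for N j
  proof -
    have N: "0 < real N" "0 \<le> ln (real N)" using j by auto
    have k: "0 < kappaN \<delta> u0 N j" "kappaN \<delta> u0 N j < km" using kappaN_range[OF j] by auto
    have y: "0 \<le> Rw 0 * nd N j" "Rw 0 * nd N j \<le> Rw 0" using nd_bounds[OF j] Rw_0_pos by auto
    have "Kinv (Rw 0) = 0" using Kinv_Rw[of 0] km_pos by simp
    then have "c * \<bar>Rw 0 * nd N j - Rw 0\<bar> ^ 6 \<le> kappaN \<delta> u0 N j"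
      using c(2)[of "Rw 0 * nd N j" "Rw 0"] y Rw_0_pos k nd_bounds[OF j] by (simp add: kappaN_eq[OF j] Ks_eq)
    moreover have "Rw 0 / (2 * real N) \<le> \<bar>Rw 0 * nd N j - Rw 0\<bar>"
    proof -
      have "1 / (2 * real N) \<le> 1 - nd N j" using j by (simp add: nd_def field_simps)
      then have "Rw 0 * (1 / (2 * real N)) \<le> Rw 0 * (1 - nd N j)" using Rw_0_pos by (intro mult_left_mono) auto
      then show ?thesis using y by (simp add: right_diff_distrib)
    qed
    then have "(Rw 0 / (2 * real N)) ^ 6 \<le> \<bar>Rw 0 * nd N j - Rw 0\<bar> ^ 6" using Rw_0_pos by (intro power_mono) auto
    then have "c * (Rw 0 / (2 * real N)) ^ 6 \<le> c * \<bar>Rw 0 * nd N j - Rw 0\<bar> ^ 6" using c(1) by (intro mult_left_mono) auto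
    ultimately have "2 * (c * (Rw 0 / (2 * real N)) ^ 6) \<le> 2 * kappaN \<delta> u0 N j" by linarith
    moreover have "2 * (c * (Rw 0 / (2 * real N)) ^ 6) = a / real N ^ 6"
      by (simp add: a_def power_divide power_mult_distrib)
    ultimately have "a / real N ^ 6 \<le> 2 * kappaN \<delta> u0 N j" by simp
    moreover have "0 < a / real N ^ 6" using a N by simp
    ultimately have "ln (a / real N ^ 6) \<le> ln (2 * kappaN \<delta> u0 N j)"
      using k by (subst ln_le_cancel_iff) auto
    moreover have "ln (a / real N ^ 6) = ln a - 6 * ln (real N)"
      using a N by (simp add: ln_div ln_realpow)
    moreover have "ln (2 * kappaN \<delta> u0 N j) \<le> ln (2 * km)"
      using k km_pos by (subst ln_le_cancel_iff) auto
    ultimately show ?thesis using N by linarith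
  qed
  then show thesis using that[of "\<bar>ln a\<bar> + \<bar>ln (2 * km)\<bar>"] by simp
qed

text \<open>Twice the logarithm of the diagonal entry of \<open>DN\<close> at \<open>z = 0\<close>,
  so that \<open>expo z j / 2\<close> is the full exponent of that entry.\<close>

definition bN :: "real \<Rightarrow> nat \<Rightarrow> nat \<Rightarrow> real" where
  "bN t N j = 2 * theta_plus \<delta> u0 (kappaN \<delta> u0 N j) / eps N
     - 2 * Im ((zetaN \<delta> u0 N j - complex_of_real (1 / (2 * \<delta>)))\<^sup>2) * t / eps N"

lemma Im_zetaN: "Im (zetaN \<delta> u0 N j) = kappaN \<delta> u0 N j"
  by (simp add: zetaN_def Im_zeta)

lemma soliton_det_instance: "0 < N \<Longrightarrow> soliton_det N (zetaN \<delta> u0 N) (eps N) km"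
  by unfold_locales (use eps_pos km_pos kappaN_range in \<open>auto simp: Im_zetaN less_imp_le\<close>)

lemma bN_V: "0 < N \<Longrightarrow> bN t N j - 2 * Im (zetaN \<delta> u0 N j) / eps N * x = - (2 / eps N) * Vfun \<delta> u0 (kappaN \<delta> u0 N j) x t"
  using eps_pos[of N] by (simp add: bN_def Vfun_def zetaN_def Im_zeta field_simps)

text \<open>Bridge from the abstract determinant to the definitions. Besides the identification of
  the branch it exhibits, on the real line, a partition function over subsets with field
  \<open>Vfun\<close> and pair interaction \<open>gker\<close>.\<close>

lemma soliton_log:
  fixes t :: real and N :: nat
  assumes N: "0 < N"
  obtains L Zr St where
    "open St" "L holomorphic_on St" "{z. \<bar>Im z\<bar> \<le> \<delta> * eps N} \<subseteq> St"
    "\<And>z. \<bar>Im z\<bar> \<le> \<delta> * eps N \<Longrightarrow> logZN \<delta> u0 N t z = L z"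
    "\<And>x. L (of_real x) = of_real (ln (Zr x))"
    "\<And>z. \<bar>Im z\<bar> \<le> \<delta> * eps N \<Longrightarrow> cmod (L z) \<le> ln (Zr (Re z)) + real N * (2 * pi - ln (cos (\<delta> * km)))"
    "\<And>x. Zr x = (\<Sum>S\<in>Pow {..<N}. (\<Prod>i\<in>S. 1 / (2 * kappaN \<delta> u0 N i)) *
        exp (- (\<Sum>i\<in>S. 2 / eps N * Vfun \<delta> u0 (kappaN \<delta> u0 N i) x t)
             - (\<Sum>i\<in>S. \<Sum>j\<in>S-{i}. gker (kappaN \<delta> u0 N i) (kappaN \<delta> u0 N j))))"
proof -
  interpret S: soliton_det N "zetaN \<delta> u0 N" "bN t N" "eps N" km by (rule soliton_det_instance[OF N])
  have e: "0 < eps N" by (rule eps_pos[OF N])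
  \<comment> \<open>Half of \<open>2 * \<delta> * km < pi\<close>; this is why a shift by
    \<open>\<delta> * eps N\<close> stays inside \<open>Strip\<close>.\<close>
  have dk: "\<delta> * km < pi / 2" "0 < \<delta> * km" using kappa_range[of km] km_pos \<delta> by auto
  have strip_bound: "\<bar>Im z\<bar> * km / eps N \<le> \<delta> * km" if "\<bar>Im z\<bar> \<le> \<delta> * eps N" for z
  proof -
    have "\<bar>Im z\<bar> * km \<le> \<delta> * eps N * km" using that km_pos by (intro mult_right_mono) auto
    then show ?thesis using e by (simp add: divide_le_eq mult_ac)
  qed
  have sub: "{z. \<bar>Im z\<bar> \<le> \<delta> * eps N} \<subseteq> S.Strip"
  proof
    fix z assume "z \<in> {z. \<bar>Im z\<bar> \<le> \<delta> * eps N}"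
    then have "\<bar>Im z\<bar> * km / eps N \<le> \<delta> * km" using strip_bound[of z] by simp
    also have "\<dots> < pi / 2" by (rule dk(1))
    finally show "z \<in> S.Strip" by (simp add: S.Strip_def)
  qed
  have DN_eq: "DN \<delta> u0 N z t j = exp (S.expo z j / 2)" for z j
  proof -
    have "sqrt (cN \<delta> u0 N j) = exp (theta_plus \<delta> u0 (kappaN \<delta> u0 N j) / eps N)"
    proof (rule real_sqrt_unique)
      show "(exp (theta_plus \<delta> u0 (kappaN \<delta> u0 N j) / eps N))\<^sup>2 = cN \<delta> u0 N j"
        by (simp add: cN_def power2_eq_square flip: exp_add)
    qed simp
    then have "complex_of_real (sqrt (cN \<delta> u0 N j)) = exp (complex_of_real (theta_plus \<delta> u0 (kappaN \<delta> u0 N j) / eps N))"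
      by (simp only: exp_of_real)
    then have "DN \<delta> u0 N z t j = exp (complex_of_real (theta_plus \<delta> u0 (kappaN \<delta> u0 N j) / eps N)
        + (- complex_of_real (kappaN \<delta> u0 N j) * z / complex_of_real (eps N)
          - complex_of_real (Im ((zetaN \<delta> u0 N j - complex_of_real (1 / (2 * \<delta>)))\<^sup>2) * t / eps N)))"
      unfolding DN_def by (simp only: exp_add)
    also have "complex_of_real (theta_plus \<delta> u0 (kappaN \<delta> u0 N j) / eps N)
        + (- complex_of_real (kappaN \<delta> u0 N j) * z / complex_of_real (eps N)
          - complex_of_real (Im ((zetaN \<delta> u0 N j - complex_of_real (1 / (2 * \<delta>)))\<^sup>2) * t / eps N)) = S.expo z j / 2"
      using e by (simp add: S.expo_def bN_def Im_zetaN field_simps)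
    finally show ?thesis .
  qed
  have Z_eq: "ZN \<delta> u0 N z t = S.Z z" for z
    by (simp add: ZN_def S.Z_def DN_eq CN_def)
  have strip_conn: "connected {z. \<bar>Im z\<bar> \<le> \<delta> * eps N}"
  proof -
    have "{z. \<bar>Im z\<bar> \<le> \<delta> * eps N} = {z. Im z \<le> \<delta> * eps N} \<inter> {z. Im z \<ge> - (\<delta> * eps N)}" by auto
    then show ?thesis by (simp add: convex_connected convex_Int convex_halfspace_Im_le convex_halfspace_Im_ge)
  qed
  \<comment> \<open>\<open>S.L\<close> witnesses the defining property, so the function chosen by
    \<open>SOME\<close> has it as well; uniqueness of the branch then identifies the two on the
    strip.\<close>
  define PL where "PL = (\<lambda>M. continuous_on (stripN \<delta> u0 N) M \<and>
        (\<forall>z\<in>stripN \<delta> u0 N. exp (M z) = ZN \<delta> u0 N z t) \<and> (\<forall>x::real. M (complex_of_real x) \<in> \<real>))"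
  have "PL S.L"
    unfolding PL_def stripN_def
    using S.exp_L S.L_real sub Z_eq
    by (auto intro!: holomorphic_on_imp_continuous_on holomorphic_on_subset[OF S.L_holomorphic])
  then have "PL (Eps PL)" by (rule someI[of PL])
  moreover have "logZN \<delta> u0 N t = Eps PL" unfolding logZN_def PL_def ..
  ultimately have "PL (logZN \<delta> u0 N t)" by simp
  then have M: "continuous_on (stripN \<delta> u0 N) (logZN \<delta> u0 N t)"
    "\<And>z. z \<in> stripN \<delta> u0 N \<Longrightarrow> exp (logZN \<delta> u0 N t z) = S.Z z" "logZN \<delta> u0 N t (of_real 0) \<in> \<real>"
    unfolding PL_def Z_eq by blast+
  have log_eq: "logZN \<delta> u0 N t z = S.L z" if "\<bar>Im z\<bar> \<le> \<delta> * eps N" for z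
    by (rule S.log_branch_unique[OF sub[folded stripN_def] strip_conn[folded stripN_def] _ M])
       (use that e \<delta> in \<open>auto simp: stripN_def\<close>)
  have Lr: "S.L (of_real x) = of_real (ln (S.Zr x))" for x
  proof -
    obtain r where r: "S.L (of_real x) = of_real r" using S.L_real by (meson Reals_cases)
    have "of_real x \<in> S.Strip" using sub e \<delta> by auto
    then have "exp (S.L (of_real x)) = of_real (S.Zr x)" using S.exp_L S.Z_real by simp
    then have "complex_of_real (exp r) = of_real (S.Zr x)" by (simp add: r exp_of_real)
    then have "exp r = S.Zr x" by (simp only: of_real_eq_iff)
    then show ?thesis using r by (metis ln_exp)
  qed
  have W_eq: "S.W A = (\<Prod>i\<in>A. 1 / (2 * kappaN \<delta> u0 N i)) *
      exp (- (\<Sum>i\<in>A. \<Sum>j\<in>A-{i}. gker (kappaN \<delta> u0 N i) (kappaN \<delta> u0 N j)))" if A: "A \<subseteq> {..<N}" for A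
  proof -
    have fin: "finite A" using A finite_subset by blast
    have "exp (- (\<Sum>i\<in>A. \<Sum>j\<in>A-{i}. gker (kappaN \<delta> u0 N i) (kappaN \<delta> u0 N j)))
       = (\<Prod>i\<in>A. \<Prod>j\<in>A-{i}. exp (- gker (kappaN \<delta> u0 N i) (kappaN \<delta> u0 N j)))"
      using fin by (simp add: exp_sum flip: sum_negf)
    also have "\<dots> = (\<Prod>i\<in>A. \<Prod>j\<in>A-{i}. cmod (zetaN \<delta> u0 N i - zetaN \<delta> u0 N j) / cmod (zetaN \<delta> u0 N i - cnj (zetaN \<delta> u0 N j)))"
    proof (intro prod.cong refl)
      fix i j assume ij: "i \<in> A" "j \<in> A - {i}"
      then have "i < N" "j < N" "i \<noteq> j" using A by auto
      then show "exp (- gker (kappaN \<delta> u0 N i) (kappaN \<delta> u0 N j)) =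
          cmod (zetaN \<delta> u0 N i - zetaN \<delta> u0 N j) / cmod (zetaN \<delta> u0 N i - cnj (zetaN \<delta> u0 N j))"
        using exp_gker[of "kappaN \<delta> u0 N i" "kappaN \<delta> u0 N j"] kappaN_range kappaN_inj by (simp add: zetaN_def)
    qed
    finally show ?thesis by (simp add: S.W_def Im_zetaN)
  qed
  have Zr_eq: "S.Zr x = (\<Sum>A\<in>Pow {..<N}. (\<Prod>i\<in>A. 1 / (2 * kappaN \<delta> u0 N i)) *
        exp (- (\<Sum>i\<in>A. 2 / eps N * Vfun \<delta> u0 (kappaN \<delta> u0 N i) x t)
             - (\<Sum>i\<in>A. \<Sum>j\<in>A-{i}. gker (kappaN \<delta> u0 N i) (kappaN \<delta> u0 N j))))" for x
    unfolding S.Zr_def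
  proof (rule sum.cong[OF refl])
    fix A assume "A \<in> Pow {..<N}"
    then have A: "A \<subseteq> {..<N}" by simp
    have s: "(\<Sum>i\<in>A. bN t N i - 2 * Im (zetaN \<delta> u0 N i) / eps N * x) = - (\<Sum>i\<in>A. 2 / eps N * Vfun \<delta> u0 (kappaN \<delta> u0 N i) x t)"
      unfolding bN_V[OF N] by (simp add: sum_negf)
    show "S.W A * exp (\<Sum>i\<in>A. bN t N i - 2 * Im (zetaN \<delta> u0 N i) / eps N * x) = (\<Prod>i\<in>A. 1 / (2 * kappaN \<delta> u0 N i)) *
        exp (- (\<Sum>i\<in>A. 2 / eps N * Vfun \<delta> u0 (kappaN \<delta> u0 N i) x t)
             - (\<Sum>i\<in>A. \<Sum>j\<in>A-{i}. gker (kappaN \<delta> u0 N i) (kappaN \<delta> u0 N j)))"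
      unfolding s W_eq[OF A] by (simp add: exp_diff exp_minus field_simps)
  qed
  have "cmod (S.L z) \<le> ln (S.Zr (Re z)) + real N * (2 * pi - ln (cos (\<delta> * km)))" if "\<bar>Im z\<bar> \<le> \<delta> * eps N" for z
    using S.norm_L_le[of z "\<delta> * km"] sub that strip_bound[OF that] dk by auto
  from that[OF S.open_O S.L_holomorphic sub log_eq Lr this Zr_eq] show thesis .
qed

text \<open>Since \<open>Rw 0 = pi * eps N * N\<close>, the Riemann weights of field and interaction
  are \<open>pi * eps N\<close> and \<open>pi * (eps N)\<^sup>2 / 2\<close>; multiplication by
  \<open>2 / (pi * (eps N)\<^sup>2)\<close> turns them into the coefficients in the exponents of the
  determinant.\<close>

lemma D_indicator:
  assumes d: "discretization (vs x t) hs B A0 B0" and N: "0 < N" and S: "S \<subseteq> {..<N}"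
  shows "2 / (pi * (eps N)\<^sup>2) * discretization.D (vs x t) hs N (indicator S)
     = (\<Sum>i\<in>S. 2 / eps N * Vfun \<delta> u0 (kappaN \<delta> u0 N i) x t)
       + (\<Sum>i\<in>S. \<Sum>j\<in>S-{i}. gker (kappaN \<delta> u0 N i) (kappaN \<delta> u0 N j))"
proof -
  interpret d: discretization "vs x t" hs B A0 B0 by (rule d)
  have e: "0 < eps N" by (rule eps_pos[OF N])
  have nd: "d.node N j = nd N j" for j by (simp add: d.node_def nd_def)
  have R: "Rw 0 = pi * eps N * real N" using pi_eps[OF N] N by (simp add: field_simps)
  have v: "vs x t (nd N j) / real N = pi * eps N * Vfun \<delta> u0 (kappaN \<delta> u0 N j) x t" if "j < N" for j
    using nd_bounds[OF that] N by (simp add: vs_def kappaN_eq[OF that] R)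
  have h: "hs (nd N i) (nd N j) / (real N)\<^sup>2 = pi * (eps N)\<^sup>2 / 2 * gker (kappaN \<delta> u0 N i) (kappaN \<delta> u0 N j)" if "i < N" "j < N" for i j
  proof -
    have "hs (nd N i) (nd N j) / (real N)\<^sup>2 = (Rw 0)\<^sup>2 / (2 * pi) / (real N)\<^sup>2 * gker (kappaN \<delta> u0 N i) (kappaN \<delta> u0 N j)"
      using nd_bounds[OF that(1)] nd_bounds[OF that(2)] by (simp add: hs_def kappaN_eq that)
    also have "(Rw 0)\<^sup>2 / (2 * pi) / (real N)\<^sup>2 = pi * (eps N)\<^sup>2 / 2"
      unfolding R using N by (simp add: power2_eq_square)
    finally show ?thesis .
  qed
  have fin: "finite S" using S finite_subset by blast
  have "(\<Sum>j<N. vs x t (nd N j) / real N * indicator S j) = (\<Sum>j\<in>S. vs x t (nd N j) / real N)"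
  proof -
    have "(\<Sum>j<N. vs x t (nd N j) / real N * indicator S j) = (\<Sum>j\<in>{..<N} \<inter> S. vs x t (nd N j) / real N)"
      by (subst sum.inter_restrict) (auto intro!: sum.cong simp: indicator_def)
    then show ?thesis using S by (simp add: Int_absorb1)
  qed
  also have "\<dots> = (\<Sum>j\<in>S. pi * eps N * Vfun \<delta> u0 (kappaN \<delta> u0 N j) x t)"
    using S v by (intro sum.cong) auto
  finally have 1: "(\<Sum>j<N. vs x t (nd N j) / real N * indicator S j) = (\<Sum>j\<in>S. pi * eps N * Vfun \<delta> u0 (kappaN \<delta> u0 N j) x t)" .
  have "(\<Sum>i<N. \<Sum>j\<in>{..<N}-{i}. hs (nd N i) (nd N j) / (real N)\<^sup>2 * indicator S i * indicator S j)
      = (\<Sum>i\<in>{..<N} \<inter> S. \<Sum>j\<in>{..<N}-{i}. hs (nd N i) (nd N j) / (real N)\<^sup>2 * indicator S i * indicator S j)"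
    by (rule sum.mono_neutral_right) auto
  also have "\<dots> = (\<Sum>i\<in>{..<N} \<inter> S. \<Sum>j\<in>S-{i}. hs (nd N i) (nd N j) / (real N)\<^sup>2)"
  proof (rule sum.cong[OF refl])
    fix i assume i: "i \<in> {..<N} \<inter> S"
    have "(\<Sum>j\<in>{..<N}-{i}. hs (nd N i) (nd N j) / (real N)\<^sup>2 * indicator S i * indicator S j)
        = (\<Sum>j\<in>S-{i}. hs (nd N i) (nd N j) / (real N)\<^sup>2 * indicator S i * indicator S j)"
      using S by (intro sum.mono_neutral_right) (auto simp: indicator_def)
    also have "\<dots> = (\<Sum>j\<in>S-{i}. hs (nd N i) (nd N j) / (real N)\<^sup>2)"
      using i by (intro sum.cong) auto
    finally show "(\<Sum>j\<in>{..<N}-{i}. hs (nd N i) (nd N j) / (real N)\<^sup>2 * indicator S i * indicator S j)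
        = (\<Sum>j\<in>S-{i}. hs (nd N i) (nd N j) / (real N)\<^sup>2)" .
  qed
  also have "\<dots> = (\<Sum>i\<in>S. \<Sum>j\<in>S-{i}. pi * (eps N)\<^sup>2 / 2 * gker (kappaN \<delta> u0 N i) (kappaN \<delta> u0 N j))"
    using S h by (intro sum.cong) auto
  finally have 2: "(\<Sum>i<N. \<Sum>j\<in>{..<N}-{i}. hs (nd N i) (nd N j) / (real N)\<^sup>2 * indicator S i * indicator S j)
      = (\<Sum>i\<in>S. \<Sum>j\<in>S-{i}. pi * (eps N)\<^sup>2 / 2 * gker (kappaN \<delta> u0 N i) (kappaN \<delta> u0 N j))" .
  have "2 / (pi * (eps N)\<^sup>2) * (pi * eps N * a) = 2 / eps N * a" for a
    using e by (simp add: power2_eq_square)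
  moreover have "2 / (pi * (eps N)\<^sup>2) * (pi * (eps N)\<^sup>2 / 2 * a) = a" for a
    using e by simp
  ultimately show ?thesis unfolding d.D_def nd 1 2 distrib_left sum_distrib_left by simp
qed

text \<open>Laplace principle for \<open>2 ^ N\<close> positive terms: the sum lies between one term
  of minimal energy and \<open>2 ^ N\<close> copies of the maximal Boltzmann factor, the prefactors
  costing at most the sum of \<open>\<bar>ln (c i)\<bar>\<close>.\<close>

lemma ln_sum_exp_bounds:
  fixes E :: "nat set \<Rightarrow> real"
  assumes c: "\<And>i. i < N \<Longrightarrow> 0 < c i"
    and Z: "Z = (\<Sum>S\<in>Pow {..<N}. (\<Prod>i\<in>S. 1 / c i) * exp (- E S))"
  shows "\<bar>ln Z + Min (E ` Pow {..<N})\<bar> \<le> (\<Sum>i<N. \<bar>ln (c i)\<bar>) + real N * ln 2"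
proof -
  define l where "l = (\<Sum>i<N. \<bar>ln (c i)\<bar>)"
  define m where "m = Min (E ` Pow {..<N})"
  have pr: "exp (- l) \<le> (\<Prod>i\<in>S. 1 / c i)" "(\<Prod>i\<in>S. 1 / c i) \<le> exp l" if S: "S \<subseteq> {..<N}" for S
  proof -
    have fin: "finite S" using S finite_subset by blast
    have "(\<Prod>i\<in>S. 1 / c i) = (\<Prod>i\<in>S. exp (- ln (c i)))"
      using S c by (intro prod.cong) (auto simp: exp_minus inverse_eq_divide)
    also have "\<dots> = exp (\<Sum>i\<in>S. - ln (c i))" by (rule exp_sum[OF fin, symmetric])
    finally have e: "(\<Prod>i\<in>S. 1 / c i) = exp (\<Sum>i\<in>S. - ln (c i))" .
    have "\<bar>\<Sum>i\<in>S. - ln (c i)\<bar> \<le> (\<Sum>i\<in>S. \<bar>- ln (c i)\<bar>)" by (rule sum_abs)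
    also have "\<dots> \<le> l" unfolding l_def using S by (simp add: sum_mono2)
    finally show "exp (- l) \<le> (\<Prod>i\<in>S. 1 / c i)" "(\<Prod>i\<in>S. 1 / c i) \<le> exp l" unfolding e by auto
  qed
  have "m \<in> E ` Pow {..<N}" unfolding m_def by (intro Min_in) auto
  then obtain S where S: "S \<subseteq> {..<N}" "m = E S" by auto
  have term0: "0 \<le> (\<Prod>i\<in>T. 1 / c i) * exp (- E T)" if "T \<subseteq> {..<N}" for T
    using pr(1)[OF that] by (intro mult_nonneg_nonneg) (auto intro: order_trans[OF less_imp_le[OF exp_gt_zero]])
  have "exp (- l) * exp (- m) \<le> (\<Prod>i\<in>S. 1 / c i) * exp (- E S)" unfolding S(2) by (rule mult_right_mono[OF pr(1)[OF S(1)]]) simp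
  also have "\<dots> \<le> Z" unfolding Z using S(1) term0 by (intro member_le_sum) auto
  finally have lower: "exp (- l - m) \<le> Z" by (simp add: exp_diff exp_minus field_simps)
  have "Z \<le> (\<Sum>T\<in>Pow {..<N}. exp l * exp (- m))"
    unfolding Z
  proof (rule sum_mono)
    fix T assume T: "T \<in> Pow {..<N}"
    then have "m \<le> E T" unfolding m_def by (intro Min_le) auto
    then show "(\<Prod>i\<in>T. 1 / c i) * exp (- E T) \<le> exp l * exp (- m)"
      using pr(2)[of T] T by (intro mult_mono) auto
  qed
  also have "\<dots> = exp (real N * ln 2 + l - m)"
    by (simp add: card_Pow exp_add exp_diff exp_minus exp_of_nat_mult field_simps)
  finally have upper: "Z \<le> exp (real N * ln 2 + l - m)" .
  have Z0: "0 < Z" using lower exp_gt_zero less_le_trans by blast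
  have "ln (exp (- l - m)) \<le> ln Z" using lower Z0 by (subst ln_le_cancel_iff) auto
  moreover have "ln Z \<le> ln (exp (real N * ln 2 + l - m))" using upper Z0 by (subst ln_le_cancel_iff) auto
  moreover have "0 \<le> real N * ln 2" by simp
  ultimately show ?thesis unfolding l_def[symmetric] m_def[symmetric] abs_le_iff ln_exp by linarith
qed

text \<open>The error is \<open>(eps N)\<^sup>2\<close> times O(N ln N), where \<open>eps N\<close>
  is a constant over \<open>N\<close>. It is uniform in \<open>x\<close> because the prefactors are
  independent of \<open>x\<close>.\<close>

lemma log_det_asymptotics:
  obtains er where "er \<longlonglongrightarrow> 0"
    "\<And>N x. 0 < N \<Longrightarrow> \<bar>(eps N)\<^sup>2 * Re (logZN \<delta> u0 N t (of_real x)) + 2 / pi * discretization.mN (vs x t) hs N\<bar> \<le> er N"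
proof -
  obtain C where C: "0 \<le> C" "\<And>N j. j < N \<Longrightarrow> \<bar>ln (2 * kappaN \<delta> u0 N j)\<bar> \<le> C + 6 * ln (real N)"
    using kappaN_log_bound by blast
  define er where "er = (\<lambda>N. (eps N)\<^sup>2 * (real N * (C + 6 * ln (real N)) + real N * ln 2))"
  have "(\<lambda>N. (Rw 0 / pi)\<^sup>2 * ((C + ln 2) / real N + 6 * (ln (real N) / real N))) \<longlonglongrightarrow> (Rw 0 / pi)\<^sup>2 * (0 + 6 * 0)"
    by (intro tendsto_intros lim_const_over_n lim_ln_over_n)
  moreover have "(Rw 0 / pi)\<^sup>2 * ((C + ln 2) / real N + 6 * (ln (real N) / real N)) = er N" for N
  proof (cases "N = 0")
    case False
    have *: "a\<^sup>2 * ((C + b) * m + 6 * (l * m)) = (a * m)\<^sup>2 * (n * (C + 6 * l) + n * b)" if "n * m = 1" for a b l m n :: real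
    proof -
      have "(a * m)\<^sup>2 * (n * (C + 6 * l) + n * b) = a\<^sup>2 * (n * m) * ((C + b) * m + 6 * (l * m))"
        by (simp add: power2_eq_square algebra_simps)
      then show ?thesis using that by simp
    qed
    have n: "real N * (1 / real N) = 1" using False by simp
    have e: "eps N = Rw 0 / pi * (1 / real N)" by (simp add: epsN_def)
    have "(Rw 0 / pi)\<^sup>2 * ((C + ln 2) * (1 / real N) + 6 * (ln (real N) * (1 / real N))) = er N"
      unfolding er_def e by (rule *[OF n])
    then show ?thesis unfolding times_divide_eq_right mult_1_right .
  qed (simp add: er_def)
  ultimately have "er \<longlonglongrightarrow> 0" by simp
  moreover have "\<bar>(eps N)\<^sup>2 * Re (logZN \<delta> u0 N t (of_real x)) + 2 / pi * discretization.mN (vs x t) hs N\<bar> \<le> er N"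
    if N: "0 < N" for N x
  proof -
    obtain A0 B0 Cv where "discretization (vs x t) hs (Rw 0 * (Cv + \<bar>x\<bar> * km)) A0 B0"
      using discretization_instance[of t] by metis
    note d = this
    interpret d: discretization "vs x t" hs "Rw 0 * (Cv + \<bar>x\<bar> * km)" A0 B0 by (rule d)
    have e: "0 < eps N" by (rule eps_pos[OF N])
    define q where "q = 2 / (pi * (eps N)\<^sup>2)"
    have q: "0 < q" using e by (simp add: q_def)
    obtain St L Zr where St: "open St" "L holomorphic_on St" "{z. \<bar>Im z\<bar> \<le> \<delta> * eps N} \<subseteq> St"
      and L: "\<And>z. \<bar>Im z\<bar> \<le> \<delta> * eps N \<Longrightarrow> logZN \<delta> u0 N t z = L z"
      and Lr: "\<And>x. L (of_real x) = of_real (ln (Zr x))"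
      and Lb: "\<And>z. \<bar>Im z\<bar> \<le> \<delta> * eps N \<Longrightarrow> cmod (L z) \<le> ln (Zr (Re z)) + real N * (2 * pi - ln (cos (\<delta> * km)))"
      and Zr: "\<And>x. Zr x = (\<Sum>S\<in>Pow {..<N}. (\<Prod>i\<in>S. 1 / (2 * kappaN \<delta> u0 N i)) *
        exp (- (\<Sum>i\<in>S. 2 / eps N * Vfun \<delta> u0 (kappaN \<delta> u0 N i) x t)
             - (\<Sum>i\<in>S. \<Sum>j\<in>S-{i}. gker (kappaN \<delta> u0 N i) (kappaN \<delta> u0 N j))))"
      by (rule soliton_log[OF N, of t], rule that)
    have Zq: "Zr x = (\<Sum>S\<in>Pow {..<N}. (\<Prod>i\<in>S. 1 / (2 * kappaN \<delta> u0 N i)) * exp (- (q * d.D N (indicator S))))"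
      unfolding Zr q_def using D_indicator[OF d N] by (intro sum.cong refl) simp
    have "\<bar>ln (Zr x) + Min ((\<lambda>S. q * d.D N (indicator S)) ` Pow {..<N})\<bar> \<le> (\<Sum>i<N. \<bar>ln (2 * kappaN \<delta> u0 N i)\<bar>) + real N * ln 2"
      by (rule ln_sum_exp_bounds[OF _ Zq]) (use kappaN_range in auto)
    also have "(\<Sum>i<N. \<bar>ln (2 * kappaN \<delta> u0 N i)\<bar>) \<le> (\<Sum>i<N. C + 6 * ln (real N))"
      using C(2) by (intro sum_mono) auto
    also have "(\<Sum>i<N. C + 6 * ln (real N)) = real N * (C + 6 * ln (real N))" by simp
    also have "Min ((\<lambda>S. q * d.D N (indicator S)) ` Pow {..<N}) = q * d.mN N"
    proof -
      have "(\<lambda>S. q * d.D N (indicator S)) ` Pow {..<N} = (*) q ` ((\<lambda>S. d.D N (indicator S)) ` Pow {..<N})"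
        by (simp add: image_image)
      moreover have "mono ((*) q)" using q by (auto intro!: monoI mult_left_mono)
      then have "q * d.mN N = Min ((*) q ` ((\<lambda>S. d.D N (indicator S)) ` Pow {..<N}))"
        unfolding d.mN_def by (rule mono_Min_commute) auto
      ultimately show ?thesis by simp
    qed
    finally have "\<bar>ln (Zr x) + q * d.mN N\<bar> \<le> real N * (C + 6 * ln (real N)) + real N * ln 2" by simp
    then have "(eps N)\<^sup>2 * \<bar>ln (Zr x) + q * d.mN N\<bar> \<le> er N" unfolding er_def by (rule mult_left_mono) simp
    moreover have "(eps N)\<^sup>2 * \<bar>ln (Zr x) + q * d.mN N\<bar> = \<bar>(eps N)\<^sup>2 * ln (Zr x) + (eps N)\<^sup>2 * q * d.mN N\<bar>"
    proof -
      have "(eps N)\<^sup>2 * \<bar>a + q * b\<bar> = \<bar>(eps N)\<^sup>2 * a + (eps N)\<^sup>2 * q * b\<bar>" for a b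
        by (simp add: mult.assoc abs_mult flip: distrib_left)
      then show ?thesis .
    qed
    moreover have "(eps N)\<^sup>2 * q = 2 / pi" using e by (simp add: q_def)
    moreover have "Re (logZN \<delta> u0 N t (of_real x)) = ln (Zr x)" using L[of "of_real x"] Lr[of x] e \<delta> by simp
    ultimately show ?thesis by simp
  qed
  ultimately show thesis using that by blast
qed

text \<open>Nonnegativity of the interaction gives the lower bound; the empty set, of energy 0,
  gives the upper one.\<close>

lemma mN_bounds:
  obtains C where "\<And>N x. 0 < N \<Longrightarrow> \<bar>discretization.mN (vs x t) hs N\<bar> \<le> Rw 0 * (C + \<bar>x\<bar> * km)"
proof -
  obtain A0 B0 C where C: "0 < C" and d: "\<And>x. discretization (vs x t) hs (Rw 0 * (C + \<bar>x\<bar> * km)) A0 B0"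
    using discretization_instance[of t] by metis
  have "\<bar>discretization.mN (vs x t) hs N\<bar> \<le> Rw 0 * (C + \<bar>x\<bar> * km)" if N: "0 < N" for N x
  proof -
    interpret d: discretization "vs x t" hs "Rw 0 * (C + \<bar>x\<bar> * km)" A0 B0 by (rule d)
    define B where "B = Rw 0 * (C + \<bar>x\<bar> * km)"
    have B: "0 \<le> B" using Rw_0_pos C km_pos by (simp add: B_def)
    have n: "0 < d.node N j \<and> d.node N j < 1" if "j < N" for j using d.node_bounds[OF N that] .
    have lower: "- B \<le> d.D N (indicator S)" for S
    proof -
      have "(\<Sum>j<N. - B / real N) \<le> (\<Sum>j<N. vs x t (d.node N j) / real N * indicator S j)"
      proof (rule sum_mono)
        fix j assume j: "j \<in> {..<N}"
        have "- B \<le> vs x t (d.node N j)" using d.v_bound[of "d.node N j"] n[of j] j by (auto simp: B_def)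
        then have "- B / real N \<le> vs x t (d.node N j) / real N" by (intro divide_right_mono) auto
        moreover have "- B / real N \<le> 0" using B by (simp add: divide_nonpos_nonneg)
        ultimately show "- B / real N \<le> vs x t (d.node N j) / real N * indicator S j" by (simp add: indicator_def)
      qed
      moreover have "(\<Sum>j<N. - B / real N) = - B" using N by simp
      moreover have "0 \<le> (\<Sum>i<N. \<Sum>j\<in>{..<N}-{i}. hs (d.node N i) (d.node N j) / (real N)\<^sup>2 * indicator S i * indicator S j)"
        using n by (intro sum_nonneg mult_nonneg_nonneg divide_nonneg_nonneg d.h_nonneg) auto
      ultimately show ?thesis unfolding d.D_def by linarith
    qed
    have "d.mN N \<in> (\<lambda>S. d.D N (indicator S)) ` Pow {..<N}" unfolding d.mN_def by (intro Min_in) auto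
    then have "- B \<le> d.mN N" using lower by auto
    moreover have "d.mN N \<le> d.D N (indicator {})" unfolding d.mN_def by (intro Min_le) auto
    moreover have "d.D N (indicator {}) = 0" by (simp add: d.D_def)
    ultimately show ?thesis using B unfolding B_def[symmetric] by linarith
  qed
  then show thesis using that by blast
qed

end

lemma deriv_funpow_eq_0_outside:
  fixes f :: "real \<Rightarrow> real"
  assumes "\<And>x. B < \<bar>x\<bar> \<Longrightarrow> f x = 0" "B < \<bar>x\<bar>"
  shows "(deriv ^^ k) f x = 0"
  using assms(2)
proof (induction k arbitrary: x)
  case (Suc k)
  have "open {x::real. B < \<bar>x\<bar>}" by (intro open_Collect_less continuous_intros)
  then have "\<forall>\<^sub>F y in nhds x. B < \<bar>y\<bar>" using Suc.prems by (auto simp: eventually_nhds)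
  then have "\<forall>\<^sub>F y in nhds x. (deriv ^^ k) f y = 0" by eventually_elim (rule Suc.IH)
  then have "deriv ((deriv ^^ k) f) x = deriv (\<lambda>_. 0) x" by (rule deriv_cong_ev) simp
  then show ?case by simp
qed (use assms(1) in simp)

lemma smooth_compact_support_derivs:
  assumes "smooth_compact_support \<phi>"
  obtains A where "0 < A" "\<And>k x. A \<le> \<bar>x\<bar> \<Longrightarrow> (deriv ^^ k) \<phi> x = 0"
    "\<And>k x. ((deriv ^^ k) \<phi> has_real_derivative (deriv ^^ Suc k) \<phi> x) (at x)"
    "\<And>k. continuous_on UNIV ((deriv ^^ k) \<phi>)"
proof -
  have "bounded (closure {x. \<phi> x \<noteq> 0})" using assms compact_imp_bounded unfolding smooth_compact_support_def by blast
  then have "bounded {x. \<phi> x \<noteq> 0}" using bounded_subset closure_subset by blast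
  then obtain B where B: "0 < B" "\<And>x. \<phi> x \<noteq> 0 \<Longrightarrow> \<bar>x\<bar> \<le> B" unfolding bounded_pos by auto
  \<comment> \<open>One unit is added to the support bound \<open>B\<close>: vanishing passes to
    derivatives on the open set \<open>\<bar>x\<bar> > B\<close>, which contains the endpoints used
    for integration by parts.\<close>
  have "(deriv ^^ k) \<phi> x = 0" if "B + 1 \<le> \<bar>x\<bar>" for k x
    by (rule deriv_funpow_eq_0_outside[of B]) (use B(2) that in force)+
  moreover have d: "((deriv ^^ k) \<phi> has_real_derivative (deriv ^^ Suc k) \<phi> x) (at x)" for k x
    using assms by (simp add: smooth_compact_support_def DERIV_deriv_iff_real_differentiable)
  moreover have "continuous_on UNIV ((deriv ^^ k) \<phi>)" for k
    using d by (auto intro!: continuous_at_imp_continuous_on DERIV_isCont)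
  ultimately show thesis using that[of "B + 1"] B(1) by auto
qed

lemma compactly_supported_lborel_integral:
  fixes f :: "real \<Rightarrow> 'a::euclidean_space"
  assumes c: "continuous_on {-A..A} f" and z: "\<And>x. A \<le> \<bar>x\<bar> \<Longrightarrow> f x = 0"
  shows "integrable lborel f" "(LINT x|lborel. f x) = integral {-A..A} f"
proof -
  have s: "set_integrable lborel {-A..A} f" by (rule borel_integrable_atLeastAtMost'[OF c])
  have "(\<lambda>x. indicator {-A..A} x *\<^sub>R f x) = f"
    using z by (fastforce simp: fun_eq_iff indicator_def)
  then show "integrable lborel f" "(LINT x|lborel. f x) = integral {-A..A} f"
    using s set_borel_integral_eq_integral(2)[OF s] by (simp_all add: set_integrable_def set_lebesgue_integral_def)
qed

section \<open>Passage to the limit against test functions\<close>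

context ilw_data
begin

text \<open>The definition differentiates along the two edges of the closed strip. As
  \<open>L\<close> is holomorphic on an open set containing them, the derivatives along the edges
  are ordinary complex derivatives.\<close>

lemma u_SSE_eq:
  assumes N: "0 < N" and St: "open St" "L holomorphic_on St" "{z. \<bar>Im z\<bar> \<le> \<delta> * eps N} \<subseteq> St"
    and L: "\<And>z. \<bar>Im z\<bar> \<le> \<delta> * eps N \<Longrightarrow> logZN \<delta> u0 N t z = L z"
    and F: "F = (\<lambda>z. complex_of_real (2 * \<delta> * (eps N)\<^sup>2) * L z)" and h: "h = \<delta> * eps N"
  shows "u_SSE \<delta> u0 N x t = (deriv F (Complex x h) - deriv F (Complex x (-h))) / (2 * \<i> * of_real h)"
proof -
  have h0: "0 < h" using eps_pos[OF N] \<delta> by (simp add: h)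
  have hol: "F holomorphic_on St" unfolding F by (intro holomorphic_intros St)
  have d: "((\<lambda>y. F (Complex y s)) has_vector_derivative deriv F (Complex x s)) (at x)" if s: "\<bar>s\<bar> \<le> h" for s
  proof -
    have "Complex x s \<in> St" using St(3) s by (auto simp: h)
    then have "(F has_field_derivative deriv F (Complex x s)) (at (Complex x s))"
      using hol St(1) by (rule holomorphic_derivI[rotated 2])
    moreover have "((\<lambda>y. Complex y s) has_vector_derivative 1) (at x)"
    proof -
      have "((\<lambda>y. complex_of_real y) has_vector_derivative 1) (at x)"
        using has_vector_derivative_of_real[OF DERIV_ident] by fastforce
      from has_vector_derivative_add[OF this has_vector_derivative_const[of "\<i> * complex_of_real s"]]
      show ?thesis by (simp add: Complex_eq)
    qed
    ultimately show ?thesis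
      using field_vector_diff_chain_at[of "\<lambda>y. Complex y s" 1 x F] by (simp add: o_def)
  qed
  have FN: "FN \<delta> u0 N z t = F z" if "\<bar>Im z\<bar> \<le> \<delta> * eps N" for z
    using L[OF that] by (simp add: FN_def F)
  have eq: "(\<lambda>y. (FN \<delta> u0 N (complex_of_real y + \<i> * complex_of_real (\<delta> * eps N)) t
               - FN \<delta> u0 N (complex_of_real y - \<i> * complex_of_real (\<delta> * eps N)) t)
               / (2 * \<i> * complex_of_real (\<delta> * eps N)))
     = (\<lambda>y. (F (Complex y h) - F (Complex y (-h))) / (2 * \<i> * of_real h))"
    using h0 by (simp add: FN Complex_eq flip: h)
  have "((\<lambda>y. (F (Complex y h) - F (Complex y (-h))) / (2 * \<i> * of_real h)) has_vector_derivative
      (deriv F (Complex x h) - deriv F (Complex x (-h))) / (2 * \<i> * of_real h)) (at x)"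
    by (intro has_vector_derivative_divide has_vector_derivative_diff d) (use h0 in auto)
  then show ?thesis unfolding u_SSE_def eq by (rule vector_derivative_at)
qed

text \<open>The restriction of \<open>FN\<close> to the real axis, where it is real.\<close>

definition GN :: "real \<Rightarrow> nat \<Rightarrow> real \<Rightarrow> real" where
  "GN t N x = 2 * \<delta> * ((eps N)\<^sup>2 * Re (logZN \<delta> u0 N t (of_real x)))"

lemma GN_tendsto: "(\<lambda>N. GN t N x) \<longlonglongrightarrow> - (4 * \<delta> / pi) * E_min \<delta> u0 x t"
proof -
  obtain er where er: "er \<longlonglongrightarrow> 0"
    "\<And>N x. 0 < N \<Longrightarrow> \<bar>(eps N)\<^sup>2 * Re (logZN \<delta> u0 N t (of_real x)) + 2 / pi * discretization.mN (vs x t) hs N\<bar> \<le> er N"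
    using log_det_asymptotics by blast
  obtain A0 B0 C where "discretization (vs x t) hs (Rw 0 * (C + \<bar>x\<bar> * km)) A0 B0"
    using discretization_instance[of t] by metis
  then interpret d: discretization "vs x t" hs "Rw 0 * (C + \<bar>x\<bar> * km)" A0 B0 .
  have 1: "(\<lambda>N. (eps N)\<^sup>2 * Re (logZN \<delta> u0 N t (of_real x)) + 2 / pi * d.mN N) \<longlonglongrightarrow> 0"
    by (rule Lim_null_comparison[OF _ er(1)])
       (use er(2) in \<open>auto intro!: eventually_sequentiallyI[of 1] simp: Suc_le_eq\<close>)
  have 2: "d.mN \<longlonglongrightarrow> E_min \<delta> u0 x t" using d.mN_tendsto by (simp add: E_min_eq)
  have "(\<lambda>N. 2 * \<delta> * (((eps N)\<^sup>2 * Re (logZN \<delta> u0 N t (of_real x)) + 2 / pi * d.mN N) - 2 / pi * d.mN N))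
      \<longlonglongrightarrow> 2 * \<delta> * (0 - 2 / pi * E_min \<delta> u0 x t)"
    by (intro tendsto_intros 1 2)
  then show ?thesis by (simp add: GN_def mult.assoc)
qed

lemma log_det_bounded:
  assumes A: "0 < A"
  obtains Q where "0 \<le> Q" "\<And>N x. 0 < N \<Longrightarrow> \<bar>x\<bar> \<le> A \<Longrightarrow> \<bar>(eps N)\<^sup>2 * Re (logZN \<delta> u0 N t (of_real x))\<bar> \<le> Q"
proof -
  obtain er where er: "er \<longlonglongrightarrow> 0"
    "\<And>N x. 0 < N \<Longrightarrow> \<bar>(eps N)\<^sup>2 * Re (logZN \<delta> u0 N t (of_real x)) + 2 / pi * discretization.mN (vs x t) hs N\<bar> \<le> er N"
    using log_det_asymptotics by blast
  obtain C where C: "\<And>N x. 0 < N \<Longrightarrow> \<bar>discretization.mN (vs x t) hs N\<bar> \<le> Rw 0 * (C + \<bar>x\<bar> * km)"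
    using mN_bounds by blast
  have "Bseq er" using er(1) by (intro convergent_imp_Bseq convergentI)
  then obtain K where K: "\<And>N. \<bar>er N\<bar> \<le> K" unfolding Bseq_def by auto
  define Q where "Q = K + 2 / pi * (Rw 0 * (C + A * km))"
  have *: "\<bar>(eps N)\<^sup>2 * Re (logZN \<delta> u0 N t (of_real x))\<bar> \<le> Q" if N: "0 < N" and x: "\<bar>x\<bar> \<le> A" for N x
  proof -
    have "Rw 0 * (C + \<bar>x\<bar> * km) \<le> Rw 0 * (C + A * km)"
      using x km_pos Rw_0_pos by (intro mult_left_mono add_left_mono mult_right_mono) auto
    then have "\<bar>discretization.mN (vs x t) hs N\<bar> \<le> Rw 0 * (C + A * km)" using C[OF N, of x] by linarith
    then have "2 / pi * \<bar>discretization.mN (vs x t) hs N\<bar> \<le> 2 / pi * (Rw 0 * (C + A * km))"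
      by (intro mult_left_mono) auto
    moreover have "\<bar>2 / pi * discretization.mN (vs x t) hs N\<bar> = 2 / pi * \<bar>discretization.mN (vs x t) hs N\<bar>"
      by (simp add: abs_mult)
    ultimately show ?thesis using er(2)[OF N, of x] K[of N] unfolding Q_def by linarith
  qed
  have "0 \<le> Q" using *[of 1 0] A abs_ge_zero order_trans by fastforce
  then show thesis using * that by blast
qed

text \<open>Applies \<open>strip_shift_estimate\<close> with \<open>h = \<delta> * eps N\<close>.
  The constant is uniform in \<open>N\<close> since \<open>Cb\<close> bounds \<open>FN\<close> on
  the whole strip over the support, so the cost is proportional to \<open>eps N\<close>.\<close>

lemma soliton_pairing_estimate:
  assumes A: "0 < A" and c0: "\<And>k x. A \<le> \<bar>x\<bar> \<Longrightarrow> (deriv ^^ k) \<phi> x = 0"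
    and der: "\<And>k x. ((deriv ^^ k) \<phi> has_real_derivative (deriv ^^ Suc k) \<phi> x) (at x)"
    and cont: "\<And>k. continuous_on UNIV ((deriv ^^ k) \<phi>)"
  obtains K where
    "\<And>N. 0 < N \<Longrightarrow> cmod ((LINT x|lborel. complex_of_real (\<phi> x) * u_SSE \<delta> u0 N x t)
        - of_real (LINT x|lborel. (deriv ^^ 2) \<phi> x * GN t N x)) \<le> K * eps N"
    "\<And>N. continuous_on UNIV (GN t N)"
proof -
  obtain Q where Q: "0 \<le> Q" "\<And>N x. 0 < N \<Longrightarrow> \<bar>x\<bar> \<le> A \<Longrightarrow> \<bar>(eps N)\<^sup>2 * Re (logZN \<delta> u0 N t (of_real x))\<bar> \<le> Q"
    using log_det_bounded[OF A] by blast
  define l where "l = 2 * pi - ln (cos (\<delta> * km))"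
  have l: "0 \<le> l"
  proof -
    have "ln (cos (\<delta> * km)) \<le> 0"
      using kappa_range[of km] km_pos \<delta> by (subst ln_le_zero_iff) (auto intro!: cos_gt_zero)
    then show ?thesis unfolding l_def using pi_gt_zero by linarith
  qed
  \<comment> \<open>\<open>Q\<close> controls the value on the real axis. The excess off the axis is
    \<open>N * l\<close>, and \<open>(eps N)\<^sup>2 * N \<le> (Rw 0 / pi)\<^sup>2\<close>.\<close>
  define Cb where "Cb = 2 * \<delta> * (Q + (Rw 0 / pi)\<^sup>2 * l)"
  obtain M where M: "\<And>x. \<bar>x\<bar> \<le> A \<Longrightarrow> \<bar>(deriv ^^ 3) \<phi> x\<bar> \<le> M"
  proof -
    have "bounded ((deriv ^^ 3) \<phi> ` {-A..A})"
      by (intro compact_imp_bounded compact_continuous_image continuous_on_subset[OF cont]) auto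
    then obtain M where "\<And>x. x \<in> {-A..A} \<Longrightarrow> \<bar>(deriv ^^ 3) \<phi> x\<bar> \<le> M" unfolding bounded_iff by (auto simp del: atLeastAtMost_iff)
    then have "\<bar>(deriv ^^ 3) \<phi> x\<bar> \<le> M" if "\<bar>x\<bar> \<le> A" for x using that by (simp add: abs_le_iff)
    then show thesis by (rule that)
  qed
  have main: "cmod ((LINT x|lborel. complex_of_real (\<phi> x) * u_SSE \<delta> u0 N x t)
        - of_real (LINT x|lborel. (deriv ^^ 2) \<phi> x * GN t N x)) \<le> \<delta> * eps N * (2 * A * M * Cb)
      \<and> continuous_on UNIV (GN t N)" if N: "0 < N" for N
  proof -
    define h where "h = \<delta> * eps N"
    have e: "0 < eps N" by (rule eps_pos[OF N])
    have h0: "0 < h" using e \<delta> by (simp add: h_def)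
    obtain St L Zr where St: "open St" "L holomorphic_on St" "{z. \<bar>Im z\<bar> \<le> \<delta> * eps N} \<subseteq> St"
      and L: "\<And>z. \<bar>Im z\<bar> \<le> \<delta> * eps N \<Longrightarrow> logZN \<delta> u0 N t z = L z"
      and Lr: "\<And>x. L (of_real x) = of_real (ln (Zr x))"
      and Lb: "\<And>z. \<bar>Im z\<bar> \<le> \<delta> * eps N \<Longrightarrow> cmod (L z) \<le> ln (Zr (Re z)) + real N * (2 * pi - ln (cos (\<delta> * km)))"
      and Zr: "\<And>x. Zr x = (\<Sum>S\<in>Pow {..<N}. (\<Prod>i\<in>S. 1 / (2 * kappaN \<delta> u0 N i)) *
        exp (- (\<Sum>i\<in>S. 2 / eps N * Vfun \<delta> u0 (kappaN \<delta> u0 N i) x t)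
             - (\<Sum>i\<in>S. \<Sum>j\<in>S-{i}. gker (kappaN \<delta> u0 N i) (kappaN \<delta> u0 N j))))"
      by (rule soliton_log[OF N, of t], rule that)
    note Lb = Lb[folded l_def]
    define F where "F = (\<lambda>z. complex_of_real (2 * \<delta> * (eps N)\<^sup>2) * L z)"
    have hol: "F holomorphic_on St" unfolding F_def by (intro holomorphic_intros St)
    have cF: "continuous_on St F" "continuous_on St (deriv F)"
      using hol St(1) by (auto intro: holomorphic_on_imp_continuous_on holomorphic_deriv)
    have inSt: "Complex x s \<in> St" if "\<bar>s\<bar> \<le> h" for x s using St(3) that by (auto simp: h_def)
    have Fr: "F (of_real x) = of_real (GN t N x)" for x
    proof -
      have "logZN \<delta> u0 N t (of_real x) = of_real (ln (Zr x))" using L[of "of_real x"] Lr e \<delta> by simp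
      then show ?thesis by (simp add: F_def GN_def Lr)
    qed
    have "continuous_on UNIV (\<lambda>x. F (of_real x))"
      by (rule continuous_on_compose2[OF cF(1)]) (use St(3) e \<delta> in \<open>auto intro!: continuous_intros\<close>)
    then have "continuous_on UNIV (\<lambda>x. Re (F (of_real x)))" by (rule continuous_on_Re)
    then have cG: "continuous_on UNIV (GN t N)" by (simp add: Fr)
    have Fb: "cmod (F z) \<le> Cb" if z: "\<bar>Re z\<bar> \<le> A" "\<bar>Im z\<bar> \<le> h" for z
    proof -
      have "Re (logZN \<delta> u0 N t (of_real (Re z))) = ln (Zr (Re z))"
        using L[of "of_real (Re z)"] Lr e \<delta> by simp
      then have 1: "(eps N)\<^sup>2 * ln (Zr (Re z)) \<le> Q" using Q(2)[OF N z(1)] by simp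
      have "(eps N)\<^sup>2 * real N = (Rw 0 / pi)\<^sup>2 * (1 / real N)"
        using N by (simp add: epsN_def power2_eq_square field_simps)
      also have "\<dots> \<le> (Rw 0 / pi)\<^sup>2 * 1" using N by (intro mult_left_mono) auto
      finally have "(eps N)\<^sup>2 * real N * l \<le> (Rw 0 / pi)\<^sup>2 * l" using l by (intro mult_right_mono) auto
      moreover have "(eps N)\<^sup>2 * cmod (L z) \<le> (eps N)\<^sup>2 * (ln (Zr (Re z)) + real N * l)"
        using Lb[of z] z by (intro mult_left_mono) (auto simp: h_def)
      ultimately have "(eps N)\<^sup>2 * cmod (L z) \<le> Q + (Rw 0 / pi)\<^sup>2 * l" using 1 by (simp add: distrib_left mult_ac)
      then have "2 * \<delta> * ((eps N)\<^sup>2 * cmod (L z)) \<le> Cb" unfolding Cb_def using \<delta> by (intro mult_left_mono) auto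
      moreover have "cmod (F z) = 2 * \<delta> * ((eps N)\<^sup>2 * cmod (L z))"
        unfolding F_def norm_mult norm_of_real using \<delta> by simp
      ultimately show ?thesis by simp
    qed
    have cs: "continuous_on UNIV (\<lambda>x. deriv F (Complex x s))" if "\<bar>s\<bar> \<le> h" for s
      by (rule continuous_on_compose2[OF cF(2)]) (use inSt[OF that] in \<open>auto intro!: continuous_intros simp: Complex_eq\<close>)
    have u: "u_SSE \<delta> u0 N x t = (deriv F (Complex x h) - deriv F (Complex x (-h))) / (2 * \<i> * of_real h)" for x
      by (rule u_SSE_eq[OF N St L F_def h_def])
    have c\<phi>: "continuous_on {-A..A} (\<lambda>x. complex_of_real ((deriv ^^ k) \<phi> x))" for k
      by (intro continuous_on_of_real continuous_on_subset[OF cont]) auto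
    have i1: "(LINT x|lborel. complex_of_real (\<phi> x) * u_SSE \<delta> u0 N x t) = integral {-A..A} (\<lambda>x. complex_of_real (\<phi> x) * u_SSE \<delta> u0 N x t)"
    proof (rule compactly_supported_lborel_integral(2))
      show "continuous_on {-A..A} (\<lambda>x. complex_of_real (\<phi> x) * u_SSE \<delta> u0 N x t)"
        unfolding u using c\<phi>[of 0] h0
        by (intro continuous_on_mult continuous_on_divide continuous_on_diff continuous_on_const
            continuous_on_subset[OF cs]) auto
    qed (use c0[of _ 0] in simp)
    have i2: "of_real (LINT x|lborel. (deriv ^^ 2) \<phi> x * GN t N x)
        = integral {-A..A} (\<lambda>x. complex_of_real ((deriv ^^ 2) \<phi> x) * F (of_real x))"
    proof -
      have "of_real (LINT x|lborel. (deriv ^^ 2) \<phi> x * GN t N x)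
          = (LINT x|lborel. complex_of_real ((deriv ^^ 2) \<phi> x) * of_real (GN t N x))"
        by (simp flip: integral_complex_of_real)
      also have "\<dots> = integral {-A..A} (\<lambda>x. complex_of_real ((deriv ^^ 2) \<phi> x) * of_real (GN t N x))"
        by (rule compactly_supported_lborel_integral(2))
           (use c0[of _ 2] in \<open>auto intro!: continuous_on_mult c\<phi> continuous_on_of_real continuous_on_subset[OF cG]\<close>)
      finally show ?thesis by (simp only: Fr)
    qed
    have "cmod (integral {-A..A} (\<lambda>x. of_real ((deriv ^^ 0) \<phi> x) * ((deriv F (Complex x h) - deriv F (Complex x (-h))) / (2 * \<i> * of_real h)))
      - integral {-A..A} (\<lambda>x. of_real ((deriv ^^ 2) \<phi> x) * F (of_real x))) \<le> h * (2 * A * M * Cb)"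
    proof (rule strip_shift_estimate[OF h0 A St(1) hol _ _ _ _ cont _ _ _ _ _ _ M Fb])
      show "{z. \<bar>Re z\<bar> \<le> A \<and> \<bar>Im z\<bar> \<le> h} \<subseteq> St" using St(3) by (auto simp: h_def)
      show "((deriv ^^ 0) \<phi> has_real_derivative (deriv ^^ 1) \<phi> x) (at x)" for x using der[of 0 x] by simp
      show "((deriv ^^ 1) \<phi> has_real_derivative (deriv ^^ 2) \<phi> x) (at x)" for x
        using der[of 1 x] by (simp add: numeral_2_eq_2)
      show "((deriv ^^ 2) \<phi> has_real_derivative (deriv ^^ 3) \<phi> x) (at x)" for x
        using der[of 2 x] by (simp add: numeral_3_eq_3 numeral_2_eq_2)
    qed (rule c0, use A in simp)+
    then have "cmod ((LINT x|lborel. complex_of_real (\<phi> x) * u_SSE \<delta> u0 N x t)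
        - of_real (LINT x|lborel. (deriv ^^ 2) \<phi> x * GN t N x)) \<le> h * (2 * A * M * Cb)"
      unfolding i1 i2 u[symmetric] funpow_0 .
    then show ?thesis using cG by (simp only: h_def simp_thms)
  qed
  have "continuous_on UNIV (GN t N)" for N
  proof (cases "N = 0")
    case True
    then have "GN t N = (\<lambda>x. 0)" by (simp add: GN_def epsN_def fun_eq_iff)
    then show ?thesis by simp
  qed (use main in auto)
  then show thesis using that[of "\<delta> * (2 * A * M * Cb)"] main by (simp add: mult_ac)
qed

text \<open>The pointwise limit of \<open>GN\<close> passes through the integral by a bound uniform
  on the support; the pairing estimate then transfers it to \<open>u_SSE\<close>.\<close>

lemma soliton_ensemble_limit:
  assumes "smooth_compact_support \<phi>"
  shows "(\<lambda>N. LINT x|lborel. complex_of_real (\<phi> x) * u_SSE \<delta> u0 N x t)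
     \<longlonglongrightarrow> complex_of_real (- (4 * \<delta> / pi) * (LINT x|lborel. deriv (deriv \<phi>) x * E_min \<delta> u0 x t))"
proof -
  obtain A where A: "0 < A" and c0: "\<And>k x. A \<le> \<bar>x\<bar> \<Longrightarrow> (deriv ^^ k) \<phi> x = 0"
    and der: "\<And>k x. ((deriv ^^ k) \<phi> has_real_derivative (deriv ^^ Suc k) \<phi> x) (at x)"
    and cont: "\<And>k. continuous_on UNIV ((deriv ^^ k) \<phi>)"
    using smooth_compact_support_derivs[OF assms] by blast
  obtain K where K: "\<And>N. 0 < N \<Longrightarrow> cmod ((LINT x|lborel. complex_of_real (\<phi> x) * u_SSE \<delta> u0 N x t)
        - of_real (LINT x|lborel. (deriv ^^ 2) \<phi> x * GN t N x)) \<le> K * eps N"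
    and cG: "\<And>N. continuous_on UNIV (GN t N)"
    using soliton_pairing_estimate[OF A c0 der cont, of t] by blast
  obtain Q where Q: "0 \<le> Q" "\<And>N x. 0 < N \<Longrightarrow> \<bar>x\<bar> \<le> A \<Longrightarrow> \<bar>(eps N)\<^sup>2 * Re (logZN \<delta> u0 N t (of_real x))\<bar> \<le> Q"
    using log_det_bounded[OF A] by blast
  \<comment> \<open>For \<open>N = 0\<close> the division by zero makes \<open>eps N\<close>, and
    with it \<open>GN\<close>, equal to 0, so the bound holds for every index.\<close>
  have bound: "\<bar>(deriv ^^ 2) \<phi> x * GN t N x\<bar> \<le> \<bar>(deriv ^^ 2) \<phi> x\<bar> * (2 * \<delta> * Q)" for N x
  proof (cases "N = 0 \<or> A \<le> \<bar>x\<bar>")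
    case True
    then show ?thesis using c0[of x 2] Q(1) \<delta> by (auto simp: GN_def epsN_def)
  next
    case False
    then have "2 * \<delta> * \<bar>(eps N)\<^sup>2 * Re (logZN \<delta> u0 N t (of_real x))\<bar> \<le> 2 * \<delta> * Q"
      using Q(2)[of N x] \<delta> by (intro mult_left_mono) auto
    then have "\<bar>GN t N x\<bar> \<le> 2 * \<delta> * Q" using \<delta> by (simp add: GN_def abs_mult)
    then show ?thesis unfolding abs_mult by (intro mult_left_mono) auto
  qed
  have lim: "(\<lambda>N. (deriv ^^ 2) \<phi> x * GN t N x) \<longlonglongrightarrow> (deriv ^^ 2) \<phi> x * (- (4 * \<delta> / pi) * E_min \<delta> u0 x t)" for x
    by (intro tendsto_mult_left GN_tendsto)
  have meas: "(\<lambda>x. (deriv ^^ 2) \<phi> x * GN t N x) \<in> borel_measurable lborel" for N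
    using borel_measurable_continuous_onI[OF continuous_on_mult[OF cont cG]] by simp
  have "(\<lambda>N. LINT x|lborel. (deriv ^^ 2) \<phi> x * GN t N x)
      \<longlonglongrightarrow> (LINT x|lborel. (deriv ^^ 2) \<phi> x * (- (4 * \<delta> / pi) * E_min \<delta> u0 x t))"
  proof (rule integral_dominated_convergence[where w = "\<lambda>x. \<bar>(deriv ^^ 2) \<phi> x\<bar> * (2 * \<delta> * Q)"])
    \<comment> \<open>The integrand with \<open>E_min\<close> is measurable as a pointwise limit of
      continuous functions of \<open>x\<close>.\<close>
    show "(\<lambda>x. (deriv ^^ 2) \<phi> x * (- (4 * \<delta> / pi) * E_min \<delta> u0 x t)) \<in> borel_measurable lborel"
      by (rule borel_measurable_LIMSEQ_real[OF lim meas])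
    have "continuous_on {-A..A} (\<lambda>x. \<bar>(deriv ^^ 2) \<phi> x\<bar> * (2 * \<delta> * Q))"
      by (intro continuous_on_mult continuous_on_rabs continuous_on_const continuous_on_subset[OF cont]) auto
    then show "integrable lborel (\<lambda>x. \<bar>(deriv ^^ 2) \<phi> x\<bar> * (2 * \<delta> * Q))"
      by (rule compactly_supported_lborel_integral(1)) (use c0[of _ 2] in simp)
  qed (use meas lim bound in auto)
  also have "(LINT x|lborel. (deriv ^^ 2) \<phi> x * (- (4 * \<delta> / pi) * E_min \<delta> u0 x t))
      = (LINT x|lborel. - (4 * \<delta> / pi) * (deriv (deriv \<phi>) x * E_min \<delta> u0 x t))"
    by (simp add: numeral_2_eq_2 mult_ac)
  also have "\<dots> = - (4 * \<delta> / pi) * (LINT x|lborel. deriv (deriv \<phi>) x * E_min \<delta> u0 x t)"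
    by (rule integral_mult_right_zero)
  finally have 1: "(\<lambda>N. complex_of_real (LINT x|lborel. (deriv ^^ 2) \<phi> x * GN t N x))
      \<longlonglongrightarrow> complex_of_real (- (4 * \<delta> / pi) * (LINT x|lborel. deriv (deriv \<phi>) x * E_min \<delta> u0 x t))"
    by (rule tendsto_of_real)
  have "(\<lambda>N. K * (Rw 0 / pi / real N)) \<longlonglongrightarrow> K * 0"
    by (intro tendsto_mult_left lim_const_over_n)
  then have "(\<lambda>N. K * eps N) \<longlonglongrightarrow> 0" by (simp add: epsN_def)
  then have "(\<lambda>N. (LINT x|lborel. complex_of_real (\<phi> x) * u_SSE \<delta> u0 N x t)
      - of_real (LINT x|lborel. (deriv ^^ 2) \<phi> x * GN t N x)) \<longlonglongrightarrow> 0"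
    by (rule Lim_null_comparison[rotated])
       (use K in \<open>auto intro!: eventually_sequentiallyI[of 1] simp: Suc_le_eq\<close>)
  from tendsto_add[OF this 1] show ?thesis by simp
qed

end

theorem mainTheorem7:
  fixes \<delta> :: real and u0 :: "real \<Rightarrow> real" and t :: real and chi :: "real \<Rightarrow> real"
  assumes "\<delta> > 0"
    and "admissible u0"
    and "integrable lborel (\<lambda>x. sqrt (u0 x))"
    and "smooth_compact_support chi"
  shows "((\<lambda>N. LINT x | lborel. complex_of_real (chi x) * u_SSE \<delta> u0 N x t)
          \<longlongrightarrow> complex_of_real (- (4 * \<delta> / pi) *
                 (LINT x | lborel. deriv (deriv chi) x * E_min \<delta> u0 x t))) sequentially"
proof -
  interpret ilw_data \<delta> u0 by unfold_locales (rule assms)+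
  show ?thesis by (rule soliton_ensemble_limit[OF assms(4)])
qed

end
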